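(* Let $G_1$ be the first characteristic quotient of the universal 2-Frattini cover of $A_5$. There are 2304 elements in $\mathrm{Ni}_1^{\rm in}=\mathrm{Ni}(G_1,\mathbf C_{3^4})^{\rm in}$. Exactly 16 are H-M representatives; 16 others are near H-M representatives. The $q_2$ orbit of an H-M (respectively near H-M) representative contains exactly one H-M (respectively near H-M) representative. All orbits of $\mathcal Q''$ on $\mathrm{Ni}_1^{\rm in}$ have length four, and $\mathcal Q''$ maps H-M (respectively near H-M) representatives among themselves. In particular, $\gamma_\infty$ orbits in $\mathrm{Ni}_1^{\rm in,rd}$ containing either H-M or near H-M representatives have type $(10,20)$. There are four orbits of $\gamma_\infty$ on $\mathrm{Ni}_1^{\rm in,rd}$ containing H-M (respectively near H-M) representatives, giving eight $\gamma_\infty$ orbits on $\mathrm{Ni}_1^{\rm in,rd}$ containing H-M or near H-M representatives.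
   Context: The universal 2-Frattini cover ${}_2\tilde A_5\to A_5$ is the largest profinite Frattini cover (no proper closed subgroup maps onto $A_5$) with pro-2 kernel $\ker_0$; $G_1={}_2\tilde A_5/\ker_1$, where $\ker_1$ is the closed subgroup of $\ker_0$ generated by commutators and squares. $\mathbf C_{3^4}$ is four repetitions of the class of elements of order 3 (in $A_5$ or $G_1$). $\mathrm{Ni}(G_1,\mathbf C_{3^4})=\{\mathbf g\in G_1^4: g_1g_2g_3g_4=1,\langle\mathbf g\rangle=G_1, g_i\text{ of order }3\}$ and $\mathrm{Ni}^{\rm in}$ is its quotient by conjugation by $G_1$. The Hurwitz monodromy group $H_4=\langle q_1,q_2,q_3\rangle$ acts by $(\mathbf g)q_i=(\dots,g_ig_{i+1}g_i^{-1},g_i,\dots)$. $\mathcal Q=\langle(q_1q_2q_3)^2,q_1q_3^{-1}\rangle\triangleleft H_4$ is a quaternion group of order 8 acting on $\mathrm{Ni}^{\rm in}$ through the Klein 4-group $\mathcal Q''=\mathcal Q/\langle(q_1q_3^{-1})^2\rangle$. $\mathrm{Ni}_1^{\rm in,rd}=\mathrm{Ni}_1^{\rm in}/\mathcal Q''$ and $\gamma_\infty$ is the action induced on it by $q_2$. The type of the $\gamma_\infty$ orbit of $\mathbf g$ is $(u,v)$ with $u={\rm ord}(g_2g_3)$ and $v$ the length of the orbit. H-M representative: a class containing some $(g_1,g_1^{-1},g_2,g_2^{-1})$. Put $\hat\kappa(\mathbf g)=((g_3g_4)^{-1}g_2^{-1}g_3g_4,(g_3g_4)^{-1}g_1^{-1}g_3g_4,g_4^{-1},g_3^{-1})$.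 Near H-M representative: $\mathbf g$ not an H-M representative for which some involution $c\in G_1$ satisfies $c\mathbf gc=\hat\kappa(\mathbf g)$ and whose image in $A_5^4$ is an H-M representative. *)

theory Defs
  imports "HOL-Analysis.Analysis" "HOL-Algebra.Group_Action" "HOL-Algebra.Sym_Groups" "HOL-Algebra.Multiplicative_Group"
begin

section \<open>Profinite groups and Frattini covers\<close>

definition profinite_group :: "'a monoid \<Rightarrow> 'a topology \<Rightarrow> bool" where
  "profinite_group G T \<longleftrightarrow>
     group G \<and> topspace T = carrier G \<and>
     continuous_map (prod_topology T T) T (\<lambda>(x, y). x \<otimes>\<^bsub>G\<^esub> y) \<and>
     continuous_map T T (\<lambda>x. inv\<^bsub>G\<^esub> x) \<and>
     compact_space T \<and> Hausdorff_space T \<and>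
     (\<forall>C \<in> connected_components_of T. \<exists>x. C = {x})"

definition pro_p_group :: "nat \<Rightarrow> 'a monoid \<Rightarrow> 'a topology \<Rightarrow> bool" where
  "pro_p_group p G T \<longleftrightarrow>
     profinite_group G T \<and>
     (\<forall>N. N \<lhd> G \<and> openin T N \<longrightarrow> (\<exists>k. order (G Mod N) = p ^ k))"

definition frattini_cover ::
    "'a monoid \<Rightarrow> 'a topology \<Rightarrow> 'b monoid \<Rightarrow> 'b topology \<Rightarrow> ('a \<Rightarrow> 'b) \<Rightarrow> bool" where
  "frattini_cover U T G S \<phi> \<longleftrightarrow>
     profinite_group U T \<and> profinite_group G S \<and>
     \<phi> \<in> epi U G \<and> continuous_map T S \<phi> \<and>
     (\<forall>H. subgroup H U \<and> closedin T H \<and> \<phi> ` H = carrier G \<longrightarrow> H = carrier U)"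

definition p_frattini_cover ::
    "nat \<Rightarrow> 'a monoid \<Rightarrow> 'a topology \<Rightarrow> 'b monoid \<Rightarrow> ('a \<Rightarrow> 'b) \<Rightarrow> bool" where
  "p_frattini_cover p U T G \<phi> \<longleftrightarrow>
     frattini_cover U T G (discrete_topology (carrier G)) \<phi> \<and>
     pro_p_group p (U\<lparr>carrier := kernel U G \<phi>\<rparr>) (subtopology T (kernel U G \<phi>))"

text \<open>
  The universal cover is the largest one: it maps onto every other cover, compatibly with the
  projections to \<^term>\<open>G\<close>.  HOL cannot quantify over types inside a definition, so the competing
  covers are carried by subsets of \<^typ>\<open>nat set\<close>.  Nothing is lost: the base group is finite, so its
  Frattini covers are topologically finitely generated profinite groups and have at most
  continuum many elements; each of them therefore has an isomorphic copy of this kind.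
\<close>

definition universal_p_frattini_cover ::
    "nat \<Rightarrow> 'a monoid \<Rightarrow> 'a topology \<Rightarrow> 'b monoid \<Rightarrow> ('a \<Rightarrow> 'b) \<Rightarrow> bool" where
  "universal_p_frattini_cover p U T G \<phi> \<longleftrightarrow>
     finite (carrier G) \<and> p_frattini_cover p U T G \<phi> \<and>
     (\<forall>(H :: nat set monoid) S \<psi>. p_frattini_cover p H S G \<psi> \<longrightarrow>
        (\<exists>\<theta>. \<theta> \<in> epi U H \<and> continuous_map T S \<theta> \<and>
             (\<forall>x \<in> carrier U. \<psi> (\<theta> x) = \<phi> x)))"

text \<open>The closed subgroup of \<open>K\<close> generated by the commutators and \<open>p\<close>-th powers of \<open>K\<close>.\<close>

definition frattini_kernel :: "nat \<Rightarrow> 'a monoid \<Rightarrow> 'a topology \<Rightarrow> 'a set \<Rightarrow> 'a set" where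
  "frattini_kernel p U T K =
     \<Inter> {H. subgroup H U \<and> closedin T H \<and>
           (\<forall>x \<in> K. \<forall>y \<in> K. x \<otimes>\<^bsub>U\<^esub> y \<otimes>\<^bsub>U\<^esub> inv\<^bsub>U\<^esub> x \<otimes>\<^bsub>U\<^esub> inv\<^bsub>U\<^esub> y \<in> H) \<and>
           (\<forall>x \<in> K. x [^]\<^bsub>U\<^esub> p \<in> H)}"

definition first_char_quotient ::
    "nat \<Rightarrow> 'a monoid \<Rightarrow> 'a topology \<Rightarrow> 'b monoid \<Rightarrow> ('a \<Rightarrow> 'b) \<Rightarrow> 'a set monoid" where
  "first_char_quotient p U T G \<phi> = U Mod (frattini_kernel p U T (kernel U G \<phi>))"

text \<open>The map on cosets induced by \<^term>\<open>\<phi>\<close>.\<close>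

definition induced_map :: "('a \<Rightarrow> 'b) \<Rightarrow> 'a set \<Rightarrow> 'b" where
  "induced_map \<phi> Y = the_elem (\<phi> ` Y)"


section \<open>Nielsen classes\<close>

type_synonym 'g tup4 = "'g \<times> 'g \<times> 'g \<times> 'g"

fun conj4 :: "'g monoid \<Rightarrow> 'g \<Rightarrow> 'g tup4 \<Rightarrow> 'g tup4" where
  "conj4 G x (g1, g2, g3, g4) =
     (x \<otimes>\<^bsub>G\<^esub> g1 \<otimes>\<^bsub>G\<^esub> inv\<^bsub>G\<^esub> x, x \<otimes>\<^bsub>G\<^esub> g2 \<otimes>\<^bsub>G\<^esub> inv\<^bsub>G\<^esub> x,
      x \<otimes>\<^bsub>G\<^esub> g3 \<otimes>\<^bsub>G\<^esub> inv\<^bsub>G\<^esub> x, x \<otimes>\<^bsub>G\<^esub> g4 \<otimes>\<^bsub>G\<^esub> inv\<^bsub>G\<^esub> x)"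

fun map4 :: "('g \<Rightarrow> 'h) \<Rightarrow> 'g tup4 \<Rightarrow> 'h tup4" where
  "map4 f (g1, g2, g3, g4) = (f g1, f g2, f g3, f g4)"

definition nielsen_class :: "'g monoid \<Rightarrow> 'g tup4 set" where
  "nielsen_class G =
     {(g1, g2, g3, g4). {g1, g2, g3, g4} \<subseteq> carrier G \<and>
        g1 \<otimes>\<^bsub>G\<^esub> g2 \<otimes>\<^bsub>G\<^esub> g3 \<otimes>\<^bsub>G\<^esub> g4 = \<one>\<^bsub>G\<^esub> \<and>
        generate G {g1, g2, g3, g4} = carrier G \<and>
        (\<forall>g \<in> {g1, g2, g3, g4}. group.ord G g = 3)}"

definition inner_class :: "'g monoid \<Rightarrow> 'g tup4 \<Rightarrow> 'g tup4 set" where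
  "inner_class G g = (\<lambda>x. conj4 G x g) ` carrier G"

definition nielsen_in :: "'g monoid \<Rightarrow> 'g tup4 set set" where
  "nielsen_in G = inner_class G ` nielsen_class G"


section \<open>The Hurwitz action\<close>

fun braid1 :: "'g monoid \<Rightarrow> 'g tup4 \<Rightarrow> 'g tup4" where
  "braid1 G (g1, g2, g3, g4) = (g1 \<otimes>\<^bsub>G\<^esub> g2 \<otimes>\<^bsub>G\<^esub> inv\<^bsub>G\<^esub> g1, g1, g3, g4)"

fun braid2 :: "'g monoid \<Rightarrow> 'g tup4 \<Rightarrow> 'g tup4" where
  "braid2 G (g1, g2, g3, g4) = (g1, g2 \<otimes>\<^bsub>G\<^esub> g3 \<otimes>\<^bsub>G\<^esub> inv\<^bsub>G\<^esub> g2, g2, g4)"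

fun braid3 :: "'g monoid \<Rightarrow> 'g tup4 \<Rightarrow> 'g tup4" where
  "braid3 G (g1, g2, g3, g4) = (g1, g2, g3 \<otimes>\<^bsub>G\<^esub> g4 \<otimes>\<^bsub>G\<^esub> inv\<^bsub>G\<^esub> g3, g3)"

definition hq1 :: "'g monoid \<Rightarrow> 'g tup4 set \<Rightarrow> 'g tup4 set" where
  "hq1 G = restrict ((`) (braid1 G)) (nielsen_in G)"

definition hq2 :: "'g monoid \<Rightarrow> 'g tup4 set \<Rightarrow> 'g tup4 set" where
  "hq2 G = restrict ((`) (braid2 G)) (nielsen_in G)"

definition hq3 :: "'g monoid \<Rightarrow> 'g tup4 set \<Rightarrow> 'g tup4 set" where
  "hq3 G = restrict ((`) (braid3 G)) (nielsen_in G)"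

text \<open>The group of permutations of \<^term>\<open>Y\<close> generated by \<^term>\<open>S\<close>, and its orbits.\<close>

definition perm_group :: "'x set \<Rightarrow> ('x \<Rightarrow> 'x) set \<Rightarrow> ('x \<Rightarrow> 'x) monoid" where
  "perm_group Y S = (BijGroup Y)\<lparr>carrier := generate (BijGroup Y) S\<rparr>"

definition perm_orbits :: "'x set \<Rightarrow> ('x \<Rightarrow> 'x) set \<Rightarrow> 'x set set" where
  "perm_orbits Y S = orbits (perm_group Y S) Y (\<lambda>\<tau>. \<tau>)"

text \<open>
  The generators \<open>(q\<^sub>1q\<^sub>2q\<^sub>3)\<^sup>2\<close> and \<open>q\<^sub>1q\<^sub>3\<^sup>-\<^sup>1\<close> of \<open>\<Q>\<close>, as permutations of the inner Nielsen class.  Braids act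
  on the right, whereas the product in \<^const>\<open>BijGroup\<close> is composition of functions; hence the
  reversed order of the factors.  The group generated by these permutations is the group through
  which \<open>\<Q>\<close>, equivalently its quotient \<open>\<Q>''\<close>, acts.
\<close>

definition q_gens :: "'g monoid \<Rightarrow> ('g tup4 set \<Rightarrow> 'g tup4 set) set" where
  "q_gens G = (let B = BijGroup (nielsen_in G) in
     {(hq3 G \<otimes>\<^bsub>B\<^esub> hq2 G \<otimes>\<^bsub>B\<^esub> hq1 G) [^]\<^bsub>B\<^esub> (2::nat), inv\<^bsub>B\<^esub> (hq3 G) \<otimes>\<^bsub>B\<^esub> hq1 G})"

definition Q_group :: "'g monoid \<Rightarrow> ('g tup4 set \<Rightarrow> 'g tup4 set) monoid" where
  "Q_group G = perm_group (nielsen_in G) (q_gens G)"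

definition Q_orbits :: "'g monoid \<Rightarrow> 'g tup4 set set set" where
  "Q_orbits G = perm_orbits (nielsen_in G) (q_gens G)"

definition nielsen_rd :: "'g monoid \<Rightarrow> 'g tup4 set set set" where
  "nielsen_rd G = Q_orbits G"

definition gamma_inf :: "'g monoid \<Rightarrow> 'g tup4 set set \<Rightarrow> 'g tup4 set set" where
  "gamma_inf G = restrict ((`) (hq2 G)) (nielsen_rd G)"

definition gamma_orbits :: "'g monoid \<Rightarrow> 'g tup4 set set set set" where
  "gamma_orbits G = perm_orbits (nielsen_rd G) {gamma_inf G}"

text \<open>The order \<open>u\<close> is required of every tuple representing an element of the orbit.\<close>

definition has_type :: "'g monoid \<Rightarrow> 'g tup4 set set set \<Rightarrow> nat \<times> nat \<Rightarrow> bool" where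
  "has_type G Y = (\<lambda>(u, v).
     (\<forall>R \<in> Y. \<forall>C \<in> R. \<forall>(g1, g2, g3, g4) \<in> C. group.ord G (g2 \<otimes>\<^bsub>G\<^esub> g3) = u) \<and> card Y = v)"


section \<open>H-M and near H-M representatives\<close>

definition HM_rep :: "'g monoid \<Rightarrow> 'g tup4 set \<Rightarrow> bool" where
  "HM_rep G C \<longleftrightarrow> C \<in> nielsen_in G \<and> (\<exists>g1 g2. (g1, inv\<^bsub>G\<^esub> g1, g2, inv\<^bsub>G\<^esub> g2) \<in> C)"

fun kappa_hat :: "'g monoid \<Rightarrow> 'g tup4 \<Rightarrow> 'g tup4" where
  "kappa_hat G (g1, g2, g3, g4) =
     (inv\<^bsub>G\<^esub> (g3 \<otimes>\<^bsub>G\<^esub> g4) \<otimes>\<^bsub>G\<^esub> inv\<^bsub>G\<^esub> g2 \<otimes>\<^bsub>G\<^esub> g3 \<otimes>\<^bsub>G\<^esub> g4,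
      inv\<^bsub>G\<^esub> (g3 \<otimes>\<^bsub>G\<^esub> g4) \<otimes>\<^bsub>G\<^esub> inv\<^bsub>G\<^esub> g1 \<otimes>\<^bsub>G\<^esub> g3 \<otimes>\<^bsub>G\<^esub> g4,
      inv\<^bsub>G\<^esub> g4, inv\<^bsub>G\<^esub> g3)"

text \<open>
  Here \<open>\<pi> : G \<rightarrow> A\<close> is the projection to the base group.  All conditions on \<open>g\<close> are invariant under
  simultaneous conjugation; for an involution \<open>c\<close>, \<^term>\<open>conj4 G c\<close> is \<open>g \<mapsto> c g c\<close>.
\<close>

definition near_HM_rep ::
    "'g monoid \<Rightarrow> 'h monoid \<Rightarrow> ('g \<Rightarrow> 'h) \<Rightarrow> 'g tup4 set \<Rightarrow> bool" where
  "near_HM_rep G A \<pi> C \<longleftrightarrow>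
     C \<in> nielsen_in G \<and> \<not> HM_rep G C \<and>
     (\<exists>g \<in> C. (\<exists>c \<in> carrier G. group.ord G c = 2 \<and> conj4 G c g = kappa_hat G g) \<and>
              HM_rep A (inner_class A (map4 \<pi> g)))"

end

theory Submission
  imports Defs "HOL-Algebra.Sylow"
begin

text \<open>
  Everything is reduced to \<open>A\<^sub>5\<close> and to the kernel \<open>M\<close> of \<open>G\<^sub>1 \<rightarrow> A\<^sub>5\<close>, an elementary abelian 2-group on
  which \<open>A\<^sub>5\<close> acts.

  \<^emph>\<open>The kernel.\<close>  Choose lifts \<open>b\<close>, \<open>c\<close> of orders 3 and 5 of a 3-cycle and a 5-cycle for which
  \<open>a = c b\<inverse>\<close> maps to an involution.  After conjugating \<open>c\<close> by a suitable element of \<open>M\<close>, the element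
  \<open>a\<^sup>2\<close> is fixed by a dihedral group of order 10 (\<open>good_lifts\<close>), so that it has at most six conjugates,
  permuted like the points of the projective line over the field of five elements.  Modulo their span
  the elements \<open>a\<close> and \<open>c\<close> satisfy a presentation of \<open>A\<^sub>5\<close> (\<open>icosahedral_presentation\<close>).  Hence they
  generate a finite subgroup that maps onto \<open>A\<^sub>5\<close>; by the Frattini property it is all of \<open>G\<^sub>1\<close>, and \<open>M\<close>
  is a quotient of the permutation module of dimension six.  The submodules of that module form a chain:
  zero, the constant vectors, the even vectors, everything.  An involution of \<open>A\<^sub>5\<close> that commutes with
  the image of \<open>a\<close> forces a linear relation (\<open>ex_relation\<close>), so that the constant vector dies.  Nothing
  else dies, because the universal cover also maps onto an explicit finite Frattini cover whose kernel
  has two different nontrivial elements (\<open>test_cover\<close>).  Therefore \<open>M\<close> has order 32 and \<open>G\<^sub>1\<close> has order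
  1920.  The image \<open>V\<close> of the even vectors is a normal subgroup of order 16 with \<open>G\<^sub>1/V\<close> the binary
  icosahedral group.  The locale \<open>level_one\<close> collects what the rest of the proof uses about \<open>G\<^sub>1\<close>.

  \<^emph>\<open>The Nielsen class.\<close>  In the binary icosahedral group a generating quadruple of elements of order
  three whose product maps to 1 has product 1 (\<open>spin_product_one\<close>); the other value \<open>-1\<close> does not occur.
  So each of the 1080 quadruples in \<open>A\<^sub>5\<close> lifts, with \<open>16\<^sup>3\<close> choices for the first three entries, and
  \<open>G\<^sub>1\<close> acts freely by conjugation: \<open>1080 \<cdot> 16\<^sup>3 / 1920 = 2304\<close>.

  \<^emph>\<open>Representatives.\<close>  For a generating pair \<open>x\<close>, \<open>y\<close> of elements of order three the product \<open>xy\<close> has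
  order 10, and its centralizer in \<open>M\<close> is \<open>{1, (xy)\<^sup>5}\<close>.  Every \<open>c\<close> in this centralizer defines a tuple
  \<open>tup x y c\<close> with outer entries \<open>x\<close> and \<open>y\<inverse>\<close>.  The choice \<open>c = 1\<close> gives \<open>(x, x\<inverse>, y, y\<inverse>)\<close>, that is,
  the H-M representatives, and \<open>c = (xy)\<^sup>5\<close> gives the near H-M representatives.  There are \<open>120 \<cdot> 16\<^sup>2\<close>
  pairs, hence 16 classes of either kind.

  \<^emph>\<open>Orbits.\<close>  The even powers of \<open>q\<^sub>2\<close> conjugate the middle pair by the powers of its product, an element
  of order 10.  A power of \<open>q\<^sub>2\<close> that carries a tuple of the form \<open>tup\<close> to another one fixes the outer
  entries, so the two have the same \<open>x\<close> and \<open>y\<close>; and passing from one value of \<open>c\<close> to the other is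
  impossible.  This gives the uniqueness statements and the orbit length 20.  Modulo conjugation the
  group \<open>\<Q>''\<close> acts through two explicit maps \<open>twist\<close> and \<open>shift\<close>, which preserve the form \<open>tup\<close>.  A
  class fixed by one of its nontrivial elements would produce an element \<open>t\<close> with \<open>t\<^sup>2 = 1\<close>; such elements
  lie in \<open>M\<close>, because involutions of \<open>A\<^sub>5\<close> lift only to elements of order 4, and that contradicts
  generation.
\<close>

section \<open>The alternating group of degree five\<close>

datatype pt = P1 | P2 | P3 | P4 | P5
text \<open>
  Five images determine a permutation of five points. In this form equality and products are
  evaluated by rewriting, so that finite statements about \<open>A\<^sub>5\<close> become
  computations.
\<close>

datatype perm5 = Perm pt pt pt pt pt

fun app :: "perm5 \<Rightarrow> pt \<Rightarrow> pt" where
  "app (Perm a b c d e) P1 = a"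
| "app (Perm a b c d e) P2 = b"
| "app (Perm a b c d e) P3 = c"
| "app (Perm a b c d e) P4 = d"
| "app (Perm a b c d e) P5 = e"

instantiation perm5 :: monoid_mult
begin
definition one_perm5 :: perm5 where "1 = Perm P1 P2 P3 P4 P5"
fun times_perm5 :: "perm5 \<Rightarrow> perm5 \<Rightarrow> perm5" where
  "p * Perm a b c d e = Perm (app p a) (app p b) (app p c) (app p d) (app p e)"
instance
proof
  have app_mul: "app (p * q) x = app p (app q x)" for p q :: perm5 and x
    by (cases q; cases x) auto
  show "p * q * r = p * (q * r)" for p q r :: perm5
    by (cases r) (simp add: app_mul)
  show "1 * p = p" for p :: perm5
  proof -
    have "app 1 x = x" for x by (cases x) (simp_all add: one_perm5_def)
    then show ?thesis by (cases p) simp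
  qed
  show "p * 1 = p" for p :: perm5
    by (cases p) (simp add: one_perm5_def)
qed
end

lemma app_mult: "app (p * q) x = app p (app q x)"
  by (cases q; cases x) auto

lemma app_one: "app 1 x = x"
  by (cases x) (simp_all add: one_perm5_def)

subsection \<open>Encoding of permutations\<close>

definition pt_of :: "nat \<Rightarrow> pt" where
  "pt_of n = (if n = 1 then P1 else if n = 2 then P2 else if n = 3 then P3 else if n = 4 then P4 else P5)"

definition enc :: "(nat \<Rightarrow> nat) \<Rightarrow> perm5" where
  "enc f = Perm (pt_of (f 1)) (pt_of (f 2)) (pt_of (f 3)) (pt_of (f 4)) (pt_of (f 5))"

lemma five_cases: "k \<in> {1..5} \<longleftrightarrow> k = 1 \<or> k = 2 \<or> k = 3 \<or> k = 4 \<or> k = (5::nat)"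
  by auto

lemma app_enc: "k \<in> {1..5} \<Longrightarrow> app (enc f) (pt_of k) = pt_of (f k)"
  unfolding five_cases by (elim disjE) (simp_all add: enc_def pt_of_def)

lemma pt_of_inj: "j \<in> {1..5} \<Longrightarrow> k \<in> {1..5} \<Longrightarrow> pt_of j = pt_of k \<Longrightarrow> j = k"
  unfolding five_cases by (elim disjE) (simp_all add: pt_of_def)

lemma enc_comp:
  assumes "g permutes {1..5}"
  shows "enc (f \<circ> g) = enc f * enc g"
proof -
  have "g k \<in> {1..5}" if "k \<in> {1..5}" for k using assms that by (meson permutes_in_image)
  then have *: "app (enc f) (pt_of (g k)) = pt_of (f (g k))" if "k \<in> {1..5}" for k
    using that app_enc by blast
  show ?thesis
    by (subst (2) enc_def) (simp add: * enc_def[of "f \<circ> g"])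
qed

lemma enc_inj:
  assumes "f permutes {1..5}" "g permutes {1..5}" "enc f = enc g"
  shows "f = g"
proof
  fix k
  show "f k = g k"
  proof (cases "k \<in> {1..5}")
    case True
    then have "pt_of (f k) = pt_of (g k)" by (metis app_enc assms(3))
    then show ?thesis using True assms(1,2) by (meson permutes_in_image pt_of_inj)
  next
    case False
    then show ?thesis using assms(1,2) by (simp add: permutes_not_in)
  qed
qed

lemma enc_id: "enc id = 1"
  by (simp add: enc_def one_perm5_def pt_of_def)

definition gam :: perm5 where "gam = Perm P2 P3 P4 P5 P1"
text \<open>
  The factorization is Klein four-group times a group of order 3 times a group of order 5.
\<close>

definition alt5_list :: "perm5 list" where
  "alt5_list = [v * t * s. v \<leftarrow> [1, Perm P2 P1 P4 P3 P5, Perm P3 P4 P1 P2 P5, Perm P4 P3 P2 P1 P5],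
      t \<leftarrow> [1, Perm P2 P3 P1 P4 P5, Perm P3 P1 P2 P4 P5],
      s \<leftarrow> [1, gam, gam * gam, gam * gam * gam, gam * gam * gam * gam]]"

definition alt5 :: "perm5 set" where "alt5 = enc ` carrier (alt_group 5)"

lemma enc_inj_on: "inj_on enc (carrier (alt_group 5))"
  by (rule inj_onI) (auto simp: alt_group_carrier intro: enc_inj)

lemma enc_mult:
  "f \<in> carrier (alt_group 5) \<Longrightarrow> g \<in> carrier (alt_group 5) \<Longrightarrow>
    enc (f \<otimes>\<^bsub>alt_group 5\<^esub> g) = enc f * enc g"
  by (simp add: alt_group_mult alt_group_carrier enc_comp)

lemma card_alt5: "card alt5 = 60"
proof -
  have "2 * card (carrier (alt_group 5)) = 120"
    using alt_group_card_carrier[of 5] by (simp add: fact_numeral)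
  then show ?thesis by (simp add: alt5_def card_image[OF enc_inj_on])
qed

lemma alt5_one: "1 \<in> alt5"
  using group.is_monoid[OF alt_group_is_group, of 5] monoid.one_closed
  by (force simp: alt5_def enc_id alt_group_one image_iff)

lemma alt5_mult: "x \<in> alt5 \<Longrightarrow> y \<in> alt5 \<Longrightarrow> x * y \<in> alt5"
proof -
  interpret A: group "alt_group 5" by (rule alt_group_is_group)
  assume "x \<in> alt5" "y \<in> alt5"
  then obtain f g where "f \<in> carrier (alt_group 5)" "g \<in> carrier (alt_group 5)"
    "x = enc f" "y = enc g" by (auto simp: alt5_def)
  then show "x * y \<in> alt5" by (auto simp: alt5_def simp flip: enc_mult)
qed

lemma alt5_inverse: "x \<in> alt5 \<Longrightarrow> \<exists>y\<in>alt5. x * y = 1 \<and> y * x = 1"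
proof -
  interpret A: group "alt_group 5" by (rule alt_group_is_group)
  assume "x \<in> alt5"
  then obtain f where f: "f \<in> carrier (alt_group 5)" "x = enc f" by (auto simp: alt5_def)
  let ?g = "inv\<^bsub>alt_group 5\<^esub> f"
  have "enc f * enc ?g = 1" "enc ?g * enc f = 1"
    using f by (simp_all flip: enc_mult add: alt_group_one enc_id)
  then show ?thesis using f by (auto simp: alt5_def)
qed

lemma alt5_eq_list: "alt5 = set alt5_list"
proof -
  have cyc: "enc (cycle_of_list [i, j, k]) \<in> alt5"
    if "distinct [i, j, k]" "{i, j, k} \<subseteq> {1..5}" for i j k
    unfolding alt5_def
    by (rule imageI, rule subsetD[OF three_cycles_incl]) (use that in fastforce)
  have "Perm P2 P3 P1 P4 P5 \<in> alt5"
    using cyc[of 1 2 3] by (simp add: enc_def pt_of_def transpose_def)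
  moreover have "Perm P3 P1 P2 P4 P5 \<in> alt5"
    using cyc[of 1 3 2] by (simp add: enc_def pt_of_def transpose_def)
  moreover have "Perm P1 P2 P4 P5 P3 \<in> alt5"
    using cyc[of 3 4 5] by (simp add: enc_def pt_of_def transpose_def)
  moreover have "Perm P1 P3 P4 P2 P5 \<in> alt5"
    using cyc[of 2 3 4] by (simp add: enc_def pt_of_def transpose_def)
  ultimately have "set [gam, Perm P2 P3 P1 P4 P5, Perm P3 P1 P2 P4 P5] \<subseteq> alt5"
    "Perm P2 P1 P4 P3 P5 \<in> alt5" "Perm P3 P4 P1 P2 P5 \<in> alt5" "Perm P4 P3 P2 P1 P5 \<in> alt5"
    using alt5_mult[of "Perm P2 P3 P1 P4 P5" "Perm P1 P2 P4 P5 P3"]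
      alt5_mult[of "Perm P2 P3 P1 P4 P5" "Perm P1 P3 P4 P2 P5"]
      alt5_mult[of "Perm P1 P3 P4 P2 P5" "Perm P2 P3 P1 P4 P5"]
      alt5_mult[of "Perm P2 P1 P4 P3 P5" "Perm P3 P4 P1 P2 P5"]
      alt5_mult[of "Perm P4 P3 P2 P1 P5" "Perm P3 P4 P1 P2 P5"]
      alt5_mult[of "Perm P4 P3 P2 P1 P5" "Perm P2 P1 P4 P3 P5"]
    by (simp_all add: gam_def)
  then have "set alt5_list \<subseteq> alt5"
    by (auto simp: alt5_list_def app_one simp del: times_perm5.simps intro!: alt5_mult alt5_one)
  moreover have "card (set alt5_list) = 60"
  proof -
    have "distinct alt5_list" "length alt5_list = 60" by code_simp+
    then show ?thesis using distinct_card by metis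
  qed
  moreover have "finite alt5" using card_alt5 by (intro card_ge_0_finite) simp
  ultimately show ?thesis by (metis card_alt5 card_subset_eq)
qed

definition three_cycle_list :: "perm5 list" where
  "three_cycle_list = filter (\<lambda>x. let y = x * x in y \<noteq> x \<and> y * x = 1) alt5_list"

abbreviation cyc3 :: "perm5 set" where "cyc3 \<equiv> set three_cycle_list"

definition common_fix :: "perm5 list \<Rightarrow> bool" where
  "common_fix xs = list_ex (\<lambda>p. list_all (\<lambda>x. app x p = p) xs) [P1, P2, P3, P4, P5]"

lemma alt5_cancel: "x \<in> alt5 \<Longrightarrow> x * y = x * z \<longleftrightarrow> y = z"
  by (metis alt5_inverse mult.assoc mult.left_neutral)

lemma alt5_cancel_right: "x \<in> alt5 \<Longrightarrow> y * x = z * x \<longleftrightarrow> y = z"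
  by (metis alt5_inverse mult.assoc mult.right_neutral)

lemma cyc3_iff: "x \<in> cyc3 \<longleftrightarrow> x \<in> alt5 \<and> x \<noteq> 1 \<and> x * x * x = 1"
  using alt5_cancel[of x x 1] by (auto simp: three_cycle_list_def alt5_eq_list Let_def)

lemma alt5_centre:
  assumes "x \<in> alt5" "\<And>y. y \<in> alt5 \<Longrightarrow> x * y = y * x"
  shows "x = 1"
proof -
  have "\<forall>x\<in>set alt5_list. (\<forall>y\<in>set alt5_list. x * y = y * x) \<longrightarrow> x = 1" by code_simp
  then show ?thesis using assms by (simp add: alt5_eq_list)
qed

lemma card_cyc3: "card cyc3 = 20"
proof -
  have "distinct three_cycle_list" "length three_cycle_list = 20" by code_simp+
  then show ?thesis using distinct_card by metis
qed

text \<open>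
  Two 3-cycles generate \<open>A\<^sub>5\<close> exactly if they have no common fixed point; the
  count runs over the conjugates of one fixed 3-cycle.
\<close>

lemma card_generating_pairs:
  "card {(x, y). x \<in> cyc3 \<and> y \<in> cyc3 \<and> \<not> common_fix [x, y]} = 120"
proof -
  let ?L = "filter (\<lambda>(x, y). \<not> common_fix [x, y]) (List.product three_cycle_list three_cycle_list)"
  have "distinct three_cycle_list" by code_simp
  then have "distinct ?L" by (simp add: distinct_product)
  moreover have "length ?L = 120" by code_simp
  ultimately have "card (set ?L) = 120" by (simp only: distinct_card)
  moreover have "{(x, y). x \<in> cyc3 \<and> y \<in> cyc3 \<and> \<not> common_fix [x, y]} = set ?L" by auto
  ultimately show ?thesis by (simp only:)
qed

lemma common_fix_iff: "common_fix xs \<longleftrightarrow> (\<exists>p. \<forall>x\<in>set xs. app x p = p)"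
proof -
  have "(\<exists>p. Q p) \<longleftrightarrow> Q P1 \<or> Q P2 \<or> Q P3 \<or> Q P4 \<or> Q P5" for Q
    by (metis pt.exhaust)
  then show ?thesis by (simp add: common_fix_def list_all_iff)
qed

lemma common_fix_conj:
  assumes "h * g = 1"
  shows "common_fix xs \<Longrightarrow> common_fix (map (\<lambda>u. g * u * h) xs)"
proof -
  assume "common_fix xs"
  then obtain p where "\<forall>x\<in>set xs. app x p = p" by (auto simp: common_fix_iff)
  then have "\<forall>x\<in>set xs. app (g * x * h) (app g p) = app g p"
    by (metis app_mult app_one assms)
  then show ?thesis by (auto simp: common_fix_iff)
qed

definition rho :: perm5 where "rho = Perm P2 P3 P1 P4 P5"

lemma cyc3_conj:
  assumes "x \<in> cyc3"
  obtains g h where "g \<in> alt5" "h \<in> alt5" "g * h = 1" "h * g = 1" "g * x * h = rho"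
proof -
  have "\<forall>x\<in>cyc3. \<exists>g\<in>set alt5_list. g * x = rho * g" by code_simp
  then obtain g where g: "g \<in> alt5" "g * x = rho * g" using assms by (auto simp: alt5_eq_list)
  then obtain h where "h \<in> alt5" "g * h = 1" "h * g = 1" using alt5_inverse by blast
  moreover from this g have "g * x * h = rho" by (simp add: mult.assoc)
  ultimately show ?thesis using g that by blast
qed

lemma conj_cyc3: "x \<in> cyc3 \<Longrightarrow> g \<in> alt5 \<Longrightarrow> h \<in> alt5 \<Longrightarrow> g * h = 1 \<Longrightarrow> h * g = 1 \<Longrightarrow> g * x * h \<in> cyc3"
  unfolding cyc3_iff
  by (smt (verit, ccfv_threshold) alt5_mult mult.assoc mult.left_neutral)

text \<open>
  The fourth entry of a quadruple with product 1 is the inverse of \<open>xyz\<close>, so triples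
  count quadruples.
\<close>

lemma card_generating_quadruples:
  "card {(x, y, z). x \<in> cyc3 \<and> y \<in> cyc3 \<and> z \<in> cyc3 \<and> x * y * z \<in> cyc3 \<and> \<not> common_fix [x, y, z]}
     = 1080"
proof -
  define F where "F x = {(y, z). y \<in> cyc3 \<and> z \<in> cyc3 \<and> x * y * z \<in> cyc3 \<and> \<not> common_fix [x, y, z]}" for x
  have fin: "finite (F x)" for x
    by (rule finite_subset[of _ "cyc3 \<times> cyc3"]) (auto simp: F_def)
  have le: "card (F x) \<le> card (F (g * x * h))"
    if gh: "g \<in> alt5" "h \<in> alt5" "g * h = 1" "h * g = 1" for x g h
  proof (rule card_inj_on_le[OF _ _ fin])
    show "inj_on (\<lambda>(y, z). (g * y * h, g * z * h)) (F x)"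
      using gh by (auto simp: inj_on_def alt5_cancel alt5_cancel_right)
    have "(g * y * h, g * z * h) \<in> F (g * x * h)" if yz: "(y, z) \<in> F x" for y z
    proof -
      have "g * x * h * (g * y * h) * (g * z * h) = g * (x * y * z) * h"
        by (metis \<open>h * g = 1\<close> mult.assoc mult.left_neutral)
      moreover have "common_fix [x, y, z]" if "common_fix [g * x * h, g * y * h, g * z * h]"
      proof -
        have "h * (g * u * h) * g = u" for u
          by (metis \<open>h * g = 1\<close> mult.assoc mult.left_neutral mult.right_neutral)
        then show ?thesis using common_fix_conj[OF \<open>g * h = 1\<close> that] by simp
      qed
      ultimately show ?thesis
        using yz conj_cyc3[OF _ gh] by (auto simp: F_def)
    qed
    then show "(\<lambda>(y, z). (g * y * h, g * z * h)) ` F x \<subseteq> F (g * x * h)" by auto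
  qed
  have "card (F x) = card (F rho)" if x: "x \<in> cyc3" for x
  proof -
    obtain g h where gh: "g \<in> alt5" "h \<in> alt5" "g * h = 1" "h * g = 1" "g * x * h = rho"
      using cyc3_conj[OF x] by blast
    then have "h * rho * g = x" by (metis mult.assoc mult.left_neutral mult.right_neutral)
    then show ?thesis using le[of g h x] le[of h g rho] gh by simp
  qed
  moreover have "card (F rho) = 54"
  proof -
    let ?L = "filter (\<lambda>(y, z). (let w = rho * y * z; v = w * w in v \<noteq> w \<and> v * w = 1) \<and> \<not> common_fix [rho, y, z])
      (List.product three_cycle_list three_cycle_list)"
    have "distinct three_cycle_list" by code_simp
    then have "distinct ?L" by (simp add: distinct_product)
    moreover have "length ?L = 54" by code_simp
    ultimately have "card (set ?L) = 54" by (simp only: distinct_card)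
    moreover have "rho \<in> cyc3" by code_simp
    then have "F rho = set ?L"
      by (auto simp: F_def cyc3_iff Let_def alt5_cancel[of _ _ 1, simplified] alt5_mult)
    ultimately show ?thesis by (simp only:)
  qed
  ultimately have "card (F x) = 54" if "x \<in> cyc3" for x using that by simp
  moreover have "{(x, y, z). x \<in> cyc3 \<and> y \<in> cyc3 \<and> z \<in> cyc3 \<and> x * y * z \<in> cyc3 \<and>
      \<not> common_fix [x, y, z]} = Sigma cyc3 F"
    by (auto simp: F_def)
  ultimately show ?thesis by (simp add: card_SigmaI fin card_cyc3)
qed

definition coset_words :: "perm5 \<Rightarrow> perm5 \<Rightarrow> perm5 list" where
  "coset_words x y = [u * s. u \<leftarrow> [1, x, y, y * x, y * y, x * y * x, x * y * y, x * x * y * x,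
      x * x * y * y, y * x * x * y * x, y * x * x * y * y, y * y * x * x * y * x],
      s \<leftarrow> (let c = x * y in [1, c, c * c, c * c * c, c * c * c * c])]"

text \<open>
  Conjugation moves the first element to a fixed 3-cycle; for each of the remaining second elements
  an explicit list of words exhausts \<open>A\<^sub>5\<close>. Closed sets instead of generated
  subgroups make the statement applicable to images of subgroups.
\<close>

lemma pair_generates:
  assumes c: "x \<in> cyc3" "y \<in> cyc3" and fx: "\<not> common_fix [x, y]"
    and Z: "x \<in> Z" "y \<in> Z" "1 \<in> Z" "\<And>u v. u \<in> Z \<Longrightarrow> v \<in> Z \<Longrightarrow> u * v \<in> Z"
  shows "alt5 \<subseteq> Z"
proof
  fix k assume k: "k \<in> alt5"
  have words: "\<forall>y\<in>cyc3. \<not> common_fix [rho, y] \<longrightarrow>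
      (let W = coset_words rho y in \<forall>k\<in>set alt5_list. k \<in> set W)"
    by code_simp
  obtain g h where gh: "g \<in> alt5" "h \<in> alt5" "g * h = 1" "h * g = 1" "g * x * h = rho"
    using cyc3_conj[OF c(1)] by blast
  have unconj: "h * (g * u * h) * g = u" for u
    by (metis gh(4) mult.assoc mult.left_neutral mult.right_neutral)
  define Z' where "Z' = {u. h * u * g \<in> Z}"
  have Z': "u * v \<in> Z'" if "u \<in> Z'" "v \<in> Z'" for u v
  proof -
    have "h * (u * v) * g = h * u * g * (h * v * g)"
      by (metis gh(3) mult.assoc mult.left_neutral)
    then show ?thesis using that Z(4) by (simp add: Z'_def)
  qed
  have xr: "h * rho * g = x" using unconj[of x] gh(5) by simp
  then have "rho \<in> Z'" "g * y * h \<in> Z'" "1 \<in> Z'" using Z gh by (simp_all add: Z'_def unconj)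
  then have "set (coset_words rho (g * y * h)) \<subseteq> Z'"
    using Z' by (auto simp: coset_words_def Let_def)
  moreover have "g * k * h \<in> set (coset_words rho (g * y * h))"
    using words[rule_format, of "g * y * h"] common_fix_conj[OF gh(3), of "[g * x * h, g * y * h]"]
      conj_cyc3[OF c(2) gh(1-4)] fx alt5_mult[OF alt5_mult[OF gh(1) k] gh(2)]
    by (auto simp: Let_def unconj gh(5) xr alt5_eq_list)
  ultimately show "k \<in> Z" by (auto simp: Z'_def unconj)
qed

lemma triple_generates:
  assumes c: "x \<in> cyc3" "y \<in> cyc3" "w \<in> cyc3" and fx: "\<not> common_fix [x, y, w]"
    and Z: "x \<in> Z" "y \<in> Z" "w \<in> Z" "1 \<in> Z" "\<And>u v. u \<in> Z \<Longrightarrow> v \<in> Z \<Longrightarrow> u * v \<in> Z"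
  shows "alt5 \<subseteq> Z"
proof -
  have *: "\<forall>y\<in>cyc3. \<forall>w\<in>cyc3. \<not> common_fix [rho, y, w] \<longrightarrow>
     \<not> common_fix [rho, y] \<or> \<not> common_fix [rho, w] \<or> \<not> common_fix [y, w] \<or>
     \<not> common_fix [w, rho * y * rho * rho]"
    by code_simp
  obtain g h where gh: "g \<in> alt5" "h \<in> alt5" "g * h = 1" "h * g = 1" "g * x * h = rho"
    using cyc3_conj[OF c(1)] by blast
  have unconj: "h * (g * u * h) * g = u" for u
    by (metis gh(4) mult.assoc mult.left_neutral mult.right_neutral)
  have xy: "x * y * x * x \<in> cyc3"
    using conj_cyc3[of y x "x * x"] c by (simp add: cyc3_iff alt5_mult mult.assoc)
  have "rho * (g * y * h) * rho * rho = g * (x * y * x * x) * h"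
    unfolding gh(5)[symmetric] by (metis gh(4) mult.assoc mult.left_neutral)
  then have "\<not> common_fix [g * x * h, g * y * h] \<or> \<not> common_fix [g * x * h, g * w * h] \<or>
     \<not> common_fix [g * y * h, g * w * h] \<or> \<not> common_fix [g * w * h, g * (x * y * x * x) * h]"
    using *[rule_format, of "g * y * h" "g * w * h"] conj_cyc3 c gh fx
      common_fix_conj[OF gh(3), of "[g * x * h, g * y * h, g * w * h]"]
      unconj[of x]
    by (auto simp: unconj gh(5))
  then consider "\<not> common_fix [x, y]" | "\<not> common_fix [x, w]" | "\<not> common_fix [y, w]"
    | "\<not> common_fix [w, x * y * x * x]" "x * y * x * x \<in> cyc3"
    using xy common_fix_conj[OF gh(4), of "[x, y]"] common_fix_conj[OF gh(4), of "[x, w]"]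
      common_fix_conj[OF gh(4), of "[y, w]"] common_fix_conj[OF gh(4), of "[w, x * y * x * x]"]
    by auto
  then show ?thesis
  proof cases
    case 1 show ?thesis by (rule pair_generates[OF c(1,2) 1]) (intro Z | assumption)+
  next
    case 2 show ?thesis by (rule pair_generates[OF c(1,3) 2]) (intro Z | assumption)+
  next
    case 3 show ?thesis by (rule pair_generates[OF c(2,3) 3]) (intro Z | assumption)+
  next
    case 4 show ?thesis by (rule pair_generates[OF c(3) 4(2,1)]) (intro Z | assumption)+
  qed
qed

text \<open>
  The cases of a pair of 3-cycles by the order of the product. In the last two an involution
  \<open>v\<close> conjugates one element into the other and \<open>xv\<close> has the odd order 3
  or 5; this feeds the spin computation.
\<close>

lemma pair_cases:
  assumes "x \<in> cyc3" "y \<in> cyc3"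
  obtains "x = y" | "x * y = 1" | "x * y \<noteq> 1" "x * y * (x * y) = 1"
  | v where "v \<in> alt5" "v \<noteq> 1" "v * v = 1" "v * x * v = y" "x * v * (x * v) * (x * v) = 1"
     "x * y * (x * y) * (x * y) = 1" "x * y \<noteq> 1"
  | v where "v \<in> alt5" "v \<noteq> 1" "v * v = 1" "v * x * v = y"
     "x * v * (x * v) * (x * v) * (x * v) * (x * v) = 1"
     "x * y * (x * y) * (x * y) * (x * y) * (x * y) = 1" "x * y \<noteq> 1"
proof -
  have "\<forall>x\<in>cyc3. \<forall>y\<in>cyc3. x = y \<or> (let z = x * y in z = 1 \<or> z * z = 1 \<or>
      (\<exists>v\<in>set alt5_list. v \<noteq> 1 \<and> v * v = 1 \<and> v * x * v = y \<and>
         (let w = x * v in w * w * w = 1 \<and> z * z * z = 1 \<or>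
            w * w * w * w * w = 1 \<and> z * z * z * z * z = 1)))"
    by code_simp
  then show ?thesis
    using assms that by (metis (no_types, lifting) alt5_eq_list)
qed

text \<open>
  In a generating pair of 3-cycles the product has order 5. The last identity says that conjugation
  by the cube of \<open>x\<inverse>y\<close> carries \<open>xy\<close> to the inverse of
  \<open>yx\<close>; it separates the H-M tuples from the near H-M tuples under odd powers of the
  middle braid.
\<close>

lemma generating_pair_cases:
  assumes "x \<in> cyc3" "y \<in> cyc3" "\<not> common_fix [x, y]"
  shows "x * y \<noteq> 1" "x * y * (x * y) \<noteq> 1" "x * y * (x * y) * (x * y) \<noteq> 1"
    "x * y * (x * y) * (x * y) * (x * y) * (x * y) = 1" "\<not> common_fix [x * x, y]"
    "\<not> common_fix [x, y * y]" "\<not> common_fix [y, x]" "x \<noteq> y"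
    "(let z = x * x * y in y * x * z * z * z * x * y = z * z * z)"
proof -
  have "\<forall>x\<in>cyc3. \<forall>y\<in>cyc3. \<not> common_fix [x, y] \<longrightarrow> (let z = x * y in z \<noteq> 1 \<and> z * z \<noteq> 1
     \<and> z * z * z \<noteq> 1 \<and> z * z * z * z * z = 1 \<and>
     \<not> common_fix [x * x, y] \<and> \<not> common_fix [x, y * y] \<and> \<not> common_fix [y, x] \<and> x \<noteq> y \<and>
     (let z = x * x * y in y * x * z * z * z * x * y = z * z * z))"
    by code_simp
  then show "x * y \<noteq> 1" "x * y * (x * y) \<noteq> 1" "x * y * (x * y) * (x * y) \<noteq> 1"
    "x * y * (x * y) * (x * y) * (x * y) * (x * y) = 1" "\<not> common_fix [x * x, y]"
    "\<not> common_fix [x, y * y]" "\<not> common_fix [y, x]" "x \<noteq> y"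
    "(let z = x * x * y in y * x * z * z * z * x * y = z * z * z)"
    using assms by (simp_all add: Let_def)
qed

text \<open>
  A product of order at most 3 forces a common fixed point.
\<close>

lemma small_product_fixes:
  assumes "x \<in> cyc3" "y \<in> cyc3"
  shows "x * y * (x * y) = 1 \<Longrightarrow> common_fix [x, y]"
    and "x * y \<noteq> 1 \<Longrightarrow> x * y * (x * y) = 1 \<Longrightarrow> app (x * y) p = p \<Longrightarrow> app x p = p \<and> app y p = p"
    and "x * y \<in> cyc3 \<Longrightarrow> common_fix [x, y, x * y]"
proof -
  have "\<forall>x\<in>cyc3. \<forall>y\<in>cyc3. let z = x * y in (z * z = 1 \<longrightarrow> common_fix [x, y] \<and>
      (z \<noteq> 1 \<longrightarrow> list_all (\<lambda>p. app z p = p \<longrightarrow> app x p = p \<and> app y p = p) [P1, P2, P3, P4, P5])) \<and>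
      (z * z * z = 1 \<longrightarrow> common_fix [x, y, z])"
    by code_simp
  then have *: "x * y * (x * y) = 1 \<longrightarrow> common_fix [x, y] \<and>
      (x * y \<noteq> 1 \<longrightarrow> list_all (\<lambda>p. app (x * y) p = p \<longrightarrow> app x p = p \<and> app y p = p) [P1, P2, P3, P4, P5])"
    "x * y * (x * y) * (x * y) = 1 \<longrightarrow> common_fix [x, y, x * y]"
    using assms unfolding Let_def by blast+
  show "x * y * (x * y) = 1 \<Longrightarrow> common_fix [x, y]" using * by simp
  show "x * y \<noteq> 1 \<Longrightarrow> x * y * (x * y) = 1 \<Longrightarrow> app (x * y) p = p \<Longrightarrow> app x p = p \<and> app y p = p"
    using * by (cases p) simp_all
  show "x * y \<in> cyc3 \<Longrightarrow> common_fix [x, y, x * y]" using * by (simp add: cyc3_iff)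
qed

section \<open>Orbits of small permutation groups\<close>

lemma BijGroup_mult_apply:
  "f \<in> Bij Y \<Longrightarrow> g \<in> Bij Y \<Longrightarrow> y \<in> Y \<Longrightarrow> (f \<otimes>\<^bsub>BijGroup Y\<^esub> g) y = f (g y)"
  by (simp add: BijGroup_def compose_def)

lemma Bij_into: "f \<in> Bij Y \<Longrightarrow> y \<in> Y \<Longrightarrow> f y \<in> Y"
  using Bij_imp_funcset by blast

lemma carrier_BijGroup: "carrier (BijGroup Y) = Bij Y"
  by (simp add: BijGroup_def)

lemma one_BijGroup: "y \<in> Y \<Longrightarrow> \<one>\<^bsub>BijGroup Y\<^esub> y = y"
  by (simp add: BijGroup_def)

lemma BijGroup_eqI:
  "f \<in> Bij Y \<Longrightarrow> g \<in> Bij Y \<Longrightarrow> (\<And>y. y \<in> Y \<Longrightarrow> f y = g y) \<Longrightarrow> f = g"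
  by (auto simp: Bij_def intro: extensionalityI)

lemma BijGroup_pow_apply:
  assumes "f \<in> Bij Y" "y \<in> Y"
  shows "(f [^]\<^bsub>BijGroup Y\<^esub> (k::nat)) y = (f ^^ k) y"
  using assms(2)
proof (induction k arbitrary: y)
  case 0
  then show ?case by (simp add: one_BijGroup)
next
  case (Suc k)
  interpret B: group "BijGroup Y" by (rule group_BijGroup)
  have "f [^]\<^bsub>BijGroup Y\<^esub> k \<in> Bij Y"
    using B.nat_pow_closed[of f k] assms(1) by (simp add: carrier_BijGroup)
  then show ?case
    using Suc assms(1) by (simp add: BijGroup_mult_apply Bij_into funpow_swap1)
qed

lemma finite_Bij: "finite Y \<Longrightarrow> finite (Bij Y)"
proof -
  assume "finite Y"
  then have "finite (Y \<rightarrow>\<^sub>E Y)" by (auto intro: finite_PiE)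
  moreover have "Bij Y \<subseteq> Y \<rightarrow>\<^sub>E Y" by (auto simp: Bij_def bij_betw_def PiE_def)
  ultimately show ?thesis by (rule finite_subset[rotated])
qed

text \<open>
  Negative powers give nothing new on a finite set.
\<close>

lemma perm_orbits_cyclic:
  assumes "finite Y" "f \<in> Bij Y"
  shows "perm_orbits Y {f} = (\<lambda>y. range (\<lambda>k. (f ^^ k) y)) ` Y"
proof -
  interpret B: group "BijGroup Y" by (rule group_BijGroup)
  have "generate (BijGroup Y) {f} = {f [^]\<^bsub>BijGroup Y\<^esub> k | k. k \<in> (UNIV :: nat set)}"
    by (rule B.generate_pow_on_finite_carrier)
      (use assms in \<open>simp_all add: carrier_BijGroup finite_Bij\<close>)
  then have "orbit (perm_group Y {f}) (\<lambda>\<tau>. \<tau>) y = range (\<lambda>k. (f ^^ k) y)" if "y \<in> Y" for y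
    using that assms by (auto simp: orbit_def perm_group_def BijGroup_pow_apply)
      (metis BijGroup_pow_apply)
  then show ?thesis
    by (auto simp: perm_orbits_def orbits_def)
qed

lemma (in group) generate_klein:
  assumes ab: "a \<in> carrier G" "b \<in> carrier G" and sq: "a \<otimes> a = \<one>" "b \<otimes> b = \<one>"
    and comm: "a \<otimes> b = b \<otimes> a"
  shows "generate G {b, a} = {\<one>, a, b, a \<otimes> b}"
proof
  have 1: "a \<otimes> (b \<otimes> a) = b" "b \<otimes> (b \<otimes> a) = a" "a \<otimes> (a \<otimes> b) = b" "b \<otimes> (a \<otimes> b) = a"
    "a \<otimes> b \<otimes> a = b" "a \<otimes> b \<otimes> b = a" "a \<otimes> b \<otimes> (a \<otimes> b) = \<one>"
    using ab sq comm by (metis m_assoc l_one r_one m_closed)+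
  have inv: "inv a = a" "inv b = b"
    using ab sq by (simp_all add: inv_equality)
  show "generate G {b, a} \<subseteq> {\<one>, a, b, a \<otimes> b}"
  proof
    fix x assume "x \<in> generate G {b, a}"
    then show "x \<in> {\<one>, a, b, a \<otimes> b}"
    proof (induction rule: generate.induct)
      case (eng h1 h2)
      then show ?case using ab sq comm 1
        by (auto simp: m_assoc)
    qed (auto simp: inv)
  qed
  show "{\<one>, a, b, a \<otimes> b} \<subseteq> generate G {b, a}"
    by (auto intro: generate.intros)
qed

lemma (in group) cancel_left:
  "x \<in> carrier G \<Longrightarrow> y \<in> carrier G \<Longrightarrow> inv x \<otimes> (x \<otimes> y) = y"
  "x \<in> carrier G \<Longrightarrow> y \<in> carrier G \<Longrightarrow> x \<otimes> (inv x \<otimes> y) = y"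
  by (simp_all flip: m_assoc)

lemmas (in group) group_word = m_assoc inv_mult_group cancel_left

lemma (in group) pow_five: "x \<in> carrier G \<Longrightarrow> x [^] (5::nat) = x \<otimes> x \<otimes> x \<otimes> x \<otimes> x"
  by (simp add: numeral_eq_Suc)

lemma (in group) pow_three: "x \<in> carrier G \<Longrightarrow> x [^] (3::nat) = x \<otimes> x \<otimes> x"
  by (simp add: numeral_eq_Suc)

lemma (in group) commute_conj:
  "x \<in> carrier G \<Longrightarrow> y \<in> carrier G \<Longrightarrow> x \<otimes> y \<otimes> inv x = y \<longleftrightarrow> x \<otimes> y = y \<otimes> x"
  by (metis inv_solve_right m_closed)

lemma (in group) pow_conj:
  "w \<in> carrier G \<Longrightarrow> x \<in> carrier G \<Longrightarrow> (w \<otimes> x \<otimes> inv w) [^] (n::nat) = w \<otimes> x [^] n \<otimes> inv w"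
  by (induction n) (simp_all add: group_word)

section \<open>Groups over the alternating group\<close>

locale alt5_epi = group G for G (structure) +
  fixes p :: "'a \<Rightarrow> perm5"
  assumes p_mult: "x \<in> carrier G \<Longrightarrow> y \<in> carrier G \<Longrightarrow> p (x \<otimes> y) = p x * p y"
    and p_surj: "p ` carrier G = alt5"
begin

lemma p_alt5: "x \<in> carrier G \<Longrightarrow> p x \<in> alt5"
  using p_surj by blast

lemma p_one: "p \<one> = 1"
proof -
  have "p \<one> * p \<one> = p \<one> * 1" by (simp flip: p_mult)
  then show ?thesis using alt5_cancel[of "p \<one>"] p_alt5 by blast
qed

lemma p_inv: "x \<in> carrier G \<Longrightarrow> p x * p (inv x) = 1" "x \<in> carrier G \<Longrightarrow> p (inv x) * p x = 1"
  by (simp_all add: p_one flip: p_mult)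

lemma p_inv_eqI: "x \<in> carrier G \<Longrightarrow> p x * y = 1 \<Longrightarrow> p (inv x) = y"
  by (metis p_inv(2) mult.assoc mult.left_neutral mult.right_neutral)

lemma p_pow: "x \<in> carrier G \<Longrightarrow> p (x [^] (n::nat)) = p x ^ n"
  by (induction n) (simp_all add: p_one p_mult power_commutes)

lemma p_conj_one: "g \<in> carrier G \<Longrightarrow> x \<in> carrier G \<Longrightarrow> p x = 1 \<Longrightarrow> p (g \<otimes> x \<otimes> inv g) = 1"
  by (simp add: p_mult p_inv)

lemma lift: "X \<in> alt5 \<Longrightarrow> \<exists>x\<in>carrier G. p x = X"
  using p_surj by (metis imageE)

end

lemma pow5_expand: "(x::'a::monoid_mult) ^ 5 = x * x * x * x * x"
  by (simp add: eval_nat_numeral mult.assoc)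

lemma pow3_expand: "(x::'a::monoid_mult) ^ 3 = x * x * x"
  by (simp add: eval_nat_numeral mult.assoc)

lemma power_inverse_pair: "(a::'a::monoid_mult) * b = 1 \<Longrightarrow> a ^ m * b ^ m = 1"
proof (induction m)
  case (Suc m)
  have "a ^ Suc m * b ^ Suc m = a ^ m * (a * b) * b ^ m"
    unfolding power_Suc2[of a] power_Suc[of b] by (simp add: mult.assoc)
  then show ?case using Suc by simp
qed simp

lemma pow_coprime_small:
  fixes x :: "'a::monoid_mult"
  shows "x ^ 3 = 1 \<Longrightarrow> x ^ 5 = 1 \<Longrightarrow> x = 1" "x ^ 3 = 1 \<Longrightarrow> x * x = 1 \<Longrightarrow> x = 1"
    "x ^ 5 = 1 \<Longrightarrow> x * x = 1 \<Longrightarrow> x = 1"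
proof -
  show "x ^ 3 = 1 \<Longrightarrow> x * x = 1 \<Longrightarrow> x = 1" "x ^ 5 = 1 \<Longrightarrow> x * x = 1 \<Longrightarrow> x = 1"
    by (simp_all add: pow3_expand pow5_expand)
  assume x: "x ^ 3 = 1" "x ^ 5 = 1"
  then have "x * x = 1" by (simp add: pow3_expand pow5_expand)
  with x show "x = 1" by (simp add: pow3_expand)
qed

section \<open>The binary icosahedral group\<close>

text \<open>
  The double cover of \<open>A\<^sub>5\<close> in which involutions lift to elements of order 4; up
  to isomorphism this is the binary icosahedral group.
\<close>

locale spin_cover = alt5_epi +
  fixes z
  assumes kernel: "x \<in> carrier G \<Longrightarrow> p x = 1 \<Longrightarrow> x = \<one> \<or> x = z"
    and z: "z \<in> carrier G" "p z = 1" "z \<noteq> \<one>" "z \<otimes> z = \<one>"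
    and involution: "x \<in> carrier G \<Longrightarrow> p x \<noteq> 1 \<Longrightarrow> p x * p x = 1 \<Longrightarrow> x \<otimes> x = z"
begin

lemma z_central: "x \<in> carrier G \<Longrightarrow> z \<otimes> x = x \<otimes> z"
proof -
  assume x: "x \<in> carrier G"
  then have "x \<otimes> z \<otimes> inv x = \<one> \<or> x \<otimes> z \<otimes> inv x = z"
    using kernel[of "x \<otimes> z \<otimes> inv x"] z p_conj_one by simp
  moreover have "x \<otimes> z \<otimes> inv x \<noteq> \<one>"
    using x z by (metis inv_closed inv_inv inv_solve_right l_one m_assoc r_one m_closed r_cancel_one' inv_unique')
  ultimately show ?thesis using x z commute_conj[of x z] by auto
qed

lemma z_pow_odd: "odd n \<Longrightarrow> z [^] (n::nat) = z"
proof -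
  assume "odd n"
  then obtain k where "n = 2 * k + 1" using oddE by blast
  moreover have "z [^] (2 * k) = \<one>"
    using z nat_pow_pow[of z 2 k] by (simp add: numeral_2_eq_2)
  ultimately show ?thesis using z by simp
qed

lemma same_image: "x \<in> carrier G \<Longrightarrow> y \<in> carrier G \<Longrightarrow> p x = p y \<Longrightarrow> y = x \<or> y = z \<otimes> x"
proof -
  assume xy: "x \<in> carrier G" "y \<in> carrier G" "p x = p y"
  then have "p (y \<otimes> inv x) = 1" by (metis inv_closed p_inv(1) p_mult)
  then have "y \<otimes> inv x = \<one> \<or> y \<otimes> inv x = z" using kernel xy by simp
  then show ?thesis using xy z by (metis inv_solve_right' l_one one_closed)
qed

text \<open>
  Of the two lifts of an element of odd order exactly one keeps that order.
\<close>

lemma odd_lift_unique: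
  assumes "x \<in> carrier G" "y \<in> carrier G" "p x = p y" "x [^] n = \<one>" "y [^] n = \<one>" "odd (n::nat)"
  shows "x = y"
proof (rule ccontr)
  assume "x \<noteq> y"
  then have "y = z \<otimes> x" using same_image assms by blast
  then have "y [^] n = z [^] n \<otimes> x [^] n"
    using pow_mult_distrib[of z x n] z z_central[of x] assms by simp
  then show False using assms z by (simp add: z_pow_odd)
qed

lemma odd_lift_exists:
  assumes "X \<in> alt5" "X ^ n = 1" "odd n"
  obtains x where "x \<in> carrier G" "p x = X" "x [^] (n::nat) = \<one>"
proof -
  obtain y where y: "y \<in> carrier G" "p y = X" using lift assms by blast
  then have "y [^] n = \<one> \<or> y [^] n = z" using kernel[of "y [^] n"] assms by (simp add: p_pow)
  then show thesis
  proof
    assume "y [^] n = z"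
    then have "(z \<otimes> y) [^] n = \<one>"
      using pow_mult_distrib[of z y n] z z_central[of y] y assms by (simp add: z_pow_odd)
    then show thesis using that[of "z \<otimes> y"] y z by (simp add: p_mult)
  qed (use that y in blast)
qed

text \<open>
  For a lift \<open>w\<close> of \<open>v\<close> one has \<open>y = w x w\<inverse>\<close> and so
  \<open>xy = (xw)\<^sup>2 w\<inverse>\<^sup>2 = (xw)\<^sup>2 z\<close>; with \<open>xw\<close>
  chosen of the odd order \<open>n\<close>, the power is \<open>z\<close>.
\<close>

lemma product_of_conjugates:
  assumes x: "x \<in> carrier G" "x [^] (3::nat) = \<one>" and y: "y \<in> carrier G" "y [^] (3::nat) = \<one>"
    and v: "v \<in> alt5" "v \<noteq> 1" "v * v = 1" "v * p x * v = p y"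
    and n: "odd n" "(p x * v) ^ n = 1"
  shows "(x \<otimes> y) [^] n = z"
proof -
  obtain u where u: "u \<in> carrier G" "p u = p x * v" "u [^] n = \<one>"
    using odd_lift_exists[of "p x * v" n] n v alt5_mult p_alt5 x by blast
  define w where "w = inv x \<otimes> u"
  have w: "w \<in> carrier G" "p w = v" "x \<otimes> w = u"
  proof -
    have "p x * p (inv x) * (p x * v) = p x * v" using p_inv(1)[OF x(1)] by simp
    then have "p (inv x) * (p x * v) = v" using alt5_cancel[OF p_alt5[OF x(1)]] by (simp add: mult.assoc)
    then show "p w = v" using x u by (simp add: w_def p_mult)
  qed (use x u in \<open>simp_all add: w_def cancel_left\<close>)
  have ww: "w \<otimes> w = z" using involution w v by simp
  have iw: "inv w = z \<otimes> w"
    using w z ww by (metis inv_unique' m_assoc m_closed z_central)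
  have "w \<otimes> x \<otimes> inv w = y"
  proof (rule odd_lift_unique[where n = 3])
    show "p (w \<otimes> x \<otimes> inv w) = p y"
      using w x v z iw by (simp add: p_mult)
    show "(w \<otimes> x \<otimes> inv w) [^] (3::nat) = \<one>"
      using w x by (simp add: pow_conj)
  qed (use w x y in auto)
  then have "x \<otimes> y = x \<otimes> w \<otimes> (x \<otimes> inv w)"
    using x w(1) by (auto simp: m_assoc)
  also have "\<dots> = u \<otimes> u \<otimes> z"
    using x w z u iw z_central[of w] by (simp add: m_assoc[symmetric])
  also have "\<dots> [^] n = \<one>  \<otimes> z"
    using pow_mult_distrib[of "u \<otimes> u" z n] pow_mult_distrib[of u u n] u z z_central[of "u \<otimes> u"] n
    by (simp add: z_pow_odd)
  finally show ?thesis using z by simp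
qed

lemma spin_pair_cases:
  assumes x: "x \<in> carrier G" "x [^] (3::nat) = \<one>" "p x \<in> cyc3"
    and y: "y \<in> carrier G" "y [^] (3::nat) = \<one>" "p y \<in> cyc3"
  obtains "p x = p y" | "p x * p y = 1" | "p x * p y \<noteq> 1" "p x * p y * (p x * p y) = 1"
  | n where "n = 3 \<or> n = (5::nat)" "p x * p y \<noteq> 1" "(p x * p y) ^ n = 1" "(x \<otimes> y) [^] n = z"
  using x(3) y(3)
proof (cases rule: pair_cases)
  case (4 v)
  then show thesis using that(4)[of 3] product_of_conjugates[of x y v 3] x y
    by (simp add: pow3_expand)
next
  case (5 v)
  then show thesis using that(4)[of 5] product_of_conjugates[of x y v 5] x y
    by (simp add: pow5_expand)
next
  case 1 then show thesis by (rule that(1))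
next
  case 2 then show thesis by (rule that(2))
next
  case 3 then show thesis by (rule that(3))
qed

lemma generating_pair_spin:
  assumes x: "x \<in> carrier G" "x [^] (3::nat) = \<one>" "p x \<in> cyc3"
    and y: "y \<in> carrier G" "y [^] (3::nat) = \<one>" "p y \<in> cyc3"
    and fx: "\<not> common_fix [p x, p y]"
  shows "(x \<otimes> y) [^] (5::nat) = z"
  using x y
proof (cases rule: spin_pair_cases)
  case (4 n)
  then show ?thesis
    using generating_pair_cases(3)[OF x(3) y(3) fx] by (auto simp: pow3_expand)
next
  case 1 then show ?thesis using generating_pair_cases(8)[OF x(3) y(3) fx] by simp
next
  case 2 then show ?thesis using generating_pair_cases(1)[OF x(3) y(3) fx] by simp
next
  case 3 then show ?thesis using generating_pair_cases(2)[OF x(3) y(3) fx] by simp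
qed

text \<open>
  The product is 1 or \<open>z\<close>. Both halves \<open>x1 x2\<close> and \<open>x3 x4\<close>
  are products of two elements of order three whose images are inverse to each other, and the case
  distinction on such a product determines its lift, with the same sign on both sides.
\<close>

theorem spin_product_one:
  assumes x: "x1 \<in> carrier G" "x1 [^] (3::nat) = \<one>" "p x1 \<in> cyc3"
     "x2 \<in> carrier G" "x2 [^] (3::nat) = \<one>" "p x2 \<in> cyc3"
     "x3 \<in> carrier G" "x3 [^] (3::nat) = \<one>" "p x3 \<in> cyc3"
     "x4 \<in> carrier G" "x4 [^] (3::nat) = \<one>" "p x4 \<in> cyc3"
    and prod: "p x1 * p x2 * (p x3 * p x4) = 1" and fx: "\<not> common_fix [p x1, p x2, p x3]"
  shows "x1 \<otimes> x2 \<otimes> (x3 \<otimes> x4) = \<one>"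
proof -
  have alt: "p x1 * p x2 \<in> alt5" "p x3 * p x4 \<in> alt5" using x by (auto simp: cyc3_iff alt5_mult)
  have prod': "p x3 * p x4 * (p x1 * p x2) = 1"
    using prod alt by (metis alt5_inverse mult.assoc mult.left_neutral mult.right_neutral)
  have fx': False if "app (p x1) q = q" "app (p x2) q = q" "app (p x3) q = q" for q
    using fx that by (auto simp: common_fix_iff)
  have f4: "app (p x4) q = q" if "app (p x1) q = q" "app (p x2) q = q" "app (p x3) q = q" for q
    using fx' that by blast
  have inverse_pair: "u \<otimes> v = \<one>"
    if u: "u \<in> carrier G" "u [^] (3::nat) = \<one>" and v: "v \<in> carrier G" "v [^] (3::nat) = \<one>"
      and "p u * p v = 1" for u v
  proof -
    have "v = inv u"
    proof (rule odd_lift_unique[where n = 3])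
      show "p v = p (inv u)" using p_inv_eqI u that(5) by metis
      show "inv u [^] (3::nat) = \<one>" using u by (simp add: nat_pow_inv)
    qed (use u v in auto)
    then show ?thesis using u by simp
  qed
  from x(1-6) show ?thesis
  proof (cases rule: spin_pair_cases)
    case 1
    then have "p x3 * p x4 = p x1"
      using prod x(3) by (metis cyc3_iff mult.assoc mult.left_neutral mult.right_neutral)
    then have "common_fix [p x3, p x4, p x1]" using small_product_fixes(3) x by metis
    then show ?thesis using 1 fx by (auto simp: common_fix_iff)
  next
    case 2
    then have "p x3 * p x4 = 1" using prod by simp
    then show ?thesis using inverse_pair[of x1 x2] inverse_pair[of x3 x4] x 2 by simp
  next
    case 3
    then have eq: "p x3 * p x4 = p x1 * p x2"
      using prod by (metis mult.assoc mult.left_neutral mult.right_neutral)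
    obtain q where q: "app (p x1) q = q" "app (p x2) q = q"
      using small_product_fixes(1)[of "p x1" "p x2"] 3 x by (auto simp: common_fix_iff)
    then have "app (p x3 * p x4) q = q" by (simp add: eq app_mult)
    then have "app (p x3) q = q"
      using small_product_fixes(2)[of "p x3" "p x4" q] 3 x eq by simp
    then show ?thesis using fx' q by blast
  next
    case (4 n)
    let ?P = "p x1 * p x2" let ?Q = "p x3 * p x4"
    have n: "odd n" using 4(1) by auto
    from x(7-12) show ?thesis
    proof (cases rule: spin_pair_cases)
      case 1
      then have "?P = p x3"
        using prod' x(9) by (metis cyc3_iff mult.assoc mult.left_neutral mult.right_neutral)
      then have "common_fix [p x1, p x2, p x3]" using small_product_fixes(3) x by metis
      then show ?thesis using fx by blast
    next
      case 2
      then show ?thesis using prod 4 by simp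
    next
      case 3
      then have "?P = ?Q" using prod by (metis mult.assoc mult.left_neutral mult.right_neutral)
      then have "?P ^ 2 = 1" using 3 by (simp add: power2_eq_square)
      then have "?P = 1" using 4(1,3) pow_coprime_small(2,3)[of ?P] by (auto simp: power2_eq_square)
      then show ?thesis using 4(2) by simp
    next
      case (4 m)
      have "?P ^ m * ?Q ^ m = 1" using prod by (rule power_inverse_pair)
      then have "?P ^ m = 1" using prod 4 by simp
      then have "n = m"
        using 4(1) \<open>n = 3 \<or> n = 5\<close> \<open>?P ^ n = 1\<close> \<open>?P \<noteq> 1\<close> pow_coprime_small(1)[of ?P] by auto
      have "x1 \<otimes> x2 \<otimes> (x3 \<otimes> x4) = \<one> \<or> x1 \<otimes> x2 \<otimes> (x3 \<otimes> x4) = z"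
        using kernel[of "x1 \<otimes> x2 \<otimes> (x3 \<otimes> x4)"] x prod by (simp add: p_mult)
      moreover have False if "x1 \<otimes> x2 \<otimes> (x3 \<otimes> x4) = z"
      proof -
        let ?a = "x1 \<otimes> x2"
        have a: "?a \<in> carrier G" "?a [^] n = z" using x \<open>(x1 \<otimes> x2) [^] n = z\<close> by auto
        have "x3 \<otimes> x4 = inv ?a \<otimes> z" using that x by (metis inv_solve_left m_closed z(1))
        then have "(x3 \<otimes> x4) [^] n = inv (?a [^] n) \<otimes> z [^] n"
          using pow_mult_distrib[of "inv ?a" z n] a z z_central[of "inv ?a"] by (simp add: nat_pow_inv)
        then have "(x3 \<otimes> x4) [^] n = \<one>" using a(2) n z by (simp add: z_pow_odd)
        then show False using 4(4) z \<open>n = m\<close> by simp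
      qed
      ultimately show ?thesis by blast
    qed
  qed
qed

end

section \<open>The level one group\<close>

lemma cyc3_square:
  assumes "x \<in> cyc3"
  shows "x * x \<in> cyc3" "x * (x * x) = 1"
proof -
  have x: "x \<in> alt5" "x \<noteq> 1" "x * x * x = 1" using assms by (simp_all add: cyc3_iff)
  then show 1: "x * (x * x) = 1" by (simp add: mult.assoc)
  have "x * x * (x * x) * (x * x) = x * (x * x) * (x * (x * x))" by (simp add: mult.assoc)
  then have "x * x * (x * x) * (x * x) = 1" using 1 by simp
  moreover have "x * x \<noteq> 1" using x 1 by (metis mult.right_neutral)
  ultimately show "x * x \<in> cyc3" using x alt5_mult by (simp add: cyc3_iff)
qed

lemma (in group) eq_inv: "x \<in> carrier G \<Longrightarrow> y \<in> carrier G \<Longrightarrow> x \<otimes> y = \<one> \<Longrightarrow> y = inv x"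
  by (metis inv_solve_left one_closed r_one inv_closed)

lemma (in group) commute_inv:
  assumes "g \<in> carrier G" "a \<in> carrier G" "g \<otimes> a = a \<otimes> g"
  shows "g \<otimes> inv a = inv a \<otimes> g"
proof -
  have "inv a \<otimes> (g \<otimes> a) \<otimes> inv a = inv a \<otimes> (a \<otimes> g) \<otimes> inv a" using assms(3) by simp
  then show ?thesis using assms(1,2) by (simp add: m_assoc cancel_left)
qed

text \<open>
  Groups over \<open>A\<^sub>5\<close> with a kernel of exponent 2, which is then abelian.
\<close>

locale elementary_kernel = alt5_epi G p for G :: "'a monoid" (structure) and p +
  assumes square: "x \<in> carrier G \<Longrightarrow> p x = 1 \<Longrightarrow> x \<otimes> x = \<one>"
begin

lemma kernel_inv: "x \<in> carrier G \<Longrightarrow> p x = 1 \<Longrightarrow> inv x = x"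
  by (simp add: inv_equality square)

lemma kernel_commute:
  assumes "x \<in> carrier G" "p x = 1" "y \<in> carrier G" "p y = 1"
  shows "x \<otimes> y = y \<otimes> x"
proof -
  have "inv (x \<otimes> y) = x \<otimes> y" using assms by (intro kernel_inv) (simp_all add: p_mult)
  then show ?thesis using assms by (simp add: inv_mult_group kernel_inv)
qed

text \<open>
  The power \<open>y\<^sup>2\<^sup>k\<close> with \<open>2k = n + 1\<close> has the same image as
  \<open>y\<close>, and squaring kills the kernel.
\<close>

lemma odd_lift:
  assumes "X \<in> alt5" "X ^ n = 1" "odd n"
  obtains x where "x \<in> carrier G" "p x = X" "x [^] (n::nat) = \<one>"
proof -
  obtain y where y: "y \<in> carrier G" "p y = X" using assms lift by blast
  obtain k where k: "n + 1 = 2 * k" using assms(3) by (metis dvdE odd_even_add odd_one)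
  let ?x = "y [^] (2 * k)"
  have "X ^ (2 * k) = X" using assms(2) k by (metis Suc_eq_plus1 mult.right_neutral power_Suc)
  moreover have "?x [^] n = \<one>"
  proof -
    have "y [^] n \<otimes> y [^] n = \<one>" using y assms by (intro square) (simp_all add: p_pow)
    then have "y [^] (2 * n) = \<one>" using y by (simp add: nat_pow_mult mult_2)
    then have "(y [^] (2 * n)) [^] k = \<one>" by simp
    then show ?thesis using y by (simp add: nat_pow_pow mult.commute mult.left_commute)
  qed
  ultimately show thesis using that[of ?x] y by (simp add: p_pow)
qed

end

text \<open>
  The properties of \<open>G\<^sub>1\<close> on which all counting rests. The subgroup
  \<open>V\<close> has index 2 in the kernel; elements of order 3 and 5 act on it without fixed
  points, and involutions of \<open>A\<^sub>5\<close> lift to elements whose square lies outside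
  \<open>V\<close>.
\<close>

locale level_one = elementary_kernel +
  fixes V :: "'a set"
  assumes frattini: "subgroup H G \<Longrightarrow> p ` H = alt5 \<Longrightarrow> H = carrier G"
    and V_normal: "V \<lhd> G"
    and V_kernel: "x \<in> V \<Longrightarrow> p x = 1"
    and V_index: "x \<in> carrier G \<Longrightarrow> p x = 1 \<Longrightarrow> x \<notin> V \<Longrightarrow>
      y \<in> carrier G \<Longrightarrow> p y = 1 \<Longrightarrow> y \<notin> V \<Longrightarrow> x \<otimes> y \<in> V"
    and card_V: "card V = 16"
    and no_fixed: "g \<in> carrier G \<Longrightarrow> p g \<noteq> 1 \<Longrightarrow> p g ^ 3 = 1 \<or> p g ^ 5 = 1 \<Longrightarrow>
      x \<in> V \<Longrightarrow> g \<otimes> x = x \<otimes> g \<Longrightarrow> x = \<one>"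
    and involution_square: "g \<in> carrier G \<Longrightarrow> p g \<noteq> 1 \<Longrightarrow> p g * p g = 1 \<Longrightarrow> g \<otimes> g \<notin> V"
    and no_centre: "x \<in> carrier G \<Longrightarrow> p x = 1 \<Longrightarrow> (\<And>g. g \<in> carrier G \<Longrightarrow> g \<otimes> x = x \<otimes> g) \<Longrightarrow> x = \<one>"
begin

sublocale V: normal V G by (rule V_normal)

declare mult_FactGroup [simp del] one_FactGroup [simp del]

lemma V_carrier: "x \<in> V \<Longrightarrow> x \<in> carrier G" by (rule V.mem_carrier)

subsection \<open>The quotient by V\<close>

abbreviation S where "S \<equiv> G Mod V"
definition pS :: "'a set \<Rightarrow> perm5" where "pS Y = the_elem (p ` Y)"

lemma pS_coset: "x \<in> carrier G \<Longrightarrow> pS (V #> x) = p x"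
proof -
  assume x: "x \<in> carrier G"
  have "p y = p x" if "y \<in> V #> x" for y
    using that x by (auto simp: r_coset_def p_mult V_carrier V_kernel)
  moreover have "x \<in> V #> x" using x V.is_subgroup by (rule rcos_self)
  ultimately have "p ` (V #> x) = {p x}" by blast
  then show ?thesis by (simp add: pS_def)
qed

lemma carrier_S: "carrier S = (\<lambda>x. V #> x) ` carrier G"
  by (simp add: carrier_FactGroup)

lemma coset_mult: "x \<in> carrier G \<Longrightarrow> y \<in> carrier G \<Longrightarrow> V #> (x \<otimes> y) = (V #> x) \<otimes>\<^bsub>S\<^esub> (V #> y)"
  unfolding mult_FactGroup by (simp add: V.rcos_sum)

lemma coset_one_iff: "x \<in> carrier G \<Longrightarrow> V #> x = \<one>\<^bsub>S\<^esub> \<longleftrightarrow> x \<in> V"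
  using V.rcos_const[OF is_group, of x] rcos_self[OF _ V.is_subgroup, of x] unfolding one_FactGroup by auto

lemma coset_pow: "x \<in> carrier G \<Longrightarrow> V #> (x [^] (n::nat)) = (V #> x) [^]\<^bsub>S\<^esub> n"
  by (simp add: V.FactGroup_pow)

lemma ex_odd: "\<exists>x. x \<in> carrier G \<and> p x = 1 \<and> x \<notin> V"
proof -
  have "Perm P2 P1 P4 P3 P5 \<in> alt5" unfolding alt5_eq_list by code_simp
  then obtain g where "g \<in> carrier G" "p g = Perm P2 P1 P4 P3 P5" using lift by blast
  then show ?thesis
    using involution_square[of g] by (intro exI[of _ "g \<otimes> g"]) (simp add: p_mult one_perm5_def)
qed

definition zS :: "'a set" where
  "zS = V #> (SOME x. x \<in> carrier G \<and> p x = 1 \<and> x \<notin> V)"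

lemma zS: obtains x where "x \<in> carrier G" "p x = 1" "x \<notin> V" "zS = V #> x"
  using someI_ex[OF ex_odd] unfolding zS_def by blast

lemma coset_odd: "x \<in> carrier G \<Longrightarrow> p x = 1 \<Longrightarrow> x \<notin> V \<Longrightarrow> V #> x = zS"
proof -
  assume x: "x \<in> carrier G" "p x = 1" "x \<notin> V"
  obtain y where y: "y \<in> carrier G" "p y = 1" "y \<notin> V" "zS = V #> y" by (rule zS)
  have "x \<otimes> inv y \<in> V" using V_index x y kernel_inv by simp
  then have "x \<in> V #> y" using x y V.rcos_module_rev is_group by blast
  then show ?thesis using y repr_independence V.is_subgroup by metis
qed

sublocale S: spin_cover S pS zS
proof -
  interpret S: group S by (rule V.factorgroup_is_group)
  show "spin_cover S pS zS"
  proof unfold_locales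
    show "pS (x \<otimes>\<^bsub>S\<^esub> y) = pS x * pS y" if "x \<in> carrier S" "y \<in> carrier S" for x y
      using that unfolding carrier_S by (auto simp flip: coset_mult simp: pS_coset p_mult)
    show "pS ` carrier S = alt5"
      unfolding carrier_S by (auto simp: image_image pS_coset simp flip: p_surj)
    show "x = \<one>\<^bsub>S\<^esub> \<or> x = zS" if "x \<in> carrier S" "pS x = 1" for x
    proof -
      obtain g where g: "g \<in> carrier G" "x = V #> g" using \<open>x \<in> carrier S\<close> unfolding carrier_S by blast
      then show ?thesis
        using coset_odd[of g] coset_one_iff[of g] that by (cases "g \<in> V") (simp_all add: pS_coset)
    qed
    obtain y where y: "y \<in> carrier G" "p y = 1" "y \<notin> V" "zS = V #> y" by (rule zS)
    show "zS \<in> carrier S" using y by (simp add: carrier_S)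
    show "pS zS = 1" using y by (simp add: pS_coset)
    show "zS \<noteq> \<one>\<^bsub>S\<^esub>" using y coset_one_iff by metis
    show "zS \<otimes>\<^bsub>S\<^esub> zS = \<one>\<^bsub>S\<^esub>"
      using y V_index[of y y] coset_one_iff[of "y \<otimes> y"] by (simp add: coset_mult)
    show "x \<otimes>\<^bsub>S\<^esub> x = zS" if "x \<in> carrier S" "pS x \<noteq> 1" "pS x * pS x = 1" for x
    proof -
      obtain g where g: "g \<in> carrier G" "x = V #> g" using \<open>x \<in> carrier S\<close> unfolding carrier_S by blast
      then have "V #> (g \<otimes> g) = zS"
        using involution_square[of g] that by (intro coset_odd) (simp_all add: pS_coset p_mult)
      then show ?thesis using g by (simp add: coset_mult)
    qed
  qed
qed

subsection \<open>Orders\<close>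

lemma card_kernel: "card {x \<in> carrier G. p x = 1} = 32"
proof -
  obtain y where y: "y \<in> carrier G" "p y = 1" "y \<notin> V" using ex_odd by blast
  have fin: "finite V" using card_V by (intro card_ge_0_finite) simp
  have "{x \<in> carrier G. p x = 1} = V \<union> (\<lambda>v. v \<otimes> y) ` V"
  proof
    show "{x \<in> carrier G. p x = 1} \<subseteq> V \<union> (\<lambda>v. v \<otimes> y) ` V"
    proof
      fix x assume x: "x \<in> {x \<in> carrier G. p x = 1}"
      show "x \<in> V \<union> (\<lambda>v. v \<otimes> y) ` V"
      proof (cases "x \<in> V")
        case False
        then have "x \<otimes> y \<in> V" using V_index x y by simp
        moreover have "x = x \<otimes> y \<otimes> y" using x y square by (simp add: m_assoc)
        ultimately show ?thesis by blast
      qed simp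
    qed
  qed (use y V_carrier V_kernel in \<open>auto simp: p_mult\<close>)
  moreover have "card ((\<lambda>v. v \<otimes> y) ` V) = 16"
    using card_V y by (subst card_image) (auto simp: inj_on_def V_carrier)
  moreover have "V \<inter> (\<lambda>v. v \<otimes> y) ` V = {}"
  proof -
    have "v \<otimes> y \<notin> V" if "v \<in> V" for v
    proof
      assume "v \<otimes> y \<in> V"
      then have "inv v \<otimes> (v \<otimes> y) \<in> V" using that by (simp add: V.m_closed V.m_inv_closed)
      then show False using that y by (simp add: cancel_left V_carrier)
    qed
    then show ?thesis by blast
  qed
  ultimately show ?thesis using fin card_V by (simp add: card_Un_disjoint)
qed

lemma card_fibre: "X \<in> alt5 \<Longrightarrow> card {x \<in> carrier G. p x = X} = 32"
proof -
  assume "X \<in> alt5"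
  then obtain g where g: "g \<in> carrier G" "p g = X" using lift by blast
  have "{x \<in> carrier G. p x = X} = (\<lambda>x. x \<otimes> g) ` {x \<in> carrier G. p x = 1}"
  proof
    show "{x \<in> carrier G. p x = X} \<subseteq> (\<lambda>x. x \<otimes> g) ` {x \<in> carrier G. p x = 1}"
    proof
      fix x assume "x \<in> {x \<in> carrier G. p x = X}"
      then show "x \<in> (\<lambda>x. x \<otimes> g) ` {x \<in> carrier G. p x = 1}"
        using g by (intro image_eqI[of _ _ "x \<otimes> inv g"]) (auto simp: m_assoc p_mult p_inv(1))
    qed
  qed (use g in \<open>auto simp: p_mult\<close>)
  then show ?thesis
    using g card_kernel by (simp add: card_image inj_on_def)
qed

lemma order_G: "card (carrier G) = 1920"
proof -
  have "card (carrier G) = card (\<Union>X\<in>alt5. {x \<in> carrier G. p x = X})"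
    by (rule arg_cong[of _ _ card]) (use p_alt5 in auto)
  also have "\<dots> = (\<Sum>X\<in>alt5. card {x \<in> carrier G. p x = X})"
    by (rule card_UN_disjoint)
      (use card_fibre in \<open>auto simp: alt5_eq_list intro!: card_ge_0_finite\<close>)
  also have "\<dots> = 1920" by (simp add: card_fibre card_alt5)
  finally show ?thesis .
qed

definition O3 where "O3 = {x \<in> carrier G. p x \<in> cyc3 \<and> x [^] (3::nat) = \<one>}"

lemma O3: "x \<in> O3 \<Longrightarrow> x \<in> carrier G" "x \<in> O3 \<Longrightarrow> p x \<in> cyc3" "x \<in> O3 \<Longrightarrow> x [^] (3::nat) = \<one>"
  by (simp_all add: O3_def)

lemma O3_cube: "x \<in> O3 \<Longrightarrow> x \<otimes> x \<otimes> x = \<one>"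
  using O3 pow_three by metis

lemma O3_inv: "x \<in> O3 \<Longrightarrow> inv x = x \<otimes> x"
  using O3_cube[of x] O3(1)[of x] by (simp add: inv_equality)

lemma p_O3_inv: "x \<in> O3 \<Longrightarrow> p (inv x) = p x * p x"
  by (simp add: O3_inv O3(1) p_mult)

lemma O3_inv_closed: "x \<in> O3 \<Longrightarrow> inv x \<in> O3"
proof -
  assume x: "x \<in> O3"
  have "p x * p x \<in> cyc3" using cyc3_square O3(2)[OF x] by blast
  then show ?thesis using x p_O3_inv[OF x] O3[OF x] by (simp add: O3_def nat_pow_inv)
qed

lemma O3_conj: "x \<in> O3 \<Longrightarrow> g \<in> carrier G \<Longrightarrow> g \<otimes> x \<otimes> inv g \<in> O3"
  using conj_cyc3[of "p x" "p g" "p (inv g)"] p_alt5[of g] p_alt5[of "inv g"]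
  by (simp add: O3_def pow_conj p_mult p_inv)

lemma ord_3_iff: "x \<in> carrier G \<Longrightarrow> ord x = 3 \<longleftrightarrow> x \<in> O3"
proof
  assume x: "x \<in> carrier G" "ord x = 3"
  then have x3: "x [^] (3::nat) = \<one>" by (metis pow_ord_eq_1)
  have "x \<noteq> \<one>" using x by (metis ord_id numeral_eq_one_iff semiring_norm(86))
  have "p x \<noteq> 1"
  proof
    assume "p x = 1"
    then have "x \<otimes> x = \<one>" using x square by blast
    then show False using x3 x \<open>x \<noteq> \<one>\<close> by (simp add: pow_three)
  qed
  then show "x \<in> O3"
    using x x3 p_pow[of x 3] p_alt5[of x] by (simp add: O3_def cyc3_iff p_one pow3_expand)
next
  assume x: "x \<in> carrier G" "x \<in> O3"
  then have "ord x dvd 3" using O3 pow_eq_id by blast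
  moreover have "ord x \<noteq> 1" using O3[OF x(2)] ord_eq_1[of x] by (auto simp: p_one cyc3_iff)
  moreover have "prime (3::nat)" by simp
  ultimately show "ord x = 3" by (metis prime_nat_iff)
qed

lemma coset_O3: "x \<in> O3 \<Longrightarrow> V #> x \<in> carrier S" "x \<in> O3 \<Longrightarrow> (V #> x) [^]\<^bsub>S\<^esub> (3::nat) = \<one>\<^bsub>S\<^esub>"
    "x \<in> O3 \<Longrightarrow> pS (V #> x) = p x"
proof -
  assume x: "x \<in> O3"
  show "V #> x \<in> carrier S" using O3[OF x] by (simp add: carrier_S)
  have "(V #> x) [^]\<^bsub>S\<^esub> (3::nat) = V #> \<one>" using O3[OF x] by (metis coset_pow)
  then show "(V #> x) [^]\<^bsub>S\<^esub> (3::nat) = \<one>\<^bsub>S\<^esub>" using coset_one_iff by simp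
  show "pS (V #> x) = p x" using O3[OF x] by (simp add: pS_coset)
qed

lemma O3_I:
  assumes "x \<in> carrier G" "p x \<in> cyc3" "(V #> x) [^]\<^bsub>S\<^esub> (3::nat) = \<one>\<^bsub>S\<^esub>"
  shows "x \<in> O3"
proof -
  have "V #> (x [^] (3::nat)) = \<one>\<^bsub>S\<^esub>" using assms by (simp add: coset_pow)
  then have "x [^] (3::nat) \<in> V" using coset_one_iff assms by simp
  moreover have "x \<otimes> x [^] (3::nat) = x [^] (3::nat) \<otimes> x" using assms nat_pow_Suc2 nat_pow_Suc by metis
  ultimately have "x [^] (3::nat) = \<one>"
    using no_fixed[of x] assms by (simp add: cyc3_iff pow3_expand)
  then show ?thesis using assms by (simp add: O3_def)
qed

text \<open>
  Multiplying by an element outside \<open>V\<close> changes the order in the binary icosahedral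
  quotient. Inside \<open>V\<close> the order three is kept, because the cube of the new lift is an
  element of \<open>V\<close> that commutes with it, hence trivial.
\<close>

lemma O3_lifts:
  assumes "x \<in> O3"
  shows "{y \<in> O3. p y = p x} = (\<lambda>v. v \<otimes> x) ` V"
proof
  show "{y \<in> O3. p y = p x} \<subseteq> (\<lambda>v. v \<otimes> x) ` V"
  proof
    fix y assume y: "y \<in> {y \<in> O3. p y = p x}"
    then have "V #> y = V #> x"
      using assms coset_O3 S.odd_lift_unique[of "V #> y" "V #> x" 3] by simp
    then have "y \<otimes> inv x \<in> V"
      using y assms O3(1) V.rcos_module_imp is_group rcos_self V.is_subgroup by blast
    moreover have "y = y \<otimes> inv x \<otimes> x" using y assms O3(1) by (simp add: m_assoc)
    ultimately show "y \<in> (\<lambda>v. v \<otimes> x) ` V" by blast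
  qed
  show "(\<lambda>v. v \<otimes> x) ` V \<subseteq> {y \<in> O3. p y = p x}"
  proof clarify
    fix v assume v: "v \<in> V"
    have x: "x \<in> carrier G" using assms O3 by blast
    have vx: "p (v \<otimes> x) = p x" using v x V_carrier V_kernel by (simp add: p_mult)
    have "V #> (v \<otimes> x) = V #> x" using v x coset_one_iff[of v] V_carrier S.l_one
      by (metis coset_mult carrier_S imageI)
    then have "v \<otimes> x \<in> O3"
      using O3_I[of "v \<otimes> x"] v x vx coset_O3[OF assms] O3[OF assms] V_carrier by simp
    with vx show "v \<otimes> x \<in> O3 \<and> p (v \<otimes> x) = p x" by simp
  qed
qed

lemma card_O3_lifts:
  assumes "X \<in> cyc3"
  shows "card {y \<in> O3. p y = X} = 16"
proof -
  obtain x where "x \<in> carrier G" "p x = X" "x [^] (3::nat) = \<one>"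
    using odd_lift[of X 3] assms by (auto simp: cyc3_iff pow3_expand)
  then have "x \<in> O3" "p x = X" using assms by (auto simp: O3_def)
  then have "{y \<in> O3. p y = X} = (\<lambda>v. v \<otimes> x) ` V" using O3_lifts[of x] by simp
  moreover have "inj_on (\<lambda>v. v \<otimes> x) V"
    using \<open>x \<in> O3\<close> O3(1) V_carrier by (auto simp: inj_on_def)
  ultimately show ?thesis by (simp add: card_image card_V)
qed

subsection \<open>Generation\<close>

text \<open>
  This is where the Frattini property enters: generation can be tested in \<open>A\<^sub>5\<close>.
\<close>

lemma generate_carrierI:
  assumes "A \<subseteq> carrier G" "alt5 \<subseteq> p ` generate G A"
  shows "generate G A = carrier G"
proof (rule frattini)
  show sub: "subgroup (generate G A) G" by (rule generate_is_subgroup[OF assms(1)])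
  show "p ` generate G A = alt5" using assms(2) p_alt5 subgroup.mem_carrier[OF sub] by blast
qed

lemma image_generate_closed:
  assumes "A \<subseteq> carrier G" "u \<in> p ` generate G A" "v \<in> p ` generate G A"
  shows "u * v \<in> p ` generate G A"
proof -
  obtain a b where "a \<in> generate G A" "b \<in> generate G A" "u = p a" "v = p b" using assms by blast
  moreover from this have "a \<otimes> b \<in> generate G A" by (simp add: generate.eng)
  moreover have "a \<in> carrier G" "b \<in> carrier G"
    using calculation assms(1) generate_in_carrier by blast+
  ultimately show ?thesis by (metis imageI p_mult)
qed

lemma generate_pair:
  assumes "x \<in> O3" "y \<in> O3" "\<not> common_fix [p x, p y]"
  shows "generate G {x, y} = carrier G"
proof (rule generate_carrierI)
  show sub: "{x, y} \<subseteq> carrier G" using assms O3 by blast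
  show "alt5 \<subseteq> p ` generate G {x, y}"
    by (rule pair_generates[OF O3(2)[OF assms(1)] O3(2)[OF assms(2)] assms(3)])
      (auto intro: generate.intros image_generate_closed[OF sub] rev_image_eqI[OF generate.one] simp: p_one)
qed

lemma generate_quadruple_iff:
  assumes g: "g1 \<in> O3" "g2 \<in> O3" "g3 \<in> O3" "g4 \<in> O3" and prod: "g1 \<otimes> g2 \<otimes> g3 \<otimes> g4 = \<one>"
  shows "generate G {g1, g2, g3, g4} = carrier G \<longleftrightarrow> \<not> common_fix [p g1, p g2, p g3]"
proof
  have sub: "{g1, g2, g3, g4} \<subseteq> carrier G" using g O3 by blast
  show "generate G {g1, g2, g3, g4} = carrier G" if "\<not> common_fix [p g1, p g2, p g3]"
  proof (rule generate_carrierI[OF sub])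
    show "alt5 \<subseteq> p ` generate G {g1, g2, g3, g4}"
      by (rule triple_generates[OF O3(2)[OF g(1)] O3(2)[OF g(2)] O3(2)[OF g(3)] that])
        (auto intro: generate.intros image_generate_closed[OF sub] rev_image_eqI[OF generate.one] simp: p_one)
  qed
  assume gen: "generate G {g1, g2, g3, g4} = carrier G"
  show "\<not> common_fix [p g1, p g2, p g3]"
  proof
    assume "common_fix [p g1, p g2, p g3]"
    then obtain q where q: "app (p g1) q = q" "app (p g2) q = q" "app (p g3) q = q"
      by (auto simp: common_fix_iff)
    define H where "H = {g \<in> carrier G. app (p g) q = q}"
    have inv: "app (p (inv a)) q = q" if "a \<in> carrier G" "app (p a) q = q" for a
      using that p_inv(2)[of a] by (metis app_mult app_one)
    have "subgroup H G"
      by (rule subgroupI) (auto simp: H_def p_mult app_mult inv p_one app_one intro: exI[of _ \<one>])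
    have "g4 = inv (g1 \<otimes> g2 \<otimes> g3)" using prod sub by (intro eq_inv) auto
    then have "app (p g4) q = q"
      using q inv[of "g1 \<otimes> g2 \<otimes> g3"] sub by (simp add: p_mult app_mult)
    then have "{g1, g2, g3, g4} \<subseteq> H" using q sub by (auto simp: H_def)
    then have "carrier G \<subseteq> H" using generate_subgroup_incl[OF _ \<open>subgroup H G\<close>] gen by blast
    then have "\<forall>x\<in>alt5. app x q = q" using lift by (auto simp: H_def)
    moreover have "gam \<in> alt5" "Perm P2 P1 P4 P3 P5 \<in> alt5" unfolding alt5_eq_list by code_simp+
    ultimately have "app gam q = q" by blast
    then show False by (cases q) (simp_all add: gam_def)
  qed
qed

lemma centre_trivial:
  assumes "g \<in> carrier G" "\<And>x. x \<in> carrier G \<Longrightarrow> g \<otimes> x = x \<otimes> g"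
  shows "g = \<one>"
proof -
  have "p g = 1"
  proof (rule alt5_centre)
    fix Y assume "Y \<in> alt5"
    then obtain y where "y \<in> carrier G" "p y = Y" using lift by blast
    then show "p g * Y = Y * p g" using assms by (metis p_mult)
  qed (use assms p_alt5 in blast)
  then show ?thesis using no_centre assms by metis
qed

text \<open>
  The image of a central element lies in the trivial centre of \<open>A\<^sub>5\<close>; then the
  kernel has no invariants.
\<close>

lemma centralizer_trivial:
  assumes "A \<subseteq> carrier G" "generate G A = carrier G" "g \<in> carrier G" "\<And>a. a \<in> A \<Longrightarrow> g \<otimes> a = a \<otimes> g"
  shows "g = \<one>"
proof (rule centre_trivial[OF assms(3)])
  have "subgroup {x \<in> carrier G. g \<otimes> x = x \<otimes> g} G"
  proof (rule subgroupI)
    show "inv a \<in> {x \<in> carrier G. g \<otimes> x = x \<otimes> g}" if "a \<in> {x \<in> carrier G. g \<otimes> x = x \<otimes> g}" for a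
      using that assms(3) commute_inv by simp
    show "a \<otimes> b \<in> {x \<in> carrier G. g \<otimes> x = x \<otimes> g}"
      if "a \<in> {x \<in> carrier G. g \<otimes> x = x \<otimes> g}" "b \<in> {x \<in> carrier G. g \<otimes> x = x \<otimes> g}" for a b
      using that assms(3) by auto (metis m_assoc)
  qed (use assms(3) in auto)
  then have "carrier G \<subseteq> {x \<in> carrier G. g \<otimes> x = x \<otimes> g}"
    using generate_subgroup_incl[of A "{x \<in> carrier G. g \<otimes> x = x \<otimes> g}"] assms by blast
  then show "\<And>x. x \<in> carrier G \<Longrightarrow> g \<otimes> x = x \<otimes> g" by blast
qed

lemma pair_centralizer:
  assumes "x \<in> O3" "y \<in> O3" "\<not> common_fix [p x, p y]" "g \<in> carrier G" "g \<otimes> x = x \<otimes> g" "g \<otimes> y = y \<otimes> g"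
  shows "g = \<one>"
  using centralizer_trivial[of "{x, y}" g] generate_pair[OF assms(1-3)] assms O3(1) by blast

subsection \<open>The Nielsen class\<close>

lemma nielsen_class_iff:
  "(g1, g2, g3, g4) \<in> nielsen_class G \<longleftrightarrow>
     g1 \<in> O3 \<and> g2 \<in> O3 \<and> g3 \<in> O3 \<and> g4 \<in> O3 \<and> g1 \<otimes> g2 \<otimes> g3 \<otimes> g4 = \<one> \<and>
     \<not> common_fix [p g1, p g2, p g3]"
  unfolding nielsen_class_def
  using generate_quadruple_iff[of g1 g2 g3 g4] O3(1) ord_3_iff by auto

text \<open>
  The product of three lifts has the right image, and \<open>spin_product_one\<close> shows that
  its class modulo \<open>V\<close> has order three.
\<close>

lemma fourth_entry:
  assumes g: "g1 \<in> O3" "g2 \<in> O3" "g3 \<in> O3" and fx: "\<not> common_fix [p g1, p g2, p g3]"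
    and c: "p g1 * p g2 * p g3 \<in> cyc3"
  shows "inv (g1 \<otimes> g2 \<otimes> g3) \<in> O3"
proof -
  let ?h = "g1 \<otimes> g2 \<otimes> g3"
  have h: "?h \<in> carrier G" "p ?h = p g1 * p g2 * p g3" using g O3(1) by (simp_all add: p_mult)
  define X where "X = p ?h * p ?h"
  have X: "X \<in> cyc3" "p ?h * X = 1"
    using c cyc3_square unfolding X_def h(2) by blast+
  obtain y where y: "y \<in> carrier G" "p y = X" "y [^] (3::nat) = \<one>"
    using odd_lift[of X 3] X by (auto simp: cyc3_iff pow3_expand)
  have yO: "y \<in> O3" using y X by (simp add: O3_def)
  have "(V #> g1) \<otimes>\<^bsub>S\<^esub> (V #> g2) \<otimes>\<^bsub>S\<^esub> ((V #> g3) \<otimes>\<^bsub>S\<^esub> (V #> y)) = \<one>\<^bsub>S\<^esub>"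
    using g yO coset_O3 O3(2) X h fx y by (intro S.spin_product_one) (auto simp: mult.assoc)
  then have "V #> (?h \<otimes> y) = \<one>\<^bsub>S\<^esub>"
    using g y O3(1) by (simp add: m_assoc flip: coset_mult)
  moreover have "V #> (?h \<otimes> inv ?h) = \<one>\<^bsub>S\<^esub>" using coset_one_iff[of \<one>] h(1) by simp
  ultimately have "(V #> ?h) \<otimes>\<^bsub>S\<^esub> (V #> inv ?h) = (V #> ?h) \<otimes>\<^bsub>S\<^esub> (V #> y)"
    using h(1) y(1) by (simp only: coset_mult inv_closed)
  then have "V #> inv ?h = V #> y"
    using S.cancel_left(1)[of "V #> ?h"] h(1) y(1) unfolding carrier_S by (metis imageI inv_closed)
  then show ?thesis using O3_I[of "inv ?h"] coset_O3[OF yO] h X p_inv_eqI[OF h(1) X(2)] by simp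
qed

text \<open>
  Each of the 1080 triples in \<open>A\<^sub>5\<close> has \<open>16\<^sup>3\<close> lifts, and the
  fourth entry is determined.
\<close>

lemma card_nielsen_class: "card (nielsen_class G) = 4423680"
proof -
  define T where "T = {(x, y, z). x \<in> cyc3 \<and> y \<in> cyc3 \<and> z \<in> cyc3 \<and> x * y * z \<in> cyc3 \<and>
      \<not> common_fix [x, y, z]}"
  define L where "L X = {y \<in> O3. p y = X}" for X
  define D where "D = (SIGMA t:T. case t of (x, y, z) \<Rightarrow> L x \<times> L y \<times> L z)"
  have finT: "finite T"
    by (rule finite_subset[of _ "cyc3 \<times> cyc3 \<times> cyc3"]) (auto simp: T_def)
  have L: "card (L x) = 16" "finite (L x)" if "x \<in> cyc3" for x
    using card_O3_lifts[OF that] by (auto simp: L_def intro!: card_ge_0_finite)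
  have fibre: "finite (case t of (x, y, z) \<Rightarrow> L x \<times> L y \<times> L z)"
    "card (case t of (x, y, z) \<Rightarrow> L x \<times> L y \<times> L z) = 4096" if "t \<in> T" for t
    using that L by (auto simp: T_def card_cartesian_product)
  have "card D = (\<Sum>t\<in>T. 4096)"
    unfolding D_def using finT fibre by (simp add: card_SigmaI)
  also have "\<dots> = 4423680"
    using card_generating_quadruples by (simp add: T_def)
  finally have D: "card D = 4423680" .
  have "bij_betw (\<lambda>(t, (g1, g2, g3)). (g1, g2, g3, inv (g1 \<otimes> g2 \<otimes> g3))) D (nielsen_class G)"
  proof (rule bij_betw_imageI)
    show "inj_on (\<lambda>(t, (g1, g2, g3)). (g1, g2, g3, inv (g1 \<otimes> g2 \<otimes> g3))) D"
      by (auto simp: inj_on_def D_def L_def T_def)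
    show "(\<lambda>(t, (g1, g2, g3)). (g1, g2, g3, inv (g1 \<otimes> g2 \<otimes> g3))) ` D = nielsen_class G"
    proof
      show "(\<lambda>(t, (g1, g2, g3)). (g1, g2, g3, inv (g1 \<otimes> g2 \<otimes> g3))) ` D \<subseteq> nielsen_class G"
        using fourth_entry O3(1) by (auto simp: D_def L_def T_def nielsen_class_iff)
      show "nielsen_class G \<subseteq> (\<lambda>(t, (g1, g2, g3)). (g1, g2, g3, inv (g1 \<otimes> g2 \<otimes> g3))) ` D"
      proof clarify
        fix g1 g2 g3 g4 assume "(g1, g2, g3, g4) \<in> nielsen_class G"
        then have g: "g1 \<in> O3" "g2 \<in> O3" "g3 \<in> O3" "g4 \<in> O3" "g1 \<otimes> g2 \<otimes> g3 \<otimes> g4 = \<one>"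
          "\<not> common_fix [p g1, p g2, p g3]" by (simp_all add: nielsen_class_iff)
        have g4: "g4 = inv (g1 \<otimes> g2 \<otimes> g3)" using g O3(1) by (intro eq_inv) auto
        then have "inv g4 = g1 \<otimes> g2 \<otimes> g3" using g O3(1) by simp
        then have "p g1 * p g2 * p g3 \<in> cyc3"
          using O3_inv_closed[OF g(4)] O3 g by (metis m_closed p_mult)
        then have "((p g1, p g2, p g3), (g1, g2, g3)) \<in> D"
          using g O3 by (auto simp: D_def L_def T_def)
        then show "(g1, g2, g3, g4) \<in> (\<lambda>(t, (g1, g2, g3)). (g1, g2, g3, inv (g1 \<otimes> g2 \<otimes> g3))) ` D"
          by (rule rev_image_eqI) (simp add: g4)
      qed
    qed
  qed
  from bij_betw_same_card[OF this] show ?thesis using D by simp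
qed

end

context level_one
begin

subsection \<open>Stabilisers of points\<close>

definition Fix where "Fix q = {g \<in> carrier G. app (p g) q = q}"

lemma subgroup_Fix: "subgroup (Fix q) G"
proof (rule subgroupI)
  show "Fix q \<subseteq> carrier G" by (auto simp: Fix_def)
  show "Fix q \<noteq> {}" using one_closed by (auto simp: Fix_def p_one app_one intro!: exI[of _ \<one>])
  show "inv a \<in> Fix q" if "a \<in> Fix q" for a
    using that p_inv(2)[of a] by (auto simp: Fix_def) (metis app_mult app_one)
  show "a \<otimes> b \<in> Fix q" if "a \<in> Fix q" "b \<in> Fix q" for a b
    using that by (auto simp: Fix_def p_mult app_mult)
qed

lemma Fix_mult: "a \<in> Fix q \<Longrightarrow> b \<in> Fix q \<Longrightarrow> a \<otimes> b \<in> Fix q"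
  by (rule subgroup.m_closed[OF subgroup_Fix])

lemma Fix_inv: "a \<in> Fix q \<Longrightarrow> inv a \<in> Fix q"
  by (rule subgroup.m_inv_closed[OF subgroup_Fix])

lemma Fix_conj: "a \<in> Fix q \<Longrightarrow> b \<in> carrier G \<Longrightarrow> a \<otimes> b \<otimes> inv a \<in> Fix q \<Longrightarrow> b \<in> Fix q"
proof -
  assume a: "a \<in> Fix q" "b \<in> carrier G" "a \<otimes> b \<otimes> inv a \<in> Fix q"
  then have "inv a \<otimes> (a \<otimes> b \<otimes> inv a) \<otimes> a \<in> Fix q"
    by (intro Fix_mult[OF Fix_mult[OF Fix_inv]])
  moreover have "a \<in> carrier G" using a by (simp add: Fix_def)
  ultimately show ?thesis using a(2) by (simp add: m_assoc cancel_left)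
qed

lemma common_fix_Fix:
  "g1 \<in> O3 \<Longrightarrow> g2 \<in> O3 \<Longrightarrow> g3 \<in> O3 \<Longrightarrow>
    common_fix [p g1, p g2, p g3] \<longleftrightarrow> (\<exists>q. g1 \<in> Fix q \<and> g2 \<in> Fix q \<and> g3 \<in> Fix q)"
  by (auto simp: common_fix_iff Fix_def O3(1))

lemma nielsen_iff:
  "(g1, g2, g3, g4) \<in> nielsen_class G \<longleftrightarrow>
     g1 \<in> O3 \<and> g2 \<in> O3 \<and> g3 \<in> O3 \<and> g4 \<in> O3 \<and> g1 \<otimes> g2 \<otimes> g3 \<otimes> g4 = \<one> \<and>
     (\<nexists>q. g1 \<in> Fix q \<and> g2 \<in> Fix q \<and> g3 \<in> Fix q \<and> g4 \<in> Fix q)"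
proof -
  have "g4 \<in> Fix q" if "g1 \<in> Fix q" "g2 \<in> Fix q" "g3 \<in> Fix q" "g4 \<in> O3" "g1 \<otimes> g2 \<otimes> g3 \<otimes> g4 = \<one>" for q
  proof -
    have "g4 = inv (g1 \<otimes> g2 \<otimes> g3)" using that by (intro eq_inv) (auto simp: Fix_def O3(1))
    then show ?thesis using that by (auto intro: Fix_mult Fix_inv)
  qed
  then show ?thesis unfolding nielsen_class_iff using common_fix_Fix by blast
qed

subsection \<open>Conjugation of tuples\<close>

lemma nielsen_carrier:
  assumes "(g1, g2, g3, g4) \<in> nielsen_class G"
  shows "g1 \<in> carrier G" "g2 \<in> carrier G" "g3 \<in> carrier G" "g4 \<in> carrier G"
  using assms O3(1) by (auto simp: nielsen_iff)

lemma nielsen_product: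
  assumes "(g1, g2, g3, g4) \<in> nielsen_class G"
  shows "g1 \<otimes> g2 = inv g4 \<otimes> inv g3"
proof -
  note c = nielsen_carrier[OF assms]
  have "g3 \<otimes> g4 = inv (g1 \<otimes> g2)"
    using assms c by (intro eq_inv) (auto simp: nielsen_iff m_assoc)
  then have "inv (g3 \<otimes> g4) = g1 \<otimes> g2" using c by simp
  then show ?thesis using c by (simp add: inv_mult_group)
qed

lemma conj4_comp:
  assumes "g \<in> nielsen_class G" "x \<in> carrier G" "y \<in> carrier G"
  shows "conj4 G x (conj4 G y g) = conj4 G (x \<otimes> y) g"
proof (cases g)
  case (fields a b c d)
  then show ?thesis using assms nielsen_carrier[of a b c d] by (simp add: group_word)
qed

lemma conj4_one: "g \<in> nielsen_class G \<Longrightarrow> conj4 G \<one> g = g"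
  using nielsen_carrier by (cases g) simp

lemma conj4_cancel:
  "g \<in> nielsen_class G \<Longrightarrow> x \<in> carrier G \<Longrightarrow> conj4 G (inv x) (conj4 G x g) = g"
  by (simp add: conj4_comp conj4_one)

lemma conj_eq_iff: "h \<in> carrier G \<Longrightarrow> a \<in> carrier G \<Longrightarrow> b \<in> carrier G \<Longrightarrow>
    h \<otimes> a \<otimes> inv h = b \<longleftrightarrow> h \<otimes> a = b \<otimes> h"
  by (metis inv_solve_right m_closed)

lemma conj_mult: "h \<in> carrier G \<Longrightarrow> a \<in> carrier G \<Longrightarrow> b \<in> carrier G \<Longrightarrow>
    h \<otimes> a \<otimes> inv h \<otimes> (h \<otimes> b \<otimes> inv h) = h \<otimes> (a \<otimes> b) \<otimes> inv h"
  by (simp add: group_word)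

lemma Fix_conj_app:
  assumes "h \<in> carrier G" "a \<in> carrier G" "h \<otimes> a \<otimes> inv h \<in> Fix q"
  shows "a \<in> Fix (app (p (inv h)) q)"
proof -
  have "app (p h * p a * p (inv h)) q = q" using assms by (simp add: Fix_def p_mult)
  then have "app (p (inv h) * (p h * (p a * p (inv h)))) q = app (p (inv h)) q"
    by (simp add: app_mult)
  then have "app (p a * p (inv h)) q = app (p (inv h)) q"
    using assms p_inv(2) by (metis mult.assoc mult.left_neutral)
  then show ?thesis using assms by (simp add: Fix_def app_mult)
qed

lemma conj4_nielsen:
  assumes "g \<in> nielsen_class G" "h \<in> carrier G"
  shows "conj4 G h g \<in> nielsen_class G"
proof (cases g)
  case (fields a b c d)
  note n = assms(1)[unfolded fields] and car = nielsen_carrier[OF assms(1)[unfolded fields]]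
  have "h \<otimes> a \<otimes> inv h \<otimes> (h \<otimes> b \<otimes> inv h) \<otimes> (h \<otimes> c \<otimes> inv h) \<otimes> (h \<otimes> d \<otimes> inv h)
      = h \<otimes> (a \<otimes> b \<otimes> c \<otimes> d) \<otimes> inv h"
    using car assms(2) by (simp add: conj_mult)
  also have "\<dots> = \<one>" using n assms(2) by (simp add: nielsen_iff)
  finally show ?thesis
    using n car assms(2) unfolding fields
    by (auto simp: nielsen_iff O3_conj dest!: Fix_conj_app[rotated 2])
qed

lemma conj4_free:
  assumes "g \<in> nielsen_class G" "h \<in> carrier G" "conj4 G h g = g"
  shows "h = \<one>"
proof (cases g)
  case (fields a b c d)
  have "generate G {a, b, c, d} = carrier G"
    using assms(1) unfolding fields nielsen_class_def by auto
  then show ?thesis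
    using assms nielsen_carrier[of a b c d] unfolding fields
    by (intro centralizer_trivial[of "{a, b, c, d}" h]) (auto simp: conj_eq_iff)
qed

lemma conj4_inj:
  assumes "g \<in> nielsen_class G" "x \<in> carrier G" "y \<in> carrier G" "conj4 G x g = conj4 G y g"
  shows "x = y"
proof -
  have "conj4 G (inv y \<otimes> x) g = g"
    using assms conj4_comp[of g "inv y" x] conj4_cancel[of g y] by simp
  then have "inv y \<otimes> x = \<one>" using conj4_free assms by simp
  then show ?thesis using assms by (metis inv_solve_left one_closed r_one)
qed

abbreviation Cl where "Cl \<equiv> inner_class G"

lemma Cl_self: "g \<in> nielsen_class G \<Longrightarrow> g \<in> Cl g"
  using conj4_one[of g] unfolding inner_class_def by (metis imageI one_closed)

lemma Cl_subset: "g \<in> nielsen_class G \<Longrightarrow> Cl g \<subseteq> nielsen_class G"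
  unfolding inner_class_def using conj4_nielsen by blast

lemma Cl_conj: "g \<in> nielsen_class G \<Longrightarrow> h \<in> carrier G \<Longrightarrow> Cl (conj4 G h g) = Cl g"
proof
  assume g: "g \<in> nielsen_class G" "h \<in> carrier G"
  show "Cl (conj4 G h g) \<subseteq> Cl g"
    using g conj4_comp by (auto simp: inner_class_def)
  show "Cl g \<subseteq> Cl (conj4 G h g)"
  proof
    fix k assume "k \<in> Cl g"
    then obtain x where x: "x \<in> carrier G" "k = conj4 G x g" by (auto simp: inner_class_def)
    then have "k = conj4 G (x \<otimes> inv h) (conj4 G h g)"
      using g by (simp add: conj4_comp m_assoc)
    then show "k \<in> Cl (conj4 G h g)" using x g by (auto simp: inner_class_def)
  qed
qed

lemma Cl_eq_iff:
  assumes "g \<in> nielsen_class G" "h \<in> nielsen_class G"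
  shows "Cl g = Cl h \<longleftrightarrow> (\<exists>x\<in>carrier G. h = conj4 G x g)"
proof
  assume "Cl g = Cl h"
  then show "\<exists>x\<in>carrier G. h = conj4 G x g"
    using Cl_self[OF assms(2)] unfolding inner_class_def by blast
next
  assume "\<exists>x\<in>carrier G. h = conj4 G x g"
  then obtain x where "x \<in> carrier G" "h = conj4 G x g" by blast
  then show "Cl g = Cl h" using Cl_conj[OF assms(1)] by simp
qed

lemma Cl_member: "g \<in> nielsen_class G \<Longrightarrow> h \<in> Cl g \<Longrightarrow> Cl h = Cl g"
proof -
  assume g: "g \<in> nielsen_class G" "h \<in> Cl g"
  then obtain x where "x \<in> carrier G" "h = conj4 G x g" unfolding inner_class_def by blast
  then show ?thesis using Cl_conj[OF g(1)] by simp
qed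

lemma finite_nielsen: "finite (nielsen_class G)"
  using card_nielsen_class by (intro card_ge_0_finite) simp

text \<open>
  Conjugation is free on generating tuples because the centre is trivial, and the group has order
  1920.
\<close>

lemma card_inner_classes:
  assumes N: "N \<subseteq> nielsen_class G" and closed: "\<And>g h. g \<in> N \<Longrightarrow> h \<in> carrier G \<Longrightarrow> conj4 G h g \<in> N"
  shows "card (Cl ` N) * 1920 = card N"
proof -
  have un: "\<Union> (Cl ` N) = N"
  proof
    show "\<Union> (Cl ` N) \<subseteq> N" unfolding inner_class_def using closed by blast
    show "N \<subseteq> \<Union> (Cl ` N)" using N Cl_self by blast
  qed
  have fin: "finite N" using N finite_nielsen finite_subset by blast
  have "card C = 1920" if "C \<in> Cl ` N" for C
  proof -
    obtain g where g: "g \<in> N" "C = Cl g" using \<open>C \<in> Cl ` N\<close> by blast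
    then have "inj_on (\<lambda>x. conj4 G x g) (carrier G)" unfolding inj_on_def using conj4_inj N by blast
    then show ?thesis using g by (simp add: inner_class_def card_image order_G)
  qed
  moreover have "C \<inter> D = {}" if "C \<in> Cl ` N" "D \<in> Cl ` N" "C \<noteq> D" for C D
  proof (rule ccontr)
    assume "C \<inter> D \<noteq> {}"
    then obtain k where k: "k \<in> C" "k \<in> D" by blast
    obtain g h where "g \<in> N" "C = Cl g" "h \<in> N" "D = Cl h" using \<open>C \<in> Cl ` N\<close> \<open>D \<in> Cl ` N\<close> by blast
    then have "C = Cl k" "D = Cl k" using k Cl_member N by blast+
    then show False using \<open>C \<noteq> D\<close> by simp
  qed
  ultimately have "1920 * card (Cl ` N) = card (\<Union> (Cl ` N))"
    by (intro card_partition) (use fin un in auto)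
  then show ?thesis using un by simp
qed

theorem card_nielsen_in: "card (nielsen_in G) = 2304"
  using card_inner_classes[of "nielsen_class G"] conj4_nielsen card_nielsen_class
  by (simp add: nielsen_in_def)

lemma finite_nielsen_in: "finite (nielsen_in G)"
  by (rule card_ge_0_finite) (simp add: card_nielsen_in)

lemma nielsen_inE: "C \<in> nielsen_in G \<Longrightarrow> (\<And>g. g \<in> nielsen_class G \<Longrightarrow> C = Cl g \<Longrightarrow> thesis) \<Longrightarrow> thesis"
  by (auto simp: nielsen_in_def)

lemma nielsen_inI: "g \<in> nielsen_class G \<Longrightarrow> Cl g \<in> nielsen_in G"
  by (auto simp: nielsen_in_def)

subsection \<open>Braids\<close>

text \<open>
  A braid commutes with conjugation, hence acts on classes; injectivity on a finite set makes it a
  permutation.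
\<close>

lemma class_map:
  assumes f: "\<And>g. g \<in> nielsen_class G \<Longrightarrow> f g \<in> nielsen_class G"
    and eqv: "\<And>g x. g \<in> nielsen_class G \<Longrightarrow> x \<in> carrier G \<Longrightarrow> f (conj4 G x g) = conj4 G x (f g)"
    and inj: "\<And>g h. g \<in> nielsen_class G \<Longrightarrow> h \<in> nielsen_class G \<Longrightarrow> f g = f h \<Longrightarrow> g = h"
  shows "g \<in> nielsen_class G \<Longrightarrow> restrict ((`) f) (nielsen_in G) (Cl g) = Cl (f g)"
    and "restrict ((`) f) (nielsen_in G) \<in> Bij (nielsen_in G)"
proof -
  let ?F = "restrict ((`) f) (nielsen_in G)"
  have F: "?F (Cl g) = Cl (f g)" if g: "g \<in> nielsen_class G" for g
  proof -
    have "f ` Cl g = Cl (f g)"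
      unfolding inner_class_def image_image using g eqv by (intro image_cong) auto
    then show ?thesis using g by (simp add: nielsen_inI)
  qed
  then show "g \<in> nielsen_class G \<Longrightarrow> ?F (Cl g) = Cl (f g)" by blast
  have "inj_on ?F (nielsen_in G)"
  proof (rule inj_onI)
    fix C D assume CD: "C \<in> nielsen_in G" "D \<in> nielsen_in G" "?F C = ?F D"
    obtain g h where g: "g \<in> nielsen_class G" "C = Cl g" and h: "h \<in> nielsen_class G" "D = Cl h"
      using CD nielsen_inE by metis
    then have "Cl (f g) = Cl (f h)" using CD(3) F by simp
    then obtain x where "x \<in> carrier G" "f h = conj4 G x (f g)"
      using Cl_eq_iff f g h by blast
    then have "h = conj4 G x g" using inj[OF h(1) conj4_nielsen[OF g(1)]] eqv g by simp
    then show "C = D" using \<open>x \<in> carrier G\<close> g h Cl_conj by simp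
  qed
  moreover have "?F ` nielsen_in G \<subseteq> nielsen_in G"
    using F f by (auto simp: nielsen_in_def)
  ultimately have "bij_betw ?F (nielsen_in G) (nielsen_in G)"
    using finite_nielsen_in by (simp add: bij_betw_def endo_inj_surj)
  then show "?F \<in> Bij (nielsen_in G)" by (simp add: Bij_def)
qed

text \<open>
  The braid \<open>q\<^sub>1q\<^sub>3\<inverse>\<close>.
\<close>

fun twist :: "'a tup4 \<Rightarrow> 'a tup4" where
  "twist (g1, g2, g3, g4) = (g1 \<otimes> g2 \<otimes> inv g1, g1, g4, inv g4 \<otimes> g3 \<otimes> g4)"

text \<open>
  The braid \<open>(q\<^sub>1q\<^sub>2q\<^sub>3)\<^sup>2\<close> up to conjugation.
\<close>

fun shift :: "'a tup4 \<Rightarrow> 'a tup4" where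
  "shift (g1, g2, g3, g4) = (g3, g4, g1, g2)"

lemma conj_inv_O3: "x \<in> O3 \<Longrightarrow> g \<in> carrier G \<Longrightarrow> inv g \<otimes> x \<otimes> g \<in> O3"
  using O3_conj[of x "inv g"] by simp

lemma Fix_conj': "a \<in> Fix q \<Longrightarrow> b \<in> carrier G \<Longrightarrow> inv a \<otimes> b \<otimes> a \<in> Fix q \<Longrightarrow> b \<in> Fix q"
  using Fix_conj[of "inv a" q b] Fix_inv[of a q] by (simp add: Fix_def)

lemma braid_nielsen:
  assumes "g \<in> nielsen_class G"
  shows "braid1 G g \<in> nielsen_class G" "braid2 G g \<in> nielsen_class G" "braid3 G g \<in> nielsen_class G"
    "twist g \<in> nielsen_class G" "shift g \<in> nielsen_class G"
proof -
  obtain a b c d where g: "g = (a, b, c, d)" by (cases g)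
  note n = assms[unfolded g] and car = nielsen_carrier[OF assms[unfolded g]]
  have O: "a \<in> O3" "b \<in> O3" "c \<in> O3" "d \<in> O3" using n by (auto simp: nielsen_iff)
  have pr: "a \<otimes> (b \<otimes> (c \<otimes> d)) = \<one>" using n car by (simp add: nielsen_iff m_assoc)
  have nf: "\<not> (a \<in> Fix q \<and> b \<in> Fix q \<and> c \<in> Fix q \<and> d \<in> Fix q)" for q
    using n by (auto simp: nielsen_iff)
  have "c \<otimes> d = inv (a \<otimes> b)" using pr car by (intro eq_inv) (simp_all add: m_assoc)
  then have pr': "c \<otimes> (d \<otimes> (a \<otimes> b)) = \<one>" using car by (simp flip: m_assoc) (simp add: m_assoc)
  have I: "(x1, x2, x3, x4) \<in> nielsen_class G"
    if "x1 \<in> O3" "x2 \<in> O3" "x3 \<in> O3" "x4 \<in> O3" "x1 \<otimes> (x2 \<otimes> (x3 \<otimes> x4)) = \<one>"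
      "\<And>q. x1 \<in> Fix q \<Longrightarrow> x2 \<in> Fix q \<Longrightarrow> x3 \<in> Fix q \<Longrightarrow> x4 \<in> Fix q \<Longrightarrow>
         a \<in> Fix q \<and> b \<in> Fix q \<and> c \<in> Fix q \<and> d \<in> Fix q"
    for x1 x2 x3 x4
    unfolding nielsen_iff using that nf O3(1) m_assoc by (metis m_closed)
  show "braid1 G g \<in> nielsen_class G"
    unfolding g braid1.simps
  proof (rule I)
    show "a \<otimes> b \<otimes> inv a \<in> O3" using O car by (intro O3_conj)
    show "a \<otimes> b \<otimes> inv a \<otimes> (a \<otimes> (c \<otimes> d)) = \<one>" using car pr by (simp add: group_word)
  qed (use O car Fix_conj[of a _ b] in blast)+
  show "braid2 G g \<in> nielsen_class G"
    unfolding g braid2.simps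
  proof (rule I)
    show "b \<otimes> c \<otimes> inv b \<in> O3" using O car by (intro O3_conj)
    show "a \<otimes> (b \<otimes> c \<otimes> inv b \<otimes> (b \<otimes> d)) = \<one>" using car pr by (simp add: group_word)
  qed (use O car Fix_conj[of b _ c] in blast)+
  show "braid3 G g \<in> nielsen_class G"
    unfolding g braid3.simps
  proof (rule I)
    show "c \<otimes> d \<otimes> inv c \<in> O3" using O car by (intro O3_conj)
    show "a \<otimes> (b \<otimes> (c \<otimes> d \<otimes> inv c \<otimes> c)) = \<one>" using car pr by (simp add: group_word)
  qed (use O car Fix_conj[of c _ d] in blast)+
  show "twist g \<in> nielsen_class G"
    unfolding g twist.simps
  proof (rule I)
    show "a \<otimes> b \<otimes> inv a \<in> O3" using O car by (intro O3_conj)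
    show "inv d \<otimes> c \<otimes> d \<in> O3" using O car by (intro conj_inv_O3)
    show "a \<otimes> b \<otimes> inv a \<otimes> (a \<otimes> (d \<otimes> (inv d \<otimes> c \<otimes> d))) = \<one>" using car pr by (simp add: group_word)
  qed (use O car Fix_conj[of a _ b] Fix_conj'[of d _ c] in blast)+
  show "shift g \<in> nielsen_class G"
    unfolding g shift.simps by (rule I) (use O pr' in auto)
qed

lemma braid_conj4:
  assumes "g \<in> nielsen_class G" "x \<in> carrier G"
  shows "braid1 G (conj4 G x g) = conj4 G x (braid1 G g)"
    "braid2 G (conj4 G x g) = conj4 G x (braid2 G g)"
    "braid3 G (conj4 G x g) = conj4 G x (braid3 G g)"
    "twist (conj4 G x g) = conj4 G x (twist g)"
    "shift (conj4 G x g) = conj4 G x (shift g)"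
  using assms nielsen_carrier by (cases g; simp add: group_word)+

lemma braid_inj:
  assumes "g \<in> nielsen_class G" "h \<in> nielsen_class G"
  shows "braid1 G g = braid1 G h \<Longrightarrow> g = h" "braid2 G g = braid2 G h \<Longrightarrow> g = h"
    "braid3 G g = braid3 G h \<Longrightarrow> g = h"
  using assms nielsen_carrier by (cases g; cases h; auto)+

lemma hq1_apply: "g \<in> nielsen_class G \<Longrightarrow> hq1 G (Cl g) = Cl (braid1 G g)"
  unfolding hq1_def
  by (rule class_map(1)) (erule braid_nielsen(1), erule (1) braid_conj4(1), erule (2) braid_inj(1), assumption)

lemma hq1_Bij: "hq1 G \<in> Bij (nielsen_in G)"
  unfolding hq1_def
  by (rule class_map(2)) (erule braid_nielsen(1), erule (1) braid_conj4(1), erule (2) braid_inj(1))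

lemma hq2_apply: "g \<in> nielsen_class G \<Longrightarrow> hq2 G (Cl g) = Cl (braid2 G g)"
  unfolding hq2_def
  by (rule class_map(1)) (erule braid_nielsen(2), erule (1) braid_conj4(2), erule (2) braid_inj(2), assumption)

lemma hq2_Bij: "hq2 G \<in> Bij (nielsen_in G)"
  unfolding hq2_def
  by (rule class_map(2)) (erule braid_nielsen(2), erule (1) braid_conj4(2), erule (2) braid_inj(2))

lemma hq3_apply: "g \<in> nielsen_class G \<Longrightarrow> hq3 G (Cl g) = Cl (braid3 G g)"
  unfolding hq3_def
  by (rule class_map(1)) (erule braid_nielsen(3), erule (1) braid_conj4(3), erule (2) braid_inj(3), assumption)

lemma hq3_Bij: "hq3 G \<in> Bij (nielsen_in G)"
  unfolding hq3_def
  by (rule class_map(2)) (erule braid_nielsen(3), erule (1) braid_conj4(3), erule (2) braid_inj(3))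

lemma class_eqI:
  assumes "g \<in> nielsen_class G" "x \<in> carrier G" "h = conj4 G x g"
  shows "Cl h = Cl g"
  using assms Cl_conj by simp

text \<open>
  So the square of \<open>q\<^sub>1q\<^sub>3\<inverse>\<close> acts trivially on classes.
\<close>

lemma twist_twist:
  assumes "g \<in> nielsen_class G"
  shows "twist (twist g) = conj4 G (fst g \<otimes> fst (snd g)) g" "Cl (twist (twist g)) = Cl g"
proof -
  obtain a b c d where g: "g = (a, b, c, d)" by (cases g)
  note car = nielsen_carrier[OF assms[unfolded g]] and pr = nielsen_product[OF assms[unfolded g]]
  have "a \<otimes> b \<otimes> c \<otimes> inv (a \<otimes> b) = inv d \<otimes> c \<otimes> d"
    "a \<otimes> b \<otimes> d \<otimes> inv (a \<otimes> b) = inv d \<otimes> inv c \<otimes> d \<otimes> c \<otimes> d"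
    unfolding pr using car by (simp_all add: group_word)
  then show 1: "twist (twist g) = conj4 G (fst g \<otimes> fst (snd g)) g"
    using car by (simp add: g group_word)
  show "Cl (twist (twist g)) = Cl g"
    by (rule class_eqI[OF assms _ 1]) (use car in \<open>simp add: g\<close>)
qed

lemma shift_shift: "shift (shift g) = g"
  by (cases g) simp

lemma twist_shift_twist_shift: "g \<in> nielsen_class G \<Longrightarrow> twist (shift (twist (shift g))) = g"
  using nielsen_carrier by (cases g) (simp add: group_word)

lemma twist_shift_commute:
  assumes "g \<in> nielsen_class G"
  shows "Cl (twist (shift g)) = Cl (shift (twist g))"
proof -
  obtain a b c d where g: "g = (a, b, c, d)" by (cases g)
  note car = nielsen_carrier[OF assms[unfolded g]] and pr = nielsen_product[OF assms[unfolded g]]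
  have "inv (inv d \<otimes> inv c) = c \<otimes> d" using car by (simp add: group_word)
  then have cd: "c \<otimes> d = inv b \<otimes> inv a" using car unfolding pr[symmetric] by (simp add: group_word)
  have "c \<otimes> d \<otimes> (a \<otimes> b \<otimes> inv a) \<otimes> inv (c \<otimes> d) = b" "c \<otimes> d \<otimes> a \<otimes> inv (c \<otimes> d) = inv b \<otimes> a \<otimes> b"
    unfolding cd using car by (simp_all add: group_word)
  then have "twist (shift g) = conj4 G (c \<otimes> d) (shift (twist g))"
    using car by (simp add: g group_word)
  then show ?thesis
    using class_eqI[OF braid_nielsen(5)[OF braid_nielsen(4)[OF assms]]] car by (metis m_closed)
qed

text \<open>
  Conjugation by \<open>q\<^sub>2\<close> interchanges two of the involutions of the Klein
  four-group; hence \<open>q\<^sub>2\<close> acts on its orbits.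
\<close>

lemma braid2_twist:
  assumes "g \<in> nielsen_class G"
  shows "Cl (braid2 G (twist g)) = Cl (shift (braid2 G g))"
proof -
  obtain a b c d where g: "g = (a, b, c, d)" by (cases g)
  note car = nielsen_carrier[OF assms[unfolded g]] and pr = nielsen_product[OF assms[unfolded g]]
  have "a \<otimes> b \<otimes> c \<otimes> inv (a \<otimes> b) = inv d \<otimes> c \<otimes> d"
    unfolding pr using car by (simp add: group_word)
  then have "braid2 G (twist g) = conj4 G a (shift (braid2 G g))"
    using car by (simp add: g group_word)
  then show ?thesis
    using class_eqI[OF braid_nielsen(5)[OF braid_nielsen(2)[OF assms]]] car by metis
qed

lemma braid2_shift:
  assumes "g \<in> nielsen_class G"
  shows "Cl (braid2 G (shift g)) = Cl (twist (braid2 G g))"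
proof -
  obtain a b c d where g: "g = (a, b, c, d)" by (cases g)
  note car = nielsen_carrier[OF assms[unfolded g]] and pr = nielsen_product[OF assms[unfolded g]]
  have "d \<otimes> (a \<otimes> b) = inv c" unfolding pr using car by (simp add: group_word)
  then have "inv (inv c) = inv (d \<otimes> (a \<otimes> b))" by simp
  then have "c = inv b \<otimes> (inv a \<otimes> inv d)" using car by (simp add: inv_mult_group m_assoc)
  then have "braid2 G (shift g) = conj4 G d (twist (braid2 G g))"
    using car by (simp add: g group_word)
  then show ?thesis
    using class_eqI[OF braid_nielsen(4)[OF braid_nielsen(2)[OF assms]]] car by metis
qed

subsection \<open>The group Q\<close>

definition qa where "qa = inv\<^bsub>BijGroup (nielsen_in G)\<^esub> (hq3 G) \<otimes>\<^bsub>BijGroup (nielsen_in G)\<^esub> hq1 G"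
definition qb where "qb = (hq3 G \<otimes>\<^bsub>BijGroup (nielsen_in G)\<^esub> hq2 G \<otimes>\<^bsub>BijGroup (nielsen_in G)\<^esub> hq1 G)
  [^]\<^bsub>BijGroup (nielsen_in G)\<^esub> (2::nat)"

lemma q_gens_eq: "q_gens G = {qb, qa}"
  by (simp add: q_gens_def qa_def qb_def Let_def)

lemma qa_qb_Bij: "qa \<in> Bij (nielsen_in G)" "qb \<in> Bij (nielsen_in G)"
proof -
  interpret B: group "BijGroup (nielsen_in G)" by (rule group_BijGroup)
  have h: "hq1 G \<in> carrier (BijGroup (nielsen_in G))" "hq2 G \<in> carrier (BijGroup (nielsen_in G))"
    "hq3 G \<in> carrier (BijGroup (nielsen_in G))"
    using hq1_Bij hq2_Bij hq3_Bij by (simp_all add: carrier_BijGroup)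
  have "qa \<in> carrier (BijGroup (nielsen_in G))" "qb \<in> carrier (BijGroup (nielsen_in G))"
    unfolding qa_def qb_def using h by - (intro B.m_closed B.inv_closed B.nat_pow_closed; assumption)+
  then show "qa \<in> Bij (nielsen_in G)" "qb \<in> Bij (nielsen_in G)" by (simp_all add: carrier_BijGroup)
qed

lemma qa_apply:
  assumes g: "g \<in> nielsen_class G"
  shows "qa (Cl g) = Cl (twist g)"
proof -
  let ?B = "BijGroup (nielsen_in G)"
  interpret B: group ?B by (rule group_BijGroup)
  have c: "hq3 G \<in> carrier ?B" using hq3_Bij by (simp add: carrier_BijGroup)
  have i: "inv\<^bsub>?B\<^esub> (hq3 G) \<in> Bij (nielsen_in G)" using B.inv_closed[OF c] by (simp add: carrier_BijGroup)
  have "braid3 G (twist g) = braid1 G g"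
    using nielsen_carrier[of "fst g" "fst (snd g)" "fst (snd (snd g))" "snd (snd (snd g))"] g
    by (cases g) (simp add: group_word)
  then have "hq1 G (Cl g) = hq3 G (Cl (twist g))"
    using g by (simp add: hq1_apply hq3_apply braid_nielsen)
  then have "qa (Cl g) = (inv\<^bsub>?B\<^esub> (hq3 G) \<otimes>\<^bsub>?B\<^esub> hq3 G) (Cl (twist g))"
    unfolding qa_def using g i hq1_Bij hq3_Bij
    by (simp add: BijGroup_mult_apply nielsen_inI braid_nielsen)
  then show ?thesis using c g by (simp add: one_BijGroup nielsen_inI braid_nielsen)
qed

lemma qb_apply:
  assumes g: "g \<in> nielsen_class G"
  shows "qb (Cl g) = Cl (shift g)"
proof -
  let ?B = "BijGroup (nielsen_in G)"
  interpret B: group ?B by (rule group_BijGroup)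
  have h: "hq1 G \<in> carrier ?B" "hq2 G \<in> carrier ?B" "hq3 G \<in> carrier ?B"
    using hq1_Bij hq2_Bij hq3_Bij by (simp_all add: carrier_BijGroup)
  let ?s = "hq3 G \<otimes>\<^bsub>?B\<^esub> hq2 G \<otimes>\<^bsub>?B\<^esub> hq1 G"
  have s: "?s \<in> Bij (nielsen_in G)" using h B.m_closed by (metis carrier_BijGroup)
  have s': "hq3 G \<otimes>\<^bsub>?B\<^esub> hq2 G \<in> Bij (nielsen_in G)" using h B.m_closed by (metis carrier_BijGroup)
  have step: "?s (Cl k) = Cl (braid3 G (braid2 G (braid1 G k)))" if "k \<in> nielsen_class G" for k
    using that s' hq1_Bij hq2_Bij hq3_Bij
    by (simp add: BijGroup_mult_apply nielsen_inI braid_nielsen hq1_apply hq2_apply hq3_apply)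
  let ?f = "\<lambda>k. braid3 G (braid2 G (braid1 G k))"
  obtain a b c d where abcd: "g = (a, b, c, d)" by (cases g)
  note car = nielsen_carrier[OF g[unfolded abcd]]
  have "?f (?f g) = conj4 G (a \<otimes> b) (shift g)"
    using car by (simp add: abcd group_word)
  then have "Cl (?f (?f g)) = Cl (shift g)"
    using car class_eqI[OF braid_nielsen(5)[OF g], of "a \<otimes> b"] by simp
  moreover have "qb (Cl g) = (?s ^^ 2) (Cl g)"
    unfolding qb_def using s g by (simp only: BijGroup_pow_apply nielsen_inI)
  then have "qb (Cl g) = Cl (?f (?f g))"
    using g by (simp add: numeral_2_eq_2 step braid_nielsen)
  ultimately show ?thesis by simp
qed

lemma Q_carrier: "carrier (Q_group G) = {\<one>\<^bsub>BijGroup (nielsen_in G)\<^esub>, qa, qb, qa \<otimes>\<^bsub>BijGroup (nielsen_in G)\<^esub> qb}"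
proof -
  let ?B = "BijGroup (nielsen_in G)"
  interpret B: group ?B by (rule group_BijGroup)
  have c: "qa \<in> carrier ?B" "qb \<in> carrier ?B" using qa_qb_Bij by (simp_all add: carrier_BijGroup)
  have eq: "f = h" if "f \<in> carrier ?B" "h \<in> carrier ?B" "\<And>g. g \<in> nielsen_class G \<Longrightarrow> f (Cl g) = h (Cl g)" for f h
    using that by (intro BijGroup_eqI[of f "nielsen_in G" h]) (auto simp: carrier_BijGroup elim!: nielsen_inE)
  have m: "(f \<otimes>\<^bsub>?B\<^esub> h) (Cl g) = f (h (Cl g))"
    if "f \<in> carrier ?B" "h \<in> carrier ?B" "g \<in> nielsen_class G" for f h g
    using that by (simp add: BijGroup_mult_apply nielsen_inI carrier_BijGroup)
  have "qa \<otimes>\<^bsub>?B\<^esub> qa = \<one>\<^bsub>?B\<^esub>"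
    by (rule eq) (use c in \<open>simp_all add: m one_BijGroup nielsen_inI qa_apply braid_nielsen twist_twist(2)\<close>)
  moreover have "qb \<otimes>\<^bsub>?B\<^esub> qb = \<one>\<^bsub>?B\<^esub>"
    by (rule eq) (use c in \<open>simp_all add: m one_BijGroup nielsen_inI qb_apply braid_nielsen shift_shift\<close>)
  moreover have "qa \<otimes>\<^bsub>?B\<^esub> qb = qb \<otimes>\<^bsub>?B\<^esub> qa"
    by (rule eq) (use c in \<open>simp_all add: m qa_apply qb_apply braid_nielsen twist_shift_commute\<close>)
  ultimately show ?thesis
    using B.generate_klein[OF c] by (simp add: Q_group_def perm_group_def q_gens_eq)
qed

definition Qorb where "Qorb g = {Cl g, Cl (twist g), Cl (shift g), Cl (twist (shift g))}"

lemma Q_orbits_eq: "Q_orbits G = Qorb ` nielsen_class G"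
proof -
  have "orbit (Q_group G) (\<lambda>\<tau>. \<tau>) (Cl g) = Qorb g" if g: "g \<in> nielsen_class G" for g
  proof -
    have "orbit (Q_group G) (\<lambda>\<tau>. \<tau>) (Cl g) = (\<lambda>\<tau>. \<tau> (Cl g)) ` carrier (Q_group G)"
      by (auto simp: orbit_def)
    then show ?thesis
      unfolding Q_carrier Qorb_def
      using g qa_qb_Bij by (simp add: one_BijGroup BijGroup_mult_apply nielsen_inI qa_apply qb_apply braid_nielsen)
  qed
  then have "(\<lambda>g. orbit (Q_group G) (\<lambda>\<tau>. \<tau>) (Cl g)) ` nielsen_class G = Qorb ` nielsen_class G"
    by (intro image_cong) auto
  moreover have "Q_orbits G = (\<lambda>C. orbit (Q_group G) (\<lambda>\<tau>. \<tau>) C) ` nielsen_in G"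
    unfolding Q_orbits_def perm_orbits_def orbits_def Q_group_def by blast
  ultimately show ?thesis unfolding nielsen_in_def image_image by simp
qed

text \<open>
  Otherwise \<open>t\<^sup>2 = 1\<close> would be a square outside \<open>V\<close>.
\<close>

lemma involution_kernel: "t \<in> carrier G \<Longrightarrow> t \<otimes> t = \<one> \<Longrightarrow> p t = 1"
  using involution_square[of t] V.one_closed by (metis p_mult p_one)

lemma p_conj_eq:
  assumes "h \<in> carrier G" "a \<in> carrier G" "h \<otimes> a \<otimes> inv h = b"
  shows "p h * p a = p b * p h"
proof -
  have "b \<in> carrier G" using assms by (metis inv_closed m_closed)
  then have "h \<otimes> a = b \<otimes> h" using assms conj_eq_iff by blast
  then show ?thesis using assms \<open>b \<in> carrier G\<close> by (metis p_mult)
qed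

text \<open>
  If conjugation by \<open>t\<close> realizes the shift, then \<open>t\<^sup>2\<close> centralizes
  the tuple, so \<open>t\<^sup>2 = 1\<close> and \<open>t\<close> is in the kernel. Then opposite
  entries have the same image in \<open>A\<^sub>5\<close>, the product of the first two images has
  square 1, and they have a common fixed point.
\<close>

lemma Cl_shift_neq:
  assumes "g \<in> nielsen_class G"
  shows "Cl (shift g) \<noteq> Cl g"
proof
  assume "Cl (shift g) = Cl g"
  then obtain h where h: "h \<in> carrier G" "shift g = conj4 G h g"
    using Cl_eq_iff assms braid_nielsen by metis
  obtain a b c d where g: "g = (a, b, c, d)" by (cases g)
  note car = nielsen_carrier[OF assms[unfolded g]]
  have n: "a \<in> O3" "b \<in> O3" "c \<in> O3" "\<not> common_fix [p a, p b, p c]" "a \<otimes> b \<otimes> c \<otimes> d = \<one>"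
    using assms unfolding g nielsen_class_iff by auto
  have "conj4 G (h \<otimes> h) g = shift (shift g)"
    using h assms braid_conj4(5)[of g h] conj4_comp[of g h h] by simp
  also have "\<dots> = g" by (rule shift_shift)
  finally have "h \<otimes> h = \<one>" using conj4_free[OF assms] h(1) by blast
  then have ph: "p h = 1" using involution_kernel h by blast
  have eq: "p c = p a" "p d = p b"
    using p_conj_eq[OF h(1) car(1), of c] p_conj_eq[OF h(1) car(2), of d]
      h(2)[unfolded g shift.simps conj4.simps prod.inject] ph by (metis mult_1_left mult_1_right)+
  have "p a * p b * p c * p d = 1" using n(5) car by (metis m_closed p_mult p_one)
  then have "p a * p b * (p a * p b) = 1" by (simp add: eq mult.assoc)
  then have "common_fix [p a, p b]" using small_product_fixes(1) O3(2) n by blast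
  then show False using n(4) by (auto simp: common_fix_iff eq)
qed

lemma Cl_twist_neq:
  assumes "g \<in> nielsen_class G"
  shows "Cl (twist g) \<noteq> Cl g"
proof
  assume "Cl (twist g) = Cl g"
  then obtain h where h: "h \<in> carrier G" "twist g = conj4 G h g"
    using Cl_eq_iff assms braid_nielsen by metis
  obtain a b c d where g: "g = (a, b, c, d)" by (cases g)
  note car = nielsen_carrier[OF assms[unfolded g]]
  have n: "a \<in> O3" "b \<in> O3" "c \<in> O3" "\<not> common_fix [p a, p b, p c]" "a \<otimes> b \<otimes> c \<otimes> d = \<one>"
    using assms unfolding g nielsen_class_iff by auto
  have "conj4 G (h \<otimes> h) g = twist (twist g)"
    using h assms braid_conj4(4)[of g h] conj4_comp[of g h h] by simp
  also have "\<dots> = conj4 G (a \<otimes> b) g" using twist_twist(1)[OF assms] by (simp only: g fst_conv snd_conv)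
  finally have hh: "h \<otimes> h = a \<otimes> b" using conj4_inj[OF assms] h(1) car by blast
  have hb: "h \<otimes> b = a \<otimes> h" 
    using conj_eq_iff[OF h(1) car(2,1)] h(2)[unfolded g twist.simps conj4.simps prod.inject] by metis
  have t: "inv a \<otimes> h = h \<otimes> inv b"
  proof -
    have "inv a \<otimes> (h \<otimes> b) \<otimes> inv b = inv a \<otimes> (a \<otimes> h) \<otimes> inv b" using hb by simp
    then show ?thesis using car h(1) by (simp add: group_word)
  qed
  have "inv a \<otimes> h \<otimes> (inv a \<otimes> h) = inv a \<otimes> (h \<otimes> h) \<otimes> inv b"
    using car h(1) by (subst (2) t) (simp add: group_word)
  also have "\<dots> = \<one>" unfolding hh using car by (simp add: group_word)
  finally have "p (inv a \<otimes> h) = 1" using involution_kernel[of "inv a \<otimes> h"] car h(1) by simp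
  then have "p a * (p (inv a) * p h) = p a" using car h(1) by (simp add: p_mult)
  then have ph: "p h = p a" using p_inv(1)[OF car(1)] by (metis mult.assoc mult.left_neutral)
  have "p h * p h = p a * p b" using hh h(1) car by (metis p_mult)
  then have pb: "p b = p a" using alt5_cancel[of "p a"] ph p_alt5 car by metis
  have pd: "p a * p c = p d * p a"
    using p_conj_eq[OF h(1) car(3), of d] h(2)[unfolded g twist.simps conj4.simps prod.inject] ph by metis
  have "p a * p b * p c * p d = 1" using n(5) car by (metis m_closed p_mult p_one)
  then have "p a * p a * p c * p d * p a = p a" by (simp add: pb)
  then have "p a * (p a * p c * (p a * p c)) = p a * 1" by (simp add: mult.assoc pd)
  then have "p a * p c * (p a * p c) = 1" using alt5_cancel p_alt5 car by blast
  then have "common_fix [p a, p c]" using small_product_fixes(1) O3(2) n by blast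
  then show False using n(4) by (auto simp: common_fix_iff pb)
qed

lemma Cl_twist_shift_neq:
  assumes "g \<in> nielsen_class G"
  shows "Cl (twist (shift g)) \<noteq> Cl g"
proof
  assume "Cl (twist (shift g)) = Cl g"
  then obtain h where h: "h \<in> carrier G" "twist (shift g) = conj4 G h g"
    using Cl_eq_iff[OF assms braid_nielsen(4)[OF braid_nielsen(5)[OF assms]]] by metis
  obtain a b c d where g: "g = (a, b, c, d)" by (cases g)
  note car = nielsen_carrier[OF assms[unfolded g]]
  have n: "a \<in> O3" "b \<in> O3" "c \<in> O3" "\<not> common_fix [p a, p b, p c]" "a \<otimes> b \<otimes> c \<otimes> d = \<one>"
    using assms unfolding g nielsen_class_iff by auto
  have "twist (shift (twist (shift g))) = conj4 G h (twist (shift g))"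
    using braid_conj4(5)[OF assms h(1)] braid_conj4(4)[OF braid_nielsen(5)[OF assms] h(1)] h(2) by metis
  also have "\<dots> = conj4 G (h \<otimes> h) g" unfolding h(2) by (rule conj4_comp[OF assms h(1) h(1)])
  finally have "conj4 G (h \<otimes> h) g = g" unfolding twist_shift_twist_shift[OF assms] by (rule sym)
  then have "h \<otimes> h = \<one>" using conj4_free[OF assms] h(1) by blast
  then have ph: "p h = 1" using involution_kernel h by blast
  have "h \<otimes> a \<otimes> inv h = c \<otimes> d \<otimes> inv c" "h \<otimes> b \<otimes> inv h = c"
    using h(2)[unfolded g shift.simps twist.simps conj4.simps prod.inject] by metis+
  then have "p a = p (c \<otimes> d \<otimes> inv c)" and pb: "p b = p c"
    using p_conj_eq[OF h(1) car(1)] p_conj_eq[OF h(1) car(2)] ph by (metis mult_1_left mult_1_right)+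
  then have pa: "p a * p c = p c * p d" using car p_inv(2)[of c] by (simp add: p_mult mult.assoc)
  have "p a * p b * p c * p d = 1" using n(5) car by (metis m_closed p_mult p_one)
  then have "p a * p c * (p a * p c) = 1" unfolding pa by (simp add: pb mult.assoc pa[symmetric])
  then have "common_fix [p a, p c]" using small_product_fixes(1) O3(2) n by blast
  then show False using n(4) by (auto simp: common_fix_iff pb)
qed

lemma Cl_twist_cong: "g \<in> nielsen_class G \<Longrightarrow> h \<in> nielsen_class G \<Longrightarrow> Cl g = Cl h \<Longrightarrow> Cl (twist g) = Cl (twist h)"
  using qa_apply by metis

lemma Cl_shift_cong: "g \<in> nielsen_class G \<Longrightarrow> h \<in> nielsen_class G \<Longrightarrow> Cl g = Cl h \<Longrightarrow> Cl (shift g) = Cl (shift h)"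
  using qb_apply by metis

text \<open>
  No nontrivial element of the Klein four-group fixes a class.
\<close>

theorem card_Qorb:
  assumes g: "g \<in> nielsen_class G"
  shows "card (Qorb g) = 4"
proof -
  have 1: "Cl (twist g) \<noteq> Cl (shift g)"
    using Cl_twist_cong[of "twist g" "shift g"] twist_twist(2)[OF g] Cl_twist_shift_neq[OF g] braid_nielsen g by metis
  have 2: "Cl (twist g) \<noteq> Cl (twist (shift g))"
    using twist_shift_commute[OF g] Cl_shift_neq[of "twist g"] braid_nielsen g by metis
  have 3: "Cl (shift g) \<noteq> Cl (twist (shift g))"
    using Cl_twist_neq[of "shift g"] braid_nielsen g by metis
  show ?thesis
    unfolding Qorb_def using 1 2 3 Cl_twist_neq[OF g] Cl_shift_neq[OF g] Cl_twist_shift_neq[OF g]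
    by (simp add: card_insert_if)
qed

end

lemma alt5_pair_commute:
  assumes "X \<in> cyc3" "Y \<in> cyc3" "\<not> common_fix [X, Y]" "u \<in> alt5" "u * X = X * u" "u * Y = Y * u"
  shows "u = 1"
proof (rule alt5_centre[OF assms(4)])
  fix k assume "k \<in> alt5"
  moreover have "alt5 \<subseteq> {k. u * k = k * u}"
  proof (rule pair_generates[OF assms(1-3)])
    show "v * w \<in> {k. u * k = k * u}" if "v \<in> {k. u * k = k * u}" "w \<in> {k. u * k = k * u}" for v w
      using that by (simp add: mult.assoc[symmetric]) (simp add: mult.assoc)
  qed (use assms in auto)
  ultimately show "u * k = k * u" by blast
qed

lemma conj_cancel_monoid:
  assumes "(h'::'m::monoid_mult) * h = 1"
  shows "h' * (h * u * h') * h = u"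
proof -
  have "h' * (h * u * h') * h = h' * h * u * (h' * h)" by (simp add: mult.assoc)
  then show ?thesis by (simp add: assms)
qed

lemma dvd_10: "(n::nat) dvd 10 \<Longrightarrow> n = 1 \<or> n = 2 \<or> n = 5 \<or> n = 10"
proof -
  assume "n dvd 10"
  moreover from this have "n \<le> 10" by (rule dvd_imp_le) simp
  then have "n = 0 \<or> n = 1 \<or> n = 2 \<or> n = 3 \<or> n = 4 \<or> n = 5 \<or> n = 6 \<or> n = 7 \<or> n = 8 \<or> n = 9 \<or> n = 10"
    by arith
  ultimately show ?thesis by auto
qed

lemma (in group) commute_mult:
  "a \<in> carrier G \<Longrightarrow> b \<in> carrier G \<Longrightarrow> w \<in> carrier G \<Longrightarrow> a \<otimes> w = w \<otimes> a \<Longrightarrow> b \<otimes> w = w \<otimes> b \<Longrightarrow>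
    a \<otimes> b \<otimes> w = w \<otimes> (a \<otimes> b)"
  by (metis m_assoc)

context level_one
begin

subsection \<open>Generating pairs of elements of order three\<close>

text \<open>
  The pairs that generate the group; the condition on fixed points is the criterion for generation.
\<close>

definition Pairs where "Pairs = {(x, y). x \<in> O3 \<and> y \<in> O3 \<and> \<not> common_fix [p x, p y]}"

lemma PairsD:
  assumes "(x, y) \<in> Pairs"
  shows "x \<in> O3" "y \<in> O3" "\<not> common_fix [p x, p y]" "x \<in> carrier G" "y \<in> carrier G"
    "p x \<in> cyc3" "p y \<in> cyc3"
  using assms O3 by (auto simp: Pairs_def)

text \<open>
  The product \<open>xy\<close> has order 10, and this power is the involution of the cyclic group
  that it generates.
\<close>

definition spine where "spine x y = (x \<otimes> y) [^] (5::nat)"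

lemma spine:
  assumes "(x, y) \<in> Pairs"
  shows "spine x y \<in> carrier G" "p (spine x y) = 1" "spine x y \<notin> V"
    "spine x y \<otimes> (x \<otimes> y) = x \<otimes> y \<otimes> spine x y"
proof -
  note P = PairsD[OF assms]
  show c: "spine x y \<in> carrier G" using P by (simp add: spine_def)
  show "p (spine x y) = 1"
    using P generating_pair_cases(4)[OF P(6,7,3)] by (simp add: spine_def p_pow p_mult pow5_expand)
  have "V #> spine x y = zS"
    using S.generating_pair_spin[of "V #> x" "V #> y"] coset_O3[OF P(1)] coset_O3[OF P(2)] P
    by (simp add: spine_def coset_pow coset_mult)
  then show "spine x y \<notin> V" using coset_one_iff[OF c] S.z(3) by simp
  show "spine x y \<otimes> (x \<otimes> y) = x \<otimes> y \<otimes> spine x y"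
    using P by (simp add: spine_def nat_pow_comm[of "x \<otimes> y" 5 1, simplified])
qed

lemma pair_image:
  assumes "(x, y) \<in> Pairs"
  shows "p (x \<otimes> y) \<noteq> 1" "p (x \<otimes> y) ^ 5 = 1" "p (x \<otimes> y) * p (x \<otimes> y) \<noteq> 1"
  using PairsD[OF assms] generating_pair_cases[of "p x" "p y"] by (auto simp: p_mult pow5_expand)

lemma pair_order:
  assumes "(x, y) \<in> Pairs"
  shows "ord (x \<otimes> y) = 10"
proof -
  note P = PairsD[OF assms] and c = spine[OF assms]
  let ?z = "x \<otimes> y"
  have z: "?z \<in> carrier G" using P by simp
  have "spine x y \<otimes> spine x y = \<one>" using c square by blast
  then have "?z [^] (10::nat) = \<one>" using z by (simp add: spine_def nat_pow_mult)
  then have "ord ?z dvd 10" using pow_eq_id z by blast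
  moreover have "\<not> ord ?z dvd 5"
    using pow_eq_id[OF z, of 5] c(3) V.one_closed by (auto simp: spine_def)
  moreover have "\<not> ord ?z dvd 2"
    using pow_eq_id[OF z, of 2] pair_image(3)[OF assms] p_pow[OF z, of 2] by (auto simp: p_one power2_eq_square)
  ultimately show ?thesis using dvd_10[of "ord ?z"] by auto
qed

lemma Pairs_swap: "(x, y) \<in> Pairs \<Longrightarrow> (y, x) \<in> Pairs"
proof -
  assume xy: "(x, y) \<in> Pairs"
  note P = PairsD[OF xy]
  show ?thesis unfolding Pairs_def using P generating_pair_cases(7)[OF P(6,7,3)] by simp
qed

lemma Pairs_image: "(x, y) \<in> Pairs \<Longrightarrow> x' \<in> O3 \<Longrightarrow> y' \<in> O3 \<Longrightarrow> p x' = p x \<Longrightarrow> p y' = p y \<Longrightarrow> (x', y') \<in> Pairs"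
  by (auto simp: Pairs_def)

lemma Pairs_inv: "(x, y) \<in> Pairs \<Longrightarrow> (inv x, y) \<in> Pairs" "(x, y) \<in> Pairs \<Longrightarrow> (x, inv y) \<in> Pairs"
proof -
  assume xy: "(x, y) \<in> Pairs"
  note P = PairsD[OF xy]
  show "(inv x, y) \<in> Pairs" "(x, inv y) \<in> Pairs"
    unfolding Pairs_def using P generating_pair_cases(5,6)[OF P(6,7,3)]
    by (simp_all add: O3_inv_closed p_O3_inv)
qed

lemma Pairs_conj:
  assumes "(x, y) \<in> Pairs" "h \<in> carrier G"
  shows "(h \<otimes> x \<otimes> inv h, h \<otimes> y \<otimes> inv h) \<in> Pairs"
proof -
  note P = PairsD[OF assms(1)]
  have "common_fix [p x, p y]" if "common_fix [p h * p x * p (inv h), p h * p y * p (inv h)]"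
  proof -
    have "p (inv h) * (p h * u * p (inv h)) * p h = u" for u
      by (rule conj_cancel_monoid[OF p_inv(2)[OF assms(2)]])
    then show ?thesis using common_fix_conj[OF p_inv(1)[OF assms(2)] that] by simp
  qed
  then show ?thesis using P assms(2) O3_conj by (auto simp: Pairs_def p_mult)
qed

text \<open>
  Over each of the 120 generating pairs of 3-cycles there are \<open>16\<^sup>2\<close> pairs.
\<close>

lemma card_Pairs: "card Pairs = 30720"
proof -
  define T where "T = {(x, y). x \<in> cyc3 \<and> y \<in> cyc3 \<and> \<not> common_fix [x, y]}"
  define L where "L X = {y \<in> O3. p y = X}" for X
  define D where "D = (SIGMA t:T. case t of (x, y) \<Rightarrow> L x \<times> L y)"
  have finT: "finite T"
    by (rule finite_subset[of _ "cyc3 \<times> cyc3"]) (auto simp: T_def)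
  have L: "card (L x) = 16" "finite (L x)" if "x \<in> cyc3" for x
    using card_O3_lifts[OF that] by (auto simp: L_def intro!: card_ge_0_finite)
  have fibre: "finite (case t of (x, y) \<Rightarrow> L x \<times> L y)" "card (case t of (x, y) \<Rightarrow> L x \<times> L y) = 256"
    if "t \<in> T" for t
    using that L by (auto simp: T_def card_cartesian_product)
  have "card D = 30720"
    unfolding D_def using finT fibre card_generating_pairs by (simp add: card_SigmaI T_def)
  moreover have "bij_betw snd D Pairs"
  proof (rule bij_betw_imageI)
    show "inj_on snd D" by (auto simp: inj_on_def D_def L_def T_def)
    show "snd ` D = Pairs"
    proof
      show "snd ` D \<subseteq> Pairs" by (auto simp: D_def L_def T_def Pairs_def)
      show "Pairs \<subseteq> snd ` D"
      proof clarify
        fix x y assume "(x, y) \<in> Pairs"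
        then have "((p x, p y), (x, y)) \<in> D" using PairsD[of x y] by (auto simp: D_def L_def T_def)
        then show "(x, y) \<in> snd ` D" by (rule rev_image_eqI) simp
      qed
    qed
  qed
  ultimately show ?thesis using bij_betw_same_card by metis
qed

subsection \<open>Tuples fixed by complex conjugation\<close>

text \<open>
  The admissible \<open>c\<close> are the elements of the kernel that commute with
  \<open>xy\<close>; by \<open>adm_iff\<close> there are two of them.
\<close>

definition adm where "adm x y c \<longleftrightarrow> (x, y) \<in> Pairs \<and> c \<in> carrier G \<and> p c = 1 \<and> c \<otimes> (x \<otimes> y) = x \<otimes> y \<otimes> c"

text \<open>
  With \<open>d = x\<inverse> c x\<close> the second entry is \<open>d x\<inverse> d\<close>, a
  conjugate of \<open>x\<inverse>\<close>, and the third is a conjugate of \<open>y\<close>; the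
  condition on \<open>c\<close> makes the product of all four entries trivial.
\<close>

definition tup where
  "tup x y c = (x, inv x \<otimes> c \<otimes> inv x \<otimes> c \<otimes> x, c \<otimes> y \<otimes> c, inv y)"

text \<open>
  An element of order 5 has no fixed points on \<open>V\<close>, so the centralizer of
  \<open>xy\<close> in the kernel meets \<open>V\<close> trivially and has order at most 2; the
  element \<open>(xy)\<^sup>5\<close> lies outside \<open>V\<close>.
\<close>

lemma adm_iff: "adm x y c \<longleftrightarrow> (x, y) \<in> Pairs \<and> (c = \<one> \<or> c = spine x y)"
proof
  assume a: "adm x y c"
  then have xy: "(x, y) \<in> Pairs" and c: "c \<in> carrier G" "p c = 1" "c \<otimes> (x \<otimes> y) = x \<otimes> y \<otimes> c"
    by (simp_all add: adm_def)
  note P = PairsD[OF xy] and s = spine[OF xy]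
  have fixed: "m = \<one>" if "m \<in> V" "m \<otimes> (x \<otimes> y) = x \<otimes> y \<otimes> m" for m
    using no_fixed[of "x \<otimes> y" m] that P pair_image[OF xy] by simp
  show "(x, y) \<in> Pairs \<and> (c = \<one> \<or> c = spine x y)"
  proof (cases "c \<in> V")
    case True
    then show ?thesis using fixed c xy by blast
  next
    case False
    have "c \<otimes> spine x y \<in> V" using V_index c s False by blast
    moreover have "c \<otimes> spine x y \<otimes> (x \<otimes> y) = x \<otimes> y \<otimes> (c \<otimes> spine x y)"
      using c s P by (intro commute_mult) simp_all
    ultimately have "c \<otimes> spine x y = \<one>" using fixed by blast
    then have "c = spine x y" using eq_inv[of c "spine x y"] c s kernel_inv[of c] by simp
    then show ?thesis using xy by blast
  qed
next
  assume "(x, y) \<in> Pairs \<and> (c = \<one> \<or> c = spine x y)"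
  then show "adm x y c" using spine PairsD p_one by (auto simp: adm_def)
qed

lemma adm_facts:
  assumes "adm x y c" and d: "d = inv x \<otimes> c \<otimes> x"
  shows "x \<in> carrier G" "y \<in> carrier G" "c \<in> carrier G" "d \<in> carrier G" "p d = 1" "c \<otimes> c = \<one>" "d \<otimes> d = \<one>"
    "d \<otimes> c = c \<otimes> d" "x \<otimes> d = c \<otimes> x" "y \<otimes> c = d \<otimes> y" "inv x \<otimes> c = d \<otimes> inv x" "inv y \<otimes> d = c \<otimes> inv y"
proof -
  have a: "(x, y) \<in> Pairs" "c \<in> carrier G" "p c = 1" "c \<otimes> (x \<otimes> y) = x \<otimes> y \<otimes> c"
    using assms(1) by (simp_all add: adm_def)
  note P = PairsD[OF a(1)]
  show x: "x \<in> carrier G" and y: "y \<in> carrier G" and c: "c \<in> carrier G" using P a by blast+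
  show dc: "d \<in> carrier G" using x c d by simp
  show pd: "p d = 1" using p_conj_one[of "inv x" c] a x by (simp add: d)
  show "c \<otimes> c = \<one>" "d \<otimes> d = \<one>" using a dc pd square by blast+
  show "d \<otimes> c = c \<otimes> d" using kernel_commute a dc pd by blast
  show "x \<otimes> d = c \<otimes> x" using x c by (simp add: d group_word)
  show "inv x \<otimes> c = d \<otimes> inv x" using x c by (simp add: d group_word)
  have "inv x \<otimes> (c \<otimes> (x \<otimes> y)) = inv x \<otimes> (x \<otimes> y \<otimes> c)" using a(4) by simp
  then show yc: "y \<otimes> c = d \<otimes> y" using x y c by (simp add: d group_word)
  have "inv y \<otimes> (d \<otimes> y) \<otimes> inv y = inv y \<otimes> (y \<otimes> c) \<otimes> inv y" using yc by simp
  then show "inv y \<otimes> d = c \<otimes> inv y" using y c dc by (simp add: group_word)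
qed

lemma extend_word:
  assumes "a \<otimes> b = a' \<otimes> b'" "a \<in> carrier G" "b \<in> carrier G" "a' \<in> carrier G" "b' \<in> carrier G" "w \<in> carrier G"
  shows "a \<otimes> (b \<otimes> w) = a' \<otimes> (b' \<otimes> w)"
  using assms by (metis m_assoc)

lemma adm_rules:
  assumes a: "adm x y c" and d: "d = inv x \<otimes> c \<otimes> x"
  shows "\<And>w. w \<in> carrier G \<Longrightarrow> c \<otimes> (c \<otimes> w) = w" "\<And>w. w \<in> carrier G \<Longrightarrow> d \<otimes> (d \<otimes> w) = w"
    "\<And>w. w \<in> carrier G \<Longrightarrow> d \<otimes> (c \<otimes> w) = c \<otimes> (d \<otimes> w)" "\<And>w. w \<in> carrier G \<Longrightarrow> x \<otimes> (d \<otimes> w) = c \<otimes> (x \<otimes> w)"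
    "\<And>w. w \<in> carrier G \<Longrightarrow> y \<otimes> (c \<otimes> w) = d \<otimes> (y \<otimes> w)" "\<And>w. w \<in> carrier G \<Longrightarrow> inv x \<otimes> (c \<otimes> w) = d \<otimes> (inv x \<otimes> w)"
    "\<And>w. w \<in> carrier G \<Longrightarrow> inv y \<otimes> (d \<otimes> w) = c \<otimes> (inv y \<otimes> w)" "inv c = c" "inv d = d"
proof -
  note f = adm_facts[OF a d]
  show "\<And>w. w \<in> carrier G \<Longrightarrow> c \<otimes> (c \<otimes> w) = w" "\<And>w. w \<in> carrier G \<Longrightarrow> d \<otimes> (d \<otimes> w) = w"
    using f by (metis m_assoc l_one)+
  show "\<And>w. w \<in> carrier G \<Longrightarrow> d \<otimes> (c \<otimes> w) = c \<otimes> (d \<otimes> w)" "\<And>w. w \<in> carrier G \<Longrightarrow> x \<otimes> (d \<otimes> w) = c \<otimes> (x \<otimes> w)"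
    "\<And>w. w \<in> carrier G \<Longrightarrow> y \<otimes> (c \<otimes> w) = d \<otimes> (y \<otimes> w)" "\<And>w. w \<in> carrier G \<Longrightarrow> inv x \<otimes> (c \<otimes> w) = d \<otimes> (inv x \<otimes> w)"
    "\<And>w. w \<in> carrier G \<Longrightarrow> inv y \<otimes> (d \<otimes> w) = c \<otimes> (inv y \<otimes> w)"
    by (rule extend_word; use f in \<open>simp; fail\<close>)+
  show "inv c = c" "inv d = d" using f by (simp_all add: inv_equality)
qed

lemma tup_alt:
  assumes "adm x y c" "d = inv x \<otimes> c \<otimes> x"
  shows "tup x y c = (x, d \<otimes> inv x \<otimes> d, c \<otimes> y \<otimes> c, inv y)"
  using adm_facts(1-4)[OF assms] by (simp add: tup_def assms(2) group_word)

lemma tup_nielsen: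
  assumes a: "adm x y c"
  shows "tup x y c \<in> nielsen_class G"
proof -
  define d where "d = inv x \<otimes> c \<otimes> x"
  note f = adm_facts[OF a d_def] and r = adm_rules[OF a d_def]
  have P: "(x, y) \<in> Pairs" "p c = 1" using a by (simp_all add: adm_def)
  note O = PairsD[OF P(1)]
  have "c \<otimes> y \<otimes> c \<in> O3" using O3_conj[OF O(2) f(3)] r(8) by simp
  moreover have "d \<otimes> inv x \<otimes> d \<in> O3" using O3_conj[OF O3_inv_closed[OF O(1)] f(4)] r(9) by simp
  moreover have "x \<otimes> (d \<otimes> inv x \<otimes> d) \<otimes> (c \<otimes> y \<otimes> c) \<otimes> inv y = \<one>"
    using f r by (simp add: group_word)
  moreover have "\<not> common_fix [p x, p (d \<otimes> inv x \<otimes> d), p (c \<otimes> y \<otimes> c)]"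
    using O(3) f P(2) by (auto simp: common_fix_iff p_mult)
  ultimately show ?thesis
    unfolding tup_alt[OF a d_def] nielsen_class_iff using O O3_inv_closed by blast
qed

lemma tup_images:
  assumes a: "adm x y c"
  shows "p (inv x \<otimes> c \<otimes> inv x \<otimes> c \<otimes> x) = p (inv x)" "p (c \<otimes> y \<otimes> c) = p y"
  using adm_facts[OF a refl] a p_inv by (simp_all add: adm_def p_mult mult.assoc)

definition cc where "cc e x y = (if e then spine x y else \<one>)"
text \<open>
  The flag \<open>e\<close> distinguishes H-M tuples (false) from near H-M tuples (true).
\<close>

definition Te where "Te e x y = tup x y (cc e x y)"

lemma adm_cc: "(x, y) \<in> Pairs \<Longrightarrow> adm x y (cc e x y)"
  by (simp add: adm_iff cc_def)

lemma spine_neq_one: "(x, y) \<in> Pairs \<Longrightarrow> spine x y \<noteq> \<one>"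
  using spine(3) V.one_closed by metis

lemma cc_eqI: "adm x' y' d \<Longrightarrow> (x, y) \<in> Pairs \<Longrightarrow> d = \<one> \<longleftrightarrow> cc e x y = \<one> \<Longrightarrow> d = cc e x' y'"
  using spine_neq_one by (auto simp: adm_iff cc_def split: if_splits)

lemma Te_nielsen: "(x, y) \<in> Pairs \<Longrightarrow> Te e x y \<in> nielsen_class G"
  using tup_nielsen adm_cc by (simp add: Te_def)

lemma spine_conj:
  assumes "x \<in> carrier G" "y \<in> carrier G" "h \<in> carrier G"
  shows "spine (h \<otimes> x \<otimes> inv h) (h \<otimes> y \<otimes> inv h) = h \<otimes> spine x y \<otimes> inv h"
  using assms by (simp add: spine_def conj_mult pow_conj)

text \<open>
  The distinguished involution is defined by a word in \<open>x\<close> and \<open>y\<close>, so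
  the family is stable under conjugation.
\<close>

lemma Te_conj:
  assumes "(x, y) \<in> Pairs" "h \<in> carrier G"
  shows "conj4 G h (Te e x y) = Te e (h \<otimes> x \<otimes> inv h) (h \<otimes> y \<otimes> inv h)"
proof -
  note P = PairsD[OF assms(1)]
  have "cc e (h \<otimes> x \<otimes> inv h) (h \<otimes> y \<otimes> inv h) = h \<otimes> cc e x y \<otimes> inv h" "cc e x y \<in> carrier G"
    using P assms spine spine_conj by (simp_all add: cc_def)
  then show ?thesis using P assms(2) by (simp add: Te_def tup_def group_word)
qed

definition F where "F e = (\<lambda>(x, y). Cl (Te e x y)) ` Pairs"

lemma F_I: "(x, y) \<in> Pairs \<Longrightarrow> Cl (Te e x y) \<in> F e"
  by (force simp: F_def)

lemma F_E: "C \<in> F e \<Longrightarrow> (\<And>x y. (x, y) \<in> Pairs \<Longrightarrow> C = Cl (Te e x y) \<Longrightarrow> thesis) \<Longrightarrow> thesis"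
  by (force simp: F_def)

lemma F_nielsen_in: "F e \<subseteq> nielsen_in G"
proof
  fix C assume "C \<in> F e"
  then obtain x y where "(x, y) \<in> Pairs" "C = Cl (Te e x y)" by (rule F_E)
  then show "C \<in> nielsen_in G" using nielsen_inI[OF Te_nielsen] by simp
qed

text \<open>
  Conjugation acts freely on the tuples: \<open>30720 = 16 \<cdot> 1920\<close>.
\<close>

theorem card_F: "card (F e) = 16"
proof -
  let ?t = "\<lambda>(x, y). Te e x y"
  have "inj_on ?t Pairs"
  proof (rule inj_onI, clarify)
    fix x y x' y' assume "(x, y) \<in> Pairs" "(x', y') \<in> Pairs" "Te e x y = Te e x' y'"
    then show "x = x' \<and> y = y'" using PairsD[of x y] PairsD[of x' y'] inv_inv[of y] inv_inv[of y']
      by (simp add: Te_def tup_def)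
  qed
  then have "card (?t ` Pairs) = 30720" by (simp add: card_image card_Pairs)
  moreover have "card (Cl ` ?t ` Pairs) * 1920 = card (?t ` Pairs)"
  proof (rule card_inner_classes)
    show "?t ` Pairs \<subseteq> nielsen_class G" using Te_nielsen by auto
    show "conj4 G h g \<in> ?t ` Pairs" if gh: "g \<in> ?t ` Pairs" "h \<in> carrier G" for g h
    proof -
      obtain q where q: "q \<in> Pairs" "g = ?t q" using gh(1) by blast
      define x y where "x = fst q" and "y = snd q"
      have xy: "(x, y) \<in> Pairs" "g = Te e x y" using q by (simp_all add: x_def y_def split_beta)
      then have "conj4 G h g = ?t (h \<otimes> x \<otimes> inv h, h \<otimes> y \<otimes> inv h)" using Te_conj gh(2) by simp
      then show ?thesis using Pairs_conj[OF xy(1) gh(2)] by blast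
    qed
  qed
  moreover have "Cl ` ?t ` Pairs = F e" unfolding F_def image_image by (auto intro!: image_cong)
  ultimately show ?thesis by simp
qed

text \<open>
  The new pair is again a generating pair, and triviality of \<open>c\<close> is preserved; by
  \<open>cc_eqI\<close> this determines the new \<open>c\<close>.
\<close>

lemma shift_Te:
  assumes xy: "(x, y) \<in> Pairs"
  shows "\<exists>x' y'. (x', y') \<in> Pairs \<and> shift (Te e x y) = Te e x' y'"
proof -
  define c where "c = cc e x y"
  have a: "adm x y c" using adm_cc xy by (simp add: c_def)
  define d where "d = inv x \<otimes> c \<otimes> x"
  note f = adm_facts[OF a d_def] and r = adm_rules[OF a d_def] and P = PairsD[OF xy]
  have pc: "p c = 1" using a by (simp add: adm_def)
  define x' y' where "x' = c \<otimes> y \<otimes> c" and "y' = d \<otimes> x \<otimes> d"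
  have O: "x' \<in> O3" "y' \<in> O3"
    using O3_conj[OF P(2) f(3)] O3_conj[OF P(1) f(4)] r by (simp_all add: x'_def y'_def)
  have xy': "(x', y') \<in> Pairs"
    by (rule Pairs_image[OF Pairs_swap[OF xy] O]) (use f pc in \<open>simp_all add: x'_def y'_def p_mult\<close>)
  have ix: "inv x' = c \<otimes> inv y \<otimes> c" using f r by (simp add: x'_def group_word)
  have iy: "inv y' = d \<otimes> inv x \<otimes> d" using f r by (simp add: y'_def group_word)
  have a': "adm x' y' d"
    unfolding adm_def using xy' f r by (simp add: x'_def y'_def group_word)
  have "inv x' \<otimes> d \<otimes> x' = c" unfolding ix unfolding x'_def using f r by (simp add: group_word)
  then have "tup x' y' d = (x', c \<otimes> inv x' \<otimes> c, d \<otimes> y' \<otimes> d, inv y')"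
    using tup_alt[OF a'] by simp
  also have "\<dots> = shift (tup x y c)"
    unfolding ix iy tup_alt[OF a d_def] using f r by (simp add: x'_def y'_def group_word)
  finally have "shift (Te e x y) = tup x' y' d" by (simp add: Te_def c_def)
  moreover have "d = \<one> \<longleftrightarrow> c = \<one>" using f d_def by (metis l_inv r_one r_cancel_one l_one)
  then have "d = cc e x' y'" using cc_eqI[OF a' xy] by (simp add: c_def)
  ultimately show ?thesis using xy' unfolding Te_def by blast
qed

lemma twist_Te:
  assumes xy: "(x, y) \<in> Pairs"
  shows "\<exists>x' y'. (x', y') \<in> Pairs \<and> twist (Te e x y) = Te e x' y'"
proof -
  define c where "c = cc e x y"
  have a: "adm x y c" using adm_cc xy by (simp add: c_def)
  define d where "d = inv x \<otimes> c \<otimes> x"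
  note f = adm_facts[OF a d_def] and r = adm_rules[OF a d_def] and P = PairsD[OF xy]
  have pc: "p c = 1" using a by (simp add: adm_def)
  define x' y' where "x' = c \<otimes> (d \<otimes> inv x)" and "y' = c \<otimes> (d \<otimes> inv y)"
  have ix: "inv x' = c \<otimes> (x \<otimes> c)" and iy: "inv y' = d \<otimes> (y \<otimes> d)"
    using f r by (simp_all add: x'_def y'_def group_word)
  have tw: "twist (tup x y c) = (x', x, inv y, inv y')"
    unfolding iy tup_alt[OF a d_def] using f r by (simp add: x'_def group_word)
  have O: "x' \<in> O3" "y' \<in> O3"
  proof -
    have "(x', x, inv y, inv y') \<in> nielsen_class G" using braid_nielsen(4)[OF tup_nielsen[OF a]] tw by simp
    then have "x' \<in> O3" "inv y' \<in> O3" by (auto simp: nielsen_iff)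
    moreover have "y' \<in> carrier G" using f by (simp add: y'_def)
    ultimately show "x' \<in> O3" "y' \<in> O3" using O3_inv_closed[of "inv y'"] by simp_all
  qed
  have xy': "(x', y') \<in> Pairs"
    by (rule Pairs_image[OF Pairs_inv(1)[OF Pairs_inv(2)[OF xy]] O]) (use f pc in \<open>simp_all add: x'_def y'_def p_mult\<close>)
  have a': "adm x' y' d"
    unfolding adm_def using xy' f r by (simp add: x'_def y'_def group_word)
  have "inv x' \<otimes> d \<otimes> x' = c" unfolding ix unfolding x'_def using f r by (simp add: group_word)
  then have "tup x' y' d = (x', c \<otimes> inv x' \<otimes> c, d \<otimes> y' \<otimes> d, inv y')"
    using tup_alt[OF a'] by simp
  also have "\<dots> = twist (tup x y c)"
    unfolding tw ix using f r by (simp add: y'_def group_word)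
  finally have "twist (Te e x y) = tup x' y' d" by (simp add: Te_def c_def)
  moreover have "d = \<one> \<longleftrightarrow> c = \<one>" using f d_def by (metis l_inv r_one r_cancel_one l_one)
  then have "d = cc e x' y'" using cc_eqI[OF a' xy] by (simp add: c_def)
  ultimately show ?thesis using xy' unfolding Te_def by blast
qed

end

lemma card_funpow_orbit:
  assumes "\<And>k. (f ^^ k) x = x \<longleftrightarrow> n dvd k" "n > 0"
  shows "card (range (\<lambda>k. (f ^^ k) x)) = n"
proof -
  have mod: "(f ^^ k) x = (f ^^ (k mod n)) x" for k
  proof -
    have "(f ^^ (k mod n + n * (k div n))) x = (f ^^ (k mod n)) ((f ^^ (n * (k div n))) x)"
      by (simp only: funpow_add o_apply)
    also have "(f ^^ (n * (k div n))) x = x" using assms by simp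
    finally show ?thesis by simp
  qed
  have "range (\<lambda>k. (f ^^ k) x) = (\<lambda>k. (f ^^ k) x) ` {..<n}"
  proof
    show "range (\<lambda>k. (f ^^ k) x) \<subseteq> (\<lambda>k. (f ^^ k) x) ` {..<n}"
    proof clarify
      fix k show "(f ^^ k) x \<in> (\<lambda>k. (f ^^ k) x) ` {..<n}"
        by (rule image_eqI[of _ _ "k mod n"]) (use mod assms(2) in auto)
    qed
  qed auto
  moreover have "inj_on (\<lambda>k. (f ^^ k) x) {..<n}"
  proof -
    have "i = j" if ij: "i \<le> j" "j < n" "(f ^^ i) x = (f ^^ j) x" for i j
    proof -
      have "(f ^^ (n - i + j)) x = (f ^^ (n - i + i)) x"
        unfolding funpow_add o_apply using ij by simp
      also have "\<dots> = x" using assms ij by simp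
      finally have "n dvd n - i + j" using assms by blast
      moreover have "n - i + j = n + (j - i)" using ij by simp
      ultimately have "n dvd j - i" by simp
      then show ?thesis using ij by (auto dest: dvd_imp_le)
    qed
    then show ?thesis by (intro inj_onI) (metis lessThan_iff nat_le_linear)
  qed
  ultimately show ?thesis by (simp add: card_image)
qed

lemma cyclic_orbit_eq:
  assumes "finite Y" "f \<in> Bij Y" "y \<in> Y" "x = (f ^^ k) y"
  shows "range (\<lambda>k. (f ^^ k) x) = range (\<lambda>k. (f ^^ k) y)"
proof -
  interpret B: group "BijGroup Y" by (rule group_BijGroup)
  define n where "n = order (BijGroup Y)"
  have n: "n > 0"
    using finite_Bij[OF assms(1)] B.order_gt_0_iff_finite by (simp add: n_def carrier_BijGroup)
  have "f [^]\<^bsub>BijGroup Y\<^esub> n = \<one>\<^bsub>BijGroup Y\<^esub>"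
    unfolding n_def using assms by (intro B.pow_order_eq_1) (simp add: carrier_BijGroup)
  then have id: "(f ^^ n) y = y" using BijGroup_pow_apply[OF assms(2,3), of n] assms(3) by (simp add: one_BijGroup)
  have idm: "(f ^^ (n * m)) y = y" for m
    by (induction m) (simp_all add: id funpow_add)
  have "y = (f ^^ (n * k - k)) x"
  proof -
    have "(f ^^ (n * k - k)) x = (f ^^ (n * k - k + k)) y" unfolding assms(4) by (simp add: funpow_add)
    also have "n * k - k + k = n * k" using n by (cases n) auto
    finally show ?thesis using idm by simp
  qed
  then obtain l where l: "y = (f ^^ l) x" by blast
  have "(f ^^ m) x \<in> range (\<lambda>k. (f ^^ k) y)" for m
    unfolding assms(4) by (metis funpow_add o_apply rangeI)
  moreover have "(f ^^ m) y \<in> range (\<lambda>k. (f ^^ k) x)" for m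
    by (subst l) (metis funpow_add o_apply rangeI)
  ultimately show ?thesis by blast
qed

lemma (in group) ord_eqI:
  assumes "a \<in> carrier G" "b \<in> carrier G" "\<And>n::nat. a [^] n = \<one> \<longleftrightarrow> b [^] n = \<one>"
  shows "ord a = ord b"
  using assms pow_eq_id by (metis dvd_antisym dvd_refl)

lemma (in group) ord_conj: "h \<in> carrier G \<Longrightarrow> a \<in> carrier G \<Longrightarrow> ord (h \<otimes> a \<otimes> inv h) = ord a"
  by (rule ord_eqI) (auto simp: pow_conj, metis inv_solve_right l_cancel_one' nat_pow_closed one_closed r_cancel_one' l_one m_closed)

context level_one
begin

subsection \<open>Orbits of the middle braid\<close>

lemma braid2_twice:
  "a \<in> carrier G \<Longrightarrow> b \<in> carrier G \<Longrightarrow> c \<in> carrier G \<Longrightarrow> d \<in> carrier G \<Longrightarrow>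
   braid2 G (braid2 G (a, b, c, d)) =
     (a, b \<otimes> c \<otimes> b \<otimes> inv (b \<otimes> c), b \<otimes> c \<otimes> c \<otimes> inv (b \<otimes> c), d)"
  by (simp add: group_word)

text \<open>
  The middle product \<open>z\<close> is invariant, and two applications conjugate the middle pair
  by it.
\<close>

lemma braid2_even:
  assumes car: "a \<in> carrier G" "b \<in> carrier G" "c \<in> carrier G" "d \<in> carrier G" and z: "z = b \<otimes> c"
  shows "(braid2 G ^^ (2 * k)) (a, b, c, d) =
     (a, z [^] k \<otimes> b \<otimes> inv (z [^] k), z [^] k \<otimes> c \<otimes> inv (z [^] k), d)"
proof (induction k)
  case 0
  then show ?case using car by simp
next
  case (Suc k)
  let ?w = "z [^] k"
  have zc: "z \<in> carrier G" using car z by simp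
  have w: "?w \<in> carrier G" using zc by simp
  have wz: "?w \<otimes> z = z \<otimes> ?w" using zc by (metis nat_pow_Suc nat_pow_Suc2)
  have BC: "?w \<otimes> b \<otimes> inv ?w \<otimes> (?w \<otimes> c \<otimes> inv ?w) = z"
    using conj_mult[OF w car(2,3)] wz w zc z by (simp add: m_assoc)
  have zw: "z [^] Suc k = z \<otimes> ?w" using zc nat_pow_Suc2 by blast
  have "(braid2 G ^^ (2 * Suc k)) (a, b, c, d) =
      braid2 G (braid2 G (a, ?w \<otimes> b \<otimes> inv ?w, ?w \<otimes> c \<otimes> inv ?w, d))"
    using Suc by (simp del: braid2.simps)
  also have "\<dots> = (a, z \<otimes> (?w \<otimes> b \<otimes> inv ?w) \<otimes> inv z, z \<otimes> (?w \<otimes> c \<otimes> inv ?w) \<otimes> inv z, d)"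
    by (rule braid2_twice[of a "?w \<otimes> b \<otimes> inv ?w" "?w \<otimes> c \<otimes> inv ?w" d, unfolded BC])
      (use car w in simp_all)
  also have "\<dots> = (a, z \<otimes> ?w \<otimes> b \<otimes> inv (z \<otimes> ?w), z \<otimes> ?w \<otimes> c \<otimes> inv (z \<otimes> ?w), d)"
    using car w zc by (simp add: group_word)
  finally show ?case unfolding zw .
qed

lemma braid2_odd:
  assumes car: "a \<in> carrier G" "b \<in> carrier G" "c \<in> carrier G" "d \<in> carrier G" and z: "z = b \<otimes> c"
  shows "(braid2 G ^^ (2 * k + 1)) (a, b, c, d) =
     (a, z [^] (k + 1) \<otimes> c \<otimes> inv (z [^] (k + 1)), z [^] k \<otimes> b \<otimes> inv (z [^] k), d)"
proof -
  let ?w = "z [^] k"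
  have zc: "z \<in> carrier G" using car z by simp
  have w: "?w \<in> carrier G" using zc by simp
  have zw: "z [^] (k + 1) = ?w \<otimes> z" using zc by simp
  have "(braid2 G ^^ (2 * k + 1)) (a, b, c, d) =
      braid2 G (a, ?w \<otimes> b \<otimes> inv ?w, ?w \<otimes> c \<otimes> inv ?w, d)"
    using braid2_even[OF car z, of k] by (simp del: braid2.simps)
  also have "\<dots> = (a, ?w \<otimes> z \<otimes> c \<otimes> inv (?w \<otimes> z), ?w \<otimes> b \<otimes> inv ?w, d)"
    using car w by (simp add: group_word z)
  finally show ?thesis unfolding zw .
qed

lemma braid2_pow_nielsen: "g \<in> nielsen_class G \<Longrightarrow> (braid2 G ^^ k) g \<in> nielsen_class G"
  by (induction k) (simp_all del: braid2.simps add: braid_nielsen)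

lemma hq2_pow: "g \<in> nielsen_class G \<Longrightarrow> (hq2 G ^^ k) (Cl g) = Cl ((braid2 G ^^ k) g)"
  by (induction k) (simp_all del: braid2.simps add: hq2_apply braid2_pow_nielsen)

lemma braid2_pow_ends: "\<exists>b' c'. (braid2 G ^^ k) (a, b, c, d) = (a, b', c', d)"
  by (induction k) auto

text \<open>
  A power of \<open>z\<close> that fixes the middle pair centralizes a generating pair, hence is
  trivial, and \<open>z\<close> has order 10. Returning after an odd number \<open>j\<close> of
  steps would make \<open>z\<^sup>j\<close> trivial, against the even order of \<open>z\<close>.
\<close>

lemma middle_return:
  assumes bc: "(b, c) \<in> Pairs" and car: "a \<in> carrier G" "d \<in> carrier G"
    and ret: "(braid2 G ^^ j) (a, b, c, d) = (a, b, c, d)"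
  shows "20 dvd j"
proof -
  note P = PairsD[OF bc]
  define z where "z = b \<otimes> c"
  have z: "z \<in> carrier G" using P by (simp add: z_def)
  have zord: "z [^] n = \<one> \<longleftrightarrow> 10 dvd n" for n :: nat
    using pow_eq_id[OF z] pair_order[OF bc] by (simp add: z_def)
  have trivial: "10 dvd n" if "z [^] n \<otimes> b = b \<otimes> z [^] n" "z [^] n \<otimes> c = c \<otimes> z [^] n" for n :: nat
    using pair_centralizer[OF P(1-3) _ that] z zord by simp
  show ?thesis
  proof (cases "even j")
    case True
    then obtain k where k: "j = 2 * k" by blast
    have "z [^] k \<otimes> b \<otimes> inv (z [^] k) = b" "z [^] k \<otimes> c \<otimes> inv (z [^] k) = c"
      using ret unfolding k braid2_even[OF car(1) P(4,5) car(2) z_def] by simp_all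
    then have "10 dvd k" using trivial[of k] conj_eq_iff z P by simp
    then show ?thesis unfolding k by auto
  next
    case False
    then obtain k where k: "j = 2 * k + 1" by (metis oddE)
    have e: "z [^] (k + 1) \<otimes> c \<otimes> inv (z [^] (k + 1)) = b" "z [^] k \<otimes> b \<otimes> inv (z [^] k) = c"
      using ret unfolding k braid2_odd[OF car(1) P(4,5) car(2) z_def] by simp_all
    then have c: "z [^] (k + 1) \<otimes> c = b \<otimes> z [^] (k + 1)" "z [^] k \<otimes> b = c \<otimes> z [^] k"
      using conj_eq_iff z P nat_pow_closed by metis+
    have s: "z [^] (2 * k + 1) = z [^] (k + 1) \<otimes> z [^] k" "z [^] (2 * k + 1) = z [^] k \<otimes> z [^] (k + 1)"
      using nat_pow_mult[OF z, of "k + 1" k] nat_pow_mult[OF z, of k "k + 1"] by (simp_all add: mult_2)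
    have "z [^] (2 * k + 1) \<otimes> b = b \<otimes> z [^] (2 * k + 1)"
      unfolding s(1) using c z P by (metis m_assoc nat_pow_closed)
    moreover have "z [^] (2 * k + 1) \<otimes> c = c \<otimes> z [^] (2 * k + 1)"
      unfolding s(2) using c z P by (metis m_assoc nat_pow_closed)
    ultimately have "10 dvd 2 * k + 1" by (rule trivial)
    then show ?thesis by presburger
  qed
qed

lemma Te_components:
  assumes xy: "(x, y) \<in> Pairs"
  obtains b c where "Te e x y = (x, b, c, inv y)" "(b, c) \<in> Pairs" "b \<in> carrier G" "c \<in> carrier G"
proof -
  note a = adm_cc[OF xy, of e] and P = PairsD[OF xy]
  let ?b = "inv x \<otimes> cc e x y \<otimes> inv x \<otimes> cc e x y \<otimes> x" and ?c = "cc e x y \<otimes> y \<otimes> cc e x y"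
  have e: "Te e x y = (x, ?b, ?c, inv y)" by (simp add: Te_def tup_def)
  have "?b \<in> O3" "?c \<in> O3" using Te_nielsen[OF xy, of e] unfolding e nielsen_iff by auto
  moreover from this have "(?b, ?c) \<in> Pairs"
    using Pairs_image[OF Pairs_inv(1)[OF xy]] tup_images[OF a] by blast
  ultimately show thesis using that e O3(1) by blast
qed

lemma Te_period:
  assumes xy: "(x, y) \<in> Pairs" "20 dvd k"
  shows "(braid2 G ^^ k) (Te e x y) = Te e x y"
proof -
  obtain b c where bc: "Te e x y = (x, b, c, inv y)" "(b, c) \<in> Pairs" "b \<in> carrier G" "c \<in> carrier G"
    using Te_components[OF xy(1)] .
  note P = PairsD[OF xy(1)]
  obtain m where m: "k = 2 * (10 * m)" using xy(2) by (auto elim!: dvdE)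
  have "(b \<otimes> c) [^] (10 * m) = \<one>"
    using pair_order[OF bc(2)] bc by (subst pow_eq_id) auto
  then show ?thesis
    unfolding bc(1) m using braid2_even[OF P(4) bc(3,4) inv_closed[OF P(5)] refl, of "10 * m"] bc by simp
qed

text \<open>
  The outer entries are not moved by the middle braid and generate the group, so a conjugating
  element that matches classes is pinned down by them.
\<close>

lemma class_return:
  assumes xy: "(x, y) \<in> Pairs" and xy': "(x', y') \<in> Pairs"
    and eq: "Cl ((braid2 G ^^ j) (Te e x y)) = Cl (Te e' x' y')"
  shows "(braid2 G ^^ j) (Te e x y) = Te e' x y"
proof -
  let ?g = "(braid2 G ^^ j) (Te e x y)"
  have g: "?g \<in> nielsen_class G" using Te_nielsen[OF xy] by (rule braid2_pow_nielsen)
  obtain h where h: "h \<in> carrier G" "Te e' x' y' = conj4 G h ?g"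
    using Cl_eq_iff[OF g Te_nielsen[OF xy']] eq by blast
  obtain b c where bc: "?g = (x, b, c, inv y)"
    using braid2_pow_ends[of j x _ _ "inv y"] Te_components[OF xy, of e] by metis
  note P = PairsD[OF xy] and P' = PairsD[OF xy']
  have "x' = h \<otimes> x \<otimes> inv h" "inv y' = h \<otimes> inv y \<otimes> inv h"
    using h(2) unfolding bc by (simp_all add: Te_def tup_def)
  moreover from this have "y' = h \<otimes> y \<otimes> inv h"
    using P P' h(1) inv_inv[of y'] by (simp add: group_word)
  ultimately have "conj4 G h (Te e' x y) = conj4 G h ?g" using Te_conj[OF xy h(1)] h(2) by simp
  then show ?thesis using conj4_cancel[OF g h(1)] conj4_cancel[OF Te_nielsen[OF xy] h(1)] by metis
qed

lemma Te_return:
  assumes xy: "(x, y) \<in> Pairs" and "(braid2 G ^^ j) (Te e x y) = Te e x y"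
  shows "20 dvd j"
proof -
  obtain b c where bc: "Te e x y = (x, b, c, inv y)" "(b, c) \<in> Pairs" using Te_components[OF xy] .
  show ?thesis
    using middle_return[OF bc(2), of x "inv y" j] assms(2) PairsD[OF xy] unfolding bc(1) by simp
qed

lemma spine_not_central:
  assumes xy: "(x, y) \<in> Pairs"
  shows "spine x y \<otimes> x \<noteq> x \<otimes> spine x y" "spine x y \<otimes> y \<noteq> y \<otimes> spine x y"
proof -
  note P = PairsD[OF xy] and s = spine[OF xy]
  let ?c = "spine x y"
  have iff: "?c \<otimes> x = x \<otimes> ?c \<longleftrightarrow> ?c \<otimes> y = y \<otimes> ?c"
  proof
    assume "?c \<otimes> x = x \<otimes> ?c"
    then have "x \<otimes> (?c \<otimes> y) = x \<otimes> (y \<otimes> ?c)" using s P by (metis m_assoc)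
    then show "?c \<otimes> y = y \<otimes> ?c" using s P by simp
  next
    assume "?c \<otimes> y = y \<otimes> ?c"
    then have "?c \<otimes> x \<otimes> y = x \<otimes> ?c \<otimes> y" using s P by (metis m_assoc)
    then show "?c \<otimes> x = x \<otimes> ?c" using s P by simp
  qed
  have "\<not> (?c \<otimes> x = x \<otimes> ?c \<and> ?c \<otimes> y = y \<otimes> ?c)"
    using pair_centralizer[OF P(1-3) s(1)] spine_neq_one[OF xy] by blast
  then show "?c \<otimes> x \<noteq> x \<otimes> ?c" "?c \<otimes> y \<noteq> y \<otimes> ?c" using iff by blast+
qed

lemma kernel_pow_image:
  assumes xy: "(x, y) \<in> Pairs" and "p ((x \<otimes> y) [^] (n::nat)) = 1"
  shows "5 dvd n"
proof -
  note P = PairsD[OF xy]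
  let ?u = "p (x \<otimes> y)"
  have u: "?u = p x * p y" using P by (simp add: p_mult)
  have five: "?u ^ 5 = 1" using pair_image[OF xy] by simp
  have "?u ^ (n mod 5 + 5 * (n div 5)) = ?u ^ (n mod 5)"
    unfolding power_add power_mult five by simp
  moreover have "?u ^ n = 1" using assms(2) P by (simp add: p_pow)
  ultimately have r: "?u ^ (n mod 5) = 1" by simp
  have ne: "?u \<noteq> 1" "?u ^ 2 \<noteq> 1" "?u ^ 3 \<noteq> 1"
    using pair_image[OF xy] generating_pair_cases(3)[OF P(6,7,3)]
    by (simp_all add: power2_eq_square pow3_expand u)
  have "?u ^ 4 \<noteq> 1" using ne(1) five by (metis mult.right_neutral numeral_eq_Suc power_Suc pred_numeral_simps(3) semiring_norm(26) semiring_norm(27))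
  then have "n mod 5 \<noteq> 1" "n mod 5 \<noteq> 2" "n mod 5 \<noteq> 3" "n mod 5 \<noteq> 4" using r ne by auto
  moreover have "n mod 5 < 5" by simp
  ultimately have "n mod 5 = 0" by linarith
  then show ?thesis by auto
qed

lemma kernel_conj_V: "g \<in> carrier G \<Longrightarrow> x \<in> carrier G \<Longrightarrow> x \<notin> V \<Longrightarrow> g \<otimes> x \<otimes> inv g \<notin> V"
  using V.inv_op_closed1[of g "g \<otimes> x \<otimes> inv g"] by (auto simp: m_assoc cancel_left)

text \<open>
  For even powers the power \<open>w\<close> of the middle product lies in the kernel and
  \<open>cw\<close> commutes with \<open>y\<close>; the absence of fixed points on \<open>V\<close>
  leaves only \<open>w = 1\<close> and \<open>w = c\<close>, and then \<open>c\<close> commutes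
  with \<open>y\<close> or with \<open>x\<close>. For odd powers the image in
  \<open>A\<^sub>5\<close> fixes the exponent modulo 10, and the fifth power of the middle product
  would commute with \<open>x\<close>.
\<close>

theorem HM_not_near:
  assumes xy: "(x, y) \<in> Pairs"
  shows "(braid2 G ^^ j) (Te False x y) \<noteq> Te True x y"
proof
  assume eq: "(braid2 G ^^ j) (Te False x y) = Te True x y"
  note P = PairsD[OF xy]
  define c where "c = spine x y"
  note s = spine[OF xy, folded c_def] and nc = spine_not_central[OF xy, folded c_def]
  have a: "adm x y c" by (simp add: adm_iff xy c_def)
  define d where "d = inv x \<otimes> c \<otimes> x"
  note f = adm_facts[OF a d_def] and r = adm_rules[OF a d_def]
  have "Te True x y = tup x y c" by (simp add: Te_def cc_def c_def)
  then have T: "Te False x y = (x, inv x, y, inv y)" "Te True x y = (x, d \<otimes> inv x \<otimes> d, c \<otimes> y \<otimes> c, inv y)"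
    using tup_alt[OF a d_def] f(1,2) by (simp_all add: Te_def cc_def tup_def m_assoc)
  define z where "z = inv x \<otimes> y"
  have z: "z \<in> carrier G" using f by (simp add: z_def)
  have ixy: "(inv x, y) \<in> Pairs" using Pairs_inv[OF xy] by blast
  note Q = PairsD[OF ixy]
  have zw: "z [^] n \<otimes> z = z \<otimes> z [^] n" for n :: nat using z by (metis nat_pow_Suc nat_pow_Suc2)
  have central: "p u = 1"
    if "u \<in> carrier G" "p u * p (inv x) = p (inv x) * p u" "p u * p y = p y * p u" for u
    using alt5_pair_commute[OF Q(6,7,3) p_alt5] that by blast
  show False
  proof (cases "even j")
    case True
    then obtain k where k: "j = 2 * k" by blast
    define w where "w = z [^] k"
    have w: "w \<in> carrier G" "w \<otimes> z = z \<otimes> w" using z zw by (simp_all add: w_def)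
    have "w \<otimes> inv x \<otimes> inv w = d \<otimes> inv x \<otimes> d" "w \<otimes> y \<otimes> inv w = c \<otimes> y \<otimes> c"
      using eq unfolding k T braid2_even[OF Q(4) Q(4,5) inv_closed[OF f(2)] z_def]
        braid2_even[OF f(1) Q(4,5) inv_closed[OF f(2)] z_def] w_def by simp_all
    then have e: "w \<otimes> inv x = d \<otimes> inv x \<otimes> d \<otimes> w" "w \<otimes> y = c \<otimes> y \<otimes> c \<otimes> w"
      using conj_eq_iff w f by simp_all
    have "p w = 1"
    proof (rule central[OF w(1)])
      show "p w * p (inv x) = p (inv x) * p w"
        using arg_cong[OF e(1), of p] f w by (simp add: p_mult)
      show "p w * p y = p y * p w"
        using arg_cong[OF e(2), of p] f w s by (simp add: p_mult)
    qed
    have cw: "c \<otimes> w \<otimes> y = y \<otimes> (c \<otimes> w)"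
      using e(2) f r w by (simp add: m_assoc)
    show False
    proof (cases "w \<in> V")
      case True
      then have "w = \<one>"
        using no_fixed[of z w] z w pair_image[OF ixy] by (simp add: z_def)
      then show False using cw nc(2) f by simp
    next
      case False
      then have "c \<otimes> w \<in> V" using V_index s w \<open>p w = 1\<close> by blast
      then have "c \<otimes> w = \<one>"
        using no_fixed[of y "c \<otimes> w"] cw f P by (simp add: cyc3_iff pow3_expand)
      then have "w = c" using eq_inv[of c w] f w r by simp
      then have "c \<otimes> (inv x \<otimes> y) = inv x \<otimes> y \<otimes> c" using w by (simp add: z_def)
      then have 1: "inv x \<otimes> y \<otimes> c = c \<otimes> inv x \<otimes> y" using f by (simp add: m_assoc)
      have "inv x \<otimes> y \<otimes> c = inv x \<otimes> d \<otimes> y" using f by (simp add: m_assoc)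
      then have "inv x \<otimes> d = c \<otimes> inv x" using 1 f by simp
      then have "x \<otimes> (inv x \<otimes> d) \<otimes> x = x \<otimes> (c \<otimes> inv x) \<otimes> x" by simp
      then have "d \<otimes> x = x \<otimes> c" using f by (simp add: group_word)
      have "c \<otimes> (x \<otimes> x) = x \<otimes> x \<otimes> c"
      proof -
        have "c \<otimes> (x \<otimes> x) = x \<otimes> (d \<otimes> x)" using f r by (simp add: m_assoc)
        then show ?thesis using \<open>d \<otimes> x = x \<otimes> c\<close> f by (simp add: m_assoc)
      qed
      then have "c \<otimes> inv x = inv x \<otimes> c" using O3_inv[OF P(1)] by simp
      then have "c \<otimes> inv (inv x) = inv (inv x) \<otimes> c" using commute_inv[of c "inv x"] f by simp
      then show False using nc(1) f by simp
    qed
  next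
    case False
    then obtain k where k: "j = 2 * k + 1" by (metis oddE)
    define w where "w = z [^] k"
    define u where "u = z [^] (k + 1)"
    have w: "w \<in> carrier G" "u \<in> carrier G" using z by (simp_all add: w_def u_def)
    have uw: "u \<otimes> w = z [^] (2 * k + 1)" "w \<otimes> u = z [^] (2 * k + 1)"
      unfolding u_def w_def using nat_pow_mult[OF z, of "k + 1" k] nat_pow_mult[OF z, of k "k + 1"]
      by (simp_all add: mult_2)
    have "u \<otimes> y \<otimes> inv u = d \<otimes> inv x \<otimes> d" "w \<otimes> inv x \<otimes> inv w = c \<otimes> y \<otimes> c"
      using eq unfolding k T braid2_odd[OF f(1) Q(4,5) inv_closed[OF f(2)] z_def] w_def u_def by simp_all
    then have e: "u \<otimes> y = d \<otimes> inv x \<otimes> d \<otimes> u" "w \<otimes> inv x = c \<otimes> y \<otimes> c \<otimes> w"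
      using conj_eq_iff w f by simp_all
    define q where "q = d \<otimes> u \<otimes> c \<otimes> w"
    define q' where "q' = c \<otimes> w \<otimes> d \<otimes> u"
    have qc: "q \<in> carrier G" "q' \<in> carrier G" using f w by (simp_all add: q_def q'_def)
    have e': "u \<otimes> (y \<otimes> v) = d \<otimes> inv x \<otimes> d \<otimes> (u \<otimes> v)" "w \<otimes> (inv x \<otimes> v) = c \<otimes> y \<otimes> c \<otimes> (w \<otimes> v)"
      if "v \<in> carrier G" for v
      using extend_word[OF e(1) _ _ _ _ that] extend_word[OF e(2) _ _ _ _ that] f(1-4) w by simp_all
    have qx: "q \<otimes> inv x = inv x \<otimes> q"
    proof -
      have "q \<otimes> inv x = d \<otimes> u \<otimes> c \<otimes> (c \<otimes> y \<otimes> c \<otimes> w)"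
        unfolding e(2)[symmetric] using f(1-4) w by (simp add: q_def m_assoc)
      also have "\<dots> = d \<otimes> (u \<otimes> (y \<otimes> (c \<otimes> w)))" using f(1-4) r(1) w by (simp add: m_assoc)
      also have "\<dots> = inv x \<otimes> q"
        unfolding q_def using e'(1)[of "c \<otimes> w"] f(1-4) r(2) w by (simp add: m_assoc)
      finally show ?thesis .
    qed
    have qy: "q' \<otimes> y = y \<otimes> q'"
    proof -
      have "q' \<otimes> y = c \<otimes> w \<otimes> d \<otimes> (d \<otimes> inv x \<otimes> d \<otimes> u)"
        unfolding e(1)[symmetric] using f(1-4) w by (simp add: q'_def m_assoc)
      also have "\<dots> = c \<otimes> (w \<otimes> (inv x \<otimes> (d \<otimes> u)))" using f(1-4) r(2) w by (simp add: m_assoc)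
      also have "\<dots> = y \<otimes> q'"
        unfolding q'_def using e'(2)[of "d \<otimes> u"] f(1-4) r(1) w by (simp add: m_assoc)
      finally show ?thesis .
    qed
    have pq: "p q = p (z [^] (2 * k + 1))" "p q' = p (z [^] (2 * k + 1))"
    proof -
      have "p q = p (u \<otimes> w)" "p q' = p (w \<otimes> u)"
        unfolding q_def q'_def using f(1-5) s(2) w by (simp_all add: p_mult)
      then show "p q = p (z [^] (2 * k + 1))" "p q' = p (z [^] (2 * k + 1))" by (simp_all only: uw)
    qed
    have pf: "p (z [^] (2 * k + 1)) = 1"
    proof (rule central)
      show "p (z [^] (2 * k + 1)) * p (inv x) = p (inv x) * p (z [^] (2 * k + 1))"
        using arg_cong[OF qx, of p] qc f unfolding pq(1)[symmetric] by (simp add: p_mult)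
      show "p (z [^] (2 * k + 1)) * p y = p y * p (z [^] (2 * k + 1))"
        using arg_cong[OF qy, of p] qc f unfolding pq(2)[symmetric] by (simp add: p_mult)
    qed (use z in simp)
    then have "5 dvd 2 * k + 1" using kernel_pow_image[OF ixy] by (simp add: z_def)
    then have "k mod 5 = 2" by presburger
    then obtain l where l: "k = 5 * l + 2" using div_mult_mod_eq[of k 5] by (metis mult.commute)
    have z10: "z [^] (10 * l) = \<one>" using pair_order[OF ixy] z by (subst pow_eq_id) (simp_all add: z_def)
    have zf: "z [^] (2 * k + 1) = spine (inv x) y"
    proof -
      have "2 * k + 1 = 10 * l + 5" using l by simp
      then have "z [^] (2 * k + 1) = z [^] (10 * l) \<otimes> z [^] (5::nat)" using z by (simp only: nat_pow_mult)
      then show ?thesis using z10 z by (simp add: spine_def z_def)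
    qed
    note sf = spine[OF ixy, folded zf]
    have pu: "p u = p z * p z * p z"
    proof -
      have "k + 1 = 5 * l + 3" using l by simp
      then have "p u = p z ^ (5 * l + 3)" unfolding u_def using p_pow[OF z] by (simp only:)
      also have "\<dots> = (p z ^ 5) ^ l * p z ^ 3" by (simp only: power_add power_mult)
      also have "p z ^ 5 = 1" using pair_image[OF ixy] by (simp add: z_def)
      finally show ?thesis by (simp add: pow3_expand)
    qed
    have pz: "p z = p x * p x * p y" using f P(1) by (simp add: z_def p_mult p_O3_inv)
    define g where "g = u \<otimes> c \<otimes> inv u"
    define t where "t = u \<otimes> (x \<otimes> y) \<otimes> inv u"
    have g: "g \<in> carrier G" "p g = 1" "g \<notin> V"
      using f w s kernel_conj_V p_conj_one by (simp_all add: g_def)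
    have t: "t \<in> carrier G" using f w by (simp add: t_def)
    have "d \<notin> V"
      using kernel_conj_V[of "inv x" c] s f(1) by (simp add: d_def)
    then have dg: "d \<otimes> g \<in> V" using V_index g f(4,5) by blast
    have "p (y \<otimes> x \<otimes> t) = p y * p x * p u * p x * p y * p (inv u)"
      using f w by (simp add: t_def p_mult mult.assoc)
    also have "p y * p x * p u * p x * p y = p u"
      using generating_pair_cases(9)[OF P(6,7,3)] by (simp add: pu pz Let_def mult.assoc)
    finally have n: "p (y \<otimes> x \<otimes> t) = 1" using p_inv w by simp
    have "g \<otimes> t = t \<otimes> g"
      using s(4) conj_mult[OF w(2) f(3), of "x \<otimes> y"] conj_mult[OF w(2) _ f(3), of "x \<otimes> y"] f(1,2)
      by (simp add: g_def t_def)
    then have gt: "g \<otimes> inv t = inv t \<otimes> g" using commute_inv g t by blast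
    have "g \<otimes> (y \<otimes> x \<otimes> t) = y \<otimes> x \<otimes> t \<otimes> g"
      using kernel_commute[OF g(1,2) _ n] f t by simp
    then have "y \<otimes> x \<otimes> t \<otimes> inv t \<otimes> g = g \<otimes> (y \<otimes> x \<otimes> t \<otimes> inv t)"
      using commute_mult[of "y \<otimes> x \<otimes> t" "inv t" g] gt g f t by simp
    then have gyx: "g \<otimes> (y \<otimes> x) = y \<otimes> x \<otimes> g" using f t by (simp add: m_assoc)
    have "d \<otimes> (y \<otimes> x) = y \<otimes> x \<otimes> d"
    proof -
      have "d \<otimes> (y \<otimes> x) = y \<otimes> c \<otimes> x" using f(1-4,10) by (simp add: m_assoc[symmetric])
      also have "\<dots> = y \<otimes> (x \<otimes> d)" using f(1-4,9) by (simp add: m_assoc)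
      finally show ?thesis using f(1-4) by (simp add: m_assoc)
    qed
    then have "d \<otimes> g \<otimes> (y \<otimes> x) = y \<otimes> x \<otimes> (d \<otimes> g)"
      using commute_mult[of d g "y \<otimes> x"] gyx g f by simp
    then have "d \<otimes> g = \<one>"
      using no_fixed[of "y \<otimes> x" "d \<otimes> g"] dg pair_image[OF Pairs_swap[OF xy]] f by simp
    then have "q = z [^] (2 * k + 1)"
    proof -
      have "q = d \<otimes> g \<otimes> (u \<otimes> w)" using f w by (simp add: q_def g_def group_word)
      then show ?thesis using \<open>d \<otimes> g = \<one>\<close> uw z by simp
    qed
    then have "spine (inv x) y \<otimes> inv x = inv x \<otimes> spine (inv x) y" using qx zf by simp
    then show False using spine_not_central(1)[OF ixy] by blast
  qed
qed

end

context level_one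
begin

subsection \<open>H-M representatives\<close>

text \<open>
  A tuple \<open>(x, x\<inverse>, y, y\<inverse>)\<close> is \<open>tup x y 1\<close>.
\<close>

lemma HM_iff: "HM_rep G C \<longleftrightarrow> C \<in> F False"
proof
  assume "HM_rep G C"
  then obtain g1 g2 where C: "C \<in> nielsen_in G" and g: "(g1, inv g1, g2, inv g2) \<in> C"
    by (auto simp: HM_rep_def)
  obtain h where h: "h \<in> nielsen_class G" "C = Cl h" using C by (rule nielsen_inE)
  let ?t = "(g1, inv g1, g2, inv g2)"
  have t: "?t \<in> nielsen_class G" using Cl_subset[OF h(1)] g h(2) by blast
  have Ct: "C = Cl ?t" using Cl_member[OF h(1)] g h(2) by metis
  have O: "g1 \<in> O3" "g2 \<in> O3" "\<not> common_fix [p g1, p (inv g1), p g2]"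
    using t by (simp_all add: nielsen_class_iff)
  have "app (p (inv g1)) q = q" if "app (p g1) q = q" for q
    using that by (simp add: p_O3_inv[OF O(1)] app_mult)
  then have "(g1, g2) \<in> Pairs" using O by (auto simp: Pairs_def common_fix_iff)
  moreover have "Te False g1 g2 = ?t" using O3(1) O by (simp add: Te_def cc_def tup_def m_assoc)
  ultimately show "C \<in> F False" using Ct F_I by metis
next
  assume "C \<in> F False"
  then obtain x y where xy: "(x, y) \<in> Pairs" "C = Cl (Te False x y)" by (rule F_E)
  note P = PairsD[OF xy(1)]
  have "Te False x y = (x, inv x, y, inv y)" using P by (simp add: Te_def cc_def tup_def m_assoc)
  then have "(x, inv x, y, inv y) \<in> C" using Cl_self[OF Te_nielsen[OF xy(1)]] xy(2) by metis
  then show "HM_rep G C" unfolding HM_rep_def using F_nielsen_in F_I[OF xy(1)] xy(2) by blast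
qed

lemma F_disjoint: "C \<in> F False \<Longrightarrow> C \<in> F True \<Longrightarrow> thesis"
proof -
  assume C: "C \<in> F False" "C \<in> F True"
  obtain x y where xy: "(x, y) \<in> Pairs" "C = Cl (Te False x y)" using C(1) by (rule F_E)
  obtain x' y' where xy': "(x', y') \<in> Pairs" "C = Cl (Te True x' y')" using C(2) by (rule F_E)
  have "(braid2 G ^^ 0) (Te False x y) = Te True x y"
    using class_return[OF xy(1) xy'(1), of 0 False True] xy(2) xy'(2) by simp
  then show thesis using HM_not_near[OF xy(1)] by blast
qed

text \<open>
  The condition that the image in \<open>A\<^sub>5\<close> is an H-M tuple.
\<close>

fun cancelling where "cancelling (g1, g2, g3, g4) \<longleftrightarrow> p g1 * p g2 = 1 \<and> p g3 * p g4 = 1"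

text \<open>
  The involution \<open>c\<close> lies in the kernel, because its image commutes with a generating
  pair. The last entries give the third entry \<open>c y c\<close>, the product relation gives the
  second one, and the first entries say that \<open>c\<close> commutes with \<open>xy\<close>.
\<close>

lemma conjugation_tuple_adm:
  assumes n: "(g1, g2, g3, g4) \<in> nielsen_class G" and can: "cancelling (g1, g2, g3, g4)"
    and c: "c \<in> carrier G" "ord c = 2" and eq: "conj4 G c (g1, g2, g3, g4) = kappa_hat G (g1, g2, g3, g4)"
  shows "(g1, inv g4) \<in> Pairs" "(g1, g2, g3, g4) = Te True g1 (inv g4)"
proof -
  note car = nielsen_carrier[OF n]
  define x y where "x = g1" and "y = inv g4"
  have O: "g1 \<in> O3" "g2 \<in> O3" "g3 \<in> O3" "g4 \<in> O3" "\<not> common_fix [p g1, p g2, p g3]" "g1 \<otimes> g2 \<otimes> g3 \<otimes> g4 = \<one>"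
    using n unfolding nielsen_class_iff by auto
  have P: "p g1 * p g2 = 1" "p g3 * p g4 = 1" using can by simp_all
  have yc: "x \<in> carrier G" "y \<in> carrier G" "g4 = inv y" using car by (simp_all add: x_def y_def)
  have py: "p y = p g3"
  proof -
    have "p g3 * (p g4 * p (inv g4)) = p g3" using p_inv(1)[OF car(4)] by simp
    then show ?thesis using P(2) unfolding y_def by (metis mult.assoc mult.left_neutral)
  qed
  have pg2: "p (inv g1) = p g2" using P(1) p_inv_eqI car by blast
  have "app (p g2) q = q" if "app (p g1) q = q" for q
    unfolding pg2[symmetric] using that by (simp add: p_O3_inv[OF O(1)] app_mult)
  then have xy: "(x, y) \<in> Pairs"
    using O O3_inv_closed[OF O(4)] py unfolding x_def y_def Pairs_def by (auto simp: common_fix_iff)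
  then show "(g1, inv g4) \<in> Pairs" by (simp add: x_def y_def)
  have c2: "c \<otimes> c = \<one>" using pow_ord_eq_1[OF c(1)] c by (simp add: numeral_2_eq_2)
  then have ic: "inv c = c" using c by (simp add: inv_equality)
  have e: "c \<otimes> x \<otimes> c = inv (g3 \<otimes> g4) \<otimes> inv g2 \<otimes> g3 \<otimes> g4" "c \<otimes> g3 \<otimes> c = y"
    using eq ic by (simp_all add: x_def y_def)
  have "p c = 1"
  proof (rule alt5_pair_commute[OF PairsD(6,7,3)[OF xy]])
    have "p (inv (g3 \<otimes> g4) \<otimes> inv g2 \<otimes> g3 \<otimes> g4) = p (inv (g3 \<otimes> g4)) * p (inv g2) * (p g3 * p g4)"
      using car by (simp add: p_mult mult.assoc)
    also have "p (inv (g3 \<otimes> g4)) = 1" using p_inv_eqI[of "g3 \<otimes> g4" 1] car P by (simp add: p_mult)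
    also have "p (inv g2) = p x" using p_inv_eqI[of g2 "p g1"] car P(1) O
      by (metis inv_inv p_inv(1) pg2 inv_closed p_inv_eqI x_def)
    finally have "p (c \<otimes> x \<otimes> c) = p x" unfolding e(1) using P by simp
    then have "p c * p x * p c * p c = p x * p c" using c yc by (simp add: p_mult)
    moreover have "p c * p c = 1" using c2 c by (metis p_mult p_one)
    ultimately show "p c * p x = p x * p c" by (simp add: mult.assoc)
    have "p (c \<otimes> g3 \<otimes> c) = p y" unfolding e(2) ..
    then have "p c * p y * p c * p c = p y * p c" using c car py by (simp add: p_mult)
    then show "p c * p y = p y * p c" using \<open>p c * p c = 1\<close> by (simp add: mult.assoc)
  qed (use c p_alt5 in blast)
  have cc': "c \<otimes> (c \<otimes> w) = w" if "w \<in> carrier G" for w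
    using c2 c that by (metis m_assoc l_one)
  have g3: "g3 = c \<otimes> y \<otimes> c" unfolding e(2)[symmetric] using c car c2 by (simp add: m_assoc cc')
  define d where "d = y \<otimes> c \<otimes> inv y"
  have d: "d \<in> carrier G" "p d = 1" using c yc \<open>p c = 1\<close> p_conj_one by (simp_all add: d_def)
  have dd: "d \<otimes> d = \<one>" "inv d = d" "d \<otimes> c = c \<otimes> d" "d \<otimes> y = y \<otimes> c"
    using d square kernel_inv kernel_commute[OF d c(1) \<open>p c = 1\<close>] c yc by (simp_all add: d_def m_assoc)
  have dd': "d \<otimes> (d \<otimes> w) = w" if "w \<in> carrier G" for w
    using dd(1) d that by (metis m_assoc l_one)
  have s: "g3 \<otimes> g4 = c \<otimes> d" 
    unfolding g3 d_def using c yc(1,2) car(4) by (simp add: m_assoc flip: yc(3))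
  have isd: "inv (c \<otimes> d) = c \<otimes> d" using c d dd ic by (simp add: inv_mult_group)
  have "inv (c \<otimes> d) \<otimes> inv g2 \<otimes> (g3 \<otimes> g4) = c \<otimes> x \<otimes> c"
    unfolding e(1) s using car c d by (simp add: m_assoc s)
  then have A: "c \<otimes> d \<otimes> inv g2 \<otimes> (c \<otimes> d) = c \<otimes> x \<otimes> c" unfolding s isd .
  then have "d \<otimes> c \<otimes> (c \<otimes> d \<otimes> inv g2 \<otimes> (c \<otimes> d)) \<otimes> (d \<otimes> c) = d \<otimes> c \<otimes> (c \<otimes> x \<otimes> c) \<otimes> (d \<otimes> c)" by simp
  then have "inv g2 = d \<otimes> x \<otimes> (c \<otimes> (d \<otimes> c))"
    using c c2 d dd(1) car yc by (simp add: m_assoc cc' dd')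
  also have "c \<otimes> (d \<otimes> c) = d" unfolding dd(3) using c d by (simp add: cc')
  finally have ig2: "inv g2 = d \<otimes> x \<otimes> d" .
  have "g2 = inv (d \<otimes> x \<otimes> d)" unfolding ig2[symmetric] using car by simp
  then have g2: "g2 = d \<otimes> inv x \<otimes> d" using d yc dd by (simp add: group_word)
  have "x \<otimes> g2 \<otimes> (g3 \<otimes> g4) = \<one>" using O(6) car by (simp add: x_def m_assoc)
  then have "x \<otimes> (d \<otimes> inv x \<otimes> d) \<otimes> (c \<otimes> d) = \<one>" unfolding s unfolding g2 .
  then have "x \<otimes> (d \<otimes> (inv x \<otimes> (d \<otimes> (c \<otimes> d)))) = \<one>" using c d yc by (simp add: m_assoc)
  moreover have "d \<otimes> (c \<otimes> d) = c" unfolding dd(3)[symmetric] using c d by (simp add: dd')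
  ultimately have "x \<otimes> (d \<otimes> (inv x \<otimes> c)) = \<one>" by simp
  then have "x \<otimes> (d \<otimes> (inv x \<otimes> c)) \<otimes> (c \<otimes> x) = c \<otimes> x" using c yc by simp
  then have xd: "x \<otimes> d = c \<otimes> x" using c d yc by (simp add: group_word cc')
  then have d': "d = inv x \<otimes> c \<otimes> x" using c d yc by (simp add: m_assoc cancel_left flip: xd)
  have "c \<otimes> (x \<otimes> y) = x \<otimes> d \<otimes> y" unfolding xd using c yc by (simp add: m_assoc)
  also have "\<dots> = x \<otimes> y \<otimes> c" using dd(4) c d yc by (simp add: m_assoc)
  finally have a: "adm x y c" unfolding adm_def using xy c \<open>p c = 1\<close> by blast
  have "c \<noteq> \<one>" using c by auto
  then have "c = spine x y" using a by (simp add: adm_iff)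
  then have "Te True x y = tup x y c" by (simp add: Te_def cc_def)
  then have "Te True x y = (x, g2, g3, g4)" unfolding tup_alt[OF a d'] g2[symmetric] g3[symmetric] using yc by simp
  then show "(g1, g2, g3, g4) = Te True g1 (inv g4)" by (simp add: x_def y_def)
qed

lemma Te_kappa_hat:
  assumes xy: "(x, y) \<in> Pairs"
  shows "ord (spine x y) = 2" "conj4 G (spine x y) (Te True x y) = kappa_hat G (Te True x y)"
    "cancelling (Te True x y)"
proof -
  note s = spine[OF xy] and P = PairsD[OF xy]
  define c where "c = spine x y"
  have a: "adm x y c" by (simp add: adm_iff xy c_def)
  define d where "d = inv x \<otimes> c \<otimes> x"
  note f = adm_facts[OF a d_def] and r = adm_rules[OF a d_def]
  have "Te True x y = tup x y c" by (simp add: Te_def cc_def c_def)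
  then have T: "Te True x y = (x, d \<otimes> inv x \<otimes> d, c \<otimes> y \<otimes> c, inv y)" using tup_alt[OF a d_def] by simp
  show "ord (spine x y) = 2"
  proof -
    have "ord c dvd 2" using f by (subst pow_eq_id[symmetric]) (simp_all add: numeral_2_eq_2)
    moreover have "ord c \<noteq> 1" using spine_neq_one[OF xy] ord_eq_1 f by (simp add: c_def)
    ultimately show ?thesis using prime_nat_iff two_is_prime_nat by (metis c_def)
  qed
  show "conj4 G (spine x y) (Te True x y) = kappa_hat G (Te True x y)"
  proof -
    have "x \<otimes> (c \<otimes> d) = x \<otimes> d \<otimes> c" unfolding f(8)[symmetric] using f(1-4) by (simp add: m_assoc)
    also have "\<dots> = c \<otimes> (x \<otimes> c)" unfolding f(9) using f(1-4) by (simp add: m_assoc)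
    finally show ?thesis unfolding T c_def[symmetric] using f r by (simp add: group_word)
  qed
  show "cancelling (Te True x y)"
    unfolding T using f s(2) p_inv P by (simp add: p_mult c_def)
qed

subsection \<open>The group Q on H-M and near H-M representatives\<close>

lemma F_qa: "C \<in> F e \<Longrightarrow> qa C \<in> F e"
proof -
  assume "C \<in> F e"
  then obtain x y where xy: "(x, y) \<in> Pairs" "C = Cl (Te e x y)" by (rule F_E)
  then show ?thesis using twist_Te[OF xy(1), of e] qa_apply[OF Te_nielsen[OF xy(1)]] F_I by metis
qed

lemma F_qb: "C \<in> F e \<Longrightarrow> qb C \<in> F e"
proof -
  assume "C \<in> F e"
  then obtain x y where xy: "(x, y) \<in> Pairs" "C = Cl (Te e x y)" by (rule F_E)
  then show ?thesis using shift_Te[OF xy(1), of e] qb_apply[OF Te_nielsen[OF xy(1)]] F_I by metis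
qed

theorem Q_preserves_F:
  assumes "\<tau> \<in> carrier (Q_group G)" "C \<in> F e"
  shows "\<tau> C \<in> F e"
proof -
  have C: "C \<in> nielsen_in G" using assms(2) F_nielsen_in by blast
  then show ?thesis
    using assms F_qa F_qb qa_qb_Bij unfolding Q_carrier
    by (auto simp: one_BijGroup BijGroup_mult_apply)
qed

lemma Qorb_subset_F:
  assumes "g \<in> nielsen_class G" "Cl g \<in> F e"
  shows "Qorb g \<subseteq> F e"
proof -
  have 1: "Cl (twist g) \<in> F e" "Cl (shift g) \<in> F e"
    using F_qa[OF assms(2)] F_qb[OF assms(2)] assms(1) by (simp_all add: qa_apply qb_apply)
  then have "Cl (twist (shift g)) \<in> F e"
    using F_qa[OF 1(2)] qa_apply[OF braid_nielsen(5)[OF assms(1)]] by simp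
  then show ?thesis using 1 assms(2) by (simp add: Qorb_def)
qed

lemma Qorb_cong:
  assumes "g \<in> nielsen_class G" "h \<in> nielsen_class G" "Cl g = Cl h"
  shows "Qorb g = Qorb h"
  using assms Cl_twist_cong[OF assms] Cl_shift_cong[OF assms]
    Cl_twist_cong[OF braid_nielsen(5)[OF assms(1)] braid_nielsen(5)[OF assms(2)] Cl_shift_cong[OF assms]]
  by (simp add: Qorb_def)

lemma Qorb_shift: "g \<in> nielsen_class G \<Longrightarrow> Qorb (shift g) = Qorb g"
  by (auto simp: Qorb_def shift_shift)

lemma Qorb_twist:
  assumes g: "g \<in> nielsen_class G"
  shows "Qorb (twist g) = Qorb g"
proof -
  have "Cl (shift (twist g)) = Cl (twist (shift g))" using twist_shift_commute[OF g] by simp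
  moreover have "Cl (twist (shift (twist g))) = Cl (shift g)"
  proof -
    have "Cl (twist (shift (twist g))) = Cl (twist (twist (shift g)))"
      using Cl_twist_cong[of "shift (twist g)" "twist (shift g)"] braid_nielsen g twist_shift_commute[OF g] by metis
    then show ?thesis using twist_twist(2)[OF braid_nielsen(5)[OF g]] by simp
  qed
  ultimately show ?thesis using twist_twist(2)[OF g] by (auto simp: Qorb_def)
qed

lemma Qorb_member:
  assumes g: "g \<in> nielsen_class G" and h: "h \<in> nielsen_class G" and m: "Cl h \<in> Qorb g"
  shows "Qorb h = Qorb g"
proof -
  note b = braid_nielsen(4)[OF g] braid_nielsen(5)[OF g] braid_nielsen(4)[OF braid_nielsen(5)[OF g]]
  have "Qorb (twist (shift g)) = Qorb g" using Qorb_twist[OF b(2)] Qorb_shift[OF g] by simp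
  moreover have "Cl h = Cl g \<or> Cl h = Cl (twist g) \<or> Cl h = Cl (shift g) \<or> Cl h = Cl (twist (shift g))"
    using m unfolding Qorb_def by simp
  ultimately show ?thesis
    using Qorb_cong[OF h g] Qorb_cong[OF h b(1)] Qorb_cong[OF h b(2)] Qorb_cong[OF h b(3)]
      Qorb_twist[OF g] Qorb_shift[OF g] by (elim disjE) simp_all
qed

lemma Qorb_self: "Cl g \<in> Qorb g" by (simp add: Qorb_def)

subsection \<open>Reduced classes\<close>

lemma nielsen_rd_eq: "nielsen_rd G = Qorb ` nielsen_class G"
  by (simp add: nielsen_rd_def Q_orbits_eq)

lemma Qorb_nielsen_in: "g \<in> nielsen_class G \<Longrightarrow> Qorb g \<subseteq> nielsen_in G"
  using nielsen_inI braid_nielsen by (simp add: Qorb_def)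

text \<open>
  The braid \<open>q\<^sub>2\<close> normalizes the Klein four-group.
\<close>

lemma hq2_Qorb:
  assumes g: "g \<in> nielsen_class G"
  shows "hq2 G ` Qorb g = Qorb (braid2 G g)"
proof -
  note b = braid_nielsen(2)[OF g] braid_nielsen(4)[OF g] braid_nielsen(5)[OF g]
  have "Cl (braid2 G (twist (shift g))) = Cl (twist (shift (braid2 G g)))"
  proof -
    have "Cl (braid2 G (twist (shift g))) = Cl (shift (braid2 G (shift g)))" by (rule braid2_twist[OF b(3)])
    also have "\<dots> = Cl (shift (twist (braid2 G g)))"
      by (rule Cl_shift_cong[OF braid_nielsen(2)[OF b(3)] braid_nielsen(4)[OF b(1)] braid2_shift[OF g]])
    also have "\<dots> = Cl (twist (shift (braid2 G g)))" using twist_shift_commute[OF b(1)] by simp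
    finally show ?thesis .
  qed
  then show ?thesis
    unfolding Qorb_def
    using hq2_apply g b braid_nielsen(4)[OF b(3)] braid2_twist[OF g] braid2_shift[OF g] by auto
qed

lemma gamma_apply: "g \<in> nielsen_class G \<Longrightarrow> gamma_inf G (Qorb g) = Qorb (braid2 G g)"
  by (simp add: gamma_inf_def nielsen_rd_eq hq2_Qorb del: braid2.simps)

lemma gamma_pow: "g \<in> nielsen_class G \<Longrightarrow> (gamma_inf G ^^ k) (Qorb g) = Qorb ((braid2 G ^^ k) g)"
  by (induction k) (simp_all del: braid2.simps add: gamma_apply braid2_pow_nielsen)

lemma finite_nielsen_rd: "finite (nielsen_rd G)"
  using finite_nielsen by (simp add: nielsen_rd_eq)

lemma gamma_Bij: "gamma_inf G \<in> Bij (nielsen_rd G)"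
proof -
  have inj: "inj_on (hq2 G) (nielsen_in G)" using hq2_Bij by (simp add: Bij_def bij_betw_def)
  have "inj_on (gamma_inf G) (nielsen_rd G)"
  proof (rule inj_onI)
    fix R R' assume R: "R \<in> nielsen_rd G" "R' \<in> nielsen_rd G" "gamma_inf G R = gamma_inf G R'"
    have "R \<subseteq> nielsen_in G" "R' \<subseteq> nielsen_in G"
      using R(1,2) Qorb_nielsen_in unfolding nielsen_rd_eq by blast+
    moreover have "hq2 G ` R = hq2 G ` R'" using R by (simp add: gamma_inf_def)
    ultimately show "R = R'" using inj_on_image_eq_iff[OF inj] by blast
  qed
  moreover have "gamma_inf G ` nielsen_rd G \<subseteq> nielsen_rd G"
    using gamma_apply braid_nielsen(2) unfolding nielsen_rd_eq by blast
  ultimately have "bij_betw (gamma_inf G) (nielsen_rd G) (nielsen_rd G)"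
    using finite_nielsen_rd by (simp add: bij_betw_def endo_inj_surj)
  then show ?thesis by (simp add: Bij_def gamma_inf_def)
qed

definition Gorb where "Gorb g = range (\<lambda>k. Qorb ((braid2 G ^^ k) g))"

lemma gamma_orbits_eq: "gamma_orbits G = Gorb ` nielsen_class G"
proof -
  have "gamma_orbits G = (\<lambda>R. range (\<lambda>k. (gamma_inf G ^^ k) R)) ` nielsen_rd G"
    unfolding gamma_orbits_def by (rule perm_orbits_cyclic[OF finite_nielsen_rd gamma_Bij])
  also have "\<dots> = Gorb ` nielsen_class G"
    unfolding nielsen_rd_eq image_image by (rule image_cong) (simp_all add: Gorb_def gamma_pow)
  finally show ?thesis .
qed

lemma Gorb_self: "Qorb g \<in> Gorb g"
  unfolding Gorb_def by (rule range_eqI[of _ _ 0]) simp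

lemma Gorb_member:
  assumes g: "g \<in> nielsen_class G" and h: "h \<in> nielsen_class G" and m: "Qorb h \<in> Gorb g"
  shows "Gorb h = Gorb g"
proof -
  obtain k where k: "Qorb h = (gamma_inf G ^^ k) (Qorb g)" using m gamma_pow[OF g] by (auto simp: Gorb_def)
  have "range (\<lambda>k. (gamma_inf G ^^ k) (Qorb h)) = range (\<lambda>k. (gamma_inf G ^^ k) (Qorb g))"
    by (rule cyclic_orbit_eq[OF finite_nielsen_rd gamma_Bij _ k]) (use g in \<open>simp add: nielsen_rd_eq\<close>)
  then show ?thesis using gamma_pow[OF g] gamma_pow[OF h] by (simp add: Gorb_def)
qed

lemma class_in_reduced_orbit:
  assumes g: "g \<in> nielsen_class G" and "R \<in> Gorb g" "C \<in> R" "C \<in> F e"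
  obtains x y where "(x, y) \<in> Pairs" "C = Cl (Te e x y)" "R = Qorb (Te e x y)" "Gorb g = Gorb (Te e x y)"
proof -
  obtain x y where xy: "(x, y) \<in> Pairs" "C = Cl (Te e x y)" using assms(4) by (rule F_E)
  note T = Te_nielsen[OF xy(1), of e]
  obtain k where k: "R = Qorb ((braid2 G ^^ k) g)" using assms(2) by (auto simp: Gorb_def)
  have "Qorb (Te e x y) = R"
    using Qorb_member[OF braid2_pow_nielsen[OF g] T] assms(3) xy(2) k by blast
  moreover from this have "Gorb (Te e x y) = Gorb g" using Gorb_member[OF g T] assms(2) by blast
  ultimately show thesis using that xy by metis
qed

text \<open>
  A power of \<open>q\<^sub>2\<close> that returns to the reduced class lands in the family, hence
  returns to the tuple itself.
\<close>

lemma Te_gamma_return: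
  assumes xy: "(x, y) \<in> Pairs"
  shows "Qorb ((braid2 G ^^ k) (Te e x y)) \<subseteq> F e \<Longrightarrow> 20 dvd k"
    and "\<not> Qorb ((braid2 G ^^ k) (Te False x y)) \<subseteq> F True"
    and "20 dvd k \<Longrightarrow> Qorb ((braid2 G ^^ k) (Te e x y)) = Qorb (Te e x y)"
proof -
  have ret: "(braid2 G ^^ k) (Te e x y) = Te e' x y" if "Qorb ((braid2 G ^^ k) (Te e x y)) \<subseteq> F e'" for e e'
  proof -
    have "Cl ((braid2 G ^^ k) (Te e x y)) \<in> F e'" using that Qorb_self by blast
    then obtain x' y' where "(x', y') \<in> Pairs" "Cl ((braid2 G ^^ k) (Te e x y)) = Cl (Te e' x' y')" by (rule F_E)
    then show ?thesis using class_return[OF xy] by blast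
  qed
  show "Qorb ((braid2 G ^^ k) (Te e x y)) \<subseteq> F e \<Longrightarrow> 20 dvd k" using ret Te_return[OF xy] by blast
  show "\<not> Qorb ((braid2 G ^^ k) (Te False x y)) \<subseteq> F True" using ret HM_not_near[OF xy] by blast
  show "20 dvd k \<Longrightarrow> Qorb ((braid2 G ^^ k) (Te e x y)) = Qorb (Te e x y)" using Te_period[OF xy] by simp
qed

lemma card_Gorb:
  assumes xy: "(x, y) \<in> Pairs"
  shows "card (Gorb (Te e x y)) = 20"
proof -
  note T = Te_nielsen[OF xy, of e]
  have "(gamma_inf G ^^ k) (Qorb (Te e x y)) = Qorb (Te e x y) \<longleftrightarrow> 20 dvd k" for k
    unfolding gamma_pow[OF T]
    using Te_gamma_return(1,3)[OF xy, of k e] Qorb_subset_F[OF T F_I[OF xy]] by auto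
  then have "card (range (\<lambda>k. (gamma_inf G ^^ k) (Qorb (Te e x y)))) = 20"
    by (rule card_funpow_orbit) simp
  then show ?thesis by (simp add: Gorb_def gamma_pow[OF T])
qed

subsection \<open>The middle product\<close>

text \<open>
  The order of the middle product is constant on orbits, since all braids involved change that
  product at most by conjugation, inversion or passage to the opposite product.
\<close>

fun mid where "mid (g1, g2, g3, g4) = ord (g2 \<otimes> g3)"

lemma mid_conj4: "g \<in> nielsen_class G \<Longrightarrow> h \<in> carrier G \<Longrightarrow> mid (conj4 G h g) = mid g"
  using nielsen_carrier by (cases g) (simp add: conj_mult ord_conj)

lemma ord_swap: "a \<in> carrier G \<Longrightarrow> b \<in> carrier G \<Longrightarrow> ord (a \<otimes> b) = ord (b \<otimes> a)"
  using ord_conj[of "inv a" "a \<otimes> b"] by (simp add: group_word)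

lemma mid_braids:
  assumes "g \<in> nielsen_class G"
  shows "mid (braid2 G g) = mid g" "mid (twist g) = mid g" "mid (shift g) = mid g"
proof -
  obtain a b c d where g: "g = (a, b, c, d)" by (cases g)
  note car = nielsen_carrier[OF assms[unfolded g]] and pr = nielsen_product[OF assms[unfolded g]]
  show "mid (braid2 G g) = mid g" using car by (simp add: g group_word)
  have "b \<otimes> c = inv a \<otimes> (a \<otimes> b) \<otimes> c" using car by (simp add: group_word)
  also have "\<dots> = inv a \<otimes> inv d" unfolding pr using car by (simp add: group_word)
  also have "\<dots> = inv (d \<otimes> a)" using car by (simp add: group_word)
  finally have bc: "ord (b \<otimes> c) = ord (d \<otimes> a)" using car by simp
  show "mid (shift g) = mid g" by (simp add: g bc)
  show "mid (twist g) = mid g" using ord_swap car by (simp add: g bc)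
qed

lemma mid_braid2_pow: "g \<in> nielsen_class G \<Longrightarrow> mid ((braid2 G ^^ k) g) = mid g"
  by (induction k) (simp_all del: braid2.simps mid.simps add: mid_braids braid2_pow_nielsen)

lemma mid_Gorb:
  assumes g: "g \<in> nielsen_class G" and "R \<in> Gorb g" "C \<in> R" "h \<in> C"
  shows "mid h = mid g"
proof -
  obtain k where k: "R = Qorb ((braid2 G ^^ k) g)" using assms(2) by (auto simp: Gorb_def)
  let ?k = "(braid2 G ^^ k) g"
  have n: "?k \<in> nielsen_class G" by (rule braid2_pow_nielsen[OF g])
  have cl: "mid h = mid l" if "l \<in> nielsen_class G" "h \<in> Cl l" for l
    using that mid_conj4[OF that(1)] unfolding inner_class_def by blast
  note b = braid_nielsen(4)[OF n] braid_nielsen(5)[OF n] braid_nielsen(4)[OF braid_nielsen(5)[OF n]]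
  have "mid h = mid ?k"
    using assms(3,4) cl[OF n] cl[OF b(1)] cl[OF b(2)] cl[OF b(3)] mid_braids[OF n] mid_braids(2)[OF b(2)]
    unfolding k Qorb_def by auto
  then show ?thesis using mid_braid2_pow[OF g] by simp
qed

lemma mid_Te: "(x, y) \<in> Pairs \<Longrightarrow> mid (Te e x y) = 10"
  using Te_components[of x y e] pair_order by (metis mid.simps)

theorem Te_type:
  assumes xy: "(x, y) \<in> Pairs"
  shows "has_type G (Gorb (Te e x y)) (10, 20)"
  using mid_Gorb[OF Te_nielsen[OF xy]] mid_Te[OF xy] card_Gorb[OF xy]
  unfolding has_type_def by fastforce

subsection \<open>Counting orbits\<close>

definition rdF where "rdF e = Qorb ` {g \<in> nielsen_class G. Cl g \<in> F e}"

lemma rdF_eq: "rdF e = (\<lambda>(x, y). Qorb (Te e x y)) ` Pairs"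
proof
  show "rdF e \<subseteq> (\<lambda>(x, y). Qorb (Te e x y)) ` Pairs"
  proof
    fix R assume "R \<in> rdF e"
    then obtain g where g: "g \<in> nielsen_class G" "Cl g \<in> F e" "R = Qorb g" unfolding rdF_def by blast
    from g(2) obtain x y where xy: "(x, y) \<in> Pairs" "Cl g = Cl (Te e x y)" by (rule F_E)
    then have "R = Qorb (Te e x y)" using Qorb_cong[OF g(1) Te_nielsen[OF xy(1)]] g by simp
    then show "R \<in> (\<lambda>(x, y). Qorb (Te e x y)) ` Pairs" using xy(1) by (intro image_eqI[of _ _ "(x, y)"]) auto
  qed
  show "(\<lambda>(x, y). Qorb (Te e x y)) ` Pairs \<subseteq> rdF e"
    unfolding rdF_def using Te_nielsen F_I by (auto split: prod.splits simp del: braid2.simps)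
qed

lemma rdF_E:
  assumes "R \<in> rdF e"
  obtains x y where "(x, y) \<in> Pairs" "R = Qorb (Te e x y)"
proof -
  obtain q where "q \<in> Pairs" "R = (case q of (x, y) \<Rightarrow> Qorb (Te e x y))"
    using assms unfolding rdF_eq by blast
  then show thesis using that[of "fst q" "snd q"] by (simp add: split_beta)
qed

text \<open>
  The 16 classes fall into orbits of length four.
\<close>

lemma card_rdF: "card (rdF e) = 4"
proof -
  have un: "\<Union> (rdF e) = F e"
  proof
    show "\<Union> (rdF e) \<subseteq> F e" using Qorb_subset_F unfolding rdF_def by blast
    show "F e \<subseteq> \<Union> (rdF e)"
    proof
      fix C assume "C \<in> F e"
      then obtain x y where xy: "(x, y) \<in> Pairs" "C = Cl (Te e x y)" by (rule F_E)
      then have "Qorb (Te e x y) \<in> rdF e" unfolding rdF_eq by (intro image_eqI[of _ _ "(x, y)"]) auto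
      then show "C \<in> \<Union> (rdF e)" using Qorb_self xy by blast
    qed
  qed
  have fin: "finite (F e)" using card_F by (intro card_ge_0_finite) simp
  have "4 * card (rdF e) = card (\<Union> (rdF e))"
  proof (rule card_partition)
    show "finite (rdF e)" unfolding rdF_def using finite_nielsen by simp
    show "finite (\<Union> (rdF e))" using un fin by simp
    show "card R = 4" if "R \<in> rdF e" for R using that card_Qorb unfolding rdF_def by blast
    show "R \<inter> R' = {}" if R: "R \<in> rdF e" "R' \<in> rdF e" "R \<noteq> R'" for R R'
    proof (rule ccontr)
      assume "R \<inter> R' \<noteq> {}"
      then obtain C where C: "C \<in> R" "C \<in> R'" by blast
      obtain g where g: "g \<in> nielsen_class G" "R = Qorb g" using R(1) unfolding rdF_def by blast
      obtain g' where g': "g' \<in> nielsen_class G" "R' = Qorb g'" using R(2) unfolding rdF_def by blast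
      have "C \<in> nielsen_in G" using C g Qorb_nielsen_in by blast
      then obtain h where "h \<in> nielsen_class G" "C = Cl h" by (rule nielsen_inE)
      then have "Qorb h = R" "Qorb h = R'" using Qorb_member g g' C by metis+
      then show False using R(3) by simp
    qed
  qed
  then show ?thesis using un card_F by simp
qed

definition gammaF where "gammaF e = {Y \<in> gamma_orbits G. \<exists>R\<in>Y. \<exists>C\<in>R. C \<in> F e}"

lemma gammaF_eq: "gammaF e = (\<lambda>(x, y). Gorb (Te e x y)) ` Pairs"
proof
  show "gammaF e \<subseteq> (\<lambda>(x, y). Gorb (Te e x y)) ` Pairs"
  proof
    fix Y assume "Y \<in> gammaF e"
    then obtain g R C where g: "g \<in> nielsen_class G" "Y = Gorb g" "R \<in> Y" "C \<in> R" "C \<in> F e"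
      unfolding gammaF_def gamma_orbits_eq by blast
    then obtain x y where "(x, y) \<in> Pairs" "Gorb g = Gorb (Te e x y)"
      using class_in_reduced_orbit[OF g(1)] by metis
    then show "Y \<in> (\<lambda>(x, y). Gorb (Te e x y)) ` Pairs" using g(2) by (intro image_eqI[of _ _ "(x, y)"]) auto
  qed
  show "(\<lambda>(x, y). Gorb (Te e x y)) ` Pairs \<subseteq> gammaF e"
  proof clarify
    fix x y assume xy: "(x, y) \<in> Pairs"
    show "Gorb (Te e x y) \<in> gammaF e"
      unfolding gammaF_def gamma_orbits_eq
      by (intro CollectI conjI imageI Te_nielsen[OF xy] bexI[OF _ Gorb_self] bexI[OF _ Qorb_self] F_I[OF xy])
  qed
qed

lemma gammaF_E:
  assumes "Y \<in> gammaF e"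
  obtains x y where "(x, y) \<in> Pairs" "Y = Gorb (Te e x y)"
proof -
  obtain q where "q \<in> Pairs" "Y = (case q of (x, y) \<Rightarrow> Gorb (Te e x y))"
    using assms unfolding gammaF_eq by blast
  then show thesis using that[of "fst q" "snd q"] by (simp add: split_beta)
qed

lemma card_gammaF: "card (gammaF e) = 4"
proof -
  let ?o = "\<lambda>R. range (\<lambda>k. (gamma_inf G ^^ k) R)"
  have o: "?o (Qorb (Te e x y)) = Gorb (Te e x y)" if "(x, y) \<in> Pairs" for x y
    using gamma_pow[OF Te_nielsen[OF that]] by (simp add: Gorb_def)
  have "gammaF e = ?o ` rdF e"
    unfolding gammaF_eq rdF_eq image_image
  proof (rule image_cong[OF refl])
    fix q assume "q \<in> Pairs"
    then show "(case q of (x, y) \<Rightarrow> Gorb (Te e x y)) = ?o (case q of (x, y) \<Rightarrow> Qorb (Te e x y))"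
      using o[of "fst q" "snd q"] by (simp add: split_beta)
  qed
  moreover have "inj_on ?o (rdF e)"
  proof (rule inj_onI)
    fix R R' assume R: "R \<in> rdF e" "R' \<in> rdF e" "?o R = ?o R'"
    obtain x y where xy: "(x, y) \<in> Pairs" "R = Qorb (Te e x y)" using R(1) by (rule rdF_E)
    obtain x' y' where xy': "(x', y') \<in> Pairs" "R' = Qorb (Te e x' y')" using R(2) by (rule rdF_E)
    have "Gorb (Te e x y) = Gorb (Te e x' y')" using R(3) xy xy' o by simp
    then have "R' \<in> Gorb (Te e x y)" using Gorb_self xy'(2) by metis
    then obtain k where k: "R' = Qorb ((braid2 G ^^ k) (Te e x y))" by (auto simp: Gorb_def)
    have "R' \<subseteq> F e" using Qorb_subset_F[OF Te_nielsen F_I] xy' by blast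
    then show "R = R'" using Te_gamma_return(1,3)[OF xy(1)] k xy(2) by metis
  qed
  ultimately show ?thesis by (simp add: card_image card_rdF)
qed

lemma gammaF_disjoint: "gammaF False \<inter> gammaF True = {}"
proof (rule ccontr)
  assume "gammaF False \<inter> gammaF True \<noteq> {}"
  then obtain Y where Y: "Y \<in> gammaF False" "Y \<in> gammaF True" by blast
  from Y(1) obtain x y where xy: "(x, y) \<in> Pairs" "Y = Gorb (Te False x y)" by (rule gammaF_E)
  from Y(2) obtain x' y' where xy': "(x', y') \<in> Pairs" "Y = Gorb (Te True x' y')" by (rule gammaF_E)
  have "Qorb (Te True x' y') \<in> Gorb (Te False x y)" using Gorb_self xy xy' by metis
  then obtain k where "Qorb (Te True x' y') = Qorb ((braid2 G ^^ k) (Te False x y))" by (auto simp: Gorb_def)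
  then show False
    using Te_gamma_return(2)[OF xy(1)] Qorb_subset_F[OF Te_nielsen[OF xy'(1)] F_I[OF xy'(1)]] by metis
qed

lemma q2_orbit_unique:
  assumes "Y \<in> perm_orbits (nielsen_in G) {hq2 G}" "C \<in> Y" "C \<in> F e"
  shows "\<exists>!C. C \<in> Y \<and> C \<in> F e"
proof (rule ex1I[of _ C])
  show "C \<in> Y \<and> C \<in> F e" using assms by blast
  fix D assume D: "D \<in> Y \<and> D \<in> F e"
  obtain B where B: "B \<in> nielsen_in G" "Y = range (\<lambda>k. (hq2 G ^^ k) B)"
    using assms(1) unfolding perm_orbits_cyclic[OF finite_nielsen_in hq2_Bij] by blast
  obtain m where m: "C = (hq2 G ^^ m) B" using assms(2) B by blast
  have "Y = range (\<lambda>k. (hq2 G ^^ k) C)"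
    using cyclic_orbit_eq[OF finite_nielsen_in hq2_Bij B(1) m] B(2) by simp
  then obtain k where k: "D = (hq2 G ^^ k) C" using D by blast
  obtain x y where xy: "(x, y) \<in> Pairs" "C = Cl (Te e x y)" using assms(3) by (rule F_E)
  have Dk: "D = Cl ((braid2 G ^^ k) (Te e x y))" using k xy hq2_pow[OF Te_nielsen] by simp
  obtain x' y' where xy': "(x', y') \<in> Pairs" "D = Cl (Te e x' y')"
    using conjunct2[OF D] by (rule F_E)
  have "(braid2 G ^^ k) (Te e x y) = Te e x y" 
    by (rule class_return[OF xy(1) xy'(1)]) (rule trans[OF Dk[symmetric] xy'(2)])
  then show "D = C" using Dk xy(2) by (simp only:)
qed

end

section \<open>The icosahedral module\<close>

definition alpha :: perm5 where "alpha = Perm P2 P1 P4 P3 P5"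
definition beta :: perm5 where "beta = Perm P1 P4 P3 P5 P2"
definition delta :: perm5 where "delta = Perm P2 P3 P5 P1 P4"
definition nu :: perm5 where "nu = Perm P3 P4 P1 P2 P5"

text \<open>
  The dihedral group of order 10 generated by \<open>delta\<close> and \<open>alpha\<close>.
\<close>

definition stab_list :: "perm5 list" where
  "stab_list = [x * y. x \<leftarrow> [1, delta, delta * delta, delta * delta * delta, delta * delta * delta * delta],
     y \<leftarrow> [1, alpha]]"

text \<open>
  Representatives of the six cosets of that dihedral group, the points of the projective line.
\<close>

definition rep0 :: perm5 where "rep0 = 1"
definition rep1 :: perm5 where "rep1 = gam"
definition rep2 :: perm5 where "rep2 = gam * gam"
definition rep3 :: perm5 where "rep3 = gam * gam * gam"
definition rep4 :: perm5 where "rep4 = gam * gam * gam * gam"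
definition rep5 :: perm5 where "rep5 = beta * gam * gam"

text \<open>
  Vectors of length six over the field with two elements; the maps below are the permutations of
  the six cosets induced by \<open>beta\<close>, \<open>gam\<close> and \<open>alpha\<close>.
\<close>

datatype six = Six bool bool bool bool bool bool

fun plus6 :: "six \<Rightarrow> six \<Rightarrow> six" where
  "plus6 (Six a b c d e f) (Six a' b' c' d' e' f') =
     Six (a \<noteq> a') (b \<noteq> b') (c \<noteq> c') (d \<noteq> d') (e \<noteq> e') (f \<noteq> f')"
fun beta6 :: "six \<Rightarrow> six" where "beta6 (Six a b c d e f) = Six e a d f b c"
fun gam6 :: "six \<Rightarrow> six" where "gam6 (Six a b c d e f) = Six e a b c d f"
fun alpha6 :: "six \<Rightarrow> six" where "alpha6 (Six a b c d e f) = Six a b e f c d"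
fun even6 :: "six \<Rightarrow> bool" where
  "even6 (Six a b c d e f) \<longleftrightarrow> \<not> (a \<noteq> (b \<noteq> (c \<noteq> (d \<noteq> (e \<noteq> f)))))"

definition zero6 where "zero6 = Six False False False False False False"
definition full6 where "full6 = Six True True True True True True"

definition bools :: "bool list" where "bools = [False, True]"

lemma set_bools: "set bools = UNIV"
  by (auto simp: bools_def)

definition six_list :: "six list" where
  "six_list = [Six a b c d e f. a \<leftarrow> bools, b \<leftarrow> bools, c \<leftarrow> bools, d \<leftarrow> bools, e \<leftarrow> bools, f \<leftarrow> bools]"

lemma in_six_list: "s \<in> set six_list"
  by (cases s) (auto simp: six_list_def set_bools image_iff)

lemma six_all: "list_all P six_list \<Longrightarrow> P s"
  using in_six_list[of s] by (simp add: list_all_iff)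

definition duads :: "six list" where
  "duads = filter (\<lambda>s. case s of Six a b c d e f \<Rightarrow> length (filter id [a, b, c, d, e, f]) = 2) six_list"

definition words :: "bool list list" where
  "words = [u @ v @ w. u \<leftarrow> [[], [True], [True, True], [True, True, True], [True, True, True, True]],
     v \<leftarrow> [[], [False], [False, False]],
     w \<leftarrow> [[], [True], [True, True], [True, True, True], [True, True, True, True]]]"

fun act_word :: "bool list \<Rightarrow> six \<Rightarrow> six" where
  "act_word [] s = s"
| "act_word (x # xs) s = (if x then gam6 (act_word xs s) else beta6 (act_word xs s))"

text \<open>
  Some element of the form \<open>s + ws\<close> has weight two. The group is doubly transitive on
  the six coordinates, and the vectors of weight two span the even vectors.
\<close>

lemma submodule_contains_even:
  assumes K: "\<And>s t. s \<in> K \<Longrightarrow> t \<in> K \<Longrightarrow> plus6 s t \<in> K" "\<And>s. s \<in> K \<Longrightarrow> beta6 s \<in> K" "\<And>s. s \<in> K \<Longrightarrow> gam6 s \<in> K"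
    and s: "s \<in> K" "s \<noteq> zero6" "s \<noteq> full6" and t: "even6 t"
  shows "t \<in> K"
proof -
  have w: "act_word xs u \<in> K" if "u \<in> K" for xs u
    using that K by (induction xs) auto
  have "list_all (\<lambda>s. s = zero6 \<or> s = full6 \<or> list_ex (\<lambda>xs. plus6 s (act_word xs s) \<in> set duads) words) six_list"
    by code_simp
  then have "\<exists>xs. plus6 s (act_word xs s) \<in> set duads"
    using s in_six_list[of s] by (auto simp: list_all_iff list_ex_iff)
  then obtain u where u: "u \<in> set duads" "u \<in> K" using K(1) w s(1) by blast
  have "list_all (\<lambda>u. list_all (\<lambda>v. list_ex (\<lambda>xs. act_word xs u = v) words) duads) duads"
    by code_simp
  then have duads: "v \<in> K" if "v \<in> set duads" for v
    using u that w by (fastforce simp: list_all_iff list_ex_iff)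
  have "list_all (\<lambda>t. even6 t \<longrightarrow> list_ex (\<lambda>u. list_ex (\<lambda>v. t = plus6 u v \<or> t = plus6 u (plus6 u v)
      \<or> t = plus6 u (plus6 (Six False False False True False True) v)) duads) duads) six_list"
    by code_simp
  then obtain u v where "u \<in> set duads" "v \<in> set duads" "t = plus6 u v \<or> t = plus6 u (plus6 u v)
      \<or> t = plus6 u (plus6 (Six False False False True False True) v)"
    using t in_six_list[of t] by (auto simp: list_all_iff list_ex_iff)
  moreover have "Six False False False True False True \<in> set duads" by code_simp
  ultimately show ?thesis using K(1) duads by blast
qed

text \<open>
  Equality modulo the constant vector is the relevant notion, since the kernel is the quotient by
  that vector.
\<close>

lemma fixed_even:
  "even6 s \<Longrightarrow> plus6 s (beta6 s) = zero6 \<or> plus6 s (beta6 s) = full6 \<Longrightarrow> s = zero6 \<or> s = full6"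
  "even6 s \<Longrightarrow> plus6 s (gam6 s) = zero6 \<or> plus6 s (gam6 s) = full6 \<Longrightarrow> s = zero6 \<or> s = full6"
  "plus6 s (beta6 s) = zero6 \<or> plus6 s (beta6 s) = full6 \<Longrightarrow>
   plus6 s (gam6 s) = zero6 \<or> plus6 s (gam6 s) = full6 \<Longrightarrow> s = zero6 \<or> s = full6"
proof -
  have *: "list_all (\<lambda>s. let x = plus6 s (beta6 s); y = plus6 s (gam6 s); z = (s = zero6 \<or> s = full6) in
     (even6 s \<longrightarrow> x = zero6 \<or> x = full6 \<longrightarrow> z) \<and> (even6 s \<longrightarrow> y = zero6 \<or> y = full6 \<longrightarrow> z) \<and>
     (x = zero6 \<or> x = full6 \<longrightarrow> y = zero6 \<or> y = full6 \<longrightarrow> z)) six_list"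
    by code_simp
  from six_all[OF *, of s] show
  "even6 s \<Longrightarrow> plus6 s (beta6 s) = zero6 \<or> plus6 s (beta6 s) = full6 \<Longrightarrow> s = zero6 \<or> s = full6"
  "even6 s \<Longrightarrow> plus6 s (gam6 s) = zero6 \<or> plus6 s (gam6 s) = full6 \<Longrightarrow> s = zero6 \<or> s = full6"
  "plus6 s (beta6 s) = zero6 \<or> plus6 s (beta6 s) = full6 \<Longrightarrow>
   plus6 s (gam6 s) = zero6 \<or> plus6 s (gam6 s) = full6 \<Longrightarrow> s = zero6 \<or> s = full6"
    unfolding Let_def by blast+
qed

lemma xor_interchange: "((a \<noteq> b) \<noteq> (c \<noteq> d)) = ((a \<noteq> c) \<noteq> (b \<noteq> d))" for a b c d :: bool
  by blast

lemma even6_plus: "even6 (plus6 s t) \<longleftrightarrow> (even6 s \<longleftrightarrow> even6 t)"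
proof (cases s, cases t)
  fix a b c d e f a' b' c' d' e' f' assume st: "s = Six a b c d e f" "t = Six a' b' c' d' e' f'"
  note x1 = xor_interchange[of e e' f f']
  note x2 = xor_interchange[of d d' "e \<noteq> f" "e' \<noteq> f'"]
  note x3 = xor_interchange[of c c' "d \<noteq> (e \<noteq> f)" "d' \<noteq> (e' \<noteq> f')"]
  note x4 = xor_interchange[of b b' "c \<noteq> (d \<noteq> (e \<noteq> f))" "c' \<noteq> (d' \<noteq> (e' \<noteq> f'))"]
  note x5 = xor_interchange[of a a' "b \<noteq> (c \<noteq> (d \<noteq> (e \<noteq> f)))" "b' \<noteq> (c' \<noteq> (d' \<noteq> (e' \<noteq> f')))"]
  define x where "x = (a \<noteq> (b \<noteq> (c \<noteq> (d \<noteq> (e \<noteq> f)))))"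
  define y where "y = (a' \<noteq> (b' \<noteq> (c' \<noteq> (d' \<noteq> (e' \<noteq> f')))))"
  have "even6 (plus6 s t) = (\<not> (x \<noteq> y))"
    unfolding st plus6.simps even6.simps x1 x2 x3 x4 x5 x_def y_def by (rule refl)
  moreover have "even6 s = (\<not> x)" "even6 t = (\<not> y)"
    unfolding st even6.simps x_def y_def by (rule refl)+
  ultimately show ?thesis by blast
qed

lemma even6_acts: "even6 (beta6 s) = even6 s" "even6 (gam6 s) = even6 s" "even6 (alpha6 s) = even6 s"
proof -
  have *: "list_all (\<lambda>s. even6 (beta6 s) = even6 s \<and> even6 (gam6 s) = even6 s \<and> even6 (alpha6 s) = even6 s) six_list"
    by code_simp
  show "even6 (beta6 s) = even6 s" "even6 (gam6 s) = even6 s" "even6 (alpha6 s) = even6 s"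
    using six_all[OF *, of s] by blast+
qed

lemma plus6_eq_zero: "plus6 s t = zero6 \<longleftrightarrow> s = t"
  by (cases s; cases t) (auto simp: zero6_def)

text \<open>
  The squares of 5-cycles form the other class of elements of order 5.
\<close>

lemma conj_to_generator:
  assumes "X \<in> alt5" "X \<noteq> 1" "X ^ 3 = 1 \<or> X ^ 5 = 1"
  obtains H where "H \<in> alt5" "X * H = H * beta \<or> X * H = H * gam \<or> X * H = H * (gam * gam)"
proof -
  have "\<forall>X\<in>set alt5_list. X \<noteq> 1 \<longrightarrow> X * X * X = 1 \<or> X * X * X * X * X = 1 \<longrightarrow>
     (\<exists>H\<in>set alt5_list. let Y = X * H in Y = H * beta \<or> Y = H * gam \<or> Y = H * (gam * gam))"
    by code_simp
  then show thesis using assms that unfolding alt5_eq_list Let_def pow3_expand pow5_expand by blast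
qed

lemma conj_to_alpha:
  assumes "X \<in> alt5" "X \<noteq> 1" "X * X = 1"
  obtains H where "H \<in> alt5" "X * H = H * alpha"
proof -
  have "\<forall>X\<in>set alt5_list. X \<noteq> 1 \<longrightarrow> X * X = 1 \<longrightarrow> (\<exists>H\<in>set alt5_list. X * H = H * alpha)"
    by code_simp
  then show thesis using assms that unfolding alt5_eq_list by blast
qed

lemma beta_gam_alt5: "alpha \<in> alt5" "beta \<in> alt5" "gam \<in> alt5" "delta \<in> alt5" "nu \<in> alt5"
  unfolding alt5_eq_list by code_simp+

lemma beta_gam_generate:
  assumes Z: "beta \<in> Z" "gam \<in> Z" "1 \<in> Z" "\<And>u v. u \<in> Z \<Longrightarrow> v \<in> Z \<Longrightarrow> u * v \<in> Z"
  shows "alt5 \<subseteq> Z"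
proof (rule pair_generates[of beta "gam * beta * (gam * gam * (gam * gam))" Z])
  show "beta \<in> cyc3" "gam * beta * (gam * gam * (gam * gam)) \<in> cyc3"
    "\<not> common_fix [beta, gam * beta * (gam * gam * (gam * gam))]" by code_simp+
  show "gam * beta * (gam * gam * (gam * gam)) \<in> Z" by (intro Z)
  show "beta \<in> Z" "1 \<in> Z" by (rule Z)+
  show "u * v \<in> Z" if "u \<in> Z" "v \<in> Z" for u v using that by (rule Z(4))
qed

context elementary_kernel
begin

subsection \<open>The action on the kernel\<close>

text \<open>
  The kernel is abelian, so conjugation by a lift depends only on the image.
\<close>

definition act where "act X x = (let g = (SOME g. g \<in> carrier G \<and> p g = X) in g \<otimes> x \<otimes> inv g)"

definition ker where "ker = {x \<in> carrier G. p x = 1}"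

lemma kerD: "x \<in> ker \<Longrightarrow> x \<in> carrier G" "x \<in> ker \<Longrightarrow> p x = 1" by (simp_all add: ker_def)

lemma act_eq:
  assumes "g \<in> carrier G" "x \<in> ker"
  shows "act (p g) x = g \<otimes> x \<otimes> inv g"
proof -
  define h where "h = (SOME h. h \<in> carrier G \<and> p h = p g)"
  have h: "h \<in> carrier G" "p h = p g"
    using someI[of "\<lambda>h. h \<in> carrier G \<and> p h = p g" g] assms(1) by (simp_all add: h_def)
  note x = kerD[OF assms(2)]
  let ?k = "inv g \<otimes> h"
  have "p ?k = 1" using h assms p_inv by (simp add: p_mult)
  then have "?k \<otimes> x = x \<otimes> ?k" using kernel_commute x h assms by simp
  then have "g \<otimes> (?k \<otimes> x) \<otimes> inv h = g \<otimes> (x \<otimes> ?k) \<otimes> inv h" by simp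
  then have "h \<otimes> x \<otimes> inv h = g \<otimes> x \<otimes> inv g" using h x assms(1) by (simp add: group_word)
  then show ?thesis by (simp add: act_def h_def Let_def)
qed

lemma act_ker: "X \<in> alt5 \<Longrightarrow> x \<in> ker \<Longrightarrow> act X x \<in> ker"
proof -
  assume a: "X \<in> alt5" "x \<in> ker"
  obtain g where g: "g \<in> carrier G" "p g = X" using a lift by blast
  then show ?thesis using a act_eq[OF g(1) a(2)] p_conj_one[of g x] by (simp add: ker_def)
qed

lemma act_mult: "X \<in> alt5 \<Longrightarrow> Y \<in> alt5 \<Longrightarrow> x \<in> ker \<Longrightarrow> act (X * Y) x = act X (act Y x)"
proof -
  assume a: "X \<in> alt5" "Y \<in> alt5" "x \<in> ker"
  obtain g h where g: "g \<in> carrier G" "p g = X" and h: "h \<in> carrier G" "p h = Y" using a lift by metis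
  have hx: "h \<otimes> x \<otimes> inv h \<in> ker"
    using act_ker[OF a(2,3)] act_eq[OF h(1) a(3)] h(2) by simp
  have "act (p (g \<otimes> h)) x = g \<otimes> (h \<otimes> x \<otimes> inv h) \<otimes> inv g"
    unfolding act_eq[OF m_closed[OF g(1) h(1)] a(3)] using g(1) h(1) kerD(1)[OF a(3)] by (simp add: group_word)
  also have "\<dots> = act (p g) (act (p h) x)"
    unfolding act_eq[OF h(1) a(3)] act_eq[OF g(1) hx] by (rule refl)
  finally show ?thesis using g h by (simp add: p_mult)
qed

lemma act_one: "x \<in> ker \<Longrightarrow> act 1 x = x"
  using act_eq[of \<one> x] by (simp add: p_one kerD)

lemma act_hom: "X \<in> alt5 \<Longrightarrow> x \<in> ker \<Longrightarrow> y \<in> ker \<Longrightarrow> act X (x \<otimes> y) = act X x \<otimes> act X y"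
proof -
  assume a: "X \<in> alt5" "x \<in> ker" "y \<in> ker"
  obtain g where g: "g \<in> carrier G" "p g = X" using a lift by blast
  have "x \<otimes> y \<in> ker" using a by (simp add: ker_def p_mult)
  show ?thesis
    unfolding g(2)[symmetric] act_eq[OF g(1) \<open>x \<otimes> y \<in> ker\<close>] act_eq[OF g(1) a(2)] act_eq[OF g(1) a(3)]
    using g(1) kerD(1)[OF a(2)] kerD(1)[OF a(3)] by (simp add: group_word)
qed

lemma subgroup_ker: "subgroup ker G"
  by (rule subgroupI) (use p_one p_inv_eqI in \<open>auto simp: ker_def p_mult kernel_inv\<close>)

sublocale K: comm_group "G\<lparr>carrier := ker\<rparr>"
proof -
  interpret K: group "G\<lparr>carrier := ker\<rparr>" by (rule subgroup_imp_group[OF subgroup_ker])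
  show "comm_group (G\<lparr>carrier := ker\<rparr>)"
    by (rule K.group_comm_groupI) (simp add: ker_def kernel_commute)
qed

lemma ker_closed: "x \<in> ker \<Longrightarrow> y \<in> ker \<Longrightarrow> x \<otimes> y \<in> ker" "\<one> \<in> ker"
  by (simp_all add: ker_def p_mult p_one)

lemma ker_ac:
  "x \<in> ker \<Longrightarrow> y \<in> ker \<Longrightarrow> x \<otimes> y = y \<otimes> x"
  "x \<in> ker \<Longrightarrow> y \<in> ker \<Longrightarrow> z \<in> ker \<Longrightarrow> x \<otimes> y \<otimes> z = x \<otimes> (y \<otimes> z)"
  "x \<in> ker \<Longrightarrow> y \<in> ker \<Longrightarrow> z \<in> ker \<Longrightarrow> x \<otimes> (y \<otimes> z) = y \<otimes> (x \<otimes> z)"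
  using K.m_ac by simp_all

lemma ker_square: "x \<in> ker \<Longrightarrow> x \<otimes> x = \<one>" "x \<in> ker \<Longrightarrow> y \<in> ker \<Longrightarrow> x \<otimes> (x \<otimes> y) = y"
proof -
  show "x \<in> ker \<Longrightarrow> x \<otimes> x = \<one>" by (simp add: ker_def square)
  then show "x \<in> ker \<Longrightarrow> y \<in> ker \<Longrightarrow> x \<otimes> (x \<otimes> y) = y"
    by (metis kerD(1) m_assoc l_one)
qed

text \<open>
  Conjugating \<open>c\<close> by \<open>m\<close> changes \<open>a\<^sup>2\<close> by \<open>m +
  cm + am + acm\<close> in additive notation. For the sum \<open>m\<close> of two conjugates of the
  old square chosen below, the part from \<open>cm\<close> cancels, and the new square is the sum
  of all five conjugates under \<open>delta\<close>.
\<close>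

lemma good_lifts:
  obtains b c where "b \<in> carrier G" "c \<in> carrier G" "p b = beta" "p c = gam" "b \<otimes> b \<otimes> b = \<one>"
    "c [^] (5::nat) = \<one>" "act delta (c \<otimes> inv b \<otimes> (c \<otimes> inv b)) = c \<otimes> inv b \<otimes> (c \<otimes> inv b)"
proof -
  have "beta ^ 3 = 1" "gam ^ 5 = 1" unfolding pow3_expand pow5_expand by code_simp+
  then obtain b c0 where b: "b \<in> carrier G" "p b = beta" "b [^] (3::nat) = \<one>"
    and c0: "c0 \<in> carrier G" "p c0 = gam" "c0 [^] (5::nat) = \<one>"
    using odd_lift[of beta 3] odd_lift[of gam 5] beta_gam_alt5 by (metis odd_numeral)
  note A = beta_gam_alt5
  define a where "a = c0 \<otimes> inv b"
  have "gam = alpha * beta" "alpha * alpha = 1" by code_simp+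
  have "gam * Z = alpha * (beta * Z)" for Z using \<open>gam = alpha * beta\<close> by (metis mult.assoc)
  then have "p a = alpha * (beta * p (inv b))"
    using b(1,2) c0(1,2) unfolding a_def by (simp add: p_mult)
  then have a: "a \<in> carrier G" "p a = alpha"
    using b(1,2) c0(1) p_inv(1)[OF b(1)] by (simp_all add: a_def)
  define m1 where "m1 = a \<otimes> a"
  have m1: "m1 \<in> ker" using a \<open>alpha * alpha = 1\<close> by (simp add: m1_def ker_def p_mult)
  have am1: "act alpha m1 = m1" using act_eq[OF a(1) m1] a by (simp add: m1_def group_word)
  define mu where "mu X = act X m1" for X
  have mu: "mu X \<in> ker" if "X \<in> alt5" for X using act_ker[OF that m1] by (simp add: mu_def)
  have mu_act: "act X (mu Y) = mu (X * Y)" if "X \<in> alt5" "Y \<in> alt5" for X Y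
    using act_mult[OF that m1] by (simp add: mu_def)
  have mu_alpha: "mu (X * alpha) = mu X" if "X \<in> alt5" for X
    using act_mult[OF that A(1) m1] am1 by (simp add: mu_def)
  have mu1: "mu 1 = m1" using act_one[OF m1] by (simp add: mu_def)
  let ?d2 = "delta * delta" let ?d3 = "delta * delta * delta" let ?d4 = "delta * delta * delta * delta"
  have D: "?d2 \<in> alt5" "?d3 \<in> alt5" "?d4 \<in> alt5" "gam * ?d3 \<in> alt5" "gam * ?d4 \<in> alt5"
    using A by (auto intro!: alt5_mult)
  have id: "alpha * ?d3 = ?d2 * alpha" "alpha * ?d4 = delta * alpha" "delta * ?d4 = 1"
    "alpha * (gam * ?d3) = gam * ?d4 \<or> alpha * (gam * ?d3) = gam * ?d4 * alpha"
    "alpha * (gam * ?d4) = gam * ?d3 \<or> alpha * (gam * ?d4) = gam * ?d3 * alpha"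
    by code_simp+
  define m where "m = mu ?d3 \<otimes> mu ?d4"
  have m: "m \<in> ker" using mu D ker_closed by (simp add: m_def)
  define n where "n = act gam m"
  have n: "n \<in> ker" "n = mu (gam * ?d3) \<otimes> mu (gam * ?d4)"
    using act_ker[OF A(3) m] mu D A act_hom[OF A(3), of "mu ?d3" "mu ?d4"] mu_act
    by (simp_all add: n_def m_def)
  have am: "act alpha m = mu ?d2 \<otimes> mu delta"
    using act_hom[OF A(1), of "mu ?d3" "mu ?d4"] mu D A mu_act id mu_alpha by (simp add: m_def)
  have an: "act alpha n = n"
  proof -
    have "mu (alpha * (gam * ?d3)) = mu (gam * ?d4)" "mu (alpha * (gam * ?d4)) = mu (gam * ?d3)"
      using id(4,5) mu_alpha D by auto
    then have "act alpha n = mu (gam * ?d4) \<otimes> mu (gam * ?d3)"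
      using act_hom[OF A(1), of "mu (gam * ?d3)" "mu (gam * ?d4)"] mu D A mu_act unfolding n(2) by simp
    then show ?thesis unfolding n(2) using ker_ac(1) mu D by simp
  qed
  define c where "c = m \<otimes> c0 \<otimes> inv m"
  have c: "c \<in> carrier G" "p c = gam" "c [^] (5::nat) = \<one>"
    using c0 m kerD[OF m] p_inv(1)[of m] pow_conj[of m c0 5] by (simp_all add: c_def p_mult)
  have "c \<otimes> inv b = m \<otimes> n \<otimes> a"
  proof -
    have "n = c0 \<otimes> m \<otimes> inv c0" using act_eq[OF c0(1) m] c0 by (simp add: n_def)
    then show ?thesis using c0 b kerD[OF m] kernel_inv[of m] by (simp add: c_def a_def group_word)
  qed
  then have "c \<otimes> inv b \<otimes> (c \<otimes> inv b) = m \<otimes> n \<otimes> (a \<otimes> (m \<otimes> n) \<otimes> inv a) \<otimes> (a \<otimes> a)"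
    using a kerD(1)[OF m] kerD(1)[OF n(1)] by (simp add: group_word)
  also have "a \<otimes> (m \<otimes> n) \<otimes> inv a = act alpha m \<otimes> act alpha n"
    using act_eq[OF a(1) ker_closed(1)[OF m n(1)]] act_hom[OF A(1) m n(1)] a by simp
  also have "m \<otimes> n \<otimes> (act alpha m \<otimes> act alpha n) \<otimes> (a \<otimes> a) = m \<otimes> act alpha m \<otimes> m1"
    unfolding an m1_def[symmetric] using m n(1) act_ker[OF A(1) m] m1 by (simp add: ker_ac ker_square ker_closed)
  also have "\<dots> = mu ?d4 \<otimes> (mu ?d3 \<otimes> (mu ?d2 \<otimes> (mu delta \<otimes> mu 1)))"
    unfolding am mu1 unfolding m_def using mu D A m1 by (simp add: ker_ac ker_closed)
  finally have w: "c \<otimes> inv b \<otimes> (c \<otimes> inv b) = mu ?d4 \<otimes> (mu ?d3 \<otimes> (mu ?d2 \<otimes> (mu delta \<otimes> mu 1)))" .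
  have "act delta (mu ?d4 \<otimes> (mu ?d3 \<otimes> (mu ?d2 \<otimes> (mu delta \<otimes> mu 1)))) =
      mu 1 \<otimes> (mu ?d4 \<otimes> (mu ?d3 \<otimes> (mu ?d2 \<otimes> mu delta)))"
    using mu D A alt5_one id(3) by (simp add: act_hom ker_closed mu_act mult.assoc)
  also have "\<dots> = mu ?d4 \<otimes> (mu ?d3 \<otimes> (mu ?d2 \<otimes> (mu delta \<otimes> mu 1)))"
    using mu D A alt5_one by (simp add: ker_ac ker_closed)
  finally show thesis using that[of b c] b c w by (simp add: pow_three)
qed

end

text \<open>
  The listed 60 words, a double coset decomposition for the cyclic group generated by
  \<open>c\<close>, are closed under left multiplication by \<open>a\<close> and \<open>c\<close>.
  The generation bound then needs only the relations \<open>a\<^sup>2 = c\<^sup>5 = (ac)\<^sup>3 =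
  1\<close>.
\<close>

lemma (in group) icosahedral_presentation:
  assumes a: "a \<in> carrier G" "a \<otimes> a = \<one>" and c: "c \<in> carrier G" "c [^] (5::nat) = \<one>"
    and ac: "a \<otimes> c \<otimes> (a \<otimes> c) \<otimes> (a \<otimes> c) = \<one>"
  obtains L where "finite L" "card L \<le> 60" "generate G {a, c} \<subseteq> L"
proof -
  define d where "d = inv c"
  have d: "d \<in> carrier G" "c \<otimes> d = \<one>" "d \<otimes> c = \<one>" using c by (simp_all add: d_def)
  have cd: "c \<otimes> (d \<otimes> x) = x" "d \<otimes> (c \<otimes> x) = x" if "x \<in> carrier G" for x
    using that c d by (simp_all flip: m_assoc)
  have aa: "a \<otimes> (a \<otimes> x) = x" if "x \<in> carrier G" for x
    using that a by (simp flip: m_assoc)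
  have ccc: "c \<otimes> (c \<otimes> c) = d \<otimes> d"
  proof -
    have "c \<otimes> (c \<otimes> (c \<otimes> (c \<otimes> c))) = \<one>" using c by (simp add: pow_five m_assoc)
    then have "d \<otimes> (d \<otimes> (c \<otimes> (c \<otimes> (c \<otimes> (c \<otimes> c))))) = d \<otimes> (d \<otimes> \<one>)" by simp
    then show ?thesis using c d by (simp add: cd)
  qed
  have ddd: "d \<otimes> (d \<otimes> d) = c \<otimes> c"
  proof -
    have "d \<otimes> (d \<otimes> d) = d \<otimes> (c \<otimes> (c \<otimes> c))" using ccc by simp
    then show ?thesis using c d by (simp add: cd)
  qed
  have ccc': "c \<otimes> (c \<otimes> (c \<otimes> x)) = d \<otimes> (d \<otimes> x)" and ddd': "d \<otimes> (d \<otimes> (d \<otimes> x)) = c \<otimes> (c \<otimes> x)"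
    if "x \<in> carrier G" for x
    using that c d ccc ddd m_assoc by (metis m_closed)+
  define k where "k = a \<otimes> (c \<otimes> (c \<otimes> a))"
  define h where "h = a \<otimes> (d \<otimes> (d \<otimes> k))"
  have kh: "k \<in> carrier G" "h \<in> carrier G" using a c d by (simp_all add: k_def h_def)
  note w = a(1) c(1) d cd aa ccc ddd ccc' ddd' m_assoc kh
  have inv_a: "inv a = a" and inv_d: "inv d = c" using a c by (simp_all add: d_def inv_equality)
  have aca0: "a \<otimes> c \<otimes> a = d \<otimes> a \<otimes> d"
  proof -
    have "inv (c \<otimes> a \<otimes> c) = a \<otimes> c \<otimes> a" by (rule inv_equality) (use ac a c in \<open>simp_all add: m_assoc\<close>)
    then show ?thesis using a c by (simp add: inv_mult_group inv_a m_assoc d_def)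
  qed
  then have "inv (a \<otimes> c \<otimes> a) = inv (d \<otimes> a \<otimes> d)" by simp
  then have ada0: "a \<otimes> d \<otimes> a = c \<otimes> a \<otimes> c" using a c d by (simp add: inv_mult_group inv_a inv_d m_assoc flip: d_def)
  have aca: "a \<otimes> (c \<otimes> (a \<otimes> x)) = d \<otimes> (a \<otimes> (d \<otimes> x))" if "x \<in> carrier G" for x
    using arg_cong[OF aca0, of "\<lambda>u. u \<otimes> x"] that a c d by (simp add: m_assoc)
  have ada: "a \<otimes> (d \<otimes> (a \<otimes> x)) = c \<otimes> (a \<otimes> (c \<otimes> x))" if "x \<in> carrier G" for x
    using arg_cong[OF ada0, of "\<lambda>u. u \<otimes> x"] that a c d by (simp add: m_assoc)
  have aka: "a \<otimes> (c \<otimes> (c \<otimes> (a \<otimes> x))) = k \<otimes> x" if "x \<in> carrier G" for x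
    using that a c by (simp add: k_def m_assoc)
  have k_eq: "k \<otimes> x = d \<otimes> (a \<otimes> (d \<otimes> (d \<otimes> (a \<otimes> (d \<otimes> x)))))" if "x \<in> carrier G" for x
  proof -
    have "k \<otimes> x = a \<otimes> (c \<otimes> (a \<otimes> (a \<otimes> (c \<otimes> (a \<otimes> x)))))" using that by (simp add: k_def w)
    also have "\<dots> = a \<otimes> (c \<otimes> (a \<otimes> (d \<otimes> (a \<otimes> (d \<otimes> x)))))" using that w(1-5) by (simp add: aca)
    also have "\<dots> = d \<otimes> (a \<otimes> (d \<otimes> (d \<otimes> (a \<otimes> (d \<otimes> x)))))" using that w(1-5) by (simp add: aca)
    finally show ?thesis .
  qed
  have addA: "a \<otimes> (d \<otimes> (d \<otimes> (a \<otimes> x))) = c \<otimes> (k \<otimes> (c \<otimes> x))" if "x \<in> carrier G" for x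
    using that by (simp add: k_eq w)
  have ack: "a \<otimes> (c \<otimes> (k \<otimes> x)) = d \<otimes> (d \<otimes> (a \<otimes> (d \<otimes> x)))" if "x \<in> carrier G" for x
  proof -
    have "a \<otimes> (c \<otimes> (k \<otimes> x)) = a \<otimes> (c \<otimes> (a \<otimes> (c \<otimes> (c \<otimes> (a \<otimes> x)))))" using that by (simp add: k_def w)
    also have "\<dots> = d \<otimes> (a \<otimes> (d \<otimes> (c \<otimes> (c \<otimes> (a \<otimes> x)))))" by (rule aca) (use that w in simp)
    also have "\<dots> = d \<otimes> (a \<otimes> (c \<otimes> (a \<otimes> x)))" using that by (simp add: w)
    finally show ?thesis using that aca by simp
  qed
  have acck: "a \<otimes> (c \<otimes> (c \<otimes> (k \<otimes> x))) = d \<otimes> (k \<otimes> (d \<otimes> x))" if "x \<in> carrier G" for x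
  proof -
    have "a \<otimes> (c \<otimes> (c \<otimes> (k \<otimes> x))) = k \<otimes> (c \<otimes> (c \<otimes> (a \<otimes> x)))"
      using that by (simp add: k_def w)
    also have "\<dots> = d \<otimes> (a \<otimes> (d \<otimes> (d \<otimes> (a \<otimes> (c \<otimes> (a \<otimes> x))))))"
      using that by (simp add: k_eq w)
    also have "\<dots> = d \<otimes> (a \<otimes> (d \<otimes> (d \<otimes> (d \<otimes> (a \<otimes> (d \<otimes> x))))))" using that aca by simp
    also have "\<dots> = d \<otimes> (a \<otimes> (c \<otimes> (c \<otimes> (a \<otimes> (d \<otimes> x)))))" using that w(1-5) ddd' by simp
    finally show ?thesis using that w(1-5) aka by simp
  qed
  have addk: "a \<otimes> (d \<otimes> (d \<otimes> (k \<otimes> x))) = h \<otimes> x" if "x \<in> carrier G" for x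
    using that kh w(1-5) by (simp add: h_def m_assoc)
  have adk: "a \<otimes> (d \<otimes> (k \<otimes> x)) = c \<otimes> (c \<otimes> (k \<otimes> (c \<otimes> x)))" if "x \<in> carrier G" for x
  proof -
    have "a \<otimes> (d \<otimes> (k \<otimes> x)) = a \<otimes> (d \<otimes> (a \<otimes> (c \<otimes> (c \<otimes> (a \<otimes> x)))))" using that by (simp add: k_def w)
    also have "\<dots> = c \<otimes> (a \<otimes> (c \<otimes> (c \<otimes> (c \<otimes> (a \<otimes> x)))))" by (rule ada) (use that w in simp)
    also have "\<dots> = c \<otimes> (a \<otimes> (d \<otimes> (d \<otimes> (a \<otimes> x))))" using that by (simp add: w)
    finally show ?thesis using that addA by simp
  qed
  have hx: "h \<otimes> x = c \<otimes> (h \<otimes> (c \<otimes> x))" if "x \<in> carrier G" for x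
  proof -
    have "h \<otimes> x = a \<otimes> (d \<otimes> (d \<otimes> (a \<otimes> (c \<otimes> (c \<otimes> (a \<otimes> x))))))" using that by (simp add: h_def k_def w)
    also have "\<dots> = c \<otimes> (k \<otimes> (c \<otimes> (c \<otimes> (c \<otimes> (a \<otimes> x)))))" by (rule addA) (use that w in simp)
    also have "\<dots> = c \<otimes> (a \<otimes> (c \<otimes> (c \<otimes> (a \<otimes> (d \<otimes> (d \<otimes> (a \<otimes> x)))))))" using that by (simp add: k_def w)
    also have "\<dots> = c \<otimes> (a \<otimes> (c \<otimes> (c \<otimes> (c \<otimes> (k \<otimes> (c \<otimes> x))))))" using that addA by simp
    also have "\<dots> = c \<otimes> (a \<otimes> (d \<otimes> (d \<otimes> (k \<otimes> (c \<otimes> x)))))" using that kh w(1-5) ccc' by simp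
    finally show ?thesis using that w(1-5) addk by simp
  qed
  have ch: "c \<otimes> (h \<otimes> x) = h \<otimes> (d \<otimes> x)" if "x \<in> carrier G" for x
    using hx[of "d \<otimes> x"] that w(1-5) by (simp add: cd)
  have ah: "a \<otimes> (h \<otimes> x) = d \<otimes> (d \<otimes> (k \<otimes> x))" if "x \<in> carrier G" for x
    using that kh w(1-5) by (simp add: h_def m_assoc aa)
  define C where "C = {\<one>, c, c \<otimes> c, d \<otimes> d, d}"
  have C: "x \<in> carrier G" if "x \<in> C" for x using that w(1-5) by (auto simp: C_def)
  have cC: "c \<otimes> x \<in> C" "d \<otimes> x \<in> C" if "x \<in> C" for x
    using that w(1-5) by (auto simp: C_def ccc ddd cd)
  define L where "L = C \<union> (\<lambda>(x, y). x \<otimes> (a \<otimes> y)) ` (C \<times> C) \<union> (\<lambda>(x, y). x \<otimes> (k \<otimes> y)) ` (C \<times> C) \<union> (\<lambda>y. h \<otimes> y) ` C"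
  have pairs: "(\<lambda>(x, y). f x y) ` (C \<times> C) = {f x y |x y. x \<in> C \<and> y \<in> C}" for f :: "'a \<Rightarrow> 'a \<Rightarrow> 'a"
    by auto
  have LI: "x \<in> C \<Longrightarrow> x \<in> L" "x \<in> C \<Longrightarrow> y \<in> C \<Longrightarrow> x \<otimes> (a \<otimes> y) \<in> L"
    "x \<in> C \<Longrightarrow> y \<in> C \<Longrightarrow> x \<otimes> (k \<otimes> y) \<in> L" "y \<in> C \<Longrightarrow> h \<otimes> y \<in> L" for x y
    unfolding L_def pairs by blast+
  have C1: "\<one> \<in> C" "c \<in> C" "d \<in> C" "c \<otimes> c \<in> C" "d \<otimes> d \<in> C" by (simp_all add: C_def)
  have L1: "a \<otimes> y \<in> L" "k \<otimes> y \<in> L" "c \<otimes> (a \<otimes> y) \<in> L" "c \<otimes> (k \<otimes> y) \<in> L" "d \<otimes> (a \<otimes> y) \<in> L" "d \<otimes> (k \<otimes> y) \<in> L"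
    "c \<otimes> (c \<otimes> (k \<otimes> y)) \<in> L" "d \<otimes> (d \<otimes> (a \<otimes> y)) \<in> L" "d \<otimes> (d \<otimes> (k \<otimes> y)) \<in> L" if "y \<in> C" for y
    using LI(2)[OF C1(1) that] LI(3)[OF C1(1) that] LI(2)[OF C1(2) that] LI(3)[OF C1(2) that]
      LI(2)[OF C1(3) that] LI(3)[OF C1(3) that] LI(3)[OF C1(4) that] LI(2)[OF C1(5) that] LI(3)[OF C1(5) that]
      C[OF that] w(1-5) kh by (simp_all add: m_assoc)
  have L: "x \<in> carrier G" if "x \<in> L" for x using that C w(1-5) kh by (auto simp: L_def)
  have cL: "c \<otimes> x \<in> L" if x: "x \<in> L" for x
  proof -
    consider "x \<in> C" | u v where "u \<in> C" "v \<in> C" "x = u \<otimes> (a \<otimes> v)" | u v where "u \<in> C" "v \<in> C" "x = u \<otimes> (k \<otimes> v)"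
      | v where "v \<in> C" "x = h \<otimes> v" using x unfolding L_def pairs by blast
    then show ?thesis
    proof cases
      case 1 then show ?thesis using cC LI(1) by blast
    next
      case (2 u v) then show ?thesis using LI(2)[OF cC(1)[OF 2(1)] 2(2)] C w(1-5) by (simp add: m_assoc)
    next
      case (3 u v) then show ?thesis using LI(3)[OF cC(1)[OF 3(1)] 3(2)] C w(1-5) kh by (simp add: m_assoc)
    next
      case (4 v) then show ?thesis using LI(4)[OF cC(2)[OF 4(1)]] ch[OF C[OF 4(1)]] by simp
    qed
  qed
  have aL: "a \<otimes> x \<in> L" if x: "x \<in> L" for x
  proof -
    have five: P if "u \<in> C" "u = \<one> \<Longrightarrow> P" "u = c \<Longrightarrow> P" "u = c \<otimes> c \<Longrightarrow> P" "u = d \<otimes> d \<Longrightarrow> P" "u = d \<Longrightarrow> P" for u P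
      using that unfolding C_def by blast
    consider "x \<in> C" | u v where "u \<in> C" "v \<in> C" "x = u \<otimes> (a \<otimes> v)" | u v where "u \<in> C" "v \<in> C" "x = u \<otimes> (k \<otimes> v)"
      | v where "v \<in> C" "x = h \<otimes> v" using x unfolding L_def pairs by blast
    then show ?thesis
    proof cases
      case 1 then show ?thesis by (rule L1)
    next
      case (2 u v)
      note v = C[OF 2(2)] 2(3) w(1-5) m_assoc
      note v' = cC[OF 2(2)]
      from 2(1) show ?thesis
      proof (rule five)
        assume "u = \<one>" then show ?thesis using v LI(1)[OF 2(2)] by (simp add: aa)
      next
        assume "u = c" then show ?thesis using v L1(5)[OF v'(2)] by (simp add: aca)
      next
        assume "u = c \<otimes> c" then show ?thesis using v L1(2)[OF 2(2)] by (simp add: aka)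
      next
        assume "u = d \<otimes> d" then show ?thesis using v L1(4)[OF v'(1)] by (simp add: addA)
      next
        assume "u = d" then show ?thesis using v L1(3)[OF v'(1)] by (simp add: ada)
      qed
    next
      case (3 u v)
      note v = C[OF 3(2)] 3(3) w(1-5) kh m_assoc
      note v' = cC[OF 3(2)]
      from 3(1) show ?thesis
      proof (rule five)
        assume "u = \<one>"
        then have "a \<otimes> x = c \<otimes> c \<otimes> (a \<otimes> v)" using v by (simp add: k_def aa)
        then show ?thesis using LI(2)[OF C1(4) 3(2)] by simp
      next
        assume "u = c" then show ?thesis using v L1(8)[OF v'(2)] by (simp add: ack)
      next
        assume "u = c \<otimes> c" then show ?thesis using v L1(6)[OF v'(2)] by (simp add: acck)
      next
        assume "u = d \<otimes> d" then show ?thesis using v LI(4)[OF 3(2)] by (simp add: addk)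
      next
        assume "u = d" then show ?thesis using v L1(7)[OF v'(1)] by (simp add: adk)
      qed
    next
      case (4 v) then show ?thesis using L1(9)[OF 4(1)] ah[OF C[OF 4(1)]] by simp
    qed
  qed
  have dL: "d \<otimes> x \<in> L" if "x \<in> L" for x
  proof -
    have "d \<otimes> x = c \<otimes> (c \<otimes> (c \<otimes> (c \<otimes> x)))" using L[OF that] w(1-5) by (simp add: ccc' cd)
    then show ?thesis using cL that by simp
  qed
  have gen: "\<forall>x\<in>L. g \<otimes> x \<in> L" if "g \<in> generate G {a, c}" for g
    using that
  proof (induction rule: generate.induct)
    case one show ?case using L by simp
  next
    case (incl g) then show ?case using aL cL by blast
  next
    case (inv g)
    have "inv a = a" using a by (simp add: inv_equality)
    then show ?case using inv aL dL unfolding d_def by (metis insertE singletonD)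
  next
    case (eng g g')
    have "g \<in> carrier G" "g' \<in> carrier G"
      using eng.hyps generate_in_carrier[of "{a, c}"] a(1) c(1) by blast+
    then show ?case using eng.IH L by (simp add: m_assoc)
  qed
  have "generate G {a, c} \<subseteq> L"
  proof
    fix g assume g: "g \<in> generate G {a, c}"
    then have "g \<in> carrier G" using generate_in_carrier[of "{a, c}"] a(1) c(1) by blast
    then show "g \<in> L" using gen[OF g] LI(1)[OF C1(1)] by (metis r_one)
  qed
  moreover have fC: "finite C" by (simp add: C_def)
  then have "finite L" by (simp add: L_def)
  moreover have "card L \<le> 60"
  proof -
    have "card C \<le> 5" using card_length[of "[\<one>, c, c \<otimes> c, d \<otimes> d, d]"] by (simp add: C_def)
    then have CC: "card (C \<times> C) \<le> 25" using mult_le_mono[of "card C" 5 "card C" 5] by (simp add: card_cartesian_product)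
    have "card L \<le> card C + card (C \<times> C) + card (C \<times> C) + card C"
      unfolding L_def
      by (intro order.trans[OF card_Un_le] add_mono card_image_le order.refl finite_cartesian_product fC)
    then show ?thesis using CC \<open>card C \<le> 5\<close> by linarith
  qed
  ultimately show thesis using that by blast
qed

fun first6 :: "six \<Rightarrow> bool" where "first6 (Six s0 s1 s2 s3 s4 s5) = s0"

lemma first6_plus: "first6 (plus6 s t) = (first6 s \<noteq> first6 t)"
  by (cases s; cases t) simp

text \<open>
  The two conditions bound the kernel from above and from below. Only finite subgroups occur in the
  Frattini condition: their preimages are closed whatever the topology of the kernel is.
\<close>

locale elementary_frattini = elementary_kernel +
  assumes finite_frattini: "subgroup H G \<Longrightarrow> finite H \<Longrightarrow> p ` H = alt5 \<Longrightarrow> H = carrier G"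
    and large_kernel: "\<exists>x\<in>carrier G. \<exists>y\<in>carrier G. p x = 1 \<and> p y = 1 \<and> x \<noteq> \<one> \<and> y \<noteq> \<one> \<and> x \<noteq> y"

locale good_generators = elementary_frattini +
  fixes b c
  assumes b: "b \<in> carrier G" "p b = beta" "b \<otimes> b \<otimes> b = \<one>"
    and c: "c \<in> carrier G" "p c = gam" "c [^] (5::nat) = \<one>"
    and delta_fixes: "act delta (c \<otimes> inv b \<otimes> (c \<otimes> inv b)) = c \<otimes> inv b \<otimes> (c \<otimes> inv b)"
begin

definition a where "a = c \<otimes> inv b"

lemma a: "a \<in> carrier G" "p a = alpha"
proof -
  show "a \<in> carrier G" using b c by (simp add: a_def)
  have "gam = alpha * beta" by code_simp
  then have "gam * Z = alpha * (beta * Z)" for Z by (metis mult.assoc)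
  then show "p a = alpha" using b c p_inv(1)[OF b(1)] by (simp add: a_def p_mult)
qed

text \<open>
  The conjugates of \<open>a\<^sup>2\<close>, indexed by group elements; they depend only on the
  coset of the dihedral stabilizer.
\<close>

definition w where "w X = act X (a \<otimes> a)"

lemma aa_ker: "a \<otimes> a \<in> ker"
proof -
  have "alpha * alpha = 1" by code_simp
  then show ?thesis using a by (simp add: ker_def p_mult)
qed

lemma w_ker: "X \<in> alt5 \<Longrightarrow> w X \<in> ker"
  by (simp add: w_def act_ker aa_ker)

lemma w_one: "w 1 = a \<otimes> a"
  by (simp add: w_def act_one aa_ker)

lemma act_w: "X \<in> alt5 \<Longrightarrow> Y \<in> alt5 \<Longrightarrow> act X (w Y) = w (X * Y)"
  by (simp add: w_def act_mult aa_ker)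

lemma w_stab: "D \<in> set stab_list \<Longrightarrow> w D = w 1"
proof -
  assume D: "D \<in> set stab_list"
  note A = beta_gam_alt5
  have 1: "w delta = w 1" unfolding w_one unfolding w_def a_def by (rule delta_fixes)
  have 2: "w alpha = w 1"
    unfolding w_one unfolding w_def using act_eq[OF a(1) aa_ker] a by (simp add: group_word)
  have 3: "w (delta * X) = w 1" if "X \<in> alt5" "w X = w 1" for X
    using act_w[OF A(4) that(1)] act_w[OF A(4) alt5_one] that 1 by simp
  have 4: "w (alpha * X) = w 1" if "X \<in> alt5" "w X = w 1" for X
    using act_w[OF A(1) that(1)] act_w[OF A(1) alt5_one] that 2 by simp
  have "D \<in> set [1, delta, delta * delta, delta * (delta * delta), delta * (delta * (delta * delta)),
    alpha, delta * alpha, delta * (delta * alpha), delta * (delta * (delta * alpha)), delta * (delta * (delta * (delta * alpha)))]"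
    using D unfolding stab_list_def by (simp only: list.map concat.simps append.simps mult.assoc mult_1_left mult_1_right list.set) blast
  then show ?thesis
    using 1 2 3 A alt5_mult by simp (elim disjE; simp)
qed

lemma w_move:
  assumes "list_ex (\<lambda>D. X * Y = Z * D) stab_list" "X \<in> alt5" "Y \<in> alt5" "Z \<in> alt5"
  shows "act X (w Y) = w Z"
proof -
  obtain D where D: "D \<in> set stab_list" "X * Y = Z * D" using assms(1) by (auto simp: list_ex_iff)
  have "list_all (\<lambda>D. D \<in> set alt5_list) stab_list" by code_simp
  then have "D \<in> alt5" using D(1) by (auto simp: list_all_iff alt5_eq_list)
  then have "w (Z * D) = act Z (w D)" using act_w assms(4) by simp
  then show ?thesis using act_w[OF assms(2,3)] act_w[OF assms(4) alt5_one] w_stab[OF D(1)] D(2) by simp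
qed

lemma rep_alt5: "rep0 \<in> alt5" "rep1 \<in> alt5" "rep2 \<in> alt5" "rep3 \<in> alt5" "rep4 \<in> alt5" "rep5 \<in> alt5"
  unfolding alt5_eq_list by code_simp+

lemmas w_rep_ker = w_ker[OF rep_alt5(1)] w_ker[OF rep_alt5(2)] w_ker[OF rep_alt5(3)]
  w_ker[OF rep_alt5(4)] w_ker[OF rep_alt5(5)] w_ker[OF rep_alt5(6)]

lemma move_beta:
  "act beta (w rep0) = w rep1" "act beta (w rep1) = w rep4" "act beta (w rep2) = w rep5"
  "act beta (w rep3) = w rep2" "act beta (w rep4) = w rep0" "act beta (w rep5) = w rep3"
  by (rule w_move, code_simp, (rule rep_alt5 beta_gam_alt5)+)+

lemma move_gam:
  "act gam (w rep0) = w rep1" "act gam (w rep1) = w rep2" "act gam (w rep2) = w rep3"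
  "act gam (w rep3) = w rep4" "act gam (w rep4) = w rep0" "act gam (w rep5) = w rep5"
  by (rule w_move, code_simp, (rule rep_alt5 beta_gam_alt5)+)+

lemma move_alpha:
  "act alpha (w rep0) = w rep0" "act alpha (w rep1) = w rep1" "act alpha (w rep2) = w rep4"
  "act alpha (w rep3) = w rep5" "act alpha (w rep4) = w rep2" "act alpha (w rep5) = w rep3"
  by (rule w_move, code_simp, (rule rep_alt5 beta_gam_alt5)+)+

lemma move_nu: "act nu (w rep0) = w rep1"
  by (rule w_move, code_simp, (rule rep_alt5 beta_gam_alt5)+)

definition pw where "pw s x = (if s then x else \<one>)"

lemma pw_ker: "x \<in> ker \<Longrightarrow> pw s x \<in> ker"
  by (simp add: pw_def ker_closed)

lemma pw_add: "x \<in> ker \<Longrightarrow> pw (s \<noteq> t) x = pw s x \<otimes> pw t x"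
  by (cases s; cases t) (simp_all add: pw_def kerD ker_square)

lemma act_pw: "X \<in> alt5 \<Longrightarrow> x \<in> ker \<Longrightarrow> act X (pw s x) = pw s (act X x)"
proof -
  assume X: "X \<in> alt5" "x \<in> ker"
  obtain g where "g \<in> carrier G" "p g = X" using lift X by blast
  then have "act X \<one> = \<one>" using act_eq[of g \<one>] ker_closed by simp
  then show ?thesis by (simp add: pw_def)
qed

text \<open>
  The module homomorphism from vectors to the kernel that sends the unit vectors to the six
  conjugates of \<open>a\<^sup>2\<close>.
\<close>

fun val where
  "val (Six s0 s1 s2 s3 s4 s5) = pw s0 (w rep0) \<otimes> (pw s1 (w rep1) \<otimes> (pw s2 (w rep2) \<otimes>
     (pw s3 (w rep3) \<otimes> (pw s4 (w rep4) \<otimes> pw s5 (w rep5)))))"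

lemma val_ker: "val s \<in> ker"
  by (cases s) (simp add: ker_closed pw_ker w_rep_ker)

lemma val_add: "val (plus6 s t) = val s \<otimes> val t"
proof (cases s, cases t)
  fix s0 s1 s2 s3 s4 s5 t0 t1 t2 t3 t4 t5
  assume "s = Six s0 s1 s2 s3 s4 s5" "t = Six t0 t1 t2 t3 t4 t5"
  moreover have "x0 \<otimes> y0 \<otimes> (x1 \<otimes> y1 \<otimes> (x2 \<otimes> y2 \<otimes> (x3 \<otimes> y3 \<otimes> (x4 \<otimes> y4 \<otimes> (x5 \<otimes> y5))))) =
      x0 \<otimes> (x1 \<otimes> (x2 \<otimes> (x3 \<otimes> (x4 \<otimes> x5)))) \<otimes> (y0 \<otimes> (y1 \<otimes> (y2 \<otimes> (y3 \<otimes> (y4 \<otimes> y5)))))"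
    if "x0 \<in> ker" "x1 \<in> ker" "x2 \<in> ker" "x3 \<in> ker" "x4 \<in> ker" "x5 \<in> ker"
      "y0 \<in> ker" "y1 \<in> ker" "y2 \<in> ker" "y3 \<in> ker" "y4 \<in> ker" "y5 \<in> ker" for x0 x1 x2 x3 x4 x5 y0 y1 y2 y3 y4 y5
    using that by (simp add: ker_ac ker_closed)
  ultimately show ?thesis using w_rep_ker pw_ker by (simp only: plus6.simps val.simps pw_add)
qed

lemma val_zero: "val zero6 = \<one>"
  by (simp add: zero6_def pw_def)

lemma act_val:
  assumes X: "X \<in> alt5"
  shows "act X (val (Six s0 s1 s2 s3 s4 s5)) = pw s0 (act X (w rep0)) \<otimes> (pw s1 (act X (w rep1)) \<otimes>
     (pw s2 (act X (w rep2)) \<otimes> (pw s3 (act X (w rep3)) \<otimes> (pw s4 (act X (w rep4)) \<otimes> pw s5 (act X (w rep5))))))"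
  using w_rep_ker by (simp add: act_hom[OF X] ker_closed pw_ker act_pw[OF X])

lemma reorder:
  assumes "x0 \<in> ker" "x1 \<in> ker" "x2 \<in> ker" "x3 \<in> ker" "x4 \<in> ker" "x5 \<in> ker"
  shows "x0 \<otimes> (x1 \<otimes> (x2 \<otimes> (x3 \<otimes> (x4 \<otimes> x5)))) = x4 \<otimes> (x0 \<otimes> (x3 \<otimes> (x5 \<otimes> (x1 \<otimes> x2))))"
    "x0 \<otimes> (x1 \<otimes> (x2 \<otimes> (x3 \<otimes> (x4 \<otimes> x5)))) = x4 \<otimes> (x0 \<otimes> (x1 \<otimes> (x2 \<otimes> (x3 \<otimes> x5))))"
    "x0 \<otimes> (x1 \<otimes> (x2 \<otimes> (x3 \<otimes> (x4 \<otimes> x5)))) = x0 \<otimes> (x1 \<otimes> (x4 \<otimes> (x5 \<otimes> (x2 \<otimes> x3))))"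
  using assms by (simp_all add: ker_ac ker_closed)

lemma val_beta: "act beta (val s) = val (beta6 s)"
proof (cases s)
  case (Six s0 s1 s2 s3 s4 s5)
  show ?thesis
    unfolding Six act_val[OF beta_gam_alt5(2)] move_beta beta6.simps unfolding val.simps
    by (rule reorder(1)) (intro pw_ker w_rep_ker)+
qed

lemma val_gam: "act gam (val s) = val (gam6 s)"
proof (cases s)
  case (Six s0 s1 s2 s3 s4 s5)
  show ?thesis
    unfolding Six act_val[OF beta_gam_alt5(3)] move_gam gam6.simps unfolding val.simps
    by (rule reorder(2)) (intro pw_ker w_rep_ker)+
qed

lemma val_alpha: "act alpha (val s) = val (alpha6 s)"
proof (cases s)
  case (Six s0 s1 s2 s3 s4 s5)
  show ?thesis
    unfolding Six act_val[OF beta_gam_alt5(1)] move_alpha alpha6.simps unfolding val.simps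
    by (rule reorder(3)) (intro pw_ker w_rep_ker)+
qed

lemma act_closed:
  assumes Z: "Z \<subseteq> ker" "\<And>x. x \<in> Z \<Longrightarrow> act beta x \<in> Z" "\<And>x. x \<in> Z \<Longrightarrow> act gam x \<in> Z"
    and x: "X \<in> alt5" "x \<in> Z"
  shows "act X x \<in> Z"
proof -
  have "alt5 \<subseteq> {X \<in> alt5. \<forall>x\<in>Z. act X x \<in> Z}"
  proof (rule beta_gam_generate)
    show "u * v \<in> {X \<in> alt5. \<forall>x\<in>Z. act X x \<in> Z}"
      if "u \<in> {X \<in> alt5. \<forall>x\<in>Z. act X x \<in> Z}" "v \<in> {X \<in> alt5. \<forall>x\<in>Z. act X x \<in> Z}" for u v
      using that Z(1) act_mult[of u v] alt5_mult by (simp add: subset_iff)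
  qed (use Z beta_gam_alt5 alt5_one act_one in \<open>simp_all add: subset_iff\<close>)
  then show ?thesis using x by blast
qed

lemma normal_of_act:
  assumes Z: "Z \<subseteq> ker" "\<one> \<in> Z" "\<And>x y. x \<in> Z \<Longrightarrow> y \<in> Z \<Longrightarrow> x \<otimes> y \<in> Z"
    "\<And>x. x \<in> Z \<Longrightarrow> act beta x \<in> Z" "\<And>x. x \<in> Z \<Longrightarrow> act gam x \<in> Z"
  shows "Z \<lhd> G"
proof (rule normal_invI)
  show "subgroup Z G"
  proof (rule subgroupI)
    show "inv x \<in> Z" if "x \<in> Z" for x using that Z(1) kernel_inv kerD by (metis subsetD)
    show "Z \<subseteq> carrier G" using Z(1) kerD(1) by auto
    show "Z \<noteq> {}" using Z(2) by auto
    show "x \<otimes> y \<in> Z" if "x \<in> Z" "y \<in> Z" for x y using Z(3) that by simp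
  qed
  show "g \<otimes> x \<otimes> inv g \<in> Z" if "g \<in> carrier G" "x \<in> Z" for g x
  proof -
    have "act (p g) x \<in> Z" by (rule act_closed[OF Z(1,4,5) p_alt5[OF that(1)] that(2)])
    then show ?thesis by (simp only: act_eq[OF that(1) subsetD[OF Z(1) that(2)]])
  qed
qed

abbreviation W where "W \<equiv> range val"

lemma W_normal: "W \<lhd> G"
proof (rule normal_of_act)
  have "val zero6 \<in> W" by simp
  then show "\<one> \<in> W" by (simp only: val_zero)
  show "x \<otimes> y \<in> W" if "x \<in> W" "y \<in> W" for x y using that by (auto simp flip: val_add)
  show "act beta x \<in> W" "act gam x \<in> W" if "x \<in> W" for x using that val_beta val_gam by auto
qed (use val_ker in blast)

lemma finite_six: "finite (UNIV :: six set)"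
  using in_six_list finite_subset[of UNIV "set six_list"] by blast

text \<open>
  In the quotient by \<open>W\<close> the presentation applies and bounds the subgroup generated by
  \<open>a\<close> and \<open>c\<close>. Its preimage is a finite subgroup that maps onto
  \<open>A\<^sub>5\<close>, so it is the whole group.
\<close>

lemma card_quotient: "finite (carrier G)" "card (carrier (G Mod W)) \<le> 60"
proof -
  interpret W: normal W G by (rule W_normal)
  interpret Q: group "G Mod W" by (rule W.factorgroup_is_group)
  let ?q = "\<lambda>x. W #> x"
  have q: "?q x \<in> carrier (G Mod W)" if "x \<in> carrier G" for x using that by (simp add: carrier_FactGroup)
  have qm: "?q (x \<otimes> y) = ?q x \<otimes>\<^bsub>G Mod W\<^esub> ?q y" if "x \<in> carrier G" "y \<in> carrier G" for x y
    using that W.rcos_sum by simp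
  have q1: "?q x = \<one>\<^bsub>G Mod W\<^esub>" if "x \<in> W" for x using W.rcos_const[OF is_group that] by simp
  note mult_FactGroup [simp del] one_FactGroup [simp del]
  have aw: "a \<otimes> a \<in> W"
  proof -
    have "val (Six True False False False False False) = a \<otimes> a"
      using kerD(1)[OF aa_ker] w_one by (simp add: pw_def rep0_def)
    then show ?thesis by (metis rangeI)
  qed
  have qa: "?q a \<otimes>\<^bsub>G Mod W\<^esub> ?q a = \<one>\<^bsub>G Mod W\<^esub>" using q1[OF aw] qm a by simp
  have qc: "?q c [^]\<^bsub>G Mod W\<^esub> (5::nat) = \<one>\<^bsub>G Mod W\<^esub>"
    using q1[of \<one>] W.one_closed c W.FactGroup_pow[of c 5] by simp
  have "?q b = ?q a \<otimes>\<^bsub>G Mod W\<^esub> ?q c"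
  proof -
    have "?q c = ?q a \<otimes>\<^bsub>G Mod W\<^esub> ?q b" using b c a qm[of a b] by (simp add: a_def m_assoc)
    then have "?q a \<otimes>\<^bsub>G Mod W\<^esub> ?q c = ?q a \<otimes>\<^bsub>G Mod W\<^esub> ?q a \<otimes>\<^bsub>G Mod W\<^esub> ?q b"
      using q a b by (simp add: Q.m_assoc)
    then show ?thesis using qa q b by simp
  qed
  moreover have "?q b \<otimes>\<^bsub>G Mod W\<^esub> ?q b \<otimes>\<^bsub>G Mod W\<^esub> ?q b = \<one>\<^bsub>G Mod W\<^esub>"
    using qm b q1[of \<one>] W.one_closed by (metis m_closed)
  ultimately obtain L where L: "finite L" "card L \<le> 60" "generate (G Mod W) {?q a, ?q c} \<subseteq> L"
    using Q.icosahedral_presentation[OF q[OF a(1)] qa q[OF c(1)] qc] by metis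
  define H where "H = {g \<in> carrier G. ?q g \<in> generate (G Mod W) {?q a, ?q c}}"
  have gen: "subgroup (generate (G Mod W) {?q a, ?q c}) (G Mod W)"
    by (rule Q.generate_is_subgroup) (use q a c in blast)
  have sub: "subgroup H G"
  proof (rule subgroupI)
    show "H \<subseteq> carrier G" by (auto simp: H_def)
    have "\<one> \<in> H" using q1[of \<one>] W.one_closed subgroup.one_closed[OF gen] by (simp add: H_def)
    then show "H \<noteq> {}" by blast
    show "x \<otimes> y \<in> H" if "x \<in> H" "y \<in> H" for x y
      using that qm subgroup.m_closed[OF gen] by (simp add: H_def)
    show "inv x \<in> H" if "x \<in> H" for x
    proof -
      have x: "x \<in> carrier G" "?q x \<in> generate (G Mod W) {?q a, ?q c}" using that by (simp_all add: H_def)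
      have "?q (inv x) \<otimes>\<^bsub>G Mod W\<^esub> ?q x = \<one>\<^bsub>G Mod W\<^esub>"
        using qm[of "inv x" x] x q1[of \<one>] W.one_closed by simp
      then have "?q (inv x) = inv\<^bsub>G Mod W\<^esub> (?q x)" using Q.inv_equality q x by simp
      then show ?thesis using x subgroup.m_inv_closed[OF gen x(2)] by (simp add: H_def)
    qed
  qed
  have "finite Y" if "Y \<in> carrier (G Mod W)" for Y
    using that finite_six by (auto simp: carrier_FactGroup r_coset_def UNION_singleton_eq_range)
  then have "finite (\<Union> (generate (G Mod W) {?q a, ?q c}))"
    using finite_subset[OF L(3,1)] subgroup.subset[OF gen] by blast
  moreover have "H \<subseteq> \<Union> (generate (G Mod W) {?q a, ?q c})"
    using rcos_self[OF _ W.is_subgroup] by (auto simp: H_def)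
  ultimately have "finite H" using finite_subset by blast
  have "a \<in> H" "c \<in> H" using a c by (simp_all add: H_def generate.incl)
  have "p ` H = alt5"
  proof
    show "p ` H \<subseteq> alt5" using p_alt5 by (auto simp: H_def)
    have "b = inv a \<otimes> c" using a b c by (simp add: a_def group_word)
    then have "b \<in> H" using subgroup.m_closed[OF sub subgroup.m_inv_closed[OF sub \<open>a \<in> H\<close>] \<open>c \<in> H\<close>] by simp
    show "alt5 \<subseteq> p ` H"
    proof (rule beta_gam_generate)
      show "beta \<in> p ` H" "gam \<in> p ` H" using \<open>b \<in> H\<close> \<open>c \<in> H\<close> b c by (metis imageI)+
      show "1 \<in> p ` H" using subgroup.one_closed[OF sub] p_one by (metis imageI)
      show "u * v \<in> p ` H" if uv: "u \<in> p ` H" "v \<in> p ` H" for u v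
      proof -
        obtain x y where xy: "x \<in> H" "y \<in> H" "u = p x" "v = p y" using uv by blast
        then have "u * v = p (x \<otimes> y)" using subgroup.subset[OF sub] by (simp add: p_mult subset_iff)
        then show ?thesis using subgroup.m_closed[OF sub xy(1,2)] by blast
      qed
    qed
  qed
  then have "H = carrier G" using finite_frattini sub \<open>finite H\<close> by blast
  then show "finite (carrier G)" using \<open>finite H\<close> by simp
  have "carrier (G Mod W) \<subseteq> L"
    using \<open>H = carrier G\<close> L(3) by (auto simp: carrier_FactGroup H_def)
  then show "card (carrier (G Mod W)) \<le> 60" using L card_mono le_trans by blast
qed

text \<open>
  The index of \<open>W\<close> is at most 60, and that of the kernel is 60.
\<close>

lemma ker_eq_W: "ker = W"
proof (rule card_subset_eq[symmetric])
  show "finite ker" using card_quotient(1) by (simp add: ker_def)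
  show "W \<subseteq> ker" using val_ker by blast
  then have "card W \<le> card ker" using \<open>finite ker\<close> card_mono by blast
  moreover have "card ker \<le> card W"
  proof -
    have "order G = card ker * 60"
    proof -
      have finite_alt5: "finite alt5" by (simp add: alt5_eq_list)
      have "card {x \<in> carrier G. p x = X} = card ker" if "X \<in> alt5" for X
      proof -
        obtain g where g: "g \<in> carrier G" "p g = X" using lift \<open>X \<in> alt5\<close> by blast
        have "bij_betw (\<lambda>x. g \<otimes> x) ker {x \<in> carrier G. p x = X}"
        proof (rule bij_betw_byWitness[of _ "\<lambda>x. inv g \<otimes> x"])
          show "(\<lambda>x. inv g \<otimes> x) ` {x \<in> carrier G. p x = X} \<subseteq> ker"
            using g p_inv(2)[OF g(1)] by (auto simp: ker_def p_mult)
        qed (use g in \<open>auto simp: ker_def p_mult group_word\<close>)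
        then show ?thesis by (simp add: bij_betw_same_card)
      qed
      moreover have "carrier G = (\<Union>X\<in>alt5. {x \<in> carrier G. p x = X})" using p_alt5 by blast
      then have "card (carrier G) = (\<Sum>X\<in>alt5. card {x \<in> carrier G. p x = X})"
        using card_UN_disjoint[of alt5 "\<lambda>X. {x \<in> carrier G. p x = X}"] card_quotient(1) finite_alt5 by auto
      ultimately show ?thesis using card_alt5 by (simp add: order_def)
    qed
    moreover have "card (rcosets W) * card W = order G"
      using lagrange normal_imp_subgroup[OF W_normal] by blast
    moreover have "card (rcosets W) \<le> 60" using card_quotient(2) by (simp add: FactGroup_def)
    ultimately have "card ker * 60 \<le> card W * 60" by (metis mult.commute mult_le_mono1)
    then show ?thesis by simp
  qed
  ultimately show "card W = card ker" by simp
qed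

text \<open>
  A lift \<open>n\<close> of an involution that commutes with the image of \<open>a\<close>
  conjugates \<open>a\<close> to \<open>ya\<close> with \<open>y\<close> in the kernel. Squaring
  expresses the second conjugate of \<open>a\<^sup>2\<close> by the first and \<open>y +
  ay\<close>; since \<open>alpha\<close> fixes the first two coordinates, the relation is not
  trivial.
\<close>

lemma ex_relation: "\<exists>s. s \<noteq> zero6 \<and> val s = \<one>"
proof -
  obtain n where n: "n \<in> carrier G" "p n = nu" using lift beta_gam_alt5(5) by blast
  define y where "y = n \<otimes> a \<otimes> inv n \<otimes> inv a"
  have "nu * alpha = alpha * nu" by code_simp
  then have "p (n \<otimes> a) = p (a \<otimes> n)" using n a by (simp add: p_mult)
  moreover have "y = n \<otimes> a \<otimes> inv (a \<otimes> n)" using n a by (simp add: y_def group_word)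
  ultimately have y: "y \<in> ker" using n a p_inv(1)[of "a \<otimes> n"] by (simp add: ker_def p_mult)
  then obtain s where s: "y = val s" using ker_eq_W by blast
  have "w rep1 = n \<otimes> (a \<otimes> a) \<otimes> inv n" using move_nu act_eq[OF n(1) aa_ker] n w_one by (simp add: rep0_def)
  also have "\<dots> = y \<otimes> (a \<otimes> y \<otimes> inv a) \<otimes> (a \<otimes> a)" using n a by (simp add: y_def group_word)
  also have "a \<otimes> y \<otimes> inv a = val (alpha6 s)" using act_eq[OF a(1) y] val_alpha a s by simp
  finally have eq: "w rep1 = val (plus6 s (alpha6 s)) \<otimes> w rep0" using s by (simp add: val_add w_one rep0_def)
  let ?e = "Six True True False False False False"
  have "val ?e = w rep0 \<otimes> w rep1" using w_rep_ker kerD by (simp add: pw_def)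
  also have "\<dots> = val (plus6 s (alpha6 s))"
    unfolding eq using ker_ac ker_square w_rep_ker val_ker ker_closed by (simp add: ker_ac ker_square)
  finally have e: "val ?e = val (plus6 s (alpha6 s))" .
  have "val (plus6 (plus6 s (alpha6 s)) ?e) = \<one>"
    unfolding val_add[of "plus6 s (alpha6 s)"] e by (rule ker_square(1)[OF val_ker])
  moreover have "plus6 (plus6 s (alpha6 s)) ?e \<noteq> zero6" by (cases s) (simp add: zero6_def)
  ultimately show ?thesis by blast
qed

text \<open>
  The kernel of \<open>val\<close> is a nonzero submodule. If it were not the span of the constant
  vector, it would contain the even vectors, and the image would have at most one nontrivial
  element.
\<close>

lemma val_eq_one_iff: "val s = \<one> \<longleftrightarrow> s = zero6 \<or> s = full6"
proof -
  define K where "K = {s. val s = \<one>}"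
  have K: "plus6 s t \<in> K" "beta6 s \<in> K" "gam6 s \<in> K" if "s \<in> K" "t \<in> K" for s t
  proof -
    have "act X \<one> = \<one>" if "X \<in> alt5" for X
    proof -
      obtain g where "g \<in> carrier G" "p g = X" using lift \<open>X \<in> alt5\<close> by blast
      then show ?thesis using act_eq[of g \<one>] ker_closed by simp
    qed
    then show "plus6 s t \<in> K" "beta6 s \<in> K" "gam6 s \<in> K"
      using that by (simp_all add: K_def val_add beta_gam_alt5 flip: val_beta val_gam)
  qed
  have even: "t \<in> K" if "s \<in> K" "s \<noteq> zero6" "s \<noteq> full6" "even6 t" for s t
    by (rule submodule_contains_even[of K s]) (use K that in auto)
  have "full6 \<in> K"
  proof -
    obtain s where "s \<noteq> zero6" "s \<in> K" using ex_relation by (auto simp: K_def)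
    moreover have "even6 full6" by code_simp
    ultimately show ?thesis using even by blast
  qed
  moreover have "s = zero6 \<or> s = full6" if "s \<in> K" for s
  proof (rule ccontr)
    assume "\<not> (s = zero6 \<or> s = full6)"
    then have all: "val t = \<one>" if "even6 t" for t using that even \<open>s \<in> K\<close> by (auto simp: K_def)
    obtain x y where "x \<in> ker" "y \<in> ker" "x \<noteq> \<one>" "y \<noteq> \<one>" "x \<noteq> y"
      using large_kernel by (auto simp: ker_def)
    moreover then obtain u v where uv: "x = val u" "y = val v" using ker_eq_W by blast
    ultimately have "\<not> even6 u" "\<not> even6 v" using all by blast+
    then have "x \<otimes> y = \<one>" using all[of "plus6 u v"] by (simp add: even6_plus val_add uv)
    then have "y = inv x" using eq_inv kerD \<open>x \<in> ker\<close> \<open>y \<in> ker\<close> by blast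
    then show False using kernel_inv kerD \<open>x \<in> ker\<close> \<open>x \<noteq> y\<close> by simp
  qed
  ultimately show ?thesis using val_zero by (auto simp: K_def)
qed

lemma val_eq_iff: "val s = val t \<longleftrightarrow> plus6 s t = zero6 \<or> plus6 s t = full6"
proof -
  have "val s = val t \<longleftrightarrow> val s \<otimes> val t = \<one>"
  proof
    assume "val s \<otimes> val t = \<one>"
    then have "val t = inv (val s)" using eq_inv kerD val_ker by blast
    then show "val s = val t" using kernel_inv kerD val_ker by simp
  qed (use ker_square val_ker in simp)
  then show ?thesis by (simp add: val_eq_one_iff flip: val_add)
qed

text \<open>
  The image of the even vectors; parity makes sense in the kernel because the constant vector of
  length six is even.
\<close>

definition V where "V = val ` {s. even6 s}"

lemma val_in_V: "val s \<in> V \<longleftrightarrow> even6 s"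
proof
  assume "val s \<in> V"
  then obtain t where t: "even6 t" "val s = val t" by (auto simp: V_def)
  have "even6 zero6" "even6 full6" by code_simp+
  then show "even6 s" using t val_eq_iff[of s t] even6_plus[of s t] by metis
qed (simp add: V_def)

lemma V_normal: "V \<lhd> G"
proof (rule normal_of_act)
  have "even6 zero6" by code_simp
  then show "\<one> \<in> V" using val_in_V val_zero by metis
  show "x \<otimes> y \<in> V" if "x \<in> V" "y \<in> V" for x y
    using that by (auto simp: V_def even6_plus simp flip: val_add)
  show "act beta x \<in> V" "act gam x \<in> V" if "x \<in> V" for x
    using that by (auto simp: V_def even6_acts val_beta val_gam)
qed (use val_ker in \<open>auto simp: V_def\<close>)

lemma card_V: "card V = 16"
proof -
  define L where "L = filter (\<lambda>s. even6 s \<and> \<not> first6 s) six_list"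
  have L: "s \<in> set L \<longleftrightarrow> even6 s \<and> \<not> first6 s" for s using in_six_list by (simp add: L_def)
  have "distinct L" "length L = 16" unfolding L_def by code_simp+
  then have "card (set L) = 16" using distinct_card by metis
  moreover have "inj_on val (set L)"
  proof (rule inj_onI)
    fix s t assume st: "s \<in> set L" "t \<in> set L" "val s = val t"
    then have "\<not> first6 (plus6 s t)" by (simp add: L first6_plus)
    then have "plus6 s t \<noteq> full6" by (auto simp: full6_def)
    then show "s = t" using st val_eq_iff plus6_eq_zero by blast
  qed
  moreover have "V = val ` set L"
  proof
    show "val ` set L \<subseteq> V" by (auto simp: V_def L)
    show "V \<subseteq> val ` set L"
    proof
      fix x assume "x \<in> V"
      then obtain s where s: "x = val s" "even6 s" by (auto simp: V_def)
      show "x \<in> val ` set L"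
      proof (cases "s \<in> set L")
        case True then show ?thesis using s by blast
      next
        case False
        have f: "even6 full6" by code_simp
        have "plus6 s full6 \<in> set L"
          using False s(2) f by (simp add: L first6_plus even6_plus) (simp add: full6_def)
        moreover have "val (plus6 s full6) = x" using s val_add val_eq_one_iff kerD val_ker by simp
        ultimately show ?thesis by (metis imageI)
      qed
    qed
  qed
  ultimately show ?thesis by (simp add: card_image)
qed

lemma conj_lift:
  assumes "g \<in> carrier G" "H \<in> alt5" "p g * H = H * Y"
  obtains h where "h \<in> carrier G" "p h = H" "p (inv h \<otimes> g \<otimes> h) = Y"
proof -
  obtain h where h: "h \<in> carrier G" "p h = H" using lift assms(2) by blast
  then have "p (inv h \<otimes> g \<otimes> h) = p (inv h) * (H * Y)" using assms by (simp add: p_mult mult.assoc)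
  also have "\<dots> = Y" using p_inv(2)[OF h(1)] h(2) by (simp flip: mult.assoc)
  finally show thesis using that h by blast
qed

text \<open>
  Up to conjugation the element acts as \<open>beta\<close>, \<open>gam\<close> or a power
  generating the same group.
\<close>

lemma fixed_in_V:
  assumes g: "g \<in> carrier G" "p g \<noteq> 1" "p g ^ 3 = 1 \<or> p g ^ 5 = 1" and x: "x \<in> V" "g \<otimes> x = x \<otimes> g"
  shows "x = \<one>"
proof -
  obtain H where H: "H \<in> alt5" "p g * H = H * beta \<or> p g * H = H * gam \<or> p g * H = H * (gam * gam)"
    using conj_to_generator g p_alt5 by metis
  then obtain Y where Y: "p g * H = H * Y" "Y = beta \<or> Y = gam \<or> Y = gam * gam" by blast
  obtain h where h: "h \<in> carrier G" "p h = H" "p (inv h \<otimes> g \<otimes> h) = Y"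
    using conj_lift[OF g(1) H(1) Y(1)] by blast
  interpret V: normal V G by (rule V_normal)
  define x' where "x' = inv h \<otimes> x \<otimes> h"
  have xG: "x \<in> carrier G" using x V.subset by blast
  have x': "x' \<in> V" using V.inv_op_closed1[OF h(1) x(1)] by (simp add: x'_def)
  then obtain s where s: "x' = val s" "even6 s" by (auto simp: V_def)
  have "inv h \<otimes> g \<otimes> h \<otimes> x' = inv h \<otimes> (g \<otimes> x) \<otimes> h" using h g xG by (simp add: x'_def group_word)
  also have "\<dots> = x' \<otimes> (inv h \<otimes> g \<otimes> h)" unfolding x(2) using h g xG by (simp add: x'_def group_word)
  finally have com: "inv h \<otimes> g \<otimes> h \<otimes> x' = x' \<otimes> (inv h \<otimes> g \<otimes> h)" .
  have x'k: "x' \<in> ker" using s val_ker by simp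
  have "act Y x' = inv h \<otimes> g \<otimes> h \<otimes> x' \<otimes> inv (inv h \<otimes> g \<otimes> h)"
    using act_eq[of "inv h \<otimes> g \<otimes> h" x'] h g x'k by simp
  also have "\<dots> = x'" unfolding com using h g kerD(1)[OF x'k] by (simp add: m_assoc)
  finally have fix_Y: "act Y x' = x'" .
  have "act beta x' = x' \<or> act gam x' = x'"
  proof (cases "Y = gam * gam")
    case True
    note A = beta_gam_alt5(3)
    have "gam * gam * (gam * gam * (gam * gam)) = gam" by code_simp
    moreover have "act (gam * gam * (gam * gam * (gam * gam))) x' = x'"
      using fix_Y True A x'k alt5_mult by (simp add: act_mult)
    ultimately show ?thesis by simp
  qed (use Y fix_Y in blast)
  then have "val s = val (beta6 s) \<or> val s = val (gam6 s)" using s val_beta val_gam by metis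
  then have "s = zero6 \<or> s = full6" using fixed_even(1,2)[OF s(2)] val_eq_iff by blast
  then have "x' = \<one>" using s val_eq_one_iff by simp
  then have "h \<otimes> x' \<otimes> inv h = \<one>" using h by simp
  then show ?thesis using h xG by (simp add: x'_def group_word)
qed

text \<open>
  Every lift of \<open>alpha\<close> is \<open>ya\<close>, with square \<open>y + ay +
  a\<^sup>2\<close>; the first two terms together are even, and \<open>a\<^sup>2\<close> is a unit
  vector.
\<close>

lemma involution_square:
  assumes g: "g \<in> carrier G" "p g \<noteq> 1" "p g * p g = 1"
  shows "g \<otimes> g \<notin> V"
proof
  assume V: "g \<otimes> g \<in> V"
  interpret V: normal V G by (rule V_normal)
  obtain H where "H \<in> alt5" "p g * H = H * alpha" using conj_to_alpha[of "p g"] g p_alt5 by blast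
  then obtain h where h: "h \<in> carrier G" "p (inv h \<otimes> g \<otimes> h) = alpha" using conj_lift g(1) by metis
  define g' where "g' = inv h \<otimes> g \<otimes> h"
  have g': "g' \<in> carrier G" using h g by (simp add: g'_def)
  have "p (g' \<otimes> inv a) = 1" using h a p_inv(1)[OF a(1)] g' by (simp add: p_mult flip: g'_def)
  then have y: "g' \<otimes> inv a \<in> ker" using g' a by (simp add: ker_def)
  then obtain t where t: "g' \<otimes> inv a = val t" using ker_eq_W by blast
  have "g' \<otimes> g' = g' \<otimes> inv a \<otimes> (a \<otimes> (g' \<otimes> inv a) \<otimes> inv a) \<otimes> (a \<otimes> a)"
    using g' a by (simp add: group_word)
  also have "a \<otimes> (g' \<otimes> inv a) \<otimes> inv a = val (alpha6 t)" using act_eq[OF a(1) y] val_alpha a t by simp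
  also have "a \<otimes> a = val (Six True False False False False False)"
    using kerD(1)[OF aa_ker] w_one by (simp add: pw_def rep0_def)
  finally have "g' \<otimes> g' = val (plus6 (plus6 t (alpha6 t)) (Six True False False False False False))"
    using t by (simp add: val_add)
  moreover have "\<not> even6 (plus6 (plus6 t (alpha6 t)) (Six True False False False False False))"
    by (simp add: even6_plus even6_acts)
  moreover have "g' \<otimes> g' = inv h \<otimes> (g \<otimes> g) \<otimes> h" using h g by (simp add: g'_def group_word)
  ultimately show False using val_in_V V.inv_op_closed1[OF h(1) V] by simp
qed

lemma central_kernel:
  assumes x: "x \<in> carrier G" "p x = 1" and com: "\<And>g. g \<in> carrier G \<Longrightarrow> g \<otimes> x = x \<otimes> g"
  shows "x = \<one>"
proof -
  have xk: "x \<in> ker" using x by (simp add: ker_def)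
  then obtain s where s: "x = val s" using ker_eq_W by blast
  have "act (p g) x = x" if "g \<in> carrier G" for g
    unfolding act_eq[OF that xk] com[OF that] using that x by (simp add: m_assoc)
  then have "act beta x = x" "act gam x = x" using b c by metis+
  then have "val s = val (beta6 s)" "val s = val (gam6 s)" using s val_beta val_gam by metis+
  then have "s = zero6 \<or> s = full6" using fixed_even(3) val_eq_iff by blast
  then show ?thesis using s val_eq_one_iff by simp
qed

lemma level_one: "level_one G p V"
proof (intro level_one.intro level_one_axioms.intro)
  show "elementary_kernel G p" by (rule elementary_kernel_axioms)
  show "H = carrier G" if "subgroup H G" "p ` H = alt5" for H
    using finite_frattini that card_quotient(1) finite_subset subgroup.subset by metis
  show "p x = 1" if "x \<in> V" for x using that val_ker kerD by (auto simp: V_def)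
  show "x \<otimes> y \<in> V" if xy: "x \<in> carrier G" "p x = 1" "x \<notin> V" "y \<in> carrier G" "p y = 1" "y \<notin> V" for x y
  proof -
    have "x \<in> ker" "y \<in> ker" using xy by (simp_all add: ker_def)
    then obtain s t where "x = val s" "y = val t" unfolding ker_eq_W by blast
    then show ?thesis using xy val_in_V by (simp add: even6_plus flip: val_add)
  qed
qed (fact V_normal card_V fixed_in_V involution_square central_kernel)+

end

theorem (in elementary_frattini) ex_level_one: "\<exists>V. level_one G p V"
proof -
  obtain b c where "b \<in> carrier G" "c \<in> carrier G" "p b = beta" "p c = gam" "b \<otimes> b \<otimes> b = \<one>"
    "c [^] (5::nat) = \<one>" "act delta (c \<otimes> inv b \<otimes> (c \<otimes> inv b)) = c \<otimes> inv b \<otimes> (c \<otimes> inv b)"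
    by (rule good_lifts)
  then interpret good_generators G p b c by unfold_locales
  show ?thesis using level_one by blast
qed

section \<open>Finite Frattini covers\<close>

text \<open>
  An odd prime divisor would give a subgroup of that prime order, which has no elements of order 2.
\<close>

lemma exponent_two_order:
  fixes G (structure)
  assumes "group G" "finite (carrier G)" "\<And>x. x \<in> carrier G \<Longrightarrow> x \<otimes>\<^bsub>G\<^esub> x = \<one>\<^bsub>G\<^esub>"
  shows "\<exists>k. order G = 2 ^ k"
proof -
  interpret group G by fact
  have pos: "order G \<noteq> 0" using assms(2) one_closed by (auto simp: order_def)
  have prime: "q = 2" if q: "prime q" "q dvd order G" for q
  proof -
    obtain m where m: "order G = q ^ 1 * m" using q(2) by (auto elim: dvdE)
    obtain H where H: "subgroup H G" "card H = q ^ 1"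
      using sylow_thm[OF q(1) assms(1) m assms(2)] by blast
    have "1 < card H" using H(2) prime_gt_1_nat[OF q(1)] by simp
    then have "\<not> H \<subseteq> {\<one>}" using card_mono[of "{\<one>}" H] by auto
    then obtain x where x: "x \<in> H" "x \<noteq> \<one>" by blast
    have xG: "x \<in> carrier G" using x(1) subgroup.subset[OF H(1)] by blast
    interpret H: group "G\<lparr>carrier := H\<rparr>" by (rule subgroup_imp_group[OF H(1)])
    have "finite H" using assms(2) subgroup.subset[OF H(1)] finite_subset by blast
    have "H.ord x dvd order (G\<lparr>carrier := H\<rparr>)"
      by (rule H.ord_dvd_group_order) (use x in simp)
    moreover have "H.ord x = 2"
    proof -
      have "x [^]\<^bsub>G\<lparr>carrier := H\<rparr>\<^esub> (2::nat) = \<one>\<^bsub>G\<lparr>carrier := H\<rparr>\<^esub>"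
        using x assms(3)[OF xG] xG by (simp add: numeral_2_eq_2 nat_pow_def)
      then have "H.ord x dvd 2" using x H.pow_eq_id by simp
      moreover have "H.ord x \<noteq> 1" using x H.ord_eq_1 by simp
      ultimately show ?thesis using prime_nat_iff two_is_prime_nat by blast
    qed
    ultimately have "2 dvd q" using H(2) by (simp add: order_def)
    then show "q = 2" using primes_dvd_imp_eq[OF two_is_prime_nat q(1)] by simp
  qed
  obtain m where m: "order G = 2 ^ multiplicity 2 (order G) * m" "\<not> 2 dvd m"
    using multiplicity_decompose'[OF pos, of 2] by auto
  have "m = 1"
  proof (rule ccontr)
    assume "m \<noteq> 1"
    then obtain q where "prime q" "q dvd m" using prime_factor_nat by blast
    moreover then have "q dvd order G" using m(1) by (metis dvd_mult)
    ultimately show False using prime m(2) by blast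
  qed
  then show ?thesis using m(1) by (metis mult.right_neutral)
qed

lemma finite_profinite:
  assumes "group G" "finite (carrier G)"
  shows "profinite_group G (discrete_topology (carrier G))"
proof -
  interpret group G by fact
  show ?thesis
    unfolding profinite_group_def
    by (auto simp: assms compact_space_discrete_topology connected_components_of_discrete_topology
      simp flip: prod_topology_discrete_topology)
qed

lemma finite_p_frattini_cover:
  assumes H: "group H" "finite (carrier H)" and A: "group A" "finite (carrier A)" and f: "f \<in> epi H A"
    and frattini: "\<And>K. subgroup K H \<Longrightarrow> f ` K = carrier A \<Longrightarrow> K = carrier H"
    and square: "\<And>x. x \<in> carrier H \<Longrightarrow> f x = \<one>\<^bsub>A\<^esub> \<Longrightarrow> x \<otimes>\<^bsub>H\<^esub> x = \<one>\<^bsub>H\<^esub>"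
  shows "p_frattini_cover 2 H (discrete_topology (carrier H)) A f"
proof -
  interpret f: group_hom H A f
    using H(1) A(1) f by (simp add: group_hom_def group_hom_axioms_def epi_def)
  let ?K = "kernel H A f"
  have sub: "subgroup ?K H" by (rule f.subgroup_kernel)
  have K: "?K \<subseteq> carrier H" by (rule subgroup.subset[OF sub])
  let ?HK = "H\<lparr>carrier := ?K\<rparr>"
  interpret K: group ?HK by (rule f.G.subgroup_imp_group[OF sub])
  have "frattini_cover H (discrete_topology (carrier H)) A (discrete_topology (carrier A)) f"
    unfolding frattini_cover_def
    using finite_profinite[OF H] finite_profinite[OF A] f frattini by (auto simp: Pi_iff)
  moreover have "pro_p_group 2 ?HK (subtopology (discrete_topology (carrier H)) ?K)"
  proof -
    have fin: "finite ?K" using H(2) K finite_subset by blast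
    have "subtopology (discrete_topology (carrier H)) ?K = discrete_topology (carrier ?HK)"
      using K by (simp add: Int_absorb1)
    moreover have "\<exists>k. order (?HK Mod N) = 2 ^ k" if N: "N \<lhd> ?HK" for N
    proof (rule exponent_two_order)
      interpret N: normal N ?HK by fact
      show "group (?HK Mod N)" by (rule N.factorgroup_is_group)
      show "finite (carrier (?HK Mod N))" using fin by (simp add: carrier_FactGroup)
      fix Y assume "Y \<in> carrier (?HK Mod N)"
      then obtain x where x: "x \<in> ?K" "Y = N #>\<^bsub>?HK\<^esub> x" by (auto simp: carrier_FactGroup)
      have "x \<otimes>\<^bsub>?HK\<^esub> x = \<one>\<^bsub>?HK\<^esub>" using square[of x] x(1) by (simp add: kernel_def)
      then have "Y <#>\<^bsub>?HK\<^esub> Y = N #>\<^bsub>?HK\<^esub> \<one>\<^bsub>?HK\<^esub>" using N.rcos_sum[of x x] x by simp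
      also have "\<dots> = N" using K.coset_mult_one[of N] N.subset by simp
      finally show "Y \<otimes>\<^bsub>?HK Mod N\<^esub> Y = \<one>\<^bsub>?HK Mod N\<^esub>" by simp
    qed
    ultimately show ?thesis
      unfolding pro_p_group_def using finite_profinite[OF K.is_group] fin by simp
  qed
  ultimately show ?thesis unfolding p_frattini_cover_def by blast
qed

text \<open>
  A finite group has a copy carried by sets of natural numbers, the type over which the universal
  property quantifies.
\<close>

lemma finite_copy:
  fixes G :: "('a, 'b) monoid_scheme" (structure)
  assumes "group G" "finite (carrier G)"
  obtains H :: "nat set monoid" and f where "group H" "f \<in> iso H G"
proof -
  interpret group G by fact
  obtain g :: "'a \<Rightarrow> nat" where "inj_on g (carrier G)"
    using assms(2) finite_imp_inj_to_nat_seg by blast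
  define e where "e x = {g x}" for x
  have inj: "inj_on e (carrier G)" using \<open>inj_on g (carrier G)\<close> by (auto simp: e_def inj_on_def)
  let ?r = "inv_into (carrier G) e"
  define H :: "nat set monoid" where
    "H = \<lparr>carrier = e ` carrier G, mult = \<lambda>x y. e (?r x \<otimes> ?r y), one = e \<one>\<rparr>"
  have r: "?r (e x) = x" if "x \<in> carrier G" for x using inj that by simp
  have "group H"
  proof (rule groupI)
    fix x assume "x \<in> carrier H"
    then obtain u where u: "u \<in> carrier G" "x = e u" by (auto simp: H_def)
    then have "e (inv u) \<in> carrier H" "e (inv u) \<otimes>\<^bsub>H\<^esub> x = \<one>\<^bsub>H\<^esub>" by (auto simp: H_def r)
    then show "\<exists>y\<in>carrier H. y \<otimes>\<^bsub>H\<^esub> x = \<one>\<^bsub>H\<^esub>" by blast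
  qed (auto simp: H_def r m_assoc)
  moreover have "?r \<in> iso H G"
  proof -
    have "bij_betw ?r (carrier H) (carrier G)"
      using bij_betw_inv_into[of e "carrier G"] inj by (simp add: H_def bij_betw_def)
    moreover have "?r \<in> hom H G" by (rule homI) (auto simp: H_def r)
    ultimately show ?thesis by (simp add: iso_def)
  qed
  ultimately show thesis using that by blast
qed

section \<open>A cover with a large kernel\<close>

definition ct :: perm5 where "ct = Perm P2 P1 P4 P3 P5"
definition cv :: perm5 where "cv = Perm P3 P4 P1 P2 P5"

fun pt_nat :: "pt \<Rightarrow> nat" where
  "pt_nat P1 = 1" | "pt_nat P2 = 2" | "pt_nat P3 = 3" | "pt_nat P4 = 4" | "pt_nat P5 = 5"

fun first_pair :: "perm5 \<Rightarrow> bool" where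
  "first_pair (Perm x1 x2 x3 x4 x5) \<longleftrightarrow> min (pt_nat x1) (pt_nat x2) < min (pt_nat x3) (pt_nat x4)"

text \<open>
  A permutation of \<open>A\<^sub>5\<close> whose square is right multiplication by the involution
  \<open>ct\<close>. Right multiplication by \<open>cv\<close> interchanges cosets of
  \<open>ct\<close> in pairs, and the condition selects one coset of each pair, so that going back
  and forth picks up one factor \<open>ct\<close>.
\<close>

definition sig :: "perm5 \<Rightarrow> perm5" where
  "sig x = (if first_pair x then x * cv else x * cv * ct)"

lemma sig_alt5: "x \<in> alt5 \<Longrightarrow> sig x \<in> alt5"
proof -
  have "cv \<in> alt5" "ct \<in> alt5" unfolding alt5_eq_list by code_simp+
  then show "x \<in> alt5 \<Longrightarrow> sig x \<in> alt5" by (simp add: sig_def alt5_mult)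
qed

lemma sig_sig: "x \<in> alt5 \<Longrightarrow> sig (sig x) = x * ct"
proof -
  have "\<forall>x\<in>set alt5_list. sig (sig x) = x * ct" by code_simp
  then show "x \<in> alt5 \<Longrightarrow> sig (sig x) = x * ct" by (simp add: alt5_eq_list)
qed

lemma first_pair_sig: "x \<in> alt5 \<Longrightarrow> first_pair (sig x) \<longleftrightarrow> \<not> first_pair x"
  and first_pair_ct: "x \<in> alt5 \<Longrightarrow> first_pair (x * ct) \<longleftrightarrow> first_pair x"
proof -
  have "\<forall>x\<in>set alt5_list. first_pair (sig x) = (\<not> first_pair x)" by code_simp
  then show "x \<in> alt5 \<Longrightarrow> first_pair (sig x) \<longleftrightarrow> \<not> first_pair x" by (simp add: alt5_eq_list)
  have "\<forall>x\<in>set alt5_list. first_pair (x * ct) = first_pair x" by code_simp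
  then show "x \<in> alt5 \<Longrightarrow> first_pair (x * ct) \<longleftrightarrow> first_pair x" by (simp add: alt5_eq_list)
qed

lemma ct: "ct * ct = 1" "ct \<noteq> 1" "ct \<in> alt5" "cv \<in> alt5" "sig 1 = cv" "x * ct * ct = x" "x \<in> alt5 \<Longrightarrow> x * ct \<noteq> x"
proof -
  show 1: "ct * ct = 1" and 2: "ct \<noteq> 1" and "sig 1 = cv" by code_simp+
  show 3: "ct \<in> alt5" and "cv \<in> alt5" unfolding alt5_eq_list by code_simp+
  show "x * ct * ct = x" using 1 by (simp add: mult.assoc)
  show "x \<in> alt5 \<Longrightarrow> x * ct \<noteq> x" using 2 3 alt5_cancel[of x ct 1] alt5_one by auto
qed

text \<open>
  The permutations of \<open>A\<^sub>5\<close> that commute with \<open>sig\<close> and induce a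
  left multiplication on the cosets of \<open>ct\<close>. The cycles of \<open>sig\<close> have
  length 4, and the elements over 1 are sign changes along the cosets.
\<close>

definition monomial :: "(perm5 \<times> (perm5 \<Rightarrow> perm5)) monoid" where
  "monomial = \<lparr>carrier = {(g, f). g \<in> alt5 \<and> f \<in> Bij alt5 \<and> (\<forall>x\<in>alt5. f (sig x) = sig (f x)) \<and>
       (\<forall>x\<in>alt5. f x = g * x \<or> f x = g * x * ct)},
     mult = \<lambda>(g, f) (g', f'). (g * g', compose alt5 f f'), one = (1, \<lambda>x\<in>alt5. x)\<rparr>"

lemma Bij_apply: "f \<in> Bij S \<Longrightarrow> x \<in> S \<Longrightarrow> f x \<in> S"
  by (auto simp: Bij_def bij_betw_def)

lemma group_monomial: "group monomial"
proof (rule groupI)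
  fix X Y assume "X \<in> carrier monomial" "Y \<in> carrier monomial"
  then obtain g f g' f' where XY: "X = (g, f)" "Y = (g', f')" and
    f: "g \<in> alt5" "f \<in> Bij alt5" "\<And>x. x \<in> alt5 \<Longrightarrow> f (sig x) = sig (f x)"
      "\<And>x. x \<in> alt5 \<Longrightarrow> f x = g * x \<or> f x = g * x * ct" and
    f': "g' \<in> alt5" "f' \<in> Bij alt5" "\<And>x. x \<in> alt5 \<Longrightarrow> f' (sig x) = sig (f' x)"
      "\<And>x. x \<in> alt5 \<Longrightarrow> f' x = g' * x \<or> f' x = g' * x * ct"
    by (auto simp: monomial_def)
  have "compose alt5 f f' \<in> Bij alt5" using f(2) f'(2) by (rule compose_Bij)
  moreover have "f (f' x) = g * g' * x \<or> f (f' x) = g * g' * x * ct" if "x \<in> alt5" for x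
    using f(4)[OF Bij_apply[OF f'(2) that]] f'(4)[OF that] ct(6) by (auto simp: mult.assoc[symmetric])
  ultimately show "X \<otimes>\<^bsub>monomial\<^esub> Y \<in> carrier monomial"
    using f f' by (auto simp: XY monomial_def compose_def alt5_mult sig_alt5 Bij_apply)
next
  show "\<one>\<^bsub>monomial\<^esub> \<in> carrier monomial"
    using id_Bij by (auto simp: monomial_def sig_alt5 alt5_one)
next
  fix X Y Z assume "X \<in> carrier monomial" "Y \<in> carrier monomial" "Z \<in> carrier monomial"
  then show "X \<otimes>\<^bsub>monomial\<^esub> Y \<otimes>\<^bsub>monomial\<^esub> Z = X \<otimes>\<^bsub>monomial\<^esub> (Y \<otimes>\<^bsub>monomial\<^esub> Z)"
    by (auto simp: monomial_def mult.assoc compose_def Bij_apply fun_eq_iff)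
next
  fix X assume "X \<in> carrier monomial"
  then show "\<one>\<^bsub>monomial\<^esub> \<otimes>\<^bsub>monomial\<^esub> X = X"
    by (auto simp: monomial_def compose_def Bij_apply Bij_def extensional_def bij_betw_def fun_eq_iff)
next
  fix X assume "X \<in> carrier monomial"
  then obtain g f where X: "X = (g, f)" and
    f: "g \<in> alt5" "f \<in> Bij alt5" "\<And>x. x \<in> alt5 \<Longrightarrow> f (sig x) = sig (f x)"
      "\<And>x. x \<in> alt5 \<Longrightarrow> f x = g * x \<or> f x = g * x * ct"
    by (auto simp: monomial_def)
  obtain h where h: "h \<in> alt5" "g * h = 1" "h * g = 1" using alt5_inverse f(1) by blast
  let ?i = "restrict (inv_into alt5 f) alt5"
  have bij: "bij_betw f alt5 alt5" using f(2) by (simp add: Bij_def)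
  have i: "?i \<in> Bij alt5" using f(2) by (rule restrict_inv_into_Bij)
  have fi: "f (?i x) = x" and ifx: "?i (f x) = x" if "x \<in> alt5" for x
    using bij that Bij_apply[OF f(2) that] by (auto simp: bij_betw_def f_inv_into_f)
  have "?i (sig x) = sig (?i x)" if "x \<in> alt5" for x
  proof -
    have "?i (sig x) = ?i (sig (f (?i x)))" using fi that by simp
    also have "\<dots> = ?i (f (sig (?i x)))" using f(3) Bij_apply[OF i that] by simp
    finally show ?thesis using ifx sig_alt5 Bij_apply[OF i that] by simp
  qed
  moreover have "?i x = h * x \<or> ?i x = h * x * ct" if "x \<in> alt5" for x
  proof -
    have "x = g * ?i x \<or> x = g * ?i x * ct" using f(4)[OF Bij_apply[OF i that]] fi[OF that] by simp
    then have "h * x = h * g * ?i x \<or> h * x = h * g * ?i x * ct" by (metis mult.assoc)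
    then show ?thesis using h(3) ct(6)[of "?i x"] by (metis mult_1_left)
  qed
  ultimately have "(h, ?i) \<in> carrier monomial" using h i by (simp add: monomial_def)
  moreover have "(h, ?i) \<otimes>\<^bsub>monomial\<^esub> X = \<one>\<^bsub>monomial\<^esub>"
    using h ifx by (auto simp: X monomial_def compose_def fun_eq_iff)
  ultimately show "\<exists>Y\<in>carrier monomial. Y \<otimes>\<^bsub>monomial\<^esub> X = \<one>\<^bsub>monomial\<^esub>" by blast
qed

lemma finite_monomial: "finite (carrier monomial)"
proof -
  have fin: "finite alt5" by (simp add: alt5_eq_list)
  have "Bij alt5 \<subseteq> Pi\<^sub>E alt5 (\<lambda>_. alt5)" by (auto simp: Bij_def bij_betw_def PiE_def)
  then have "finite (Bij alt5)" using fin finite_PiE[of alt5 "\<lambda>_. alt5"] finite_subset by blast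
  moreover have "carrier monomial \<subseteq> alt5 \<times> Bij alt5" by (auto simp: monomial_def)
  ultimately show ?thesis using fin finite_subset by blast
qed

lemma monomial_mult: "X \<otimes>\<^bsub>monomial\<^esub> Y = (fst X * fst Y, compose alt5 (snd X) (snd Y))"
  by (simp add: monomial_def case_prod_beta)

lemma monomial_onto: "fst ` carrier monomial = alt5"
proof
  show "fst ` carrier monomial \<subseteq> alt5" by (auto simp: monomial_def)
  show "alt5 \<subseteq> fst ` carrier monomial"
  proof
    fix g assume g: "g \<in> alt5"
    define f where "f = (\<lambda>x\<in>alt5. if first_pair x then g * x else sig (g * (sig x * ct)))"
    have f: "f x = (if first_pair x then g * x else sig (g * (sig x * ct)))" if "x \<in> alt5" for x
      using that by (simp add: f_def)
    have near: "f x = g * x \<or> f x = g * x * ct" if "x \<in> alt5" for x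
    proof (cases "first_pair x")
      case False
      have "cv * ct * ct * cv = 1" "cv * ct * ct * cv * ct = ct" by code_simp+
      then have "x * cv * ct * ct * cv = x" "x * cv * ct * ct * cv * ct = x * ct" by (metis mult.assoc mult_1_right)+
      then show ?thesis using f[OF that] False unfolding sig_def by (auto simp: mult.assoc)
    qed (use f that in simp)
    have comm: "f (sig x) = sig (f x)" if x: "x \<in> alt5" for x
    proof (cases "first_pair x")
      case True
      then show ?thesis using f[OF x] f[OF sig_alt5[OF x]] first_pair_sig[OF x] sig_sig[OF x] ct(6) by simp
    next
      case False
      have "g * (sig x * ct) \<in> alt5" using g x ct(3) sig_alt5 alt5_mult by simp
      then have "sig (sig (g * (sig x * ct))) = g * sig x"
        using sig_sig ct(1) by (simp add: mult.assoc)
      then show ?thesis using f[OF x] f[OF sig_alt5[OF x]] first_pair_sig[OF x] False by simp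
    qed
    have "inj_on f alt5"
    proof (rule inj_onI)
      fix x y assume xy: "x \<in> alt5" "y \<in> alt5" "f x = f y"
      have "g * x = g * y \<or> g * x = g * (y * ct)"
        using near[OF xy(1)] near[OF xy(2)] xy(3) ct(6) by (metis mult.assoc)
      then have c: "x = y \<or> x = y * ct" using alt5_cancel[OF g] xy alt5_mult ct(3) by blast
      then have "first_pair x = first_pair y" using first_pair_ct[OF xy(2)] by auto
      then show "x = y"
      proof (cases "first_pair x")
        case True then show ?thesis using xy f alt5_cancel[OF g] \<open>first_pair x = first_pair y\<close> by simp
      next
        case False
        have m: "g * (sig x * ct) \<in> alt5" "g * (sig y * ct) \<in> alt5" "sig x * ct \<in> alt5" "sig y * ct \<in> alt5"
          using g xy ct(3) sig_alt5 alt5_mult by simp_all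
        have "sig (sig (g * (sig x * ct))) = sig (sig (g * (sig y * ct)))"
          using xy f False \<open>first_pair x = first_pair y\<close> by simp
        then have "g * (sig x * ct) * ct = g * (sig y * ct) * ct" using sig_sig m by simp
        then have "g * sig x = g * sig y" using ct(1) by (simp add: mult.assoc)
        then have "sig x = sig y" using alt5_cancel[OF g] xy sig_alt5 by blast
        then have "x * ct = y * ct" using sig_sig xy by metis
        then show ?thesis using ct(6) by metis
      qed
    qed
    moreover have fc: "f x \<in> alt5" if "x \<in> alt5" for x
      using near[OF that] g that ct(3) alt5_mult by metis
    moreover have "finite alt5" by (simp add: alt5_eq_list)
    ultimately have "f ` alt5 = alt5" by (intro endo_inj_surj) auto
    then have "f \<in> Bij alt5" using \<open>inj_on f alt5\<close> by (simp add: Bij_def bij_betw_def f_def)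
    then have "(g, f) \<in> carrier monomial" using g comm near by (simp add: monomial_def)
    then show "g \<in> fst ` carrier monomial" by force
  qed
qed

lemma monomial_kernel_square:
  assumes "X \<in> carrier monomial" "fst X = 1"
  shows "X \<otimes>\<^bsub>monomial\<^esub> X = \<one>\<^bsub>monomial\<^esub>"
proof -
  obtain f where X: "X = (1, f)" and f: "f \<in> Bij alt5" "\<And>x. x \<in> alt5 \<Longrightarrow> f (sig x) = sig (f x)"
    "\<And>x. x \<in> alt5 \<Longrightarrow> f x = x \<or> f x = x * ct"
    using assms by (auto simp: monomial_def)
  have "f (f x) = x" if x: "x \<in> alt5" for x
  proof (cases "f x = x")
    case False
    then have "f x = x * ct" using f(3)[OF x] by simp
    moreover have "f (x * ct) = f x * ct"
      using f(2) sig_sig x sig_alt5 Bij_apply[OF f(1)] by metis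
    ultimately show ?thesis using ct(6) by simp
  qed simp
  then show ?thesis by (auto simp: X monomial_def compose_def fun_eq_iff)
qed

text \<open>
  If \<open>g\<close> moves a coset like \<open>sig\<close>, then every lift acts there as
  \<open>sig\<close> or its inverse, and its square is multiplication by \<open>ct\<close>; if
  \<open>g\<close> fixes the coset, then the square is trivial there.
\<close>

lemma monomial_square:
  assumes X: "X \<in> carrier monomial" and x: "x \<in> alt5"
  shows "fst X * x = x * cv \<Longrightarrow> snd (X \<otimes>\<^bsub>monomial\<^esub> X) x = x * ct"
    "fst X * x = x * ct \<Longrightarrow> snd (X \<otimes>\<^bsub>monomial\<^esub> X) x = x"
proof -
  obtain g f where X: "X = (g, f)" and f: "f \<in> Bij alt5" "\<And>x. x \<in> alt5 \<Longrightarrow> f (sig x) = sig (f x)"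
    "\<And>x. x \<in> alt5 \<Longrightarrow> f x = g * x \<or> f x = g * x * ct"
    using assms(1) by (auto simp: monomial_def)
  have f_ct: "f (y * ct) = f y * ct" if "y \<in> alt5" for y
    using f(2) sig_sig that sig_alt5 Bij_apply[OF f(1)] by metis
  have sq: "snd (X \<otimes>\<^bsub>monomial\<^esub> X) x = f (f x)" using x by (simp add: X monomial_mult compose_def)
  have sigx: "sig x = x * cv \<or> sig x = x * cv * ct" by (simp add: sig_def)
  show "snd (X \<otimes>\<^bsub>monomial\<^esub> X) x = x * ct" if "fst X * x = x * cv"
  proof -
    have "f x = sig x \<or> f x = sig x * ct"
      using f(3)[OF x] that sigx ct(6) by (auto simp: X)
    then show ?thesis
    proof
      assume "f x = sig x"
      then have "f (f x) = sig (sig x)" using f(2)[OF x] by simp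
      then show ?thesis using sq sig_sig[OF x] by simp
    next
      assume fx: "f x = sig x * ct"
      then have "f (f x) = sig (f x) * ct" using f(2)[OF x] f_ct[OF sig_alt5[OF x]] by simp
      moreover have "sig (sig x * ct) = sig (sig (sig (sig x)))" using sig_sig[OF sig_alt5[OF x]] by simp
      moreover have "\<dots> = x * ct * ct" using sig_sig sig_alt5 x by metis
      ultimately show ?thesis using sq fx ct(6) by simp
    qed
  qed
  show "snd (X \<otimes>\<^bsub>monomial\<^esub> X) x = x" if "fst X * x = x * ct"
  proof -
    have "f x = x * ct \<or> f x = x" using f(3)[OF x] that ct(6) by (auto simp: X)
    then show ?thesis using sq f_ct[OF x] ct(6) by auto
  qed
qed

text \<open>
  A subgroup of minimal order that maps onto \<open>A\<^sub>5\<close> is a Frattini cover.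
\<close>

lemma minimal_supplement:
  "\<exists>H. subgroup H monomial \<and> fst ` H = alt5 \<and>
     (\<forall>K. subgroup K monomial \<and> K \<subseteq> H \<and> fst ` K = alt5 \<longrightarrow> K = H)"
proof -
  interpret M: group monomial by (rule group_monomial)
  let ?P = "\<lambda>K. subgroup K monomial \<and> fst ` K = alt5"
  have "?P (carrier monomial)" using M.subgroup_self monomial_onto by blast
  then obtain H where H: "?P H" "\<And>K. ?P K \<Longrightarrow> card H \<le> card K"
    using ex_has_least_nat[of ?P "carrier monomial" card] by blast
  have "finite H" by (rule finite_subset[OF subgroup.subset[OF conjunct1[OF H(1)]] finite_monomial])
  then have "K = H" if "subgroup K monomial" "K \<subseteq> H" "fst ` K = alt5" for K
    using that H(2)[of K] card_seteq[of H K] by blast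
  then show ?thesis using H(1) by blast
qed

text \<open>
  The kernel elements are the squares of a lift of \<open>cv\<close>, which moves the element 1,
  and of a lift of \<open>ct\<close>, which fixes 1 but moves an element at which \<open>ct\<close>
  acts like \<open>cv\<close>.
\<close>

lemma test_cover:
  "\<exists>(H :: nat set monoid) f k l.
     p_frattini_cover 2 H (discrete_topology (carrier H)) (alt_group 5) f \<and>
     (\<forall>x\<in>carrier H. f x = \<one>\<^bsub>alt_group 5\<^esub> \<longrightarrow> x \<otimes>\<^bsub>H\<^esub> x = \<one>\<^bsub>H\<^esub>) \<and>
     k \<in> carrier H \<and> l \<in> carrier H \<and> f k = \<one>\<^bsub>alt_group 5\<^esub> \<and> f l = \<one>\<^bsub>alt_group 5\<^esub> \<and>
     k \<noteq> \<one>\<^bsub>H\<^esub> \<and> l \<noteq> \<one>\<^bsub>H\<^esub> \<and> k \<noteq> l"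
proof -
  interpret M: group monomial by (rule group_monomial)
  interpret A: group "alt_group 5" by (rule alt_group_is_group)
  let ?A = "alt_group 5"
  from minimal_supplement obtain M where M0: "subgroup M monomial \<and> fst ` M = alt5 \<and>
     (\<forall>K. subgroup K monomial \<and> K \<subseteq> M \<and> fst ` K = alt5 \<longrightarrow> K = M)" by (rule exE)
  have M: "subgroup M monomial" "fst ` M = alt5"
    "\<And>K. subgroup K monomial \<Longrightarrow> K \<subseteq> M \<Longrightarrow> fst ` K = alt5 \<Longrightarrow> K = M"
    using M0 by simp_all
  have MG: "M \<subseteq> carrier monomial" using M(1) by (rule subgroup.subset)
  let ?M = "monomial\<lparr>carrier := M\<rparr>"
  interpret M': group ?M by (rule M.subgroup_imp_group[OF M(1)])
  have "finite (carrier ?M)" using MG finite_monomial finite_subset by auto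
  then obtain H :: "nat set monoid" and h where H: "group H" and h: "h \<in> iso H ?M"
    using finite_copy[OF M'.is_group] by blast
  interpret H: group H by (rule H)
  interpret h: group_hom H ?M h
    using h by (simp add: group_hom_def group_hom_axioms_def iso_def M'.is_group H)
  have h_bij: "bij_betw h (carrier H) M" using h by (simp add: iso_def)
  have h_in: "h x \<in> M" if "x \<in> carrier H" for x using h_bij that bij_betwE by blast
  have finH: "finite (carrier H)" using h_bij \<open>finite (carrier ?M)\<close> by (simp add: bij_betw_finite)
  let ?e = "inv_into (carrier ?A) enc"
  have e: "?e x \<in> carrier ?A" "enc (?e x) = x" if "x \<in> alt5" for x
    using that by (auto simp: alt5_def inv_into_into f_inv_into_f)
  have e_enc: "?e (enc x) = x" if "x \<in> carrier ?A" for x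
    using enc_inj_on that by (rule inv_into_f_f)
  define f where "f x = ?e (fst (h x))" for x
  have p: "fst (h x) \<in> alt5" if "x \<in> carrier H" for x using h_in[OF that] M(2) by blast
  have enc_f: "enc (f x) = fst (h x)" if "x \<in> carrier H" for x using e(2)[OF p[OF that]] by (simp add: f_def)
  have f_one: "f x = \<one>\<^bsub>?A\<^esub> \<longleftrightarrow> fst (h x) = 1" if "x \<in> carrier H" for x
    using enc_f[OF that] e_enc[OF A.one_closed] enc_id by (auto simp: f_def alt_group_one)
  have f_hom: "f \<in> hom H ?A"
  proof (rule homI)
    show "f x \<in> carrier ?A" if "x \<in> carrier H" for x using e(1)[OF p[OF that]] by (simp add: f_def)
    fix x y assume xy: "x \<in> carrier H" "y \<in> carrier H"
    have "h (x \<otimes>\<^bsub>H\<^esub> y) = h x \<otimes>\<^bsub>monomial\<^esub> h y" using h.hom_mult[OF xy] by simp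
    then have "fst (h (x \<otimes>\<^bsub>H\<^esub> y)) = fst (h x) * fst (h y)" by (simp add: monomial_mult)
    also have "\<dots> = enc (f x \<otimes>\<^bsub>?A\<^esub> f y)"
      using enc_mult[of "f x" "f y"] e(1)[OF p[OF xy(1)]] e(1)[OF p[OF xy(2)]] enc_f xy by (simp add: f_def)
    finally show "f (x \<otimes>\<^bsub>H\<^esub> y) = f x \<otimes>\<^bsub>?A\<^esub> f y"
      using e_enc e(1)[OF p[OF xy(1)]] e(1)[OF p[OF xy(2)]] by (simp add: f_def)
  qed
  have f_image: "f ` K = carrier ?A \<longleftrightarrow> fst ` h ` K = alt5" if K: "K \<subseteq> carrier H" for K
  proof
    assume "f ` K = carrier ?A"
    then have "enc ` f ` K = alt5" by (simp add: alt5_def)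
    moreover have "enc ` f ` K = fst ` h ` K"
      unfolding image_image by (rule image_cong) (use enc_f K in auto)
    ultimately show "fst ` h ` K = alt5" by simp
  next
    assume "fst ` h ` K = alt5"
    then have "f ` K = ?e ` alt5" by (simp add: f_def image_image flip: image_image[of ?e "\<lambda>x. fst (h x)"])
    then show "f ` K = carrier ?A" using e_enc by (force simp: alt5_def image_image)
  qed
  have f_epi: "f \<in> epi H ?A"
    using f_hom f_image[of "carrier H"] h_bij M(2) by (simp add: epi_def bij_betw_def)
  have inj: "inj_on h (carrier H)" using h_bij by (simp add: bij_betw_def)
  have square: "x \<otimes>\<^bsub>H\<^esub> x = \<one>\<^bsub>H\<^esub>" if x: "x \<in> carrier H" "f x = \<one>\<^bsub>?A\<^esub>" for x
  proof -
    have "h x \<otimes>\<^bsub>monomial\<^esub> h x = \<one>\<^bsub>monomial\<^esub>"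
      using monomial_kernel_square[of "h x"] x f_one h_in MG by blast
    then have "h (x \<otimes>\<^bsub>H\<^esub> x) = h \<one>\<^bsub>H\<^esub>" using h.hom_mult[OF x(1) x(1)] h.hom_one by simp
    then show ?thesis by (rule inj_onD[OF inj]) (use x in simp_all)
  qed
  have cover: "p_frattini_cover 2 H (discrete_topology (carrier H)) ?A f"
  proof (rule finite_p_frattini_cover)
    have "finite alt5" by (simp add: alt5_eq_list)
    then show "finite (carrier ?A)" unfolding alt5_def using enc_inj_on by (rule finite_imageD)
    fix K assume K: "subgroup K H" "f ` K = carrier ?A"
    have KH: "K \<subseteq> carrier H" using K(1) by (rule subgroup.subset)
    have "subgroup (h ` K) ?M" using h.subgroup_img_is_subgroup K(1) by blast
    then have "subgroup (h ` K) monomial" using M.incl_subgroup M(1) by blast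
    moreover have "h ` K \<subseteq> M" using h_in KH by blast
    ultimately have "h ` K = M" using M(3) K(2) f_image[OF KH] by blast
    then show "K = carrier H" using inj KH h_bij by (metis bij_betw_imp_surj_on inj_on_image_eq_iff order.refl)
  qed (use H finH A.is_group f_epi square in blast)+
  obtain y where y: "y \<in> alt5" "ct * y = y * cv"
  proof -
    have "\<exists>y\<in>set alt5_list. ct * y = y * cv" by code_simp
    then show thesis using that by (auto simp: alt5_eq_list)
  qed
  have lift: "\<exists>x\<in>carrier H. fst (h x) = g" if "g \<in> alt5" for g
  proof -
    have "g \<in> fst ` M" using that M(2) by simp
    then obtain X where X: "X \<in> M" "fst X = g" by auto
    then obtain x where "x \<in> carrier H" "h x = X" using h_bij by (auto simp: bij_betw_def)
    then show ?thesis using X by blast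
  qed
  obtain a b where ab: "a \<in> carrier H" "fst (h a) = cv" "b \<in> carrier H" "fst (h b) = ct"
    using lift ct(3,4) by metis
  have sq: "h (x \<otimes>\<^bsub>H\<^esub> x) = h x \<otimes>\<^bsub>monomial\<^esub> h x" if "x \<in> carrier H" for x
    using h.hom_mult[OF that that] by simp
  have one: "snd (h \<one>\<^bsub>H\<^esub>) x = x" if "x \<in> alt5" for x using that h.hom_one by (simp add: monomial_def)
  have "cv * cv = 1" by code_simp
  then have ker: "f (a \<otimes>\<^bsub>H\<^esub> a) = \<one>\<^bsub>?A\<^esub>" "f (b \<otimes>\<^bsub>H\<^esub> b) = \<one>\<^bsub>?A\<^esub>"
    using f_one[of "a \<otimes>\<^bsub>H\<^esub> a"] f_one[of "b \<otimes>\<^bsub>H\<^esub> b"] sq ab ct(1) by (simp_all add: monomial_mult)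
  have a1: "snd (h (a \<otimes>\<^bsub>H\<^esub> a)) 1 = ct"
    using monomial_square(1)[of "h a" 1] h_in[OF ab(1)] MG ab alt5_one sq by auto
  have b1: "snd (h (b \<otimes>\<^bsub>H\<^esub> b)) 1 = 1"
    using monomial_square(2)[of "h b" 1] h_in[OF ab(3)] MG ab alt5_one sq by auto
  have by': "snd (h (b \<otimes>\<^bsub>H\<^esub> b)) y = y * ct"
    using monomial_square(1)[of "h b" y] h_in[OF ab(3)] MG ab y sq by auto
  have "a \<otimes>\<^bsub>H\<^esub> a \<noteq> \<one>\<^bsub>H\<^esub>" using a1 one[OF alt5_one] ct(2) by metis
  moreover have "b \<otimes>\<^bsub>H\<^esub> b \<noteq> \<one>\<^bsub>H\<^esub>" using by' one[OF y(1)] ct(7)[OF y(1)] by metis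
  moreover have "a \<otimes>\<^bsub>H\<^esub> a \<noteq> b \<otimes>\<^bsub>H\<^esub> b" using a1 b1 ct(2) by metis
  moreover have "a \<otimes>\<^bsub>H\<^esub> a \<in> carrier H" "b \<otimes>\<^bsub>H\<^esub> b \<in> carrier H" using ab by simp_all
  ultimately have "p_frattini_cover 2 H (discrete_topology (carrier H)) ?A f \<and>
     (\<forall>x\<in>carrier H. f x = \<one>\<^bsub>?A\<^esub> \<longrightarrow> x \<otimes>\<^bsub>H\<^esub> x = \<one>\<^bsub>H\<^esub>) \<and>
     a \<otimes>\<^bsub>H\<^esub> a \<in> carrier H \<and> b \<otimes>\<^bsub>H\<^esub> b \<in> carrier H \<and> f (a \<otimes>\<^bsub>H\<^esub> a) = \<one>\<^bsub>?A\<^esub> \<and> f (b \<otimes>\<^bsub>H\<^esub> b) = \<one>\<^bsub>?A\<^esub> \<and>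
     a \<otimes>\<^bsub>H\<^esub> a \<noteq> \<one>\<^bsub>H\<^esub> \<and> b \<otimes>\<^bsub>H\<^esub> b \<noteq> \<one>\<^bsub>H\<^esub> \<and> a \<otimes>\<^bsub>H\<^esub> a \<noteq> b \<otimes>\<^bsub>H\<^esub> b"
    using cover square ker by blast
  then show ?thesis
    by - (rule exI[of _ H], rule exI[of _ f], rule exI[of _ "a \<otimes>\<^bsub>H\<^esub> a"], rule exI[of _ "b \<otimes>\<^bsub>H\<^esub> b"], assumption)
qed

lemma enc_eq_one: "x \<in> carrier (alt_group 5) \<Longrightarrow> enc x = 1 \<longleftrightarrow> x = \<one>\<^bsub>alt_group 5\<^esub>"
proof -
  interpret A: group "alt_group 5" by (rule alt_group_is_group)
  assume x: "x \<in> carrier (alt_group 5)"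
  have "enc \<one>\<^bsub>alt_group 5\<^esub> = 1" by (simp add: alt_group_one enc_id)
  then show ?thesis using inj_on_eq_iff[OF enc_inj_on x A.one_closed] by simp
qed

context level_one
begin

subsection \<open>Near H-M representatives\<close>

text \<open>
  The product of two entries is trivial in every conjugate if it is trivial in one. Conversely,
  orders and generation pass to the image, so that a tuple with cancelling neighbours lies in the
  Nielsen class of \<open>A\<^sub>5\<close>.
\<close>

lemma HM_image:
  assumes \<pi>: "\<pi> \<in> epi G (alt_group 5)" and p: "\<And>x. x \<in> carrier G \<Longrightarrow> p x = enc (\<pi> x)"
    and g: "(g1, g2, g3, g4) \<in> nielsen_class G"
  shows "HM_rep (alt_group 5) (inner_class (alt_group 5) (map4 \<pi> (g1, g2, g3, g4))) \<longleftrightarrow>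
    cancelling (g1, g2, g3, g4)"
proof -
  let ?A = "alt_group 5"
  interpret A: group ?A by (rule alt_group_is_group)
  interpret \<pi>: group_hom G ?A \<pi>
    using \<pi> by (simp add: group_hom_def group_hom_axioms_def epi_def A.is_group is_group)
  note car = nielsen_carrier[OF g]
  have onto: "\<pi> ` carrier G = carrier ?A" using \<pi> by (simp add: epi_def)
  note h = \<pi>.hom_closed[OF car(1)] \<pi>.hom_closed[OF car(2)] \<pi>.hom_closed[OF car(3)] \<pi>.hom_closed[OF car(4)]
  note enc_one = enc_eq_one
  have pair: "p x * p y = 1 \<longleftrightarrow> \<pi> x \<otimes>\<^bsub>?A\<^esub> \<pi> y = \<one>\<^bsub>?A\<^esub>" if "x \<in> carrier G" "y \<in> carrier G" for x y
    using enc_one[of "\<pi> x \<otimes>\<^bsub>?A\<^esub> \<pi> y"] that p enc_mult[of "\<pi> x" "\<pi> y"] by simp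
  have can: "cancelling (g1, g2, g3, g4) \<longleftrightarrow>
      \<pi> g1 \<otimes>\<^bsub>?A\<^esub> \<pi> g2 = \<one>\<^bsub>?A\<^esub> \<and> \<pi> g3 \<otimes>\<^bsub>?A\<^esub> \<pi> g4 = \<one>\<^bsub>?A\<^esub>"
    using pair car by simp
  have trivial: "a \<otimes>\<^bsub>?A\<^esub> b = \<one>\<^bsub>?A\<^esub>"
    if x: "x \<in> carrier ?A" "a \<in> carrier ?A" "b \<in> carrier ?A"
      and eq: "x \<otimes>\<^bsub>?A\<^esub> b \<otimes>\<^bsub>?A\<^esub> inv\<^bsub>?A\<^esub> x = inv\<^bsub>?A\<^esub> (x \<otimes>\<^bsub>?A\<^esub> a \<otimes>\<^bsub>?A\<^esub> inv\<^bsub>?A\<^esub> x)" for x a b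
  proof -
    have "x \<otimes>\<^bsub>?A\<^esub> b \<otimes>\<^bsub>?A\<^esub> inv\<^bsub>?A\<^esub> x = x \<otimes>\<^bsub>?A\<^esub> inv\<^bsub>?A\<^esub> a \<otimes>\<^bsub>?A\<^esub> inv\<^bsub>?A\<^esub> x"
      unfolding eq using x by (simp add: A.inv_mult_group A.m_assoc)
    then have "b = inv\<^bsub>?A\<^esub> a" using x by simp
    then show ?thesis using x by simp
  qed
  show ?thesis unfolding can
  proof
    assume "HM_rep ?A (inner_class ?A (map4 \<pi> (g1, g2, g3, g4)))"
    then obtain a b where "(a, inv\<^bsub>?A\<^esub> a, b, inv\<^bsub>?A\<^esub> b) \<in> inner_class ?A (map4 \<pi> (g1, g2, g3, g4))"
      unfolding HM_rep_def by blast
    then obtain x where x: "x \<in> carrier ?A"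
      and e: "(a, inv\<^bsub>?A\<^esub> a, b, inv\<^bsub>?A\<^esub> b) = conj4 ?A x (\<pi> g1, \<pi> g2, \<pi> g3, \<pi> g4)"
      by (auto simp: inner_class_def)
    note e = e[unfolded conj4.simps prod.inject]
    have e1: "a = x \<otimes>\<^bsub>?A\<^esub> \<pi> g1 \<otimes>\<^bsub>?A\<^esub> inv\<^bsub>?A\<^esub> x" by (rule e[THEN conjunct1])
    have e2: "inv\<^bsub>?A\<^esub> a = x \<otimes>\<^bsub>?A\<^esub> \<pi> g2 \<otimes>\<^bsub>?A\<^esub> inv\<^bsub>?A\<^esub> x" by (rule e[THEN conjunct2, THEN conjunct1])
    have e3: "b = x \<otimes>\<^bsub>?A\<^esub> \<pi> g3 \<otimes>\<^bsub>?A\<^esub> inv\<^bsub>?A\<^esub> x"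
      by (rule e[THEN conjunct2, THEN conjunct2, THEN conjunct1])
    have e4: "inv\<^bsub>?A\<^esub> b = x \<otimes>\<^bsub>?A\<^esub> \<pi> g4 \<otimes>\<^bsub>?A\<^esub> inv\<^bsub>?A\<^esub> x"
      by (rule e[THEN conjunct2, THEN conjunct2, THEN conjunct2])
    show "\<pi> g1 \<otimes>\<^bsub>?A\<^esub> \<pi> g2 = \<one>\<^bsub>?A\<^esub> \<and> \<pi> g3 \<otimes>\<^bsub>?A\<^esub> \<pi> g4 = \<one>\<^bsub>?A\<^esub>"
      using trivial[OF x h(1,2) e2[symmetric, unfolded e1]]
        trivial[OF x h(3,4) e4[symmetric, unfolded e3]] by (rule conjI)
  next
    assume tr: "\<pi> g1 \<otimes>\<^bsub>?A\<^esub> \<pi> g2 = \<one>\<^bsub>?A\<^esub> \<and> \<pi> g3 \<otimes>\<^bsub>?A\<^esub> \<pi> g4 = \<one>\<^bsub>?A\<^esub>"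
    have ord: "A.ord (\<pi> x) = 3" if "x \<in> O3" for x
    proof -
      have x: "x \<in> carrier G" "p x \<in> cyc3" using O3[OF that] by simp_all
      have "\<pi> x [^]\<^bsub>?A\<^esub> (3::nat) = \<one>\<^bsub>?A\<^esub>" using O3(3)[OF that] x \<pi>.hom_nat_pow[of x 3] by simp
      then have "A.ord (\<pi> x) dvd 3" using A.pow_eq_id x(1) by simp
      moreover have "\<pi> x \<noteq> \<one>\<^bsub>?A\<^esub>" using x p[OF x(1)] enc_one[of "\<pi> x"] by (auto simp: cyc3_iff)
      then have "A.ord (\<pi> x) \<noteq> 1" using A.ord_eq_1 x(1) by simp
      moreover have "prime (3::nat)" by simp
      ultimately show ?thesis by (metis prime_nat_iff)
    qed
    have n: "g1 \<in> O3" "g2 \<in> O3" "g3 \<in> O3" "g4 \<in> O3" using g by (simp_all add: nielsen_iff)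
    have pr: "g1 \<otimes> g2 \<otimes> g3 \<otimes> g4 = \<one>" and gen: "generate G {g1, g2, g3, g4} = carrier G"
      using g by (simp_all add: nielsen_class_def)
    have "\<pi> (g1 \<otimes> g2 \<otimes> g3 \<otimes> g4) = \<one>\<^bsub>?A\<^esub>" using pr by simp
    then have "\<pi> g1 \<otimes>\<^bsub>?A\<^esub> \<pi> g2 \<otimes>\<^bsub>?A\<^esub> \<pi> g3 \<otimes>\<^bsub>?A\<^esub> \<pi> g4 = \<one>\<^bsub>?A\<^esub>" using car by simp
    moreover have "generate ?A {\<pi> g1, \<pi> g2, \<pi> g3, \<pi> g4} = carrier ?A"
      using \<pi>.generate_img[of "{g1, g2, g3, g4}"] car gen onto by simp
    ultimately have "(\<pi> g1, \<pi> g2, \<pi> g3, \<pi> g4) \<in> nielsen_class ?A"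
      using h n by (simp add: nielsen_class_def ord)
    then have in_A: "inner_class ?A (map4 \<pi> (g1, g2, g3, g4)) \<in> nielsen_in ?A"
      by (simp add: nielsen_in_def)
    have "inv\<^bsub>?A\<^esub> \<pi> g1 = \<pi> g2" "inv\<^bsub>?A\<^esub> \<pi> g3 = \<pi> g4"
      using tr h A.eq_inv by metis+
    then have "conj4 ?A \<one>\<^bsub>?A\<^esub> (map4 \<pi> (g1, g2, g3, g4)) =
        (\<pi> g1, inv\<^bsub>?A\<^esub> \<pi> g1, \<pi> g3, inv\<^bsub>?A\<^esub> \<pi> g3)" using h by simp
    then have "(\<pi> g1, inv\<^bsub>?A\<^esub> \<pi> g1, \<pi> g3, inv\<^bsub>?A\<^esub> \<pi> g3) \<in> inner_class ?A (map4 \<pi> (g1, g2, g3, g4))"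
      unfolding inner_class_def by (metis A.one_closed imageI)
    then show "HM_rep ?A (inner_class ?A (map4 \<pi> (g1, g2, g3, g4)))"
      using in_A unfolding HM_rep_def by blast
  qed
qed

lemma near_HM_iff:
  assumes \<pi>: "\<pi> \<in> epi G (alt_group 5)" and p: "\<And>x. x \<in> carrier G \<Longrightarrow> p x = enc (\<pi> x)"
  shows "near_HM_rep G (alt_group 5) \<pi> C \<longleftrightarrow> C \<in> F True"
proof
  assume near: "near_HM_rep G (alt_group 5) \<pi> C"
  then have C: "C \<in> nielsen_in G" by (simp add: near_HM_rep_def)
  obtain g c where g: "g \<in> C" and c: "c \<in> carrier G" "ord c = 2" "conj4 G c g = kappa_hat G g"
    and HM: "HM_rep (alt_group 5) (inner_class (alt_group 5) (map4 \<pi> g))"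
    using near unfolding near_HM_rep_def by blast
  obtain h where h: "h \<in> nielsen_class G" "C = Cl h" using C by (rule nielsen_inE)
  obtain k where k: "k \<in> carrier G" "g = conj4 G k h" using g h(2) by (auto simp: inner_class_def)
  have gn: "g \<in> nielsen_class G" using conj4_nielsen[OF h(1) k(1)] k(2) by simp
  have Cg: "C = Cl g" using Cl_conj[OF h(1) k(1)] h(2) k(2) by simp
  obtain g1 g2 g3 g4 where eq: "g = (g1, g2, g3, g4)" by (cases g)
  have "cancelling (g1, g2, g3, g4)" using HM_image[OF \<pi> p] gn HM unfolding eq by blast
  then have "(g1, inv g4) \<in> Pairs" "g = Te True g1 (inv g4)"
    using conjugation_tuple_adm gn c unfolding eq by blast+
  then show "C \<in> F True" using F_I Cg by metis
next
  assume F: "C \<in> F True"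
  then obtain x y where xy: "(x, y) \<in> Pairs" "C = Cl (Te True x y)" by (rule F_E)
  note T = Te_nielsen[OF xy(1), of True] and k = Te_kappa_hat[OF xy(1)]
  obtain g1 g2 g3 g4 where eq: "Te True x y = (g1, g2, g3, g4)" by (cases "Te True x y")
  have "HM_rep (alt_group 5) (inner_class (alt_group 5) (map4 \<pi> (Te True x y)))"
    using HM_image[OF \<pi> p] T k(3) unfolding eq by blast
  moreover have "\<not> HM_rep G C" using HM_iff F F_disjoint by blast
  moreover have "C \<in> nielsen_in G" using F F_nielsen_in by blast
  moreover have "Te True x y \<in> C" using Cl_self[OF T] xy(2) by simp
  ultimately show "near_HM_rep G (alt_group 5) \<pi> C"
    unfolding near_HM_rep_def using spine(1)[OF xy(1)] k(1,2) by blast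
qed

lemma F_summary:
  assumes HM: "\<And>C. HM C \<longleftrightarrow> C \<in> F False" and near: "\<And>C. near C \<longleftrightarrow> C \<in> F True"
  shows "card (nielsen_in G) = 2304 \<and>
     card {C \<in> nielsen_in G. HM C} = 16 \<and>
     card {C \<in> nielsen_in G. near C} = 16 \<and>
     (\<forall>Y \<in> perm_orbits (nielsen_in G) {hq2 G}.
        ((\<exists>C \<in> Y. HM C) \<longrightarrow> (\<exists>!C. C \<in> Y \<and> HM C)) \<and>
        ((\<exists>C \<in> Y. near C) \<longrightarrow> (\<exists>!C. C \<in> Y \<and> near C))) \<and>
     (\<forall>R \<in> Q_orbits G. card R = 4) \<and>
     (\<forall>\<tau> \<in> carrier (Q_group G). \<forall>C \<in> nielsen_in G.
        (HM C \<longrightarrow> HM (\<tau> C)) \<and> (near C \<longrightarrow> near (\<tau> C))) \<and>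
     (\<forall>Y \<in> gamma_orbits G.
        (\<exists>R \<in> Y. \<exists>C \<in> R. HM C \<or> near C) \<longrightarrow> has_type G Y (10, 20)) \<and>
     card {Y \<in> gamma_orbits G. \<exists>R \<in> Y. \<exists>C \<in> R. HM C} = 4 \<and>
     card {Y \<in> gamma_orbits G. \<exists>R \<in> Y. \<exists>C \<in> R. near C} = 4 \<and>
     card {Y \<in> gamma_orbits G. \<exists>R \<in> Y. \<exists>C \<in> R. HM C \<or> near C} = 8"
  unfolding HM near
proof (intro conjI ballI impI)
  show "card (nielsen_in G) = 2304" by (rule card_nielsen_in)
  have "{C \<in> nielsen_in G. C \<in> F e} = F e" for e using F_nielsen_in by blast
  then show "card {C \<in> nielsen_in G. C \<in> F False} = 16" "card {C \<in> nielsen_in G. C \<in> F True} = 16"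
    using card_F by simp_all
  show "\<exists>!C. C \<in> Y \<and> C \<in> F False"
    if "Y \<in> perm_orbits (nielsen_in G) {hq2 G}" "\<exists>C\<in>Y. C \<in> F False" for Y
    using q2_orbit_unique that by blast
  show "\<exists>!C. C \<in> Y \<and> C \<in> F True"
    if "Y \<in> perm_orbits (nielsen_in G) {hq2 G}" "\<exists>C\<in>Y. C \<in> F True" for Y
    using q2_orbit_unique that by blast
  show "card R = 4" if "R \<in> Q_orbits G" for R
    using that card_Qorb by (auto simp: Q_orbits_eq)
  show "\<tau> C \<in> F False" if "\<tau> \<in> carrier (Q_group G)" "C \<in> F False" for \<tau> C
    using Q_preserves_F that by blast
  show "\<tau> C \<in> F True" if "\<tau> \<in> carrier (Q_group G)" "C \<in> F True" for \<tau> C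
    using Q_preserves_F that by blast
  have type: "has_type G Y (10, 20)" if "Y \<in> gammaF e" for Y e
    using that Te_type by (metis gammaF_E)
  show "has_type G Y (10, 20)" if "Y \<in> gamma_orbits G" "\<exists>R\<in>Y. \<exists>C\<in>R. C \<in> F False \<or> C \<in> F True" for Y
  proof -
    have "Y \<in> gammaF False \<or> Y \<in> gammaF True" using that unfolding gammaF_def by blast
    then show ?thesis using type by blast
  qed
  show "card {Y \<in> gamma_orbits G. \<exists>R\<in>Y. \<exists>C\<in>R. C \<in> F False} = 4"
    "card {Y \<in> gamma_orbits G. \<exists>R\<in>Y. \<exists>C\<in>R. C \<in> F True} = 4"
    using card_gammaF unfolding gammaF_def by blast+
  have "{Y \<in> gamma_orbits G. \<exists>R\<in>Y. \<exists>C\<in>R. C \<in> F False \<or> C \<in> F True} = gammaF False \<union> gammaF True"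
    unfolding gammaF_def by blast
  moreover have "finite (gammaF e)" for e using card_gammaF[of e] by (intro card_ge_0_finite) simp
  ultimately show "card {Y \<in> gamma_orbits G. \<exists>R\<in>Y. \<exists>C\<in>R. C \<in> F False \<or> C \<in> F True} = 8"
    using card_Un_disjoint[OF _ _ gammaF_disjoint] card_gammaF by simp
qed

end

section \<open>The first characteristic quotient\<close>

locale universal_cover =
  fixes U :: "'a monoid" and T :: "'a topology" and \<phi> :: "'a \<Rightarrow> (nat \<Rightarrow> nat)"
  assumes univ: "universal_p_frattini_cover 2 U T (alt_group 5) \<phi>"
begin

abbreviation A where "A \<equiv> alt_group 5"
abbreviation K where "K \<equiv> kernel U A \<phi>"
abbreviation N where "N \<equiv> frattini_kernel 2 U T K"

lemma cover: "frattini_cover U T A (discrete_topology (carrier A)) \<phi>"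
  using univ by (simp add: universal_p_frattini_cover_def p_frattini_cover_def)

lemma profinite: "profinite_group U T"
  using cover by (simp add: frattini_cover_def)

sublocale U: group U
  using profinite by (simp add: profinite_group_def)

sublocale A: group A by (rule alt_group_is_group)

lemma phi: "\<phi> \<in> epi U A" "continuous_map T (discrete_topology (carrier A)) \<phi>"
  "subgroup H U \<Longrightarrow> closedin T H \<Longrightarrow> \<phi> ` H = carrier A \<Longrightarrow> H = carrier U"
  using cover by (simp_all add: frattini_cover_def)

sublocale \<phi>: group_hom U A \<phi>
  using phi(1) by (simp add: group_hom_def group_hom_axioms_def epi_def A.is_group U.is_group)

lemma topspace: "topspace T = carrier U"
  using profinite by (simp add: profinite_group_def)

lemma translate_right: "g \<in> carrier U \<Longrightarrow> continuous_map T T (\<lambda>x. x \<otimes>\<^bsub>U\<^esub> g)"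
  and translate_left: "g \<in> carrier U \<Longrightarrow> continuous_map T T (\<lambda>x. g \<otimes>\<^bsub>U\<^esub> x)"
proof -
  assume g: "g \<in> carrier U"
  have mult: "continuous_map (prod_topology T T) T (\<lambda>(x, y). x \<otimes>\<^bsub>U\<^esub> y)"
    using profinite by (simp add: profinite_group_def)
  have "continuous_map T (prod_topology T T) (\<lambda>x. (x, g))" "continuous_map T (prod_topology T T) (\<lambda>x. (g, x))"
    using g topspace by (simp_all add: continuous_map_pairedI)
  then have "continuous_map T T ((\<lambda>(x, y). x \<otimes>\<^bsub>U\<^esub> y) \<circ> (\<lambda>x. (x, g)))"
    "continuous_map T T ((\<lambda>(x, y). x \<otimes>\<^bsub>U\<^esub> y) \<circ> (\<lambda>x. (g, x)))"
    using continuous_map_compose mult by blast+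
  moreover have "(\<lambda>(x, y). x \<otimes>\<^bsub>U\<^esub> y) \<circ> (\<lambda>x. (x, g)) = (\<lambda>x. x \<otimes>\<^bsub>U\<^esub> g)"
    "(\<lambda>(x, y). x \<otimes>\<^bsub>U\<^esub> y) \<circ> (\<lambda>x. (g, x)) = (\<lambda>x. g \<otimes>\<^bsub>U\<^esub> x)" by (simp_all add: fun_eq_iff)
  ultimately show "continuous_map T T (\<lambda>x. x \<otimes>\<^bsub>U\<^esub> g)" "continuous_map T T (\<lambda>x. g \<otimes>\<^bsub>U\<^esub> x)" by simp_all
qed

lemma closed_kernel:
  assumes "continuous_map T (discrete_topology (carrier H)) f" "group H"
  shows "closedin T {x \<in> carrier U. f x = \<one>\<^bsub>H\<^esub>}"
proof -
  interpret H: group H by fact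
  have "closedin T {x \<in> topspace T. f x \<in> {\<one>\<^bsub>H\<^esub>}}"
    by (rule closedin_continuous_map_preimage[OF assms(1)]) simp
  then show ?thesis by (simp add: topspace)
qed

lemma K_conj: "g \<in> carrier U \<Longrightarrow> x \<in> K \<Longrightarrow> g \<otimes>\<^bsub>U\<^esub> x \<otimes>\<^bsub>U\<^esub> inv\<^bsub>U\<^esub> g \<in> K"
  by (simp add: kernel_def)

definition family where
  "family = {H. subgroup H U \<and> closedin T H \<and>
     (\<forall>x\<in>K. \<forall>y\<in>K. x \<otimes>\<^bsub>U\<^esub> y \<otimes>\<^bsub>U\<^esub> inv\<^bsub>U\<^esub> x \<otimes>\<^bsub>U\<^esub> inv\<^bsub>U\<^esub> y \<in> H) \<and> (\<forall>x\<in>K. x [^]\<^bsub>U\<^esub> (2::nat) \<in> H)}"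

lemma N_eq: "N = \<Inter> family"
  by (simp add: frattini_kernel_def family_def)

text \<open>
  A continuous homomorphism to a discrete group that makes the image of \<open>K\<close> a group of
  exponent 2 kills \<open>N\<close>.
\<close>

lemma kernel_in_family:
  assumes f: "group_hom U H f" "continuous_map T (discrete_topology (carrier H)) f"
    and sq: "\<And>x. x \<in> K \<Longrightarrow> f x \<otimes>\<^bsub>H\<^esub> f x = \<one>\<^bsub>H\<^esub>"
  shows "kernel U H f \<in> family"
proof -
  interpret f: group_hom U H f by fact
  have xK: "x \<in> carrier U" if "x \<in> K" for x using that by (simp add: kernel_def)
  have comm: "f x \<otimes>\<^bsub>H\<^esub> f y \<otimes>\<^bsub>H\<^esub> inv\<^bsub>H\<^esub> f x \<otimes>\<^bsub>H\<^esub> inv\<^bsub>H\<^esub> f y = \<one>\<^bsub>H\<^esub>" if "x \<in> K" "y \<in> K" for x y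
  proof -
    have i: "inv\<^bsub>H\<^esub> f z = f z" if "z \<in> K" for z using sq[OF that] xK[OF that] by (simp add: f.H.inv_equality)
    have "x \<otimes>\<^bsub>U\<^esub> y \<in> K" using that by (simp add: kernel_def)
    then have "f (x \<otimes>\<^bsub>U\<^esub> y) \<otimes>\<^bsub>H\<^esub> f (x \<otimes>\<^bsub>U\<^esub> y) = \<one>\<^bsub>H\<^esub>" by (rule sq)
    then show ?thesis using that xK by (simp add: i f.H.m_assoc)
  qed
  have "kernel U H f = {x \<in> carrier U. f x = \<one>\<^bsub>H\<^esub>}" by (simp add: kernel_def)
  then have "closedin T (kernel U H f)" using closed_kernel[OF f(2) f.H.is_group] by simp
  moreover have "x \<otimes>\<^bsub>U\<^esub> y \<otimes>\<^bsub>U\<^esub> inv\<^bsub>U\<^esub> x \<otimes>\<^bsub>U\<^esub> inv\<^bsub>U\<^esub> y \<in> kernel U H f" if "x \<in> K" "y \<in> K" for x y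
    unfolding kernel_def using comm[OF that] xK[OF that(1)] xK[OF that(2)] by simp
  moreover have "x [^]\<^bsub>U\<^esub> (2::nat) \<in> kernel U H f" if "x \<in> K" for x
    unfolding kernel_def using sq[OF that] xK[OF that] by (simp add: numeral_2_eq_2)
  ultimately show ?thesis
    unfolding family_def using f.subgroup_kernel by blast
qed

lemma N_subset_K: "N \<subseteq> K" and K_family: "K \<in> family"
proof -
  have xK: "x \<in> carrier U" "\<phi> x = \<one>\<^bsub>A\<^esub>" if "x \<in> K" for x using that by (simp_all add: kernel_def)
  have "\<phi> x \<otimes>\<^bsub>A\<^esub> \<phi> x = \<one>\<^bsub>A\<^esub>" if "x \<in> K" for x using xK[OF that] by simp
  then show "K \<in> family" by (intro kernel_in_family \<phi>.group_hom_axioms phi(2))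
  then show "N \<subseteq> K" unfolding N_eq by blast
qed

lemma N_subgroup: "subgroup N U"
  unfolding N_eq using K_family by (intro U.subgroups_Inter) (auto simp: family_def)

lemma N_closed: "closedin T N"
  unfolding N_eq using K_family by (intro closedin_Inter) (auto simp: family_def)

lemma N_square: "x \<in> K \<Longrightarrow> x \<otimes>\<^bsub>U\<^esub> x \<in> N"
  unfolding N_eq by (auto simp: family_def kernel_def numeral_2_eq_2)

text \<open>
  Conjugation is a homeomorphism and preserves \<open>K\<close>, so it permutes the subgroups whose
  intersection is \<open>N\<close>.
\<close>

lemma N_normal: "N \<lhd> U"
proof (rule U.normal_invI[OF N_subgroup])
  fix g n assume g: "g \<in> carrier U" and n: "n \<in> N"
  show "g \<otimes>\<^bsub>U\<^esub> n \<otimes>\<^bsub>U\<^esub> inv\<^bsub>U\<^esub> g \<in> N"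
    unfolding N_eq
  proof
    fix H assume H: "H \<in> family"
    let ?c = "\<lambda>x. g \<otimes>\<^bsub>U\<^esub> x \<otimes>\<^bsub>U\<^esub> inv\<^bsub>U\<^esub> g"
    have c_mult: "?c (x \<otimes>\<^bsub>U\<^esub> y) = ?c x \<otimes>\<^bsub>U\<^esub> ?c y" if "x \<in> carrier U" "y \<in> carrier U" for x y
      using g that by (simp add: U.group_word)
    have c_inv: "?c (inv\<^bsub>U\<^esub> x) = inv\<^bsub>U\<^esub> ?c x" if "x \<in> carrier U" for x
      using g that by (simp add: U.group_word)
    have xK: "x \<in> carrier U" if "x \<in> K" for x using that by (simp add: kernel_def)
    have Hs: "subgroup H U" using H by (simp add: family_def)
    interpret H: subgroup H U by (rule Hs)
    let ?H = "{x \<in> carrier U. ?c x \<in> H}"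
    have "subgroup ?H U"
    proof (rule U.subgroupI)
      have "?c \<one>\<^bsub>U\<^esub> \<in> H" using g by simp
      then show "?H \<noteq> {}" by blast
      show "inv\<^bsub>U\<^esub> x \<in> ?H" if "x \<in> ?H" for x using that c_inv by simp
      show "x \<otimes>\<^bsub>U\<^esub> y \<in> ?H" if "x \<in> ?H" "y \<in> ?H" for x y using that c_mult by simp
    qed blast
    moreover have "closedin T ?H"
    proof -
      have "continuous_map T T (\<lambda>x. ?c x)"
        using continuous_map_compose[OF translate_left[OF g] translate_right[OF U.inv_closed[OF g]]]
        by (simp add: o_def)
      moreover have "closedin T H" using H by (simp add: family_def)
      ultimately have "closedin T {x \<in> topspace T. ?c x \<in> H}" by (rule closedin_continuous_map_preimage)
      then show ?thesis by (simp add: topspace)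
    qed
    moreover have "x \<otimes>\<^bsub>U\<^esub> y \<otimes>\<^bsub>U\<^esub> inv\<^bsub>U\<^esub> x \<otimes>\<^bsub>U\<^esub> inv\<^bsub>U\<^esub> y \<in> ?H" if "x \<in> K" "y \<in> K" for x y
    proof -
      have "?c x \<otimes>\<^bsub>U\<^esub> ?c y \<otimes>\<^bsub>U\<^esub> inv\<^bsub>U\<^esub> ?c x \<otimes>\<^bsub>U\<^esub> inv\<^bsub>U\<^esub> ?c y \<in> H"
        using H K_conj[OF g] that by (simp add: family_def)
      moreover have "?c (x \<otimes>\<^bsub>U\<^esub> y \<otimes>\<^bsub>U\<^esub> inv\<^bsub>U\<^esub> x \<otimes>\<^bsub>U\<^esub> inv\<^bsub>U\<^esub> y) =
          ?c x \<otimes>\<^bsub>U\<^esub> ?c y \<otimes>\<^bsub>U\<^esub> inv\<^bsub>U\<^esub> ?c x \<otimes>\<^bsub>U\<^esub> inv\<^bsub>U\<^esub> ?c y"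
        using xK[OF that(1)] xK[OF that(2)] by (simp only: c_mult c_inv U.m_closed U.inv_closed)
      ultimately show ?thesis using xK[OF that(1)] xK[OF that(2)] by simp
    qed
    moreover have "x [^]\<^bsub>U\<^esub> (2::nat) \<in> ?H" if "x \<in> K" for x
    proof -
      have "?c x [^]\<^bsub>U\<^esub> (2::nat) \<in> H" using H K_conj[OF g that] by (simp add: family_def)
      then show ?thesis using U.pow_conj[OF g xK[OF that], of 2] xK[OF that] by simp
    qed
    ultimately have "?H \<in> family" unfolding family_def by blast
    then have "n \<in> ?H" using n unfolding N_eq by blast
    then show "?c n \<in> H" by simp
  qed
qed

sublocale N: normal N U by (rule N_normal)

abbreviation G where "G \<equiv> U Mod N"

sublocale G: group G by (rule N.factorgroup_is_group)

lemma carrier_G: "carrier G = (\<lambda>x. N #>\<^bsub>U\<^esub> x) ` carrier U"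
  by (simp add: carrier_FactGroup)

declare mult_FactGroup [simp del] one_FactGroup [simp del]

lemma coset_mult: "x \<in> carrier U \<Longrightarrow> y \<in> carrier U \<Longrightarrow>
    N #>\<^bsub>U\<^esub> (x \<otimes>\<^bsub>U\<^esub> y) = (N #>\<^bsub>U\<^esub> x) \<otimes>\<^bsub>G\<^esub> (N #>\<^bsub>U\<^esub> y)"
  unfolding mult_FactGroup by (simp add: N.rcos_sum)

lemma coset_eq_one: "x \<in> carrier U \<Longrightarrow> N #>\<^bsub>U\<^esub> x = \<one>\<^bsub>G\<^esub> \<longleftrightarrow> x \<in> N"
  using N.rcos_const[OF U.is_group, of x] U.rcos_self[OF _ N_subgroup, of x] unfolding one_FactGroup by auto

definition \<pi> where "\<pi> = induced_map \<phi>"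

lemma \<pi>_coset: "x \<in> carrier U \<Longrightarrow> \<pi> (N #>\<^bsub>U\<^esub> x) = \<phi> x"
proof -
  assume x: "x \<in> carrier U"
  have "\<phi> (n \<otimes>\<^bsub>U\<^esub> x) = \<phi> x" if "n \<in> N" for n
    using subsetD[OF N_subset_K that] x by (simp add: kernel_def)
  then have "\<phi> y = \<phi> x" if "y \<in> N #>\<^bsub>U\<^esub> x" for y using that by (auto simp: r_coset_def)
  moreover have "x \<in> N #>\<^bsub>U\<^esub> x" using U.rcos_self[OF x N_subgroup] .
  ultimately have "\<phi> ` (N #>\<^bsub>U\<^esub> x) = {\<phi> x}" by blast
  then show ?thesis by (simp add: \<pi>_def induced_map_def)
qed

lemma \<pi>_epi: "\<pi> \<in> epi G A"
proof -
  have "\<pi> \<in> hom G A"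
  proof (rule homI)
    show "\<pi> X \<in> carrier A" if "X \<in> carrier G" for X
      using that unfolding carrier_G by (auto simp: \<pi>_coset)
    show "\<pi> (X \<otimes>\<^bsub>G\<^esub> Y) = \<pi> X \<otimes>\<^bsub>A\<^esub> \<pi> Y" if "X \<in> carrier G" "Y \<in> carrier G" for X Y
      using that unfolding carrier_G by (auto simp: \<pi>_coset simp flip: coset_mult)
  qed
  moreover have "\<pi> ` carrier G = carrier A"
    using phi(1) unfolding carrier_G image_image epi_def by (simp add: \<pi>_coset)
  ultimately show ?thesis by (simp add: epi_def)
qed

definition p where "p X = enc (\<pi> X)"

lemma p_coset: "x \<in> carrier U \<Longrightarrow> p (N #>\<^bsub>U\<^esub> x) = enc (\<phi> x)"
  by (simp add: p_def \<pi>_coset)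

lemma p_coset_one: "x \<in> carrier U \<Longrightarrow> p (N #>\<^bsub>U\<^esub> x) = 1 \<longleftrightarrow> x \<in> K"
proof -
  assume x: "x \<in> carrier U"
  have "x \<in> K \<longleftrightarrow> \<phi> x = \<one>\<^bsub>A\<^esub>" using x by (simp add: kernel_def)
  then show ?thesis using enc_eq_one[OF \<phi>.hom_closed[OF x]] unfolding p_coset[OF x] by simp
qed

text \<open>
  A coset is the preimage of \<open>N\<close> under a translation.
\<close>

lemma closed_coset: "x \<in> carrier U \<Longrightarrow> closedin T (N #>\<^bsub>U\<^esub> x)"
proof -
  assume x: "x \<in> carrier U"
  have "N #>\<^bsub>U\<^esub> x = {y \<in> topspace T. y \<otimes>\<^bsub>U\<^esub> inv\<^bsub>U\<^esub> x \<in> N}"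
  proof
    show "N #>\<^bsub>U\<^esub> x \<subseteq> {y \<in> topspace T. y \<otimes>\<^bsub>U\<^esub> inv\<^bsub>U\<^esub> x \<in> N}"
    proof
      fix y assume "y \<in> N #>\<^bsub>U\<^esub> x"
      then obtain n where n: "n \<in> N" "y = n \<otimes>\<^bsub>U\<^esub> x" unfolding r_coset_def by blast
      have nU: "n \<in> carrier U" by (rule N.mem_carrier[OF n(1)])
      then have "y \<otimes>\<^bsub>U\<^esub> inv\<^bsub>U\<^esub> x = n" using x by (simp add: n(2) U.m_assoc)
      moreover have "y \<in> topspace T" using nU x by (simp add: n(2) topspace)
      ultimately show "y \<in> {y \<in> topspace T. y \<otimes>\<^bsub>U\<^esub> inv\<^bsub>U\<^esub> x \<in> N}" using n(1) by (intro CollectI conjI) simp_all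
    qed
    show "{y \<in> topspace T. y \<otimes>\<^bsub>U\<^esub> inv\<^bsub>U\<^esub> x \<in> N} \<subseteq> N #>\<^bsub>U\<^esub> x"
      unfolding topspace using N.rcos_module_rev[OF U.is_group x] by blast
  qed
  then show ?thesis
    using closedin_continuous_map_preimage[OF translate_right[OF U.inv_closed[OF x]] N_closed] by (simp only:)
qed

sublocale ef: elementary_frattini G p
proof
  show "p (X \<otimes>\<^bsub>G\<^esub> Y) = p X * p Y" if "X \<in> carrier G" "Y \<in> carrier G" for X Y
    using that unfolding carrier_G by (auto simp: p_coset enc_mult simp flip: coset_mult)
  have "p ` carrier G = enc ` \<phi> ` carrier U"
    unfolding carrier_G image_image by (rule image_cong) (simp_all add: p_coset)
  then show "p ` carrier G = alt5" using phi(1) by (simp add: epi_def alt5_def)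
  show "X \<otimes>\<^bsub>G\<^esub> X = \<one>\<^bsub>G\<^esub>" if X: "X \<in> carrier G" "p X = 1" for X
  proof -
    obtain x where x: "x \<in> carrier U" "X = N #>\<^bsub>U\<^esub> x" using X(1) unfolding carrier_G by blast
    then have "x \<otimes>\<^bsub>U\<^esub> x \<in> N" using X(2) p_coset_one N_square by blast
    then show ?thesis using x coset_eq_one[of "x \<otimes>\<^bsub>U\<^esub> x"] by (simp add: coset_mult)
  qed
  show "H = carrier G" if H: "subgroup H G" "finite H" "p ` H = alt5" for H
  proof -
    interpret H: subgroup H G by fact
    define L where "L = {x \<in> carrier U. N #>\<^bsub>U\<^esub> x \<in> H}"
    have coset: "\<exists>x\<in>carrier U. X = N #>\<^bsub>U\<^esub> x" if "X \<in> H" for X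
      using H.mem_carrier[OF that] unfolding carrier_G by blast
    have "L = \<Union> H"
    proof
      show "L \<subseteq> \<Union> H" using U.rcos_self[OF _ N_subgroup] by (auto simp: L_def)
      show "\<Union> H \<subseteq> L"
      proof
        fix y assume "y \<in> \<Union> H"
        then obtain X where X: "X \<in> H" "y \<in> X" by blast
        then obtain x where x: "x \<in> carrier U" "X = N #>\<^bsub>U\<^esub> x" using coset by blast
        have "y \<in> carrier U" using X x U.r_coset_subset_G[OF N.subset] by blast
        moreover have "N #>\<^bsub>U\<^esub> y = X" using U.repr_independence[of y N x] X x N_subgroup by simp
        ultimately show "y \<in> L" using X by (simp add: L_def)
      qed
    qed
    moreover have "closedin T (\<Union> H)"
      using H(2) coset closed_coset by (intro closedin_Union) auto
    ultimately have "closedin T L" by simp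
    moreover have "subgroup L U"
    proof (rule U.subgroupI)
      have "\<one>\<^bsub>U\<^esub> \<in> L" using coset_eq_one[of "\<one>\<^bsub>U\<^esub>"] by (simp add: L_def)
      then show "L \<noteq> {}" by blast
      show "x \<otimes>\<^bsub>U\<^esub> y \<in> L" if "x \<in> L" "y \<in> L" for x y using that by (simp add: L_def coset_mult)
      show "inv\<^bsub>U\<^esub> x \<in> L" if "x \<in> L" for x
      proof -
        have x: "x \<in> carrier U" "N #>\<^bsub>U\<^esub> x \<in> H" using that by (simp_all add: L_def)
        have "(N #>\<^bsub>U\<^esub> inv\<^bsub>U\<^esub> x) \<otimes>\<^bsub>G\<^esub> (N #>\<^bsub>U\<^esub> x) = \<one>\<^bsub>G\<^esub>"
          using x coset_eq_one[of "\<one>\<^bsub>U\<^esub>"] by (simp flip: coset_mult)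
        then have "inv\<^bsub>G\<^esub> (N #>\<^bsub>U\<^esub> x) = N #>\<^bsub>U\<^esub> inv\<^bsub>U\<^esub> x"
          using x by (intro G.inv_equality) (auto simp: carrier_G)
        then show ?thesis using x H.m_inv_closed[OF x(2)] by (simp add: L_def)
      qed
    qed (simp add: L_def)
    moreover have "\<phi> ` L = carrier A"
    proof
      show "\<phi> ` L \<subseteq> carrier A" by (auto simp: L_def)
      show "carrier A \<subseteq> \<phi> ` L"
      proof
        fix y assume y: "y \<in> carrier A"
        then have "enc y \<in> p ` H" using H(3) by (simp add: alt5_def)
        then obtain X where X: "X \<in> H" "p X = enc y" by auto
        then obtain x where x: "x \<in> carrier U" "X = N #>\<^bsub>U\<^esub> x" using coset by blast
        then have "\<phi> x = y" using X(2) inj_onD[OF enc_inj_on, of "\<phi> x" y] y by (simp add: p_coset)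
        then show "y \<in> \<phi> ` L" using X(1) x by (auto simp: L_def)
      qed
    qed
    ultimately have "L = carrier U" using phi(3) by blast
    then have "carrier G \<subseteq> H" unfolding carrier_G by (auto simp: L_def)
    then show ?thesis using H.subset by blast
  qed
  show "\<exists>X\<in>carrier G. \<exists>Y\<in>carrier G. p X = 1 \<and> p Y = 1 \<and> X \<noteq> \<one>\<^bsub>G\<^esub> \<and> Y \<noteq> \<one>\<^bsub>G\<^esub> \<and> X \<noteq> Y"
  proof -
    from test_cover obtain H :: "nat set monoid" and f k l where c:
      "p_frattini_cover 2 H (discrete_topology (carrier H)) A f \<and>
       (\<forall>x\<in>carrier H. f x = \<one>\<^bsub>A\<^esub> \<longrightarrow> x \<otimes>\<^bsub>H\<^esub> x = \<one>\<^bsub>H\<^esub>) \<and>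
       k \<in> carrier H \<and> l \<in> carrier H \<and> f k = \<one>\<^bsub>A\<^esub> \<and> f l = \<one>\<^bsub>A\<^esub> \<and> k \<noteq> \<one>\<^bsub>H\<^esub> \<and> l \<noteq> \<one>\<^bsub>H\<^esub> \<and> k \<noteq> l"
      by (elim exE)
    have cov: "p_frattini_cover 2 H (discrete_topology (carrier H)) A f"
      using c by (rule conjunct1)
    have sq: "x \<otimes>\<^bsub>H\<^esub> x = \<one>\<^bsub>H\<^esub>" if "x \<in> carrier H" "f x = \<one>\<^bsub>A\<^esub>" for x
      using c that by blast
    have kl: "k \<in> carrier H" "l \<in> carrier H" "f k = \<one>\<^bsub>A\<^esub>" "f l = \<one>\<^bsub>A\<^esub>" "k \<noteq> \<one>\<^bsub>H\<^esub>" "l \<noteq> \<one>\<^bsub>H\<^esub>" "k \<noteq> l"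
      using c by simp_all
    obtain \<theta> where \<theta>: "\<theta> \<in> epi U H" "continuous_map T (discrete_topology (carrier H)) \<theta>"
      "\<And>x. x \<in> carrier U \<Longrightarrow> f (\<theta> x) = \<phi> x"
      using univ cov unfolding universal_p_frattini_cover_def by blast
    have "group H"
      using cov by (simp add: p_frattini_cover_def frattini_cover_def profinite_group_def)
    then interpret \<theta>: group_hom U H \<theta>
      using \<theta>(1) by (simp add: group_hom_def group_hom_axioms_def epi_def U.is_group)
    have "kernel U H \<theta> \<in> family"
    proof (rule kernel_in_family[OF \<theta>.group_hom_axioms \<theta>(2)])
      show "\<theta> x \<otimes>\<^bsub>H\<^esub> \<theta> x = \<one>\<^bsub>H\<^esub>" if "x \<in> K" for x
        using sq[of "\<theta> x"] \<theta>(3)[of x] that by (simp add: kernel_def)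
    qed
    then have N_ker: "\<theta> n = \<one>\<^bsub>H\<^esub>" if "n \<in> N" for n using that unfolding N_eq by (auto simp: kernel_def)
    have onto: "\<theta> ` carrier U = carrier H" using \<theta>(1) by (simp add: epi_def)
    obtain x y where xy: "x \<in> carrier U" "\<theta> x = k" "y \<in> carrier U" "\<theta> y = l"
      using kl(1,2) onto by (metis imageE)
    have "N #>\<^bsub>U\<^esub> x \<noteq> N #>\<^bsub>U\<^esub> y"
    proof
      assume "N #>\<^bsub>U\<^esub> x = N #>\<^bsub>U\<^esub> y"
      then have "x \<in> N #>\<^bsub>U\<^esub> y" using U.rcos_self[OF xy(1) N_subgroup] by simp
      then obtain n where n: "n \<in> N" "x = n \<otimes>\<^bsub>U\<^esub> y" by (auto simp: r_coset_def)
      have "\<theta> x = \<theta> y" using N_ker[OF n(1)] N.mem_carrier[OF n(1)] xy n(2) kl(2) by simp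
      then show False using xy kl(7) by simp
    qed
    moreover have "x \<notin> N" "y \<notin> N" using N_ker xy kl by blast+
    moreover have "x \<in> K" "y \<in> K" using \<theta>(3)[OF xy(1)] \<theta>(3)[OF xy(3)] xy kl by (simp_all add: kernel_def)
    ultimately show ?thesis
      using xy p_coset_one coset_eq_one unfolding carrier_G by (metis imageI)
  qed
qed

end

theorem proposition7p9:
  fixes U :: "'a monoid" and T :: "'a topology" and \<phi> :: "'a \<Rightarrow> (nat \<Rightarrow> nat)"
    and G1 :: "'a set monoid"
    and HM near :: "'a set tup4 set \<Rightarrow> bool"
  assumes univ: "universal_p_frattini_cover 2 U T (alt_group 5) \<phi>"
    and G1: "G1 = first_char_quotient 2 U T (alt_group 5) \<phi>"
    and HM: "HM = HM_rep G1"
    and near: "near = near_HM_rep G1 (alt_group 5) (induced_map \<phi>)"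
  shows
    "card (nielsen_in G1) = 2304 \<and>
     card {C \<in> nielsen_in G1. HM C} = 16 \<and>
     card {C \<in> nielsen_in G1. near C} = 16 \<and>
     (\<forall>Y \<in> perm_orbits (nielsen_in G1) {hq2 G1}.
        ((\<exists>C \<in> Y. HM C) \<longrightarrow> (\<exists>!C. C \<in> Y \<and> HM C)) \<and>
        ((\<exists>C \<in> Y. near C) \<longrightarrow> (\<exists>!C. C \<in> Y \<and> near C))) \<and>
     (\<forall>R \<in> Q_orbits G1. card R = 4) \<and>
     (\<forall>\<tau> \<in> carrier (Q_group G1). \<forall>C \<in> nielsen_in G1.
        (HM C \<longrightarrow> HM (\<tau> C)) \<and> (near C \<longrightarrow> near (\<tau> C))) \<and>
     (\<forall>Y \<in> gamma_orbits G1.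
        (\<exists>R \<in> Y. \<exists>C \<in> R. HM C \<or> near C) \<longrightarrow> has_type G1 Y (10, 20)) \<and>
     card {Y \<in> gamma_orbits G1. \<exists>R \<in> Y. \<exists>C \<in> R. HM C} = 4 \<and>
     card {Y \<in> gamma_orbits G1. \<exists>R \<in> Y. \<exists>C \<in> R. near C} = 4 \<and>
     card {Y \<in> gamma_orbits G1. \<exists>R \<in> Y. \<exists>C \<in> R. HM C \<or> near C} = 8"
proof -
  interpret universal_cover U T \<phi> by unfold_locales (rule univ)
  have eq: "G1 = G" unfolding G1 first_char_quotient_def by (rule refl)
  obtain V where "level_one G p V" using ef.ex_level_one by blast
  then interpret L: level_one G p V .
  show ?thesis
    unfolding eq
  proof (rule L.F_summary)
    show "HM C \<longleftrightarrow> C \<in> L.F False" for C unfolding HM eq by (rule L.HM_iff)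
    show "near C \<longleftrightarrow> C \<in> L.F True" for C
      unfolding near eq \<pi>_def[symmetric] by (rule L.near_HM_iff[OF \<pi>_epi]) (simp add: p_def)
  qed
qed

end
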